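(* If for some $\varepsilon>0$ and $t\in\mathbb{N}$ we can solve at least one of the following: \begin{itemize} \item fully dynamic \#SSR, SC2, AppxSCC, MaxSCC, SubUnion, or ConnSub, with preprocessing time $O(n^{t})$, amortized update time $O(m^{1-\varepsilon})$, and amortized query time $O(m^{1-\varepsilon})$; or $\emptyset$-PP over a universe of size $n$ with preprocessing time $O(n^t)$, amortized update time $O(n^{1-\varepsilon})$ and amortized query time $O(n^{1-\varepsilon})$; \item incremental or decremental \#SSR, SC2, AppxSCC, MaxSCC, SubUnion, or ConnSub, with preprocessing time $O(n^{t})$, worst case update time $O(m^{1-\varepsilon})$, and worst case query time $O(m^{1-\varepsilon})$; \item fully dynamic $ST$-Reach or $4/3$-Diam with preprocessing time $O(n^{t})$, amortized update time $O(m^{2-\varepsilon})$, and amortized query time $O(m^{2-\varepsilon})$; \item incremental or decremental $ST$-Reach or $4/3$-Diam with preprocessing time $O(n^{t})$, worst case update time $O(m^{2-\varepsilon})$, and worst case query time $O(m^{2-\varepsilon})$; \end{itemize} then the Strong Exponential Time Hypothesis is false.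
   Context: Strong Exponential Time Hypothesis (SETH): for every $\varepsilon>0$ there exists an integer $k$ such that SAT on $k$-CNF formulas on $n$ variables cannot be solved in $2^{(1-\varepsilon)n}\,\mathrm{poly}(n)$ time. A dynamic algorithm preprocesses an initial instance, and then processes an online sequence of updates and queries. For graph problems, $n$ and $m$ are upper bounds on the numbers of nodes and edges of the input graph at any time. Fully dynamic means that both insertions and deletions are supported; incremental means only insertions; decremental means only deletions. The problems are: \#SSR: maintain a directed graph with a fixed source $s$ under edge insertions/deletions; query: given $\ell$, is the number of nodes reachable from $s$ less than $\ell$? SC2: maintain a directed graph under edge insertions/deletions; query: does it have more than $2$ strongly connected components (SCCs)? AppxSCC (for a constant $k$): maintain a directed graph under edge insertions/deletions; query: is the number of SCCs $2$ or more than $k$ (i.e. distinguish these two cases)? MaxSCC: maintain a directed graph under edge insertions/deletions; query: what is the size of the largest SCC? ConnSub: maintain a subset $S$ of the vertices of a fixed undirected graph under insertion/removal of a node into/from $S$; query: is the subgraph induced by $S$ connected? SubUnion: a fixed collection $X$ of subsets of a universe $U$ is given; here $n$ is the size of $U$, with $|X|\le n$, and $m=\sum_{X_i\in X}|X_i|$. Maintain a subcollection $S\subseteq X$ under insertion/removal of a set $X_i$ into/from $S$; query: is $\bigcup_{X_i\in S}X_i=U$? $\emptyset$-PP (Pagh's Problem with Emptiness Queries): maintain a collection $X$ of subsets $X_1,X_2,\dots\subseteq[n]$; update: given $i,j$, insert $X_i\cap X_j$ as a new set into $X$; query: given $i$, is $X_i=\emptyset$? The time bounds are functions of the universe size $n$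 only. $ST$-Reach: maintain a directed graph with fixed node subsets $S$ and $T$ under edge insertions/deletions; query: are there some $s\in S$, $t\in T$ such that $t$ is unreachable from $s$? $4/3$-Diam: maintain an undirected graph under edge insertions/deletions; query: is the diameter $3$ or $4$ (i.e. distinguish these two cases)? *)

theory Defs
  imports
    Complex_Main
    "HOL-Library.Log_Nat"
    "Graph_Theory.Digraph_Component"
    "Graph_Theory.Shortest_Path"
begin

section \<open>Word RAM\<close>

text \<open>
  Programs are structured (sequence, conditional, loop) programs over a word RAM: a finite program
  names finitely many registers, and there is one random access memory.  All words are
  \<open>w\<close>-bit numbers, arithmetic is modulo \<open>2 ^ w\<close>, and every
  elementary instruction and every test costs one unit of time.  The all-zero word is false.
\<close>

datatype binop = Add | Sub | Mul | Div | Mod | And | Or | Xor | Shl | Shr | Less | Eq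

datatype com =
    Skip
  | Const nat nat            \<comment> \<open>\<open>R[i] := v\<close>\<close>
  | Op binop nat nat nat     \<comment> \<open>\<open>R[i] := R[j] op R[k]\<close>\<close>
  | Load nat nat             \<comment> \<open>\<open>R[i] := M[R[j]]\<close>\<close>
  | Store nat nat            \<comment> \<open>\<open>M[R[i]] := R[j]\<close>\<close>
  | Seq com com
  | Cond nat com com         \<comment> \<open>test \<open>R[i] \<noteq> 0\<close>\<close>
  | While nat com            \<comment> \<open>loop while \<open>R[i] \<noteq> 0\<close>\<close>

fun binop_val :: "nat \<Rightarrow> binop \<Rightarrow> nat \<Rightarrow> nat \<Rightarrow> nat" where
  "binop_val w Add x y = (x + y) mod 2 ^ w"
| "binop_val w Sub x y = (x + 2 ^ w - y) mod 2 ^ w"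
| "binop_val w Mul x y = (x * y) mod 2 ^ w"
| "binop_val w Div x y = (x div y) mod 2 ^ w"
| "binop_val w Mod x y = (x mod y) mod 2 ^ w"
| "binop_val w And x y = and x y mod 2 ^ w"
| "binop_val w Or x y = or x y mod 2 ^ w"
| "binop_val w Xor x y = xor x y mod 2 ^ w"
| "binop_val w Shl x y = push_bit y x mod 2 ^ w"
| "binop_val w Shr x y = drop_bit y x mod 2 ^ w"
| "binop_val w Less x y = of_bool (x < y) mod 2 ^ w"
| "binop_val w Eq x y = of_bool (x = y) mod 2 ^ w"

text \<open>A configuration consists of the register contents and the memory contents.\<close>

type_synonym config = "(nat \<Rightarrow> nat) \<times> (nat \<Rightarrow> nat)"

text \<open>\<open>exec w P \<sigma> t \<sigma>'\<close>: started in \<open>\<sigma>\<close>, program \<open>P\<close> halts in \<open>\<sigma>'\<close> after exactly \<open>t\<close> time units.\<close>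

inductive exec :: "nat \<Rightarrow> com \<Rightarrow> config \<Rightarrow> nat \<Rightarrow> config \<Rightarrow> bool" for w :: nat where
  Skip: "exec w Skip \<sigma> 1 \<sigma>"
| Const: "exec w (Const i v) (R, M) 1 (R(i := v mod 2 ^ w), M)"
| Op: "exec w (Op f i j k) (R, M) 1 (R(i := binop_val w f (R j) (R k)), M)"
| Load: "exec w (Load i j) (R, M) 1 (R(i := M (R j)), M)"
| Store: "exec w (Store i j) (R, M) 1 (R, M(R i := R j))"
| Seq: "exec w P \<sigma> t \<sigma>' \<Longrightarrow> exec w P' \<sigma>' t' \<sigma>'' \<Longrightarrow> exec w (Seq P P') \<sigma> (t + t') \<sigma>''"
| CondT: "fst \<sigma> i \<noteq> 0 \<Longrightarrow> exec w P \<sigma> t \<sigma>' \<Longrightarrow> exec w (Cond i P P') \<sigma> (1 + t) \<sigma>'"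
| CondF: "fst \<sigma> i = 0 \<Longrightarrow> exec w P' \<sigma> t \<sigma>' \<Longrightarrow> exec w (Cond i P P') \<sigma> (1 + t) \<sigma>'"
| WhileF: "fst \<sigma> i = 0 \<Longrightarrow> exec w (While i P) \<sigma> 1 \<sigma>"
| WhileT: "fst \<sigma> i \<noteq> 0 \<Longrightarrow> exec w P \<sigma> t \<sigma>' \<Longrightarrow> exec w (While i P) \<sigma>' t' \<sigma>'' \<Longrightarrow>
    exec w (While i P) \<sigma> (1 + t + t') \<sigma>''"

text \<open>The input is placed in memory from address 0 on and its length in register 0; everything else is 0.\<close>

definition boot :: "nat \<Rightarrow> nat list \<Rightarrow> config" where
  "boot w xs = ((\<lambda>_. 0)(0 := length xs mod 2 ^ w),
                (\<lambda>i. if i < length xs then xs ! i mod 2 ^ w else 0))"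

definition result :: "config \<Rightarrow> nat" where
  "result \<sigma> = fst \<sigma> 0"

definition enc_list :: "nat list \<Rightarrow> nat list" where
  "enc_list xs = length xs # xs"

definition enc_pairs :: "(nat \<times> nat) list \<Rightarrow> nat list" where
  "enc_pairs es = length es # concat (map (\<lambda>(u, v). [u, v]) es)"

definition enc_lists :: "nat list list \<Rightarrow> nat list" where
  "enc_lists xss = length xss # concat (map enc_list xss)"


section \<open>The Strong Exponential Time Hypothesis\<close>

text \<open>
  A literal is a variable with the truth value that satisfies it.  A formula is a set of clauses, and
  a clause a set of literals, each given by a list without repetitions; so for fixed \<open>k\<close>
  a formula on \<open>n\<close> variables has size polynomial in \<open>n\<close>.
\<close>

type_synonym cnf = "(nat \<times> bool) list list"

definition kcnf :: "nat \<Rightarrow> nat \<Rightarrow> cnf \<Rightarrow> bool" where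
  "kcnf k n F \<longleftrightarrow> distinct (map set F) \<and>
     (\<forall>cl \<in> set F. distinct cl \<and> length cl \<le> k \<and> (\<forall>(v, b) \<in> set cl. v < n))"

definition satisfiable :: "cnf \<Rightarrow> bool" where
  "satisfiable F \<longleftrightarrow> (\<exists>\<alpha>. \<forall>cl \<in> set F. \<exists>(v, b) \<in> set cl. \<alpha> v = b)"

definition enc_cnf :: "nat \<Rightarrow> cnf \<Rightarrow> nat list" where
  "enc_cnf n F = n # enc_lists (map (map (\<lambda>(v, b). 2 * v + of_bool b)) F)"

text \<open>Words have \<open>O(n)\<close> bits, as needed to address memory of size \<open>2 ^ n\<close>.\<close>

definition ksat_solvable :: "nat \<Rightarrow> real \<Rightarrow> bool" where
  "ksat_solvable k \<epsilon> \<longleftrightarrow>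
    (\<exists>P c (C :: real) d. \<forall>n F. kcnf k n F \<longrightarrow>
      (\<exists>t \<sigma>. exec (c * (n + 1)) P (boot (c * (n + 1)) (enc_cnf n F)) t \<sigma> \<and>
             result \<sigma> = of_bool (satisfiable F) \<and>
             real t \<le> 2 powr ((1 - \<epsilon>) * real n) * (C * (real n + 1) ^ d)))"

definition SETH :: bool where
  "SETH \<longleftrightarrow> (\<forall>\<epsilon> > 0. \<exists>k. \<not> ksat_solvable k \<epsilon>)"


section \<open>Dynamic problems and algorithms\<close>

text \<open>
  \<open>start\<close> pairs each initial state with its possible input words.
  Insertions, deletions and queries take a list of words as arguments; \<open>can_ins\<close>,
  \<open>can_del\<close> and \<open>can_ask\<close> say when they may be issued.  The latter
  also expresses the promise of promise problems.  The answer to a yes/no query is 1 or 0.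
\<close>

record 's dyn_problem =
  start :: "(nat list \<times> 's) set"
  can_ins :: "'s \<Rightarrow> nat list \<Rightarrow> bool"
  ins :: "'s \<Rightarrow> nat list \<Rightarrow> 's"
  can_del :: "'s \<Rightarrow> nat list \<Rightarrow> bool"
  del :: "'s \<Rightarrow> nat list \<Rightarrow> 's"
  can_ask :: "'s \<Rightarrow> nat list \<Rightarrow> bool"
  ans :: "'s \<Rightarrow> nat list \<Rightarrow> nat"

datatype request = Ins "nat list" | Del "nat list" | Query "nat list"

datatype mode = Fully_Dynamic | Incremental | Decremental

fun permitted :: "mode \<Rightarrow> request \<Rightarrow> bool" where
  "permitted M (Ins a) \<longleftrightarrow> M \<noteq> Decremental"
| "permitted M (Del a) \<longleftrightarrow> M \<noteq> Incremental"
| "permitted M (Query a) \<longleftrightarrow> True"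

fun valid :: "'s dyn_problem \<Rightarrow> 's \<Rightarrow> request \<Rightarrow> bool" where
  "valid Q s (Ins a) \<longleftrightarrow> can_ins Q s a"
| "valid Q s (Del a) \<longleftrightarrow> can_del Q s a"
| "valid Q s (Query a) \<longleftrightarrow> can_ask Q s a"

fun upd :: "'s dyn_problem \<Rightarrow> 's \<Rightarrow> request \<Rightarrow> 's" where
  "upd Q s (Ins a) = ins Q s a"
| "upd Q s (Del a) = del Q s a"
| "upd Q s (Query a) = s"

fun valid_seq :: "mode \<Rightarrow> 's dyn_problem \<Rightarrow> 's \<Rightarrow> request list \<Rightarrow> bool" where
  "valid_seq M Q s [] \<longleftrightarrow> True"
| "valid_seq M Q s (r # rs) \<longleftrightarrow> permitted M r \<and> valid Q s r \<and> valid_seq M Q (upd Q s r) rs"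

text \<open>
  Requests arrive online: the kind of the request is put in register 0 and its arguments
  in registers 1, 2, ...; all other registers and the memory persist between requests.
\<close>

fun request_words :: "request \<Rightarrow> nat list" where
  "request_words (Ins a) = 0 # a"
| "request_words (Del a) = 1 # a"
| "request_words (Query a) = 2 # a"

definition load_request :: "nat \<Rightarrow> request \<Rightarrow> config \<Rightarrow> config" where
  "load_request w r \<sigma> =
    ((\<lambda>i. if i < length (request_words r) then request_words r ! i mod 2 ^ w else fst \<sigma> i), snd \<sigma>)"

fun correct_answer :: "'s dyn_problem \<Rightarrow> 's \<Rightarrow> request \<Rightarrow> nat \<Rightarrow> bool" where
  "correct_answer Q s (Ins a) y \<longleftrightarrow> True"
| "correct_answer Q s (Del a) y \<longleftrightarrow> True"
| "correct_answer Q s (Query a) y \<longleftrightarrow> y = ans Q s a"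

text \<open>
  \<open>serves w P Q \<sigma> s rs ts\<close>: from machine configuration \<open>\<sigma>\<close> and problem
  state \<open>s\<close>, program \<open>P\<close> processes the requests \<open>rs\<close> one by one with correct
  answers, spending the times \<open>ts\<close>.
\<close>

fun serves :: "nat \<Rightarrow> com \<Rightarrow> 's dyn_problem \<Rightarrow> config \<Rightarrow> 's \<Rightarrow> request list \<Rightarrow> nat list \<Rightarrow> bool" where
  "serves w P Q \<sigma> s [] ts \<longleftrightarrow> ts = []"
| "serves w P Q \<sigma> s (r # rs) ts \<longleftrightarrow>
    (\<exists>t ts' \<sigma>'. ts = t # ts' \<and> exec w P (load_request w r \<sigma>) t \<sigma>' \<and>
       correct_answer Q s r (result \<sigma>') \<and> serves w P Q \<sigma>' (upd Q s r) rs ts')"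

text \<open>Words of \<open>O(log (n + m))\<close> bits.\<close>

definition word_size :: "nat \<Rightarrow> nat \<Rightarrow> nat \<Rightarrow> nat" where
  "word_size c n m = c * floorlog 2 (n + m + 1)"

text \<open>
  Problems are indexed by the size parameters \<open>n\<close> and \<open>m\<close>.
  Preprocessing takes \<open>O(n ^ t)\<close>, and every update and query takes \<open>O(f n m)\<close>, either in the
  worst case or amortized.  In the amortized case preprocessing counts as one of the
  operations among which cost may be shifted: the total time of every
  sequence is bounded by the sum of the bounds of preprocessing and of the operations.
  The algorithm has to be correct for all parameters, the time bounds
  hold for all sufficiently large ones.
\<close>

definition solvable_amortized ::
    "mode \<Rightarrow> (nat \<Rightarrow> nat \<Rightarrow> 's dyn_problem) \<Rightarrow> nat \<Rightarrow> (nat \<Rightarrow> nat \<Rightarrow> real) \<Rightarrow> bool" where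
  "solvable_amortized M Q t f \<longleftrightarrow>
    (\<exists>P\<^sub>0 P c (C :: real) N. \<forall>n m xs s rs.
       (xs, s) \<in> start (Q n m) \<and> valid_seq M (Q n m) s rs \<longrightarrow>
       (\<exists>t\<^sub>0 \<sigma> ts.
          exec (word_size c n m) P\<^sub>0 (boot (word_size c n m) xs) t\<^sub>0 \<sigma> \<and>
          serves (word_size c n m) P (Q n m) \<sigma> s rs ts \<and>
          (n \<ge> N \<and> m \<ge> N \<longrightarrow>
             real t\<^sub>0 \<le> C * real n ^ t \<and>
             real (t\<^sub>0 + sum_list ts) \<le> C * real n ^ t + real (length rs) * (C * f n m))))"

definition solvable_worst_case ::
    "mode \<Rightarrow> (nat \<Rightarrow> nat \<Rightarrow> 's dyn_problem) \<Rightarrow> nat \<Rightarrow> (nat \<Rightarrow> nat \<Rightarrow> real) \<Rightarrow> bool" where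
  "solvable_worst_case M Q t f \<longleftrightarrow>
    (\<exists>P\<^sub>0 P c (C :: real) N. \<forall>n m xs s rs.
       (xs, s) \<in> start (Q n m) \<and> valid_seq M (Q n m) s rs \<longrightarrow>
       (\<exists>t\<^sub>0 \<sigma> ts.
          exec (word_size c n m) P\<^sub>0 (boot (word_size c n m) xs) t\<^sub>0 \<sigma> \<and>
          serves (word_size c n m) P (Q n m) \<sigma> s rs ts \<and>
          (n \<ge> N \<and> m \<ge> N \<longrightarrow>
             real t\<^sub>0 \<le> C * real n ^ t \<and> (\<forall>\<tau> \<in> set ts. real \<tau> \<le> C * f n m))))"


text \<open>The bounds \<open>m powr a\<close> and \<open>n powr a\<close> as functions of both size parameters.\<close>

definition m_pow :: "real \<Rightarrow> nat \<Rightarrow> nat \<Rightarrow> real" where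
  "m_pow a n m = real m powr a"

definition n_pow :: "real \<Rightarrow> nat \<Rightarrow> nat \<Rightarrow> real" where
  "n_pow a n m = real n powr a"


section \<open>The problems\<close>

subsection \<open>Directed graphs\<close>

text \<open>
  The nodes are \<open>0, ..., n - 1\<close>, the state holds the set of arcs; there are no loops or parallel arcs.
  The bound \<open>m\<close> on the number of arcs applies at any time and is part of the input.
\<close>

definition digraph_of :: "nat \<Rightarrow> (nat \<times> nat) set \<Rightarrow> (nat, nat \<times> nat) pre_digraph" where
  "digraph_of n E = with_proj \<lparr>pverts = {..<n}, parcs = E\<rparr>"

definition arc_list :: "nat \<Rightarrow> nat \<Rightarrow> (nat \<times> nat) list \<Rightarrow> bool" where
  "arc_list n m es \<longleftrightarrow> distinct es \<and> length es \<le> m \<and> (\<forall>(u, v) \<in> set es. u < n \<and> v < n \<and> u \<noteq> v)"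

definition can_ins_arc :: "nat \<Rightarrow> nat \<Rightarrow> (nat \<times> nat) set \<Rightarrow> nat list \<Rightarrow> bool" where
  "can_ins_arc n m E a \<longleftrightarrow>
    (\<exists>u v. a = [u, v] \<and> u < n \<and> v < n \<and> u \<noteq> v \<and> (u, v) \<notin> E \<and> card E < m)"

definition ins_arc :: "(nat \<times> nat) set \<Rightarrow> nat list \<Rightarrow> (nat \<times> nat) set" where
  "ins_arc E a = insert (a ! 0, a ! 1) E"

definition can_del_arc :: "(nat \<times> nat) set \<Rightarrow> nat list \<Rightarrow> bool" where
  "can_del_arc E a \<longleftrightarrow> (\<exists>u v. a = [u, v] \<and> (u, v) \<in> E)"

definition del_arc :: "(nat \<times> nat) set \<Rightarrow> nat list \<Rightarrow> (nat \<times> nat) set" where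
  "del_arc E a = E - {(a ! 0, a ! 1)}"

definition num_sccs :: "('a, 'b) pre_digraph \<Rightarrow> nat" where
  "num_sccs G = card (pre_digraph.sccs G)"

definition CountSSR :: "nat \<Rightarrow> nat \<Rightarrow> (nat \<times> (nat \<times> nat) set) dyn_problem" where
  "CountSSR n m = \<lparr>
    start = {(n # m # s # enc_pairs es, (s, set es)) | s es. s < n \<and> arc_list n m es},
    can_ins = (\<lambda>(s, E). can_ins_arc n m E),
    ins = (\<lambda>(s, E) a. (s, ins_arc E a)),
    can_del = (\<lambda>(s, E). can_del_arc E),
    del = (\<lambda>(s, E) a. (s, del_arc E a)),
    can_ask = (\<lambda>(s, E) a. \<exists>l \<le> n. a = [l]),
    ans = (\<lambda>(s, E) a. of_bool (card {v. reachable (digraph_of n E) s v} < a ! 0)) \<rparr>"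

definition digraph_problem ::
    "((nat, nat \<times> nat) pre_digraph \<Rightarrow> bool) \<Rightarrow> ((nat, nat \<times> nat) pre_digraph \<Rightarrow> nat) \<Rightarrow>
      nat \<Rightarrow> nat \<Rightarrow> (nat \<times> nat) set dyn_problem" where
  "digraph_problem promise answer n m = \<lparr>
    start = {(n # m # enc_pairs es, set es) | es. arc_list n m es},
    can_ins = can_ins_arc n m,
    ins = ins_arc,
    can_del = can_del_arc,
    del = del_arc,
    can_ask = (\<lambda>E a. a = [] \<and> promise (digraph_of n E)),
    ans = (\<lambda>E a. answer (digraph_of n E)) \<rparr>"

definition SC2 :: "nat \<Rightarrow> nat \<Rightarrow> (nat \<times> nat) set dyn_problem" where
  "SC2 = digraph_problem (\<lambda>G. True) (\<lambda>G. of_bool (num_sccs G > 2))"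

definition AppxSCC :: "nat \<Rightarrow> nat \<Rightarrow> nat \<Rightarrow> (nat \<times> nat) set dyn_problem" where
  "AppxSCC k = digraph_problem (\<lambda>G. num_sccs G = 2 \<or> num_sccs G > k) (\<lambda>G. of_bool (num_sccs G > k))"

text \<open>The promise excludes the graph without nodes, which has no largest SCC.\<close>

definition MaxSCC :: "nat \<Rightarrow> nat \<Rightarrow> (nat \<times> nat) set dyn_problem" where
  "MaxSCC = digraph_problem (\<lambda>G. verts G \<noteq> {}) (\<lambda>G. Max ((\<lambda>H. card (verts H)) ` pre_digraph.sccs G))"

definition STReach :: "nat \<Rightarrow> nat \<Rightarrow> (nat set \<times> nat set \<times> (nat \<times> nat) set) dyn_problem" where
  "STReach n m = \<lparr>
    start = {(n # m # enc_list ss @ enc_list ts @ enc_pairs es, (set ss, set ts, set es)) | ss ts es.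
      distinct ss \<and> set ss \<subseteq> {..<n} \<and> distinct ts \<and> set ts \<subseteq> {..<n} \<and> arc_list n m es},
    can_ins = (\<lambda>(S, T, E). can_ins_arc n m E),
    ins = (\<lambda>(S, T, E) a. (S, T, ins_arc E a)),
    can_del = (\<lambda>(S, T, E). can_del_arc E),
    del = (\<lambda>(S, T, E) a. (S, T, del_arc E a)),
    can_ask = (\<lambda>(S, T, E) a. a = []),
    ans = (\<lambda>(S, T, E) a. of_bool (\<exists>s \<in> S. \<exists>t \<in> T. \<not> reachable (digraph_of n E) s t)) \<rparr>"


subsection \<open>Undirected graphs\<close>

text \<open>A set \<open>E\<close> of two-element node sets represents the symmetric digraph with both orientations of each edge.\<close>

definition ugraph_of :: "nat \<Rightarrow> nat set set \<Rightarrow> (nat, nat \<times> nat) pre_digraph" where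
  "ugraph_of n E = with_proj \<lparr>pverts = {..<n}, parcs = {(u, v). u \<noteq> v \<and> {u, v} \<in> E}\<rparr>"

definition edge_set :: "(nat \<times> nat) list \<Rightarrow> nat set set" where
  "edge_set es = (\<lambda>(u, v). {u, v}) ` set es"

definition edge_list :: "nat \<Rightarrow> nat \<Rightarrow> (nat \<times> nat) list \<Rightarrow> bool" where
  "edge_list n m es \<longleftrightarrow> distinct (map (\<lambda>(u, v). {u, v}) es) \<and> length es \<le> m \<and>
    (\<forall>(u, v) \<in> set es. u < n \<and> v < n \<and> u \<noteq> v)"

definition diameter :: "('a, 'b) pre_digraph \<Rightarrow> ereal" where
  "diameter G = (SUP u \<in> verts G. SUP v \<in> verts G. wf_digraph.\<mu> G (\<lambda>_. 1) u v)"

definition Diam43 :: "nat \<Rightarrow> nat \<Rightarrow> nat set set dyn_problem" where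
  "Diam43 n m = \<lparr>
    start = {(n # m # enc_pairs es, edge_set es) | es. edge_list n m es},
    can_ins = (\<lambda>E a. \<exists>u v. a = [u, v] \<and> u < n \<and> v < n \<and> u \<noteq> v \<and> {u, v} \<notin> E \<and> card E < m),
    ins = (\<lambda>E a. insert {a ! 0, a ! 1} E),
    can_del = (\<lambda>E a. \<exists>u v. a = [u, v] \<and> {u, v} \<in> E),
    del = (\<lambda>E a. E - {{a ! 0, a ! 1}}),
    can_ask = (\<lambda>E a. a = [] \<and> (diameter (ugraph_of n E) = 3 \<or> diameter (ugraph_of n E) = 4)),
    ans = (\<lambda>E a. if diameter (ugraph_of n E) = 3 then 3 else 4) \<rparr>"

text \<open>Queries are only asked for nonempty \<open>S\<close>, so no convention on the connectedness of the null graph is involved.\<close>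

definition ConnSub :: "nat \<Rightarrow> nat \<Rightarrow> (nat set set \<times> nat set) dyn_problem" where
  "ConnSub n m = \<lparr>
    start = {(n # m # enc_pairs es @ enc_list vs, (edge_set es, set vs)) | es vs.
      edge_list n m es \<and> distinct vs \<and> set vs \<subseteq> {..<n}},
    can_ins = (\<lambda>(E, S) a. \<exists>v < n. a = [v] \<and> v \<notin> S),
    ins = (\<lambda>(E, S) a. (E, insert (a ! 0) S)),
    can_del = (\<lambda>(E, S) a. \<exists>v \<in> S. a = [v]),
    del = (\<lambda>(E, S) a. (E, S - {a ! 0})),
    can_ask = (\<lambda>(E, S) a. a = [] \<and> S \<noteq> {}),
    ans = (\<lambda>(E, S) a. of_bool (connected (induce_subgraph (ugraph_of n E) S))) \<rparr>"


subsection \<open>Set systems\<close>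

text \<open>The universe is \<open>{..<n}\<close>; the sets of a collection are referred to by their position in a list.\<close>

definition set_list :: "nat \<Rightarrow> nat list list \<Rightarrow> bool" where
  "set_list n xss \<longleftrightarrow> (\<forall>xs \<in> set xss. distinct xs \<and> set xs \<subseteq> {..<n})"

definition SubUnion :: "nat \<Rightarrow> nat \<Rightarrow> (nat set list \<times> nat set) dyn_problem" where
  "SubUnion n m = \<lparr>
    start = {(n # m # enc_lists xss @ enc_list js, (map set xss, set js)) | xss js.
      set_list n xss \<and> length xss \<le> n \<and> (\<Sum>xs\<leftarrow>xss. card (set xs)) = m \<and>
      distinct js \<and> set js \<subseteq> {..<length xss}},
    can_ins = (\<lambda>(X, S) a. \<exists>i < length X. a = [i] \<and> i \<notin> S),
    ins = (\<lambda>(X, S) a. (X, insert (a ! 0) S)),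
    can_del = (\<lambda>(X, S) a. \<exists>i \<in> S. a = [i]),
    del = (\<lambda>(X, S) a. (X, S - {a ! 0})),
    can_ask = (\<lambda>(X, S) a. a = []),
    ans = (\<lambda>(X, S) a. of_bool ((\<Union>i \<in> S. X ! i) = {..<n})) \<rparr>"

text \<open>
  Here \<open>m\<close> is an upper bound on the number of sets in the collection at any time; the time
  bounds do not involve it, but words must be long enough to hold the index of a set.  The
  initial collection has at most \<open>n\<close> sets: a larger one could not even be read within
  a preprocessing time depending on \<open>n\<close> only.  There are no deletions.
\<close>

definition EmptyPP :: "nat \<Rightarrow> nat \<Rightarrow> nat set list dyn_problem" where
  "EmptyPP n m = \<lparr>
    start = {(n # m # enc_lists xss, map set xss) | xss.
      set_list n xss \<and> length xss \<le> n \<and> length xss \<le> m},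
    can_ins = (\<lambda>X a. \<exists>i j. a = [i, j] \<and> i < length X \<and> j < length X \<and> length X < m),
    ins = (\<lambda>X a. X @ [X ! (a ! 0) \<inter> X ! (a ! 1)]),
    can_del = (\<lambda>X a. False),
    del = (\<lambda>X a. X),
    can_ask = (\<lambda>X a. \<exists>i < length X. a = [i]),
    ans = (\<lambda>X a. of_bool (X ! (a ! 0) = {})) \<rparr>"

end

(* Split the variables of a CNF formula: g blocks of L variables (g = 1 or 2) and the rest.  The
   dynamic instance has polynomially many (in the formula) nodes for each of the 2^L partial
   assignments of a block, and toggles for the clauses.  For each of the 2^(n - g L) assignments of the
   remaining variables, a phase of few updates marks the clauses that it falsifies, and one query
   tells whether a partial assignment (for g = 2, a pair of them) satisfies the other ones.  With L a
   small fraction of n, preprocessing is cheap, and update time m^(g - eps) makes the total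
   2^((1 - delta) n).

   SETH speaks about a single program with word size linear in n.  So the instances and requests are
   described by expressions that are compiled to the RAM, and the data structure runs on a simulated
   machine with words of the smaller size.  Its memory is versioned by epochs: in the partially
   dynamic worst-case setting, where toggles cannot be undone, each phase restarts from the state after
   preprocessing by starting a new epoch. *)

theory Submission
  imports Defs
begin

section \<open>Determinism of the RAM and a calculus of time-bounded runs\<close>

section \<open>Timed total correctness of RAM programs\<close>

text \<open>SETH fails only if a single saving e > 0 works for every clause width k. So the block
  length L = n div D has to be fixed before k is known: D = 2 (z + t + 1) g, where t is the
  preprocessing exponent and z bounds the degree of the running time of the generators. For this
  reason generators are pieces of syntax that do not mention k; it acts only through the value of
  one variable. Costs (2^L)^j with j \<le> z + t are then at most 2^(n/2), while 2^(n - g L) phases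
  at (2^L)^(g - \<epsilon>) each cost 2^(n - \<epsilon> L); this gives e = \<epsilon> / D. For fixed
  k the number of clauses is polynomial in n and disappears in poly(n). On the machine side, one
  program must serve all n, although the data structure expects words of c log(n + m) bits and
  behaves differently on longer ones. All sizes are therefore compared on the scale of powers of B =
  2^(n+1): values stay below B^u, addresses below a small multiple of B^h, words have (h + 3)(n + 1)
  bits, and u and h do not depend on n.\<close>

inductive_cases exec_SkipE: "exec w Skip \<sigma> t \<sigma>'"
inductive_cases exec_ConstE: "exec w (Const i v) \<sigma> t \<sigma>'"
inductive_cases exec_OpE: "exec w (Op f i j k) \<sigma> t \<sigma>'"
inductive_cases exec_LoadE: "exec w (Load i j) \<sigma> t \<sigma>'"
inductive_cases exec_StoreE: "exec w (Store i j) \<sigma> t \<sigma>'"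
inductive_cases exec_SeqE: "exec w (Seq P Q) \<sigma> t \<sigma>'"
inductive_cases exec_CondE: "exec w (Cond i P Q) \<sigma> t \<sigma>'"
inductive_cases exec_WhileE: "exec w (While i P) \<sigma> t \<sigma>'"

text \<open>The assumption on a dynamic algorithm yields some run of the preprocessing for each
  request sequence separately. Determinism identifies the configurations in which these runs end, so
  that all worst-case phases can restart from the same one.\<close>

lemma exec_deterministic:
  "exec w P \<sigma> t \<sigma>' \<Longrightarrow> exec w P \<sigma> u \<sigma>'' \<Longrightarrow> u = t \<and> \<sigma>'' = \<sigma>'"
proof (induction arbitrary: u \<sigma>'' rule: exec.induct)
  case (Skip \<sigma>) then show ?case by (auto elim: exec_SkipE)
next
  case Const then show ?case by (auto elim: exec_ConstE)
next
  case Op then show ?case by (auto elim: exec_OpE)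
next
  case Load then show ?case by (auto elim: exec_LoadE)
next
  case Store then show ?case by (auto elim: exec_StoreE)
next
  case (Seq P \<sigma> t \<sigma>' P' t' \<tau>)
  from Seq.prems obtain a b \<rho> where "exec w P \<sigma> a \<rho>" "exec w P' \<rho> b \<sigma>''" "u = a + b"
    by (rule exec_SeqE)
  then show ?case using Seq.IH by blast
next
  case (CondT \<sigma> i P t \<sigma>' P')
  from CondT.prems obtain a where "exec w P \<sigma> a \<sigma>''" "u = 1 + a"
    by (rule exec_CondE) (use CondT.hyps in auto)
  then show ?case using CondT.IH by blast
next
  case (CondF \<sigma> i P' t \<sigma>' P)
  from CondF.prems obtain a where "exec w P' \<sigma> a \<sigma>''" "u = 1 + a"
    by (rule exec_CondE) (use CondF.hyps in auto)
  then show ?case using CondF.IH by blast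
next
  case (WhileF \<sigma> i P)
  from WhileF.prems show ?case by (rule exec_WhileE) (use WhileF.hyps in auto)
next
  case (WhileT \<sigma> i P t \<sigma>' t' \<tau>)
  from WhileT.prems obtain a b \<rho> where "exec w P \<sigma> a \<rho>" "exec w (While i P) \<rho> b \<sigma>''" "u = 1 + a + b"
    by (rule exec_WhileE) (use WhileT.hyps in auto)
  then show ?case using WhileT.IH by blast
qed

lemma exec_Skip_iff: "exec w Skip \<sigma> t \<sigma>' \<longleftrightarrow> t = 1 \<and> \<sigma>' = \<sigma>"
  and exec_Const_iff: "exec w (Const i v) (R, M) t \<sigma>' \<longleftrightarrow> t = 1 \<and> \<sigma>' = (R(i := v mod 2 ^ w), M)"
  and exec_Op_iff: "exec w (Op f i j k) (R, M) t \<sigma>' \<longleftrightarrow>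
    t = 1 \<and> \<sigma>' = (R(i := binop_val w f (R j) (R k)), M)"
  and exec_Load_iff: "exec w (Load i j) (R, M) t \<sigma>' \<longleftrightarrow> t = 1 \<and> \<sigma>' = (R(i := M (R j)), M)"
  and exec_Store_iff: "exec w (Store i j) (R, M) t \<sigma>' \<longleftrightarrow> t = 1 \<and> \<sigma>' = (R, M(R i := R j))"
  by (metis exec.Skip exec_deterministic, metis exec.Const exec_deterministic,
      metis exec.Op exec_deterministic, metis exec.Load exec_deterministic,
      metis exec.Store exec_deterministic)

definition runs :: "nat \<Rightarrow> com \<Rightarrow> config \<Rightarrow> nat \<Rightarrow> (config \<Rightarrow> bool) \<Rightarrow> bool" where
  "runs w P \<sigma> n \<Phi> \<longleftrightarrow> (\<exists>t \<sigma>'. exec w P \<sigma> t \<sigma>' \<and> t \<le> n \<and> \<Phi> \<sigma>')"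

lemma runs_weaken:
  "runs w P \<sigma> n \<Phi> \<Longrightarrow> n \<le> n' \<Longrightarrow> (\<And>\<sigma>'. \<Phi> \<sigma>' \<Longrightarrow> \<Psi> \<sigma>') \<Longrightarrow> runs w P \<sigma> n' \<Psi>"
  unfolding runs_def by (meson order_trans)

lemma runs_Seq:
  assumes "runs w P \<sigma> n \<Psi>" "\<And>\<sigma>'. \<Psi> \<sigma>' \<Longrightarrow> runs w Q \<sigma>' n' \<Phi>"
  shows "runs w (Seq P Q) \<sigma> (n + n') \<Phi>"
  using assms unfolding runs_def by (meson exec.Seq add_mono)

lemma runs_Seq':
  assumes "runs w P \<sigma> n \<Psi>" "\<And>\<sigma>'. \<Psi> \<sigma>' \<Longrightarrow> runs w Q \<sigma>' n' \<Phi>" "n + n' \<le> N"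
  shows "runs w (Seq P Q) \<sigma> N \<Phi>"
  by (rule runs_weaken[OF runs_Seq[OF assms(1,2)] assms(3)])

lemma runs_Skip [simp]: "runs w Skip \<sigma> n \<Phi> \<longleftrightarrow> 1 \<le> n \<and> \<Phi> \<sigma>"
  by (auto simp: runs_def exec_Skip_iff)

lemma runs_Const [simp]: "runs w (Const i v) (R, M) n \<Phi> \<longleftrightarrow> 1 \<le> n \<and> \<Phi> (R(i := v mod 2 ^ w), M)"
  by (auto simp: runs_def exec_Const_iff)

lemma runs_Op [simp]: "runs w (Op f i j k) (R, M) n \<Phi> \<longleftrightarrow> 1 \<le> n \<and> \<Phi> (R(i := binop_val w f (R j) (R k)), M)"
  by (auto simp: runs_def exec_Op_iff)

lemma runs_Load [simp]: "runs w (Load i j) (R, M) n \<Phi> \<longleftrightarrow> 1 \<le> n \<and> \<Phi> (R(i := M (R j)), M)"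
  by (auto simp: runs_def exec_Load_iff)

lemma runs_Store [simp]: "runs w (Store i j) (R, M) n \<Phi> \<longleftrightarrow> 1 \<le> n \<and> \<Phi> (R, M(R i := R j))"
  by (auto simp: runs_def exec_Store_iff)

text \<open>Right-nested sequences are the normal form. With the \<open>runs_Seq_...\<close> rules
  below, the simplifier executes straight-line code symbolically and leaves only the final
  assertion.\<close>

lemma runs_Seq_assoc [simp]: "runs w (Seq (Seq P Q) S) \<sigma> n \<Phi> \<longleftrightarrow> runs w (Seq P (Seq Q S)) \<sigma> n \<Phi>"
proof -
  have "exec w (Seq (Seq P Q) S) \<sigma> t \<sigma>' \<longleftrightarrow> exec w (Seq P (Seq Q S)) \<sigma> t \<sigma>'" for t \<sigma>'
    by (auto elim!: exec_SeqE simp: add.assoc intro: exec.Seq)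
      (metis add.assoc exec.Seq)+
  then show ?thesis by (simp add: runs_def)
qed

lemma runs_step:
  assumes "\<And>n \<Phi>. runs w P \<sigma> n \<Phi> \<longleftrightarrow> 1 \<le> n \<and> \<Phi> \<sigma>'"
  shows "runs w (Seq P Q) \<sigma> n \<Phi> \<longleftrightarrow> 1 \<le> n \<and> runs w Q \<sigma>' (n - 1) \<Phi>"
proof -
  have P: "exec w P \<sigma> t \<tau> \<longleftrightarrow> t = 1 \<and> \<tau> = \<sigma>'" for t \<tau>
  proof -
    \<comment> \<open>Two instances of the premise: budget 1 with a postcondition that pins down
      \<open>\<sigma>'\<close>, and budget 0, which excludes a faster run. Hence the time is exactly
      1.\<close>
    have "runs w P \<sigma> 1 (\<lambda>\<tau>. \<tau> = \<sigma>')" "\<not> runs w P \<sigma> 0 (\<lambda>_. True)" using assms by auto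
    then have "exec w P \<sigma> 1 \<sigma>'" unfolding runs_def by (metis One_nat_def le_SucE le_zero_eq)
    then show ?thesis using exec_deterministic by blast
  qed
  have S: "exec w (Seq P Q) \<sigma> t \<tau> \<longleftrightarrow> (\<exists>u. t = 1 + u \<and> exec w Q \<sigma>' u \<tau>)" for t \<tau>
  proof
    assume "exec w (Seq P Q) \<sigma> t \<tau>"
    then show "\<exists>u. t = 1 + u \<and> exec w Q \<sigma>' u \<tau>" by (rule exec_SeqE) (use P in auto)
  next
    assume "\<exists>u. t = 1 + u \<and> exec w Q \<sigma>' u \<tau>"
    then show "exec w (Seq P Q) \<sigma> t \<tau>" using P exec.Seq by blast
  qed
  have "runs w (Seq P Q) \<sigma> n \<Phi> \<longleftrightarrow> (\<exists>u \<tau>. exec w Q \<sigma>' u \<tau> \<and> 1 + u \<le> n \<and> \<Phi> \<tau>)"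
    unfolding runs_def S by blast
  also have "\<dots> \<longleftrightarrow> 1 \<le> n \<and> runs w Q \<sigma>' (n - 1) \<Phi>"
    unfolding runs_def by (cases n) auto
  finally show ?thesis .
qed

lemma runs_Seq_Skip [simp]: "runs w (Seq Skip Q) \<sigma> n \<Phi> \<longleftrightarrow> 1 \<le> n \<and> runs w Q \<sigma> (n - 1) \<Phi>"
  by (rule runs_step) simp

lemma runs_Seq_Const [simp]: "runs w (Seq (Const i v) Q) (R, M) n \<Phi> \<longleftrightarrow>
    1 \<le> n \<and> runs w Q (R(i := v mod 2 ^ w), M) (n - 1) \<Phi>"
  by (rule runs_step) simp

lemma runs_Seq_Op [simp]: "runs w (Seq (Op f i j k) Q) (R, M) n \<Phi> \<longleftrightarrow>
    1 \<le> n \<and> runs w Q (R(i := binop_val w f (R j) (R k)), M) (n - 1) \<Phi>"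
  by (rule runs_step) simp

lemma runs_Seq_Load [simp]: "runs w (Seq (Load i j) Q) (R, M) n \<Phi> \<longleftrightarrow>
    1 \<le> n \<and> runs w Q (R(i := M (R j)), M) (n - 1) \<Phi>"
  by (rule runs_step) simp

lemma runs_Seq_Store [simp]: "runs w (Seq (Store i j) Q) (R, M) n \<Phi> \<longleftrightarrow>
    1 \<le> n \<and> runs w Q (R, M(R i := R j)) (n - 1) \<Phi>"
  by (rule runs_step) simp

lemma runs_Cond [simp]: "runs w (Cond i P Q) \<sigma> n \<Phi> \<longleftrightarrow>
    1 \<le> n \<and> (if fst \<sigma> i \<noteq> 0 then runs w P \<sigma> (n - 1) \<Phi> else runs w Q \<sigma> (n - 1) \<Phi>)"
proof -
  have "exec w (Cond i P Q) \<sigma> t \<tau> \<longleftrightarrow>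
    (\<exists>u. t = 1 + u \<and> (if fst \<sigma> i \<noteq> 0 then exec w P \<sigma> u \<tau> else exec w Q \<sigma> u \<tau>))" for t \<tau>
    by (cases "fst \<sigma> i = 0") (auto intro: exec.CondT[simplified] exec.CondF[simplified] elim: exec_CondE)
  then show ?thesis unfolding runs_def
    by (cases n) (auto split: if_splits)
qed

lemma runs_While_step: "fst \<sigma> i \<noteq> 0 \<Longrightarrow> runs w P \<sigma> n \<Psi> \<Longrightarrow>
    (\<And>\<sigma>'. \<Psi> \<sigma>' \<Longrightarrow> runs w (While i P) \<sigma>' n' \<Phi>) \<Longrightarrow> runs w (While i P) \<sigma> (1 + n + n') \<Phi>"
  unfolding runs_def by (meson add_mono exec.WhileT le_refl)

lemma runs_While_done: "fst \<sigma> i = 0 \<Longrightarrow> 1 \<le> n \<Longrightarrow> \<Phi> \<sigma> \<Longrightarrow> runs w (While i P) \<sigma> n \<Phi>"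
  unfolding runs_def by (meson exec.WhileF)

text \<open>The invariant is indexed by the number of finished iterations, which doubles as the
  variant. Each iteration pays 1 for its test; the final 1 is the failing test.\<close>

lemma runs_While_count:
  assumes "I 0 \<sigma>"
    and "\<And>i \<sigma>. i < N \<Longrightarrow> I i \<sigma> \<Longrightarrow> fst \<sigma> r \<noteq> 0 \<and> runs w P \<sigma> (c i) (I (Suc i))"
    and "\<And>\<sigma>. I N \<sigma> \<Longrightarrow> fst \<sigma> r = 0 \<and> \<Phi> \<sigma>"
  shows "runs w (While r P) \<sigma> ((\<Sum>i<N. c i + 1) + 1) \<Phi>"
proof -
  have "runs w (While r P) \<sigma> ((\<Sum>i=k..<N. c i + 1) + 1) \<Phi>" if "k \<le> N" "I k \<sigma>" for k \<sigma>
    using that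
  proof (induction k arbitrary: \<sigma> rule: inc_induct)
    case base
    then show ?case using assms(3) by (intro runs_While_done) auto
  next
    case (step k)
    have "runs w (While r P) \<sigma> (1 + c k + ((\<Sum>i=Suc k..<N. c i + 1) + 1)) \<Phi>"
      using assms(2)[OF step(2,4)] step(3) by (intro runs_While_step[where \<Psi> = "I (Suc k)"]) auto
    moreover have "1 + c k + ((\<Sum>i=Suc k..<N. c i + 1) + 1) = (\<Sum>i=k..<N. c i + 1) + 1"
      using step(2) by (simp add: sum.atLeast_Suc_lessThan)
    ultimately show ?case by metis
  qed
  from this[of 0] assms(1) show ?thesis by (simp add: atLeast0LessThan)
qed

lemma runs_While_count_const:
  assumes "I 0 \<sigma>"
    and "\<And>i \<sigma>. i < N \<Longrightarrow> I i \<sigma> \<Longrightarrow> fst \<sigma> r \<noteq> 0 \<and> runs w P \<sigma> c (I (Suc i))"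
    and "\<And>\<sigma>. I N \<sigma> \<Longrightarrow> fst \<sigma> r = 0 \<and> \<Phi> \<sigma>"
    and "N \<le> X" "X * (c + 1) + 1 \<le> n"
  shows "runs w (While r P) \<sigma> n \<Phi>"
proof -
  have "runs w (While r P) \<sigma> ((\<Sum>i<N. c + 1) + 1) \<Phi>"
    using assms(1-3) by (rule runs_While_count[where c = "\<lambda>_. c"])
  moreover have "(\<Sum>i<N. c + 1) + 1 \<le> n"
    using mult_le_mono1[OF assms(4), of "c + 1"] assms(5) by simp
  ultimately show ?thesis by (rule runs_weaken)
qed


section \<open>Expressions with bounded sums, list generators, and their compilation\<close>

section \<open>Compiling expressions and list generators\<close>

datatype bop = BAdd | BMul | BDiv | BMod | BLess | BEq | BShr

fun bval :: "bop \<Rightarrow> nat \<Rightarrow> nat \<Rightarrow> nat" where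
  "bval BAdd x y = x + y"
| "bval BMul x y = x * y"
| "bval BDiv x y = x div y"
| "bval BMod x y = x mod y"
| "bval BLess x y = of_bool (x < y)"
| "bval BEq x y = of_bool (x = y)"
| "bval BShr x y = drop_bit y x"

fun binop_of :: "bop \<Rightarrow> binop" where
  "binop_of BAdd = Add"
| "binop_of BMul = Mul"
| "binop_of BDiv = Div"
| "binop_of BMod = Mod"
| "binop_of BLess = Less"
| "binop_of BEq = Eq"
| "binop_of BShr = Shr"

text \<open>
  Variables are registers.  Loop bounds are variables, so that the running time of an expression is
  governed by the variables that occur as loop bounds and not by the size of other values.
\<close>

datatype ex = Cn nat | Vr nat | Bin bop ex ex | Inp ex | Scan nat | Sum nat nat ex

text \<open>
  In \<open>enc_cnf n F\<close> the clauses start at address 2, each preceded by its length;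
  \<open>scan m c\<close> is the address of the length of clause \<open>c\<close>.
\<close>

fun scan :: "(nat \<Rightarrow> nat) \<Rightarrow> nat \<Rightarrow> nat" where
  "scan m 0 = 2"
| "scan m (Suc c) = scan m c + m (scan m c) + 1"

fun ev :: "(nat \<Rightarrow> nat) \<Rightarrow> (nat \<Rightarrow> nat) \<Rightarrow> ex \<Rightarrow> nat" where
  "ev m s (Cn c) = c"
| "ev m s (Vr v) = s v"
| "ev m s (Bin f a b) = bval f (ev m s a) (ev m s b)"
| "ev m s (Inp a) = m (ev m s a)"
| "ev m s (Scan u) = scan m (s u)"
| "ev m s (Sum v u b) = (\<Sum>i<s u. ev m (s(v := i)) b)"

fun vars_below :: "nat \<Rightarrow> ex \<Rightarrow> bool" where
  "vars_below B (Cn c) \<longleftrightarrow> True"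
| "vars_below B (Vr v) \<longleftrightarrow> v < B"
| "vars_below B (Bin f a b) \<longleftrightarrow> vars_below B a \<and> vars_below B b"
| "vars_below B (Inp a) \<longleftrightarrow> vars_below B a"
| "vars_below B (Scan u) \<longleftrightarrow> u < B"
| "vars_below B (Sum v u b) \<longleftrightarrow> v < B \<and> u < B \<and> vars_below B b"

fun loop_vars :: "ex \<Rightarrow> nat set" where
  "loop_vars (Cn c) = {}"
| "loop_vars (Vr v) = {}"
| "loop_vars (Bin f a b) = loop_vars a \<union> loop_vars b"
| "loop_vars (Inp a) = loop_vars a"
| "loop_vars (Scan u) = {u}"
| "loop_vars (Sum v u b) = insert u (loop_vars b)"

text \<open>The exponent in \<open>ev_le\<close>. A constant \<open>c\<close> gets
  \<open>Suc c\<close> because \<open>c < 2 ^ c\<close>, and because every degree has to be at least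
  1: the case of \<open>Inp\<close> bounds a memory entry by \<open>V ^ 1\<close>.\<close>

fun degree_ex :: "ex \<Rightarrow> nat" where
  "degree_ex (Cn c) = Suc c"
| "degree_ex (Vr v) = 1"
| "degree_ex (Bin f a b) = degree_ex a + degree_ex b + 1"
| "degree_ex (Inp a) = degree_ex a"
| "degree_ex (Scan u) = 2"
| "degree_ex (Sum v u b) = degree_ex b + 1"

fun time_ex :: "nat \<Rightarrow> ex \<Rightarrow> nat" where
  "time_ex X (Cn c) = 1"
| "time_ex X (Vr v) = 1"
| "time_ex X (Bin f a b) = time_ex X a + time_ex X b + 1"
| "time_ex X (Inp a) = time_ex X a + 1"
| "time_ex X (Scan u) = 5 * X + 4"
| "time_ex X (Sum v u b) = X * (time_ex X b + 4) + 7"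

text \<open>The result goes to register \<open>d\<close>; registers from \<open>d\<close> on are
  scratch, those below are preserved. \<open>Op And d v v\<close> copies a register. The bound
  variable of \<open>Sum\<close> is itself a program register, so it is saved in
  \<open>d + 1\<close> and restored at the end. Loops count a register down because
  \<open>While\<close> can only compare with 0.\<close>

fun comp_ex :: "nat \<Rightarrow> ex \<Rightarrow> com" where
  "comp_ex d (Cn c) = Const d c"
| "comp_ex d (Vr v) = Op And d v v"
| "comp_ex d (Bin f a b) = Seq (comp_ex d a) (Seq (comp_ex (Suc d) b) (Op (binop_of f) d d (Suc d)))"
| "comp_ex d (Inp a) = Seq (comp_ex d a) (Load d d)"
| "comp_ex d (Scan u) = Seq (Const d 2) (Seq (Op And (d+1) u u) (Seq (Const (d+2) 1)
    (While (d+1) (Seq (Load (d+3) d) (Seq (Op Add d d (d+3)) (Seq (Op Add d d (d+2))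
      (Op Sub (d+1) (d+1) (d+2))))))))"
| "comp_ex d (Sum v u b) = Seq (Const d 0) (Seq (Op And (d+1) v v) (Seq (Op And (d+2) u u)
    (Seq (Const (d+3) 1) (Seq (Const v 0)
    (Seq (While (d+2) (Seq (comp_ex (d+4) b) (Seq (Op Add d d (d+4)) (Seq (Op Add v v (d+3))
      (Op Sub (d+2) (d+2) (d+3)))))) (Op And v (d+1) (d+1)))))))"

lemma ev_cong: "vars_below B e \<Longrightarrow> (\<And>v. v < B \<Longrightarrow> s v = s' v) \<Longrightarrow> ev m s e = ev m s' e"
proof (induction e arbitrary: s s')
  case (Sum v u b)
  then have "ev m (s(v := i)) b = ev m (s'(v := i)) b" for i by (intro Sum.IH) auto
  then show ?case using Sum.prems by simp
next
  case (Bin f a b)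
  have "ev m s a = ev m s' a" by (rule Bin.IH(1)) (use Bin.prems in auto)
  moreover have "ev m s b = ev m s' b" by (rule Bin.IH(2)) (use Bin.prems in auto)
  ultimately show ?case by simp
next
  case (Inp a)
  have "ev m s a = ev m s' a" by (rule Inp.IH) (use Inp.prems in auto)
  then show ?case by simp
qed auto

text \<open>The additional 1 in the exponent pays for the factor 2 that addition costs; the other
  operations fit without it.\<close>

lemma bval_le: "2 \<le> V \<Longrightarrow> x \<le> V ^ a \<Longrightarrow> y \<le> V ^ b \<Longrightarrow> bval f x y \<le> V ^ (a + b + 1)" for V :: nat
proof -
  assume a: "2 \<le> V" "x \<le> V ^ a" "y \<le> V ^ b"
  have p: "V ^ k \<ge> 1" for k using a(1) by simp
  have m: "x \<le> V ^ (a + b)" "y \<le> V ^ (a + b)"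
    using a power_increasing[of a "a+b" V] power_increasing[of b "a+b" V] by (auto intro: order_trans)
  have s: "2 * V ^ (a + b) \<le> V ^ (a + b + 1)" using a(1) by simp
  have x: "x \<le> V ^ (a + b + 1)" using m s by linarith
  have d: "drop_bit y x \<le> x" by (simp add: drop_bit_eq_div)
  have mm: "x * y \<le> V ^ (a + b)" using a mult_le_mono[OF a(2,3)] by (simp add: power_add)
  have dv: "x div y \<le> x" "x mod y \<le> x" by auto
  show ?thesis
  proof (cases f)
    case BAdd
    have "x + y \<le> V ^ (a + b + 1)" using m s by linarith
    then show ?thesis using BAdd by (simp only: bval.simps)
  next
    case BMul
    have "x * y \<le> V ^ (a + b + 1)" using mm s by linarith
    then show ?thesis using BMul by (simp only: bval.simps)
  next
    case BShr
    then show ?thesis using d x by (simp only: bval.simps)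
  next
    case BDiv
    then show ?thesis using dv(1) x by (simp only: bval.simps)
  next
    case BMod
    then show ?thesis using dv(2) x by (simp only: bval.simps)
  next
    case BLess
    then show ?thesis using p[of "a + b + 1"] by (simp add: of_bool_def)
  next
    case BEq
    then show ?thesis using p[of "a + b + 1"] by (simp add: of_bool_def)
  qed
qed

lemma ev_le:
  assumes "2 \<le> V" "\<And>a. m a \<le> V" "\<And>c. scan m c \<le> V + c"
  shows "vars_below B e \<Longrightarrow> (\<And>v. v < B \<Longrightarrow> s v \<le> V) \<Longrightarrow> ev m s e \<le> V ^ degree_ex e"
proof (induction e arbitrary: s)
  case (Cn c)
  have "c < 2 ^ c" by simp
  also have "(2::nat) ^ c \<le> V ^ c" using assms(1) by (rule power_mono) simp
  also have "\<dots> \<le> V ^ Suc c" using assms(1) by simp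
  finally show ?case by simp
next
  case (Bin f a b)
  then show ?case using bval_le[OF assms(1)] by simp
next
  case (Inp a)
  have "V ^ 1 \<le> V ^ degree_ex a" using assms(1)
    by (intro power_increasing) (auto, induction a, auto)
  then show ?case using assms(2)[of "ev m s a"] by simp
next
  case (Scan u)
  have "scan m (s u) \<le> V + V" using assms(3)[of "s u"] Scan by (meson add_left_mono order_trans vars_below.simps)
  also have "V + V \<le> V ^ 2" using assms(1) by (simp add: power2_eq_square flip: mult_2)
  finally show ?case by (simp add: numeral_2_eq_2)
next
  case (Sum v u b)
  have "ev m (s(v := i)) b \<le> V ^ degree_ex b" if "i < s u" for i
    using Sum.prems that by (intro Sum.IH) (auto, meson less_imp_le_nat order_trans)
  then have "(\<Sum>i<s u. ev m (s(v := i)) b) \<le> s u * V ^ degree_ex b"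
    using sum_bounded_above[of "{..<s u}" "\<lambda>i. ev m (s(v := i)) b" "V ^ degree_ex b"] by simp
  also have "\<dots> \<le> V * V ^ degree_ex b" using Sum.prems by simp
  finally show ?case by simp
qed auto

lemma binop_val_exact: "bval f x y < 2 ^ w \<Longrightarrow> binop_val w (binop_of f) x y = bval f x y"
  by (cases f) simp_all

lemma add_power_diff: "y \<le> x \<Longrightarrow> x < 2 ^ w \<Longrightarrow> (x + 2 ^ w - y) mod 2 ^ w = x - (y::nat)"
  by (metis Nat.add_diff_assoc2 less_imp_diff_less mod_add_self2 mod_less)

text \<open>\<open>m\<close> stands for the input, extended to all addresses, and \<open>V\<close>
  bounds its entries. The current memory agrees with \<open>m\<close> only below \<open>H\<close>.
  One condition \<open>V ^ degree_ex e < H\<close> therefore has two effects: every address that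
  \<open>e\<close> reads lies in the intact region, and no operation overflows.\<close>

locale input_memory =
  fixes m :: "nat \<Rightarrow> nat" and H V B w :: nat
  assumes V2: "2 \<le> V" and m_le: "\<And>a. m a \<le> V" and scan_le: "\<And>c. scan m c \<le> V + c"
begin

lemma comp_ex_runs:
  assumes "vars_below B e" "B \<le> d" "V ^ degree_ex e < H" "H \<le> 2 ^ w"
    and "\<And>v. v < B \<Longrightarrow> R v \<le> V" "\<And>a. a < H \<Longrightarrow> M a = m a"
    and "\<And>u. u \<in> loop_vars e \<Longrightarrow> R u \<le> X"
  shows "runs w (comp_ex d e) (R, M) (time_ex X e)
     (\<lambda>(R', M'). R' d = ev m R e \<and> (\<forall>v<d. R' v = R v) \<and> M' = M)"
  using assms
proof (induction e arbitrary: d R)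
  case (Cn c)
  have "c \<le> V ^ Suc c" using ev_le[OF V2 m_le scan_le, of 0 "Cn c" R] by simp
  then have "c < 2 ^ w" using Cn.prems(3,4) by simp
  then show ?case by auto
next
  case (Vr v)
  have "R v \<le> V" using Vr by simp
  then have "R v < 2 ^ w" using Vr.prems(3,4) by simp
  then show ?case by auto
next
  case (Bin f a b)
  have le: "V ^ degree_ex a < H" "V ^ degree_ex b < H"
    using Bin.prems(3) V2 power_increasing[of "degree_ex a" "degree_ex (Bin f a b)" V]
       power_increasing[of "degree_ex b" "degree_ex (Bin f a b)" V] by auto
  have bd: "ev m R (Bin f a b) < 2 ^ w"
    using ev_le[OF V2 m_le scan_le, of B "Bin f a b" R] Bin.prems by fastforce
  have 1: "runs w (comp_ex d a) (R, M) (time_ex X a)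
     (\<lambda>(R', M'). R' d = ev m R a \<and> (\<forall>v<d. R' v = R v) \<and> M' = M)"
    using Bin.prems le by (intro Bin.IH(1)) auto
  show ?case unfolding comp_ex.simps
  proof (rule runs_Seq'[OF 1])
    fix \<sigma>' assume "case \<sigma>' of (R', M') \<Rightarrow> R' d = ev m R a \<and> (\<forall>v<d. R' v = R v) \<and> M' = M"
    then obtain R' where [simp]: "\<sigma>' = (R', M)" and R': "R' d = ev m R a" "\<And>v. v < d \<Longrightarrow> R' v = R v"
      by (cases \<sigma>') auto
    have "R' v = R v" if "v < B" for v using that Bin.prems R' by simp
    then have eq: "ev m R' b = ev m R b" using Bin.prems by (intro ev_cong[of B]) auto
    have lv: "loop_vars b \<subseteq> {..<B}" using Bin.prems(1)
      by (simp, induction b) auto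
    have 2: "runs w (comp_ex (Suc d) b) (R', M) (time_ex X b)
       (\<lambda>(R'', M'). R'' (Suc d) = ev m R' b \<and> (\<forall>v<Suc d. R'' v = R' v) \<and> M' = M)"
      using Bin.prems le R' lv by (intro Bin.IH(2)) auto
    show "runs w (Seq (comp_ex (Suc d) b) (Op (binop_of f) d d (Suc d))) \<sigma>' (time_ex X b + 1)
            (\<lambda>(R', M'). R' d = ev m R (Bin f a b) \<and> (\<forall>v<d. R' v = R v) \<and> M' = M)"
      unfolding \<open>\<sigma>' = _\<close>
      by (rule runs_Seq'[OF 2]) (use eq bd R' in \<open>auto simp: binop_val_exact\<close>)
  qed simp
next
  case (Inp a)
  have 1: "runs w (comp_ex d a) (R, M) (time_ex X a)
     (\<lambda>(R', M'). R' d = ev m R a \<and> (\<forall>v<d. R' v = R v) \<and> M' = M)"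
    using Inp.prems by (intro Inp.IH) auto
  have "ev m R a < H" using ev_le[OF V2 m_le scan_le, of B a R] Inp.prems by fastforce
  then show ?case unfolding comp_ex.simps
    by (intro runs_Seq'[OF 1]) (use Inp.prems in auto)
next
  case (Scan u)
  have u: "R u \<le> V" "u < d" "u < B" "R u \<le> X" using Scan.prems by auto
  have VH: "V ^ 2 < H" using Scan.prems by simp
  have V4: "V + V \<le> V ^ 2" using V2 by (simp add: power2_eq_square flip: mult_2)
  \<comment> \<open>The scanned address is at most \<open>V + V \<le> V ^ 2\<close>; this is where
    the degree 2 of \<open>Scan\<close> comes from.\<close>
  have sc: "scan m c < H" if "c \<le> R u" for c using scan_le[of c] that u V4 VH by linarith
  have "1 < H" using sc[of 0] by simp
  then have H1: "(1::nat) < 2 ^ w" "(2::nat) < 2 ^ w"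
    using Scan.prems sc[of 0] by simp_all
  have Ru: "R u < 2 ^ w" using u V4 VH Scan.prems by linarith
  define I where "I = (\<lambda>i (R'::nat\<Rightarrow>nat, M'). R' d = scan m i \<and> R' (d+1) = R u - i \<and> R' (d+2) = 1
      \<and> (\<forall>v<d. R' v = R v) \<and> M' = M)"
  have step: "fst \<sigma> (d+1) \<noteq> 0 \<and> runs w (Seq (Load (d+3) d) (Seq (Op Add d d (d+3)) (Seq (Op Add d d (d+2))
      (Op Sub (d+1) (d+1) (d+2))))) \<sigma> 4 (I (Suc i))" if i: "i < R u" and Ii: "I i \<sigma>" for i \<sigma>
  proof -
    obtain R' where [simp]: "\<sigma> = (R', M)" and I: "R' d = scan m i" "R' (d+1) = R u - i" "R' (d+2) = 1"
       "\<And>v. v < d \<Longrightarrow> R' v = R v" using Ii by (cases \<sigma>) (auto simp: I_def)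
    have M: "M (scan m i) = m (scan m i)" using sc[of i] i Scan.prems by simp
    have "scan m (Suc i) < 2 ^ w" using sc[of "Suc i"] i Scan.prems(4) by simp
    moreover have "(R u - i + 2 ^ w - Suc 0) mod 2 ^ w = R u - Suc i"
      using i Ru add_power_diff[of 1 "R u - i" w] by simp
    ultimately show ?thesis using i I by (auto simp: M I_def mod_simps)
  qed
  have "runs w (While (d+1) (Seq (Load (d+3) d) (Seq (Op Add d d (d+3)) (Seq (Op Add d d (d+2))
      (Op Sub (d+1) (d+1) (d+2)))))) \<sigma> (5 * X + 1)
      (\<lambda>(R', M'). R' d = ev m R (Scan u) \<and> (\<forall>v<d. R' v = R v) \<and> M' = M)" if "I 0 \<sigma>" for \<sigma>
    by (rule runs_While_count_const[where I = I and N = "R u" and c = 4 and X = X])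
      (use that step u in \<open>auto simp: I_def\<close>)
  moreover have "0 < w" using H1 by (cases w) auto
  ultimately show ?case using H1 Ru u
    by (simp add: I_def del: scan.simps(2))
next
  case (Sum v u b)
  have u: "R u \<le> V" "u < d" "u < B" "R u \<le> X" "v < B" "v < d" "R v \<le> V" using Sum.prems by auto
  have V1: "V ^ degree_ex b < H" "V < 2 ^ w" "V < H"
  proof -
    have "V ^ degree_ex b \<le> V ^ degree_ex (Sum v u b)" "V ^ 1 \<le> V ^ degree_ex (Sum v u b)"
      by (rule power_increasing; use V2 in simp)+
    then show "V ^ degree_ex b < H" "V < 2 ^ w" "V < H"
      using Sum.prems(3,4) unfolding power_one_right by linarith+
  qed
  have le: "(\<Sum>j<i. ev m (R(v := j)) b) < 2 ^ w" if "i \<le> R u" for i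
  proof -
    have "(\<Sum>j<i. ev m (R(v := j)) b) \<le> (\<Sum>j<R u. ev m (R(v := j)) b)"
      using that by (intro sum_mono2) auto
    also have "\<dots> \<le> V ^ degree_ex (Sum v u b)"
      using ev_le[OF V2 m_le scan_le, of B "Sum v u b" R] Sum.prems by auto
    finally show ?thesis using Sum.prems(3,4) by linarith
  qed
  define I where "I = (\<lambda>i (R'::nat\<Rightarrow>nat, M'). R' d = (\<Sum>j<i. ev m (R(v := j)) b) \<and> R' (d+1) = R v
      \<and> R' (d+2) = R u - i \<and> R' (d+3) = 1 \<and> R' v = i \<and> (\<forall>x<d. x \<noteq> v \<longrightarrow> R' x = R x) \<and> M' = M)"
  have lv: "loop_vars b \<subseteq> {..<B}" using Sum.prems(1)
      by (simp, induction b) auto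
  have step: "fst \<sigma> (d+2) \<noteq> 0 \<and> runs w (Seq (comp_ex (d+4) b) (Seq (Op Add d d (d+4)) (Seq (Op Add v v (d+3))
      (Op Sub (d+2) (d+2) (d+3))))) \<sigma> (time_ex X b + 3) (I (Suc i))" if i: "i < R u" and Ii: "I i \<sigma>" for i \<sigma>
  proof -
    obtain R' where \<sigma>: "\<sigma> = (R', M)" and I: "R' d = (\<Sum>j<i. ev m (R(v := j)) b)" "R' (d+1) = R v"
      "R' (d+2) = R u - i" "R' (d+3) = 1" "R' v = i" "\<And>x. x < d \<Longrightarrow> x \<noteq> v \<Longrightarrow> R' x = R x"
      using Ii by (cases \<sigma>) (auto simp: I_def)
    have eq: "ev m R' b = ev m (R(v := i)) b"
      using Sum.prems I by (intro ev_cong[of B]) auto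
    \<comment> \<open>An inner loop may be bounded by the index of the outer one, whose value
      \<open>i\<close> is below \<open>R u\<close> and hence below \<open>X\<close>.\<close>
    have X: "R' x \<le> X" if "x \<in> loop_vars b" for x
    proof (cases "x = v")
      case True then show ?thesis using i I u by simp
    next
      case False
      then have "R' x = R x" using that lv Sum.prems(2) I(6)[of x] by fastforce
      then show ?thesis using Sum.prems(7)[of x] that by simp
    qed
    have V: "R' x \<le> V" if "x < B" for x
    proof (cases "x = v")
      case True then show ?thesis using i I u by simp
    next
      case False
      then show ?thesis using that Sum.prems(2,5) I(6)[of x] by simp
    qed
    have 2: "runs w (comp_ex (d+4) b) (R', M) (time_ex X b)
       (\<lambda>(R'', M'). R'' (d+4) = ev m R' b \<and> (\<forall>x<d+4. R'' x = R' x) \<and> M' = M)"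
      by (rule Sum.IH) (use Sum.prems V1 V X in auto)
    have "Suc i < 2 ^ w" using u i V1 by linarith
    moreover have "(R u - i + 2 ^ w - Suc 0) mod 2 ^ w = R u - Suc i"
      using i u V1 add_power_diff[of 1 "R u - i" w] by simp
    moreover have "(\<Sum>j<i. ev m (R(v := j)) b) + ev m (R(v := i)) b < 2 ^ w"
      using le[of "Suc i"] i by simp
    moreover have "runs w (Seq (Op Add d d (d+4)) (Seq (Op Add v v (d+3)) (Op Sub (d+2) (d+2) (d+3))))
        \<sigma>' 3 (I (Suc i))"
      if *: "case \<sigma>' of (R'', M') \<Rightarrow> R'' (d+4) = ev m R' b \<and> (\<forall>x<d+4. R'' x = R' x) \<and> M' = M" for \<sigma>'
    proof -
      obtain R'' where \<sigma>': "\<sigma>' = (R'', M)" and 4: "R'' (d+4) = ev m (R(v := i)) b" "\<forall>x<d+4. R'' x = R' x"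
        using * eq by (cases \<sigma>') auto
      have 5: "R'' d = (\<Sum>j<i. ev m (R(v := j)) b)" "R'' (Suc d) = R v" "R'' (Suc (Suc d)) = R u - i"
        "R'' (d+3) = 1" "R'' v = i" "\<forall>x<d. x \<noteq> v \<longrightarrow> R'' x = R x"
        using 4(2) I u by simp_all
      show ?thesis unfolding \<sigma>' using calculation 4(1) 5 u by (simp add: I_def)
    qed
    ultimately have "runs w (Seq (comp_ex (d+4) b) (Seq (Op Add d d (d+4)) (Seq (Op Add v v (d+3))
      (Op Sub (d+2) (d+2) (d+3))))) \<sigma> (time_ex X b + 3) (I (Suc i))"
      unfolding \<sigma> by (intro runs_Seq[OF 2])
    then show ?thesis unfolding \<sigma> using i I by simp
  qed
  have W: "runs w (Seq (While (d+2) (Seq (comp_ex (d+4) b) (Seq (Op Add d d (d+4)) (Seq (Op Add v v (d+3))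
      (Op Sub (d+2) (d+2) (d+3)))))) (Op And v (d+1) (d+1))) \<sigma> (X * (time_ex X b + 4) + 2)
      (\<lambda>(R', M'). R' d = ev m R (Sum v u b) \<and> (\<forall>v<d. R' v = R v) \<and> M' = M)" if "I 0 \<sigma>" for \<sigma>
  proof (rule runs_Seq'[where n = "X * (time_ex X b + 4) + 1" and n' = 1 and \<Psi> = "I (R u)"])
    show "runs w (While (d+2) (Seq (comp_ex (d+4) b) (Seq (Op Add d d (d+4)) (Seq (Op Add v v (d+3))
      (Op Sub (d+2) (d+2) (d+3)))))) \<sigma> (X * (time_ex X b + 4) + 1) (I (R u))"
      by (rule runs_While_count_const[where I = I and N = "R u" and c = "time_ex X b + 3" and X = X])
        (use that step u in \<open>auto simp: I_def\<close>)
    show "runs w (Op And v (d + 1) (d + 1)) \<sigma>' 1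
           (\<lambda>(R', M'). R' d = ev m R (Sum v u b) \<and> (\<forall>v<d. R' v = R v) \<and> M' = M)" if "I (R u) \<sigma>'" for \<sigma>'
      using that u V1 by (cases \<sigma>') (auto simp: I_def)
  qed simp
  have "(1::nat) < 2 ^ w" using V2 V1 by linarith
  then have "0 < w" by (cases w) auto
  moreover have "R u < 2 ^ w" "R v < 2 ^ w" using u V1 by linarith+
  ultimately show ?case using u W[of "(R(d := 0, Suc d := R v, Suc (Suc d) := R u, d + 3 := 1, v := 0), M)"]
    by (simp add: I_def)
qed

end


datatype gen = Emit ex | Nop | Sq gen gen | For nat nat gen | Iff ex gen gen

fun gl :: "(nat \<Rightarrow> nat) \<Rightarrow> (nat \<Rightarrow> nat) \<Rightarrow> gen \<Rightarrow> nat list" where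
  "gl m s (Emit e) = [ev m s e]"
| "gl m s Nop = []"
| "gl m s (Sq g h) = gl m s g @ gl m s h"
| "gl m s (For v u g) = concat (map (\<lambda>i. gl m (s(v := i)) g) [0..<s u])"
| "gl m s (Iff e g h) = (if ev m s e \<noteq> 0 then gl m s g else gl m s h)"

fun vars_below_gen :: "nat \<Rightarrow> gen \<Rightarrow> bool" where
  "vars_below_gen B (Emit e) \<longleftrightarrow> vars_below B e"
| "vars_below_gen B Nop \<longleftrightarrow> True"
| "vars_below_gen B (Sq g h) \<longleftrightarrow> vars_below_gen B g \<and> vars_below_gen B h"
| "vars_below_gen B (For v u g) \<longleftrightarrow> v < B \<and> u < B \<and> vars_below_gen B g"
| "vars_below_gen B (Iff e g h) \<longleftrightarrow> vars_below B e \<and> vars_below_gen B g \<and> vars_below_gen B h"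

fun loop_vars_gen :: "gen \<Rightarrow> nat set" where
  "loop_vars_gen (Emit e) = loop_vars e"
| "loop_vars_gen Nop = {}"
| "loop_vars_gen (Sq g h) = loop_vars_gen g \<union> loop_vars_gen h"
| "loop_vars_gen (For v u g) = insert u (loop_vars_gen g)"
| "loop_vars_gen (Iff e g h) = loop_vars e \<union> loop_vars_gen g \<union> loop_vars_gen h"

text \<open>The input formats put the length of a list before its entries, so it must be computable
  before the list is generated. A conditional becomes a sum of two products, exactly one of which
  has factor 1.\<close>

fun len_ex :: "gen \<Rightarrow> ex" where
  "len_ex (Emit e) = Cn 1"
| "len_ex Nop = Cn 0"
| "len_ex (Sq g h) = Bin BAdd (len_ex g) (len_ex h)"
| "len_ex (For v u g) = Sum v u (len_ex g)"
| "len_ex (Iff e g h) = Bin BAdd (Bin BMul (Bin BLess (Cn 0) e) (len_ex g))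
     (Bin BMul (Bin BEq e (Cn 0)) (len_ex h))"

fun degree_gen :: "gen \<Rightarrow> nat" where
  "degree_gen (Emit e) = degree_ex e"
| "degree_gen Nop = 1"
| "degree_gen (Sq g h) = degree_gen g + degree_gen h"
| "degree_gen (For v u g) = degree_gen g"
| "degree_gen (Iff e g h) = degree_ex e + degree_gen g + degree_gen h"

fun time_gen :: "nat \<Rightarrow> gen \<Rightarrow> nat" where
  "time_gen X (Emit e) = time_ex X e + 3"
| "time_gen X Nop = 1"
| "time_gen X (Sq g h) = time_gen X g + time_gen X h"
| "time_gen X (For v u g) = X * (time_gen X g + 3) + 6"
| "time_gen X (Iff e g h) = time_ex X e + 1 + time_gen X g + time_gen X h"

text \<open>Register \<open>p\<close> is the output pointer, the only register below
  \<open>d\<close> whose final value differs from the initial one.\<close>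

fun comp_gen :: "nat \<Rightarrow> nat \<Rightarrow> gen \<Rightarrow> com" where
  "comp_gen p d (Emit e) = Seq (comp_ex d e) (Seq (Store p d) (Seq (Const d 1) (Op Add p p d)))"
| "comp_gen p d Nop = Skip"
| "comp_gen p d (Sq g h) = Seq (comp_gen p d g) (comp_gen p d h)"
| "comp_gen p d (For v u g) = Seq (Op And d v v) (Seq (Op And (d+1) u u) (Seq (Const (d+2) 1)
    (Seq (Const v 0) (Seq (While (d+1) (Seq (comp_gen p (d+3) g) (Seq (Op Add v v (d+2))
      (Op Sub (d+1) (d+1) (d+2))))) (Op And v d d)))))"
| "comp_gen p d (Iff e g h) = Seq (comp_ex d e) (Cond d (comp_gen p d g) (comp_gen p d h))"

definition put :: "(nat \<Rightarrow> nat) \<Rightarrow> nat \<Rightarrow> nat list \<Rightarrow> nat \<Rightarrow> nat" where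
  "put M p ys = (\<lambda>a. if p \<le> a \<and> a < p + length ys then ys ! (a - p) else M a)"

lemma put_Nil [simp]: "put M p [] = M"
  by (auto simp: put_def)

lemma put_append: "put M p (xs @ ys) = put (put M p xs) (p + length xs) ys"
  by (auto simp: put_def nth_append fun_eq_iff)

lemma put_single: "put M p [y] = M(p := y)"
  by (auto simp: put_def fun_eq_iff)

lemma put_below: "a < p \<Longrightarrow> put M p ys a = M a"
  by (simp add: put_def)

lemma ev_len_ex: "ev m s (len_ex g) = length (gl m s g)"
  by (induction g arbitrary: s)
    (auto simp: length_concat comp_def interv_sum_list_conv_sum_set_nat atLeast0LessThan)

lemma gl_cong: "vars_below_gen B g \<Longrightarrow> (\<And>v. v < B \<Longrightarrow> s v = s' v) \<Longrightarrow> gl m s g = gl m s' g"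
proof (induction g arbitrary: s s')
  case (Emit e)
  then show ?case using ev_cong[of B e s s'] by simp
next
  case (Sq g h)
  have "gl m s g = gl m s' g" by (rule Sq.IH(1)) (use Sq.prems in auto)
  moreover have "gl m s h = gl m s' h" by (rule Sq.IH(2)) (use Sq.prems in auto)
  ultimately show ?case by simp
next
  case (For v u g)
  have "gl m (s(v := i)) g = gl m (s'(v := i)) g" for i by (rule For.IH) (use For.prems in auto)
  then show ?case using For.prems by simp
next
  case (Iff e g h)
  have "gl m s g = gl m s' g" by (rule Iff.IH(1)) (use Iff.prems in auto)
  moreover have "gl m s h = gl m s' h" by (rule Iff.IH(2)) (use Iff.prems in auto)
  moreover have "ev m s e = ev m s' e" by (rule ev_cong[of B]) (use Iff.prems in auto)
  ultimately show ?case by simp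
qed auto

lemma loop_vars_below: "vars_below B e \<Longrightarrow> loop_vars e \<subseteq> {..<B}"
  by (induction e) auto

lemma loop_vars_gen_below: "vars_below_gen B g \<Longrightarrow> loop_vars_gen g \<subseteq> {..<B}"
  by (induction g) (auto dest: loop_vars_below)

context input_memory
begin

lemma pow_mono_H: "V ^ k < H \<Longrightarrow> j \<le> k \<Longrightarrow> V ^ j < H"
  using power_increasing[of j k V] V2 by linarith

text \<open>The output starts at or above \<open>H\<close>, so writing it leaves intact the part of
  the input that later expressions read.\<close>

lemma comp_gen_runs:
  assumes "vars_below_gen B g" "B \<le> p" "p < d" "V ^ degree_gen g < H" "H \<le> 2 ^ w" "1 < H" "V < H"
    and "\<And>v. v < B \<Longrightarrow> R v \<le> V" "\<And>a. a < H \<Longrightarrow> M a = m a"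
    and "\<And>u. u \<in> loop_vars_gen g \<Longrightarrow> R u \<le> X"
    and "H \<le> R p" "R p + length (gl m R g) < 2 ^ w"
  shows "runs w (comp_gen p d g) (R, M) (time_gen X g)
     (\<lambda>(R', M'). R' p = R p + length (gl m R g) \<and> (\<forall>v<d. v \<noteq> p \<longrightarrow> R' v = R v) \<and> M' = put M (R p) (gl m R g))"
  using assms
proof (induction g arbitrary: d R M)
  case (Emit e)
  have w: "0 < w" using Emit.prems(5,6) by (cases w) auto
  have 1: "runs w (comp_ex d e) (R, M) (time_ex X e)
     (\<lambda>(R', M'). R' d = ev m R e \<and> (\<forall>v<d. R' v = R v) \<and> M' = M)"
    by (rule comp_ex_runs) (use Emit.prems in auto)
  show ?case unfolding comp_gen.simps
    by (rule runs_Seq'[OF 1, where n' = 3]) (use Emit.prems w in \<open>auto simp: put_single fun_eq_iff\<close>)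
next
  case Nop
  then show ?case by simp
next
  case (Sq g h)
  have H: "V ^ degree_gen g < H" "V ^ degree_gen h < H"
    using Sq.prems(4) by (auto intro: pow_mono_H)
  have 1: "runs w (comp_gen p d g) (R, M) (time_gen X g)
     (\<lambda>(R', M'). R' p = R p + length (gl m R g) \<and> (\<forall>v<d. v \<noteq> p \<longrightarrow> R' v = R v) \<and> M' = put M (R p) (gl m R g))"
    by (rule Sq.IH(1)) (use Sq.prems H in auto)
  show ?case unfolding comp_gen.simps
  proof (rule runs_Seq'[OF 1, where n' = "time_gen X h"])
    fix \<sigma>' assume *: "case \<sigma>' of (R', M') \<Rightarrow> R' p = R p + length (gl m R g) \<and> (\<forall>v<d. v \<noteq> p \<longrightarrow> R' v = R v)
       \<and> M' = put M (R p) (gl m R g)"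
    obtain R' where \<sigma>: "\<sigma>' = (R', put M (R p) (gl m R g))" "R' p = R p + length (gl m R g)"
      "\<And>v. v < d \<Longrightarrow> v \<noteq> p \<Longrightarrow> R' v = R v" using * by (cases \<sigma>') auto
    have eq: "gl m R' h = gl m R h" by (rule gl_cong[of B]) (use Sq.prems \<sigma> in auto)
    have lv: "loop_vars_gen h \<subseteq> {..<B}" using Sq.prems(1) loop_vars_gen_below by simp
    have lv': "R' u = R u" if "u \<in> loop_vars_gen h" for u
      using that lv Sq.prems(2,3) \<sigma>(3)[of u] by auto
    have "runs w (comp_gen p d h) (R', put M (R p) (gl m R g)) (time_gen X h)
     (\<lambda>(R'', M'). R'' p = R' p + length (gl m R' h) \<and> (\<forall>v<d. v \<noteq> p \<longrightarrow> R'' v = R' v) \<and>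
        M' = put (put M (R p) (gl m R g)) (R' p) (gl m R' h))"
      by (rule Sq.IH(2)) (use Sq.prems H \<sigma> eq lv' in \<open>auto simp: put_below\<close>)
    then show "runs w (comp_gen p d h) \<sigma>' (time_gen X h) (\<lambda>(R', M'). R' p = R p + length (gl m R (Sq g h)) \<and>
        (\<forall>v<d. v \<noteq> p \<longrightarrow> R' v = R v) \<and> M' = put M (R p) (gl m R (Sq g h)))"
      unfolding \<sigma>(1) by (rule runs_weaken) (use \<sigma> eq in \<open>auto simp: put_append\<close>)
  qed simp
next
  case (For v u g)
  have u: "R u \<le> V" "u < d" "u < B" "R u \<le> X" "v < B" "v < d" "R v \<le> V" "v \<noteq> p" "u \<noteq> p" "v < p" "u < p"
    using For.prems by auto
  have w: "0 < w" "V < 2 ^ w" using For.prems(5,6,7) by (cases w; auto)+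
  define ls where "ls i = concat (map (\<lambda>j. gl m (R(v := j)) g) [0..<i])" for i
  have ls: "ls (Suc i) = ls i @ gl m (R(v := i)) g" for i by (simp add: ls_def)
  \<comment> \<open>Prefixes of the output are no longer than the whole output, so the pointer
    cannot overflow in the middle of the loop.\<close>
  have lsle: "length (ls i) \<le> length (gl m R (For v u g))" if "i \<le> R u" for i
  proof -
    have "[0..<R u] = [0..<i] @ [i..<R u]" using that upt_add_eq_append[of 0 i "R u - i"] by simp
    then show ?thesis by (simp add: ls_def)
  qed
  define I where "I = (\<lambda>i (R'::nat\<Rightarrow>nat, M'). R' p = R p + length (ls i) \<and> R' d = R v
      \<and> R' (d+1) = R u - i \<and> R' (d+2) = 1 \<and> R' v = i \<and> (\<forall>x<d. x \<noteq> v \<longrightarrow> x \<noteq> p \<longrightarrow> R' x = R x) \<and>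
      M' = put M (R p) (ls i))"
  have lv: "loop_vars_gen g \<subseteq> {..<B}" using For.prems(1) loop_vars_gen_below by simp
  have step: "fst \<sigma> (d+1) \<noteq> 0 \<and> runs w (Seq (comp_gen p (d+3) g) (Seq (Op Add v v (d+2))
      (Op Sub (d+1) (d+1) (d+2)))) \<sigma> (time_gen X g + 2) (I (Suc i))" if i: "i < R u" and Ii: "I i \<sigma>" for i \<sigma>
  proof -
    obtain R' where \<sigma>: "\<sigma> = (R', put M (R p) (ls i))" and I: "R' p = R p + length (ls i)" "R' d = R v"
      "R' (d+1) = R u - i" "R' (d+2) = 1" "R' v = i" "\<And>x. x < d \<Longrightarrow> x \<noteq> v \<Longrightarrow> x \<noteq> p \<Longrightarrow> R' x = R x"
      using Ii by (cases \<sigma>) (auto simp: I_def)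
    have eq: "gl m R' g = gl m (R(v := i)) g"
      using For.prems I by (intro gl_cong[of B]) auto
    have X: "R' x \<le> X" if "x \<in> loop_vars_gen g" for x
    proof (cases "x = v")
      case True then show ?thesis using i I u by simp
    next
      case False
      then have "R' x = R x" using that lv For.prems(2,3) I(6)[of x] by fastforce
      then show ?thesis using For.prems(10)[of x] that by simp
    qed
    have V: "R' x \<le> V" if "x < B" for x
    proof (cases "x = v")
      case True then show ?thesis using i I u by simp
    next
      case False
      then show ?thesis using that For.prems(2,3,8) I(6)[of x] by simp
    qed
    have lt: "R p + length (ls (Suc i)) < 2 ^ w" using lsle[of "Suc i"] i For.prems(12) by simp
    have 2: "runs w (comp_gen p (d+3) g) (R', put M (R p) (ls i)) (time_gen X g)
       (\<lambda>(R'', M'). R'' p = R' p + length (gl m R' g) \<and> (\<forall>v<d+3. v \<noteq> p \<longrightarrow> R'' v = R' v) \<and>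
         M' = put (put M (R p) (ls i)) (R' p) (gl m R' g))"
      by (rule For.IH) (use For.prems V X I lt eq in \<open>auto simp: put_below ls\<close>)
    have "Suc i < 2 ^ w" using u i w by linarith
    moreover have "(R u - i + 2 ^ w - Suc 0) mod 2 ^ w = R u - Suc i"
      using i u w add_power_diff[of 1 "R u - i" w] by simp
    moreover have "runs w (Seq (Op Add v v (d+2)) (Op Sub (d+1) (d+1) (d+2))) \<sigma>' 2 (I (Suc i))"
      if *: "case \<sigma>' of (R'', M') \<Rightarrow> R'' p = R' p + length (gl m R' g) \<and> (\<forall>v<d+3. v \<noteq> p \<longrightarrow> R'' v = R' v) \<and>
         M' = put (put M (R p) (ls i)) (R' p) (gl m R' g)" for \<sigma>'
    proof -
      obtain R'' where \<sigma>': "\<sigma>' = (R'', put M (R p) (ls (Suc i)))"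
          and 4: "R'' p = R p + length (ls (Suc i))" "\<forall>x<d+3. x \<noteq> p \<longrightarrow> R'' x = R' x"
        using * by (cases \<sigma>') (auto simp: I(1) eq ls put_append)
      have 5: "R'' d = R v" "R'' (Suc d) = R u - i"
        "R'' (Suc (Suc d)) = 1" "R'' v = i" "\<forall>x<d. x \<noteq> v \<longrightarrow> x \<noteq> p \<longrightarrow> R'' x = R x"
        using 4(2) I u For.prems(3) by simp_all
      show ?thesis unfolding \<sigma>' using calculation 4(1) 5 u For.prems(3) by (simp add: I_def)
    qed
    ultimately have "runs w (Seq (comp_gen p (d+3) g) (Seq (Op Add v v (d+2))
      (Op Sub (d+1) (d+1) (d+2)))) \<sigma> (time_gen X g + 2) (I (Suc i))"
      unfolding \<sigma> by (intro runs_Seq[OF 2])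
    then show ?thesis unfolding \<sigma> using i I by simp
  qed
  have W: "runs w (Seq (While (d+1) (Seq (comp_gen p (d+3) g) (Seq (Op Add v v (d+2))
      (Op Sub (d+1) (d+1) (d+2))))) (Op And v d d)) \<sigma> (X * (time_gen X g + 3) + 2)
      (\<lambda>(R', M'). R' p = R p + length (gl m R (For v u g)) \<and> (\<forall>x<d. x \<noteq> p \<longrightarrow> R' x = R x) \<and>
        M' = put M (R p) (gl m R (For v u g)))" if I0: "I 0 \<sigma>" for \<sigma>
  proof (rule runs_Seq'[where n = "X * (time_gen X g + 3) + 1" and n' = 1 and \<Psi> = "I (R u)"])
    show "runs w (While (d+1) (Seq (comp_gen p (d+3) g) (Seq (Op Add v v (d+2))
      (Op Sub (d+1) (d+1) (d+2))))) \<sigma> (X * (time_gen X g + 3) + 1) (I (R u))"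
      by (rule runs_While_count_const[where I = I and N = "R u" and c = "time_gen X g + 2" and X = X])
        (use I0 step u in \<open>auto simp: I_def algebra_simps\<close>)
    show "runs w (Op And v d d) \<sigma>' 1 (\<lambda>(R', M'). R' p = R p + length (gl m R (For v u g)) \<and>
        (\<forall>x<d. x \<noteq> p \<longrightarrow> R' x = R x) \<and> M' = put M (R p) (gl m R (For v u g)))" if Iu: "I (R u) \<sigma>'" for \<sigma>'
      using Iu u w by (cases \<sigma>') (auto simp: I_def ls_def)
  qed simp
  have "R u < 2 ^ w" "R v < 2 ^ w" using u w by linarith+
  then show ?case using u w W[of "(R(d := R v, Suc d := R u, Suc (Suc d) := 1, v := 0), M)"] For.prems(3)
    by (simp add: I_def ls_def)
next
  case (Iff e g h)
  have H: "V ^ degree_ex e < H" "V ^ degree_gen g < H" "V ^ degree_gen h < H"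
    using Iff.prems(4) by (auto intro: pow_mono_H)
  have 1: "runs w (comp_ex d e) (R, M) (time_ex X e)
     (\<lambda>(R', M'). R' d = ev m R e \<and> (\<forall>v<d. R' v = R v) \<and> M' = M)"
    by (rule comp_ex_runs) (use Iff.prems H in auto)
  show ?case unfolding comp_gen.simps
  proof (rule runs_Seq'[OF 1, where n' = "1 + time_gen X g + time_gen X h"])
    fix \<sigma>' assume *: "case \<sigma>' of (R', M') \<Rightarrow> R' d = ev m R e \<and> (\<forall>v<d. R' v = R v) \<and> M' = M"
    obtain R' where \<sigma>: "\<sigma>' = (R', M)" "R' d = ev m R e"
      "\<And>v. v < d \<Longrightarrow> R' v = R v" using * by (cases \<sigma>') auto
    have eq: "gl m R' h = gl m R h" "gl m R' g = gl m R g"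
      by (rule gl_cong[of B]; use Iff.prems \<sigma> in simp)+
    have lv: "loop_vars_gen g \<subseteq> {..<B}" "loop_vars_gen h \<subseteq> {..<B}" using Iff.prems(1) loop_vars_gen_below by simp_all
    have lv': "R' u = R u" if "u \<in> loop_vars_gen g \<union> loop_vars_gen h" for u
      using that lv Iff.prems(2,3) \<sigma>(3)[of u] by auto
    have 2: "runs w (comp_gen p d g) (R', M) (time_gen X g)
     (\<lambda>(R'', M'). R'' p = R' p + length (gl m R' g) \<and> (\<forall>v<d. v \<noteq> p \<longrightarrow> R'' v = R' v) \<and>
        M' = put M (R' p) (gl m R' g))" if "ev m R e \<noteq> 0"
      by (rule Iff.IH(1)) (use Iff.prems H \<sigma> eq lv' that in auto)
    have 3: "runs w (comp_gen p d h) (R', M) (time_gen X h)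
     (\<lambda>(R'', M'). R'' p = R' p + length (gl m R' h) \<and> (\<forall>v<d. v \<noteq> p \<longrightarrow> R'' v = R' v) \<and>
        M' = put M (R' p) (gl m R' h))" if "ev m R e = 0"
      by (rule Iff.IH(2)) (use Iff.prems H \<sigma> eq lv' that in auto)
    show "runs w (Cond d (comp_gen p d g) (comp_gen p d h)) \<sigma>' (1 + time_gen X g + time_gen X h)
       (\<lambda>(R', M'). R' p = R p + length (gl m R (Iff e g h)) \<and>
        (\<forall>v<d. v \<noteq> p \<longrightarrow> R' v = R v) \<and> M' = put M (R p) (gl m R (Iff e g h)))"
      unfolding \<sigma>(1) using \<sigma>(2,3) eq Iff.prems(3)
      by (auto intro!: runs_weaken[OF 2] runs_weaken[OF 3])
  qed simp
qed

end


section \<open>Simulation of short words on long words, with undo by epochs\<close>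

section \<open>Simulating a machine with shorter words\<close>

text \<open>
  The registers and the memory of the simulated machine live in addresses \<open>0, ..., r - 1\<close> and
  \<open>r, r + 1, ...\<close> of a virtual address space of size \<open>H\<close>.  The value of address \<open>a\<close>
  is \<open>M (X + a)\<close> if it was written in the current epoch \<open>p\<close>, which the
  stamp \<open>M (3 * H + a)\<close> tells, and otherwise \<open>M (H + a)\<close>.  So with
  \<open>X = 2 * H\<close> the increment of \<open>p\<close> undoes all writes.
\<close>

definition view :: "nat \<Rightarrow> nat \<Rightarrow> nat \<Rightarrow> (nat \<Rightarrow> nat) \<Rightarrow> nat \<Rightarrow> nat" where
  "view H X p M a = (if M (3 * H + a) = p then M (X + a) else M (H + a))"

fun below_regs :: "nat \<Rightarrow> com \<Rightarrow> bool" where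
  "below_regs r Skip \<longleftrightarrow> True"
| "below_regs r (Const i v) \<longleftrightarrow> i < r"
| "below_regs r (Op f i j k) \<longleftrightarrow> i < r \<and> j < r \<and> k < r"
| "below_regs r (Load i j) \<longleftrightarrow> i < r \<and> j < r"
| "below_regs r (Store i j) \<longleftrightarrow> i < r \<and> j < r"
| "below_regs r (Seq P Q) \<longleftrightarrow> below_regs r P \<and> below_regs r Q"
| "below_regs r (Cond i P Q) \<longleftrightarrow> i < r \<and> below_regs r P \<and> below_regs r Q"
| "below_regs r (While i P) \<longleftrightarrow> i < r \<and> below_regs r P"

lemma below_regs_mono: "below_regs r P \<Longrightarrow> r \<le> r' \<Longrightarrow> below_regs r' P"
  by (induction P) auto

lemma ex_below_regs: "\<exists>r. below_regs r P"
proof (induction P)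
  case (Seq P Q)
  then obtain r r' where "below_regs r P" "below_regs r' Q" by blast
  then have "below_regs (max r r') (Seq P Q)" by (auto intro: below_regs_mono)
  then show ?case ..
next
  case (Cond i P Q)
  then obtain r r' where "below_regs r P" "below_regs r' Q" by blast
  then have "below_regs (max (Suc i) (max r r')) (Cond i P Q)"
    by (auto intro: below_regs_mono)
  then show ?case ..
next
  case (While i P)
  then obtain r where "below_regs r P" by blast
  then have "below_regs (max (Suc i) r) (While i P)" by (auto intro: below_regs_mono)
  then show ?case ..
next
  case (Const i v) then show ?case by auto
next
  case (Op f i j k)
  have "below_regs (Suc (i + j + k)) (Op f i j k)" by auto
  then show ?case ..
next
  case (Load i j)
  have "below_regs (Suc (i + j)) (Load i j)" by auto
  then show ?case ..
next
  case (Store i j)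
  have "below_regs (Suc (i + j)) (Store i j)" by auto
  then show ?case ..
qed auto

text \<open>
  Registers 20 to 24 hold \<open>2 ^ w'\<close>, \<open>X\<close>, \<open>p\<close>, \<open>H\<close>, \<open>3 * H\<close>; registers 40 to 43 are scratch.
\<close>

definition get :: "nat \<Rightarrow> nat \<Rightarrow> com" where
  "get i j = Seq (Op Add 43 24 j) (Seq (Load 43 43) (Seq (Op Eq 43 43 22)
    (Seq (Cond 43 (Op Add 43 21 j) (Op Add 43 23 j)) (Load i 43))))"

definition set_at :: "nat \<Rightarrow> nat \<Rightarrow> com" where
  "set_at j i = Seq (Op Add 43 21 j) (Seq (Store 43 i) (Seq (Op Add 43 24 j) (Store 43 22)))"

text \<open>Taking the remainder by register 20 turns a long result into the short one. A simulated
  register must be fetched before it can be tested; hence the test of a loop is fetched once in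
  front of the loop and again at the end of its body.\<close>

fun sim :: "nat \<Rightarrow> com \<Rightarrow> com" where
  "sim r Skip = Skip"
| "sim r (Const i v) = Seq (Const 40 i) (Seq (Const 41 v) (Seq (Op Mod 41 41 20) (set_at 40 41)))"
| "sim r (Op f i j k) = Seq (Const 40 j) (Seq (get 41 40) (Seq (Const 40 k) (Seq (get 42 40)
    (Seq (Op f 41 41 42) (Seq (Op Mod 41 41 20) (Seq (Const 40 i) (set_at 40 41)))))))"
| "sim r (Load i j) = Seq (Const 40 j) (Seq (get 41 40) (Seq (Const 40 r) (Seq (Op Add 41 41 40)
    (Seq (get 42 41) (Seq (Const 40 i) (set_at 40 42))))))"
| "sim r (Store i j) = Seq (Const 40 j) (Seq (get 42 40) (Seq (Const 40 i) (Seq (get 41 40)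
    (Seq (Const 40 r) (Seq (Op Add 41 41 40) (set_at 41 42))))))"
| "sim r (Seq P Q) = Seq (sim r P) (sim r Q)"
| "sim r (Cond i P Q) = Seq (Const 40 i) (Seq (get 41 40) (Cond 41 (sim r P) (sim r Q)))"
| "sim r (While i P) = Seq (Seq (Const 40 i) (get 41 40)) (While 41 (Seq (sim r P) (Seq (Const 40 i) (get 41 40))))"

lemma runs_Seq_Cond [simp]: "runs w (Seq (Cond i P Q) S) \<sigma> n \<Phi> \<longleftrightarrow>
    1 \<le> n \<and> (if fst \<sigma> i \<noteq> 0 then runs w (Seq P S) \<sigma> (n - 1) \<Phi> else runs w (Seq Q S) \<sigma> (n - 1) \<Phi>)"
proof -
  have T: "exec w (Seq (Cond i P Q) S) \<sigma> t \<tau> \<longleftrightarrow> (\<exists>u. t = 1 + u \<and> exec w (Seq P S) \<sigma> u \<tau>)"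
    if i: "fst \<sigma> i \<noteq> 0" for t \<tau>
  proof
    assume "exec w (Seq (Cond i P Q) S) \<sigma> t \<tau>"
    then obtain a b \<rho> where "exec w (Cond i P Q) \<sigma> a \<rho>" "exec w S \<rho> b \<tau>" "t = a + b" by (rule exec_SeqE)
    moreover from this(1) obtain c where "exec w P \<sigma> c \<rho>" "a = 1 + c" by (rule exec_CondE) (use i in auto)
    ultimately show "\<exists>u. t = 1 + u \<and> exec w (Seq P S) \<sigma> u \<tau>" by (auto intro: exec.Seq)
  next
    assume "\<exists>u. t = 1 + u \<and> exec w (Seq P S) \<sigma> u \<tau>"
    then obtain u where u: "t = 1 + u" "exec w (Seq P S) \<sigma> u \<tau>" by blast
    from u(2) obtain a b \<rho> where "exec w P \<sigma> a \<rho>" "exec w S \<rho> b \<tau>" "u = a + b" by (rule exec_SeqE)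
    then show "exec w (Seq (Cond i P Q) S) \<sigma> t \<tau>"
      using exec.Seq[OF exec.CondT[OF i]] u(1) by (metis add.assoc)
  qed
  have F: "exec w (Seq (Cond i P Q) S) \<sigma> t \<tau> \<longleftrightarrow> (\<exists>u. t = 1 + u \<and> exec w (Seq Q S) \<sigma> u \<tau>)"
    if i: "fst \<sigma> i = 0" for t \<tau>
  proof
    assume "exec w (Seq (Cond i P Q) S) \<sigma> t \<tau>"
    then obtain a b \<rho> where "exec w (Cond i P Q) \<sigma> a \<rho>" "exec w S \<rho> b \<tau>" "t = a + b" by (rule exec_SeqE)
    moreover from this(1) obtain c where "exec w Q \<sigma> c \<rho>" "a = 1 + c" by (rule exec_CondE) (use i in auto)
    ultimately show "\<exists>u. t = 1 + u \<and> exec w (Seq Q S) \<sigma> u \<tau>" by (auto intro: exec.Seq)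
  next
    assume "\<exists>u. t = 1 + u \<and> exec w (Seq Q S) \<sigma> u \<tau>"
    then obtain u where u: "t = 1 + u" "exec w (Seq Q S) \<sigma> u \<tau>" by blast
    from u(2) obtain a b \<rho> where "exec w Q \<sigma> a \<rho>" "exec w S \<rho> b \<tau>" "u = a + b" by (rule exec_SeqE)
    then show "exec w (Seq (Cond i P Q) S) \<sigma> t \<tau>"
      using exec.Seq[OF exec.CondF[OF i]] u(1) by (metis add.assoc)
  qed
  show ?thesis
  proof (cases "fst \<sigma> i = 0")
    case True
    then show ?thesis unfolding runs_def F[OF True] by (cases n) auto
  next
    case False
    then show ?thesis unfolding runs_def T[OF False] by (cases n) auto
  qed
qed

text \<open>In the compiled form \<open>T; While i (P; T)\<close>, what remains after the first
  \<open>P\<close> has the same form. So the induction hypothesis about the rest of a simulated loop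
  applies to it as it stands.\<close>

lemma runs_While_rotate:
  assumes "fst \<sigma> i \<noteq> 0" "runs w P \<sigma> n \<Psi>"
    and "\<And>\<sigma>'. \<Psi> \<sigma>' \<Longrightarrow> runs w (Seq T (While i (Seq P T))) \<sigma>' n' \<Phi>"
  shows "runs w (While i (Seq P T)) \<sigma> (1 + n + n') \<Phi>"
proof -
  from assms(2) obtain t \<rho> where P: "exec w P \<sigma> t \<rho>" "t \<le> n" "\<Psi> \<rho>" unfolding runs_def by blast
  from assms(3)[OF P(3)] obtain u \<tau> where u: "exec w (Seq T (While i (Seq P T))) \<rho> u \<tau>" "u \<le> n'" "\<Phi> \<tau>"
    unfolding runs_def by blast
  from u(1) obtain a b \<mu> where ab: "exec w T \<rho> a \<mu>" "exec w (While i (Seq P T)) \<mu> b \<tau>" "u = a + b"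
    by (rule exec_SeqE)
  have "exec w (While i (Seq P T)) \<sigma> (1 + (t + a) + b) \<tau>"
    by (rule exec.WhileT[OF assms(1) exec.Seq[OF P(1) ab(1)] ab(2)])
  moreover have "1 + (t + a) + b \<le> 1 + n + n'" using P(2) u(2) ab(3) by simp
  ultimately show ?thesis using u(3) unfolding runs_def by blast
qed

text \<open>Since \<open>2 ^ w'\<close> divides \<open>2 ^ w\<close>, reducing modulo the larger
  power first does no harm. Subtraction is special as it adds the power itself; the two powers
  differ by a multiple of \<open>2 ^ w'\<close>.\<close>

lemma binop_val_mod:
  assumes "w' \<le> w" "x < 2 ^ w'" "y < 2 ^ w'"
  shows "binop_val w f x y mod 2 ^ w' = binop_val w' f x y"
proof -
  have dv: "(2::nat) ^ w' dvd 2 ^ w" using assms(1) by (rule le_imp_power_dvd)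
  show ?thesis
  proof (cases f)
    case Sub
    obtain d where d: "w = w' + d" using assms(1) le_Suc_ex by blast
    have "x + 2 ^ w - y = (x + 2 ^ w' - y) + (2 ^ d - 1) * 2 ^ w'"
      using assms(3) by (simp add: d power_add algebra_simps)
    then show ?thesis using dv Sub by (simp add: mod_mod_cancel)
  qed (use dv in \<open>simp_all add: mod_mod_cancel\<close>)
qed

definition same :: "(nat \<Rightarrow> nat) \<Rightarrow> (nat \<Rightarrow> nat) \<Rightarrow> bool" where
  "same R R' \<longleftrightarrow> (\<forall>v. v \<notin> {40, 41, 42, 43} \<longrightarrow> R' v = R v)"

lemma same_refl [simp]: "same R R" by (simp add: same_def)

lemma same_trans: "same R R' \<Longrightarrow> same R' R'' \<Longrightarrow> same R R''" by (simp add: same_def)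

lemma same_upd [simp]:
  assumes "i \<in> {40, 41, 42, 43}"
  shows "same R (R'(i := z)) \<longleftrightarrow> same R R'"
proof -
  have "(R'(i := z)) v = R' v" if "v \<notin> {40, 41, 42, 43}" for v using assms that by (metis fun_upd_other)
  then show ?thesis unfolding same_def by metis
qed

text \<open>Four banks of \<open>H\<close> words: the input, the base values from \<open>H\<close>,
  the values of the current epoch from \<open>2 * H\<close>, and the stamps from
  \<open>3 * H\<close>. A value bank has room for the \<open>r\<close> registers and the whole
  \<open>w'\<close>-bit memory of the simulated machine. The request buffer is placed above, from
  \<open>4 * H\<close>.\<close>

locale machine_sim =
  fixes w w' r H :: nat
  assumes r_le: "r + 2 ^ w' \<le> H" and H_le: "4 * H \<le> 2 ^ w"
begin

lemma H_pos: "0 < H" using r_le by (metis add_gr_0 gr0I le_zero_eq zero_less_numeral zero_less_power not_less_zero)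

lemma w_pos: "0 < w" using H_le H_pos by (cases w) auto

lemma w'_le: "w' \<le> w"
proof -
  have "(2::nat) ^ w' \<le> 2 ^ w" using r_le H_le by linarith
  then show ?thesis by simp
qed

definition sim_regs :: "nat \<Rightarrow> nat \<Rightarrow> (nat \<Rightarrow> nat) \<Rightarrow> bool" where
  "sim_regs X p R \<longleftrightarrow> R 20 = 2 ^ w' \<and> R 21 = X \<and> R 22 = p \<and> R 23 = H \<and> R 24 = 3 * H \<and> X \<in> {H, 2 * H}"

definition rep :: "nat \<Rightarrow> nat \<Rightarrow> (nat \<Rightarrow> nat) \<Rightarrow> config \<Rightarrow> bool" where
  "rep X p M \<sigma> \<longleftrightarrow> (\<forall>i<r. view H X p M i = fst \<sigma> i \<and> fst \<sigma> i < 2 ^ w') \<and>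
     (\<forall>a<2 ^ w'. view H X p M (r + a) = snd \<sigma> a \<and> snd \<sigma> a < 2 ^ w')"

text \<open>Outside the bank at \<open>X\<close> only stamps change, and only to the current epoch.
  This is exactly the information that a later rollback needs.\<close>

definition frame :: "nat \<Rightarrow> nat \<Rightarrow> (nat \<Rightarrow> nat) \<Rightarrow> (nat \<Rightarrow> nat) \<Rightarrow> bool" where
  "frame X p M M' \<longleftrightarrow> (\<forall>a. M' a = M a \<or> X \<le> a \<and> a < X + H \<or> 3 * H \<le> a \<and> a < 4 * H \<and> M' a = p)"

lemma frame_refl [simp]: "frame X p M M" by (simp add: frame_def)

lemma frame_trans: "frame X p M M' \<Longrightarrow> frame X p M' M'' \<Longrightarrow> frame X p M M''"
  unfolding frame_def by metis

abbreviation stamp_write :: "nat \<Rightarrow> nat \<Rightarrow> (nat \<Rightarrow> nat) \<Rightarrow> nat \<Rightarrow> nat \<Rightarrow> nat \<Rightarrow> nat" where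
  "stamp_write X p M a v \<equiv> M(X + a := v, 3 * H + a := p)"

lemma frame_write: "a < H \<Longrightarrow> X \<in> {H, 2 * H} \<Longrightarrow> frame X p M (stamp_write X p M a v)"
  by (auto simp: frame_def)

lemma view_write: "a < H \<Longrightarrow> b < H \<Longrightarrow> X \<in> {H, 2 * H} \<Longrightarrow>
    view H X p (stamp_write X p M a v) b = (if b = a then v else view H X p M b)"
  by (auto simp: view_def)

lemma rep_write_reg:
  assumes "rep X p M (R1, M1)" "i < r" "v < 2 ^ w'" "X \<in> {H, 2 * H}"
  shows "rep X p (stamp_write X p M i v) (R1(i := v), M1)"
proof -
  have *: "r + a < H" if "a < 2 ^ w'" for a using that r_le by linarith
  have **: "j < H" if "j < r" for j using that r_le by linarith
  show ?thesis using assms unfolding rep_def by (simp add: view_write * **)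
qed

lemma rep_write_mem:
  assumes "rep X p M (R1, M1)" "a < 2 ^ w'" "v < 2 ^ w'" "X \<in> {H, 2 * H}"
  shows "rep X p (stamp_write X p M (r + a) v) (R1, M1(a := v))"
proof -
  have *: "r + a < H" if "a < 2 ^ w'" for a using that r_le by linarith
  have **: "j < H" if "j < r" for j using that r_le by linarith
  show ?thesis using assms unfolding rep_def by (simp add: view_write * **)
qed

lemma get_runs:
  assumes "sim_regs X p R" "R j < H" "j \<noteq> 43" "6 \<le> n"
    and "\<And>z. runs w Q (R(43 := z, i := view H X p M (R j)), M) (n - 6) \<Phi>"
  shows "runs w (Seq (get i j) Q) (R, M) n \<Phi>"
proof -
  have b: "3 * H + R j < 2 ^ w" "H + R j < 2 ^ w" "X + R j < 2 ^ w"
    using assms(1,2) H_le by (auto simp: sim_regs_def)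
  have s: "R 21 = X" "R 22 = p" "R 23 = H" "R 24 = 3 * H" using assms(1) by (simp_all add: sim_regs_def)
  have f: "Suc 0 \<le> n - Suc 0" "Suc 0 \<le> n - Suc (Suc 0)" "Suc 0 \<le> n - Suc (Suc (Suc 0))" "Suc 0 \<le> n - Suc (Suc (Suc (Suc 0)))" "Suc 0 \<le> n - Suc (Suc (Suc (Suc (Suc 0))))"
    using assms(4) by linarith+
  have e: "n - Suc (Suc (Suc (Suc (Suc (Suc 0))))) = n - 6" by simp
  show ?thesis
    using assms(5)[of "H + R j"] assms(5)[of "X + R j"] assms(2-4) b w_pos s unfolding get_def
    by (cases "M (3 * H + R j) = p"; simp add: view_def e f)
qed

lemma set_runs_last:
  assumes "sim_regs X p R" "R j < H" "j \<noteq> 43" "i \<noteq> 43" "4 \<le> n"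
    and "\<And>z. \<Phi> (R(43 := z), stamp_write X p M (R j) (R i))"
  shows "runs w (set_at j i) (R, M) n \<Phi>"
proof -
  have b: "3 * H + R j < 2 ^ w" "H + R j < 2 ^ w" "X + R j < 2 ^ w"
    using assms(1,2) H_le by (auto simp: sim_regs_def)
  have s: "R 21 = X" "R 22 = p" "R 23 = H" "R 24 = 3 * H" using assms(1) by (simp_all add: sim_regs_def)
  have f: "Suc 0 \<le> n - Suc 0" "Suc 0 \<le> n - Suc (Suc 0)" "Suc 0 \<le> n - Suc (Suc (Suc 0))"
    using assms(5) by linarith+
  have e: "n - Suc (Suc (Suc (Suc 0))) = n - 4" by simp
  show ?thesis
    using assms(6)[of "3 * H + R j"] assms(2-5) b w_pos s unfolding set_at_def
    by (simp add: e f)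
qed

lemma sim_regs_upd [simp]:
  assumes "i \<in> {40, 41, 42, 43}"
  shows "sim_regs X p (R(i := z)) \<longleftrightarrow> sim_regs X p R"
proof -
  have "i \<noteq> 20 \<and> i \<noteq> 21 \<and> i \<noteq> 22 \<and> i \<noteq> 23 \<and> i \<noteq> 24" using assms by auto
  then show ?thesis by (simp add: sim_regs_def)
qed

lemma sim_regs_same: "sim_regs X p R \<Longrightarrow> same R R' \<Longrightarrow> sim_regs X p R'"
  by (auto simp: sim_regs_def same_def)

lemma rep_reg: "rep X p M \<sigma> \<Longrightarrow> i < r \<Longrightarrow> view H X p M i = fst \<sigma> i" "rep X p M \<sigma> \<Longrightarrow> i < r \<Longrightarrow> fst \<sigma> i < 2 ^ w'"
  by (auto simp: rep_def)

lemma rep_mem: "rep X p M \<sigma> \<Longrightarrow> a < 2 ^ w' \<Longrightarrow> view H X p M (r + a) = snd \<sigma> a" "rep X p M \<sigma> \<Longrightarrow> a < 2 ^ w' \<Longrightarrow> snd \<sigma> a < 2 ^ w'"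
  by (auto simp: rep_def)

text \<open>One instruction takes at most two reads of 6 steps, one write of 4 and a few constants.
  The factor 30 also covers the fetches that conditionals and loops add.\<close>

theorem sim_runs:
  assumes "exec w' P \<sigma> t \<sigma>'" "below_regs r P" "sim_regs X p R" "rep X p M \<sigma>"
  shows "runs w (sim r P) (R, M) (30 * t)
    (\<lambda>(R', M'). same R R' \<and> rep X p M' \<sigma>' \<and> frame X p M M')"
  using assms
proof (induction arbitrary: R M rule: exec.induct)
  case (Skip \<sigma>)
  then show ?case by simp
next
  case (Const i v R1 M1)
  have lt: "i < r" "i < H" "i < 2 ^ w" "i mod 2 ^ w = i" using Const r_le H_le by auto
  have X: "X \<in> {H, 2 * H}" "R 20 = 2 ^ w'" using Const by (auto simp: sim_regs_def)
  have "v mod 2 ^ w mod 2 ^ w' = v mod 2 ^ w'" using w'_le by (simp add: mod_mod_cancel le_imp_power_dvd)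
  moreover have "v mod 2 ^ w' < 2 ^ w" using w'_le
    by (meson less_le_trans mod_less_divisor pos2 power_increasing_iff one_less_numeral_iff semiring_norm(76) zero_less_power)
  ultimately show ?case using Const.prems lt X
    by (auto intro!: set_runs_last[of X p] frame_write rep_write_reg)
next
  case (Op f i j k R1 M1)
  have lt: "i < r" "i < H" "i < 2 ^ w" "i mod 2 ^ w = i" "j < r" "j < H" "j < 2 ^ w" "j mod 2 ^ w = j"
     "k < r" "k < H" "k < 2 ^ w" "k mod 2 ^ w = k" using Op r_le H_le by auto
  have X: "X \<in> {H, 2 * H}" "R 20 = 2 ^ w'" using Op by (auto simp: sim_regs_def)
  have b: "binop_val w f (R1 j) (R1 k) mod 2 ^ w' = binop_val w' f (R1 j) (R1 k)"
    using rep_reg(2)[OF Op.prems(3), of j] rep_reg(2)[OF Op.prems(3), of k] lt by (simp add: binop_val_mod w'_le)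
  then have b2: "binop_val w' f (R1 j) (R1 k) < 2 ^ w'"
    by (metis mod_less_divisor pos2 zero_less_power)
  then have b3: "binop_val w f (R1 j) (R1 k) mod 2 ^ w' mod 2 ^ w = binop_val w' f (R1 j) (R1 k)"
    using b w'_le by (metis mod_less less_le_trans one_le_numeral power_increasing)
  show ?case using Op.prems lt X b3 b2 rep_reg[OF Op.prems(3)]
    by (auto intro!: set_runs_last[of X p] get_runs[of X p] frame_write rep_write_reg)
next
  case (Load i j R1 M1)
  have lt: "i < r" "i < H" "i < 2 ^ w" "i mod 2 ^ w = i" "j < r" "j < H" "j < 2 ^ w" "j mod 2 ^ w = j"
     "r mod 2 ^ w = r" using Load r_le H_le by auto
  have X: "X \<in> {H, 2 * H}" "R 20 = 2 ^ w'" using Load by (auto simp: sim_regs_def)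
  have j: "R1 j < 2 ^ w'" using rep_reg(2)[OF Load.prems(3), of j] lt by simp
  then have a: "r + R1 j < H" "(R1 j + r) mod 2 ^ w = r + R1 j" using r_le H_le by auto
  show ?case using Load.prems lt X j a rep_reg[OF Load.prems(3)] rep_mem[OF Load.prems(3), of "R1 j"]
    by (auto intro!: set_runs_last[of X p] get_runs[of X p] frame_write rep_write_reg)
next
  case (Store i j R1 M1)
  have lt: "i < r" "i < H" "i < 2 ^ w" "i mod 2 ^ w = i" "j < r" "j < H" "j < 2 ^ w" "j mod 2 ^ w = j"
     "r mod 2 ^ w = r" using Store r_le H_le by auto
  have X: "X \<in> {H, 2 * H}" "R 20 = 2 ^ w'" using Store by (auto simp: sim_regs_def)
  have j: "R1 j < 2 ^ w'" "R1 i < 2 ^ w'" using rep_reg(2)[OF Store.prems(3)] lt by auto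
  then have a: "r + R1 i < H" "(R1 i + r) mod 2 ^ w = r + R1 i" using r_le H_le by auto
  show ?case using Store.prems lt X j a rep_reg[OF Store.prems(3)]
    by (auto intro!: set_runs_last[of X p] get_runs[of X p] frame_write rep_write_mem)
next
  case (Seq P \<sigma> t \<sigma>' P' t' \<sigma>'')
  have 1: "runs w (sim r P) (R, M) (30 * t) (\<lambda>(R', M'). same R R' \<and> rep X p M' \<sigma>' \<and> frame X p M M')"
    by (rule Seq.IH(1)) (use Seq.prems in auto)
  show ?case unfolding sim.simps
  proof (rule runs_Seq'[OF 1, where n' = "30 * t'"])
    fix \<tau> assume *: "case \<tau> of (R', M') \<Rightarrow> same R R' \<and> rep X p M' \<sigma>' \<and> frame X p M M'"
    obtain R' M' where \<tau>: "\<tau> = (R', M')" "same R R'" "rep X p M' \<sigma>'" "frame X p M M'"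
      using * by (cases \<tau>) auto
    have "runs w (sim r P') (R', M') (30 * t') (\<lambda>(R'', M''). same R' R'' \<and> rep X p M'' \<sigma>'' \<and> frame X p M' M'')"
      by (rule Seq.IH(2)) (use Seq.prems \<tau> sim_regs_same in auto)
    then show "runs w (sim r P') \<tau> (30 * t') (\<lambda>(R', M'). same R R' \<and> rep X p M' \<sigma>'' \<and> frame X p M M')"
      unfolding \<tau>(1) by (rule runs_weaken) (use \<tau> same_trans frame_trans in auto)
  qed simp
next
  case (CondT \<sigma> i P t \<sigma>' P')
  have lt: "i < r" "i < H" "i mod 2 ^ w = i" using CondT.prems r_le H_le by auto
  have i: "view H X p M i \<noteq> 0" using rep_reg(1)[OF CondT.prems(3)] lt CondT.hyps by simp
  have IH: "runs w (sim r P) (R1, M) (30 * t)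
     (\<lambda>(R', M'). same R R' \<and> rep X p M' \<sigma>' \<and> frame X p M M')" if R1: "same R R1" for R1
  proof -
    have S: "sim_regs X p R1" by (rule sim_regs_same[OF CondT.prems(2) R1])
    have B: "below_regs r P" using CondT.prems(1) by simp
    show ?thesis by (rule runs_weaken[OF CondT.IH[OF B S CondT.prems(3)]]) (auto intro: same_trans[OF R1])
  qed
  show ?case using CondT.prems(2) lt i by (auto intro!: get_runs[of X p] runs_weaken[OF IH])
next
  case (CondF \<sigma> i P' t \<sigma>' P)
  have lt: "i < r" "i < H" "i mod 2 ^ w = i" using CondF.prems r_le H_le by auto
  have i: "view H X p M i = 0" using rep_reg(1)[OF CondF.prems(3)] lt CondF.hyps by simp
  have IH: "runs w (sim r P') (R1, M) (30 * t)
     (\<lambda>(R', M'). same R R' \<and> rep X p M' \<sigma>' \<and> frame X p M M')" if R1: "same R R1" for R1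
  proof -
    have S: "sim_regs X p R1" by (rule sim_regs_same[OF CondF.prems(2) R1])
    have B: "below_regs r P'" using CondF.prems(1) by simp
    show ?thesis by (rule runs_weaken[OF CondF.IH[OF B S CondF.prems(3)]]) (auto intro: same_trans[OF R1])
  qed
  show ?case using CondF.prems(2) lt i by (auto intro!: get_runs[of X p] runs_weaken[OF IH])
next
  case (WhileF \<sigma> i P)
  have lt: "i < r" "i < H" "i mod 2 ^ w = i" using WhileF.prems r_le H_le by auto
  have i: "view H X p M i = 0" using rep_reg(1)[OF WhileF.prems(3)] lt WhileF.hyps by simp
  show ?case using WhileF.prems lt i by (auto intro!: get_runs[of X p] runs_While_done)
next
  case (WhileT \<sigma> i P t \<sigma>' t' \<sigma>'')
  have lt: "i < r" "i < H" "i mod 2 ^ w = i" using WhileT.prems r_le H_le by auto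
  have i: "view H X p M i \<noteq> 0" using rep_reg(1)[OF WhileT.prems(3)] lt WhileT.hyps by simp
  let ?W = "While 41 (Seq (sim r P) (Seq (Const 40 i) (get 41 40)))"
  have W: "runs w ?W (R1, M) (1 + 30 * t + 30 * t') (\<lambda>(R', M'). same R R' \<and> rep X p M' \<sigma>'' \<and> frame X p M M')"
    if R1: "same R R1" "R1 41 \<noteq> 0" for R1
  proof (rule runs_While_rotate)
    show "fst (R1, M) 41 \<noteq> 0" using R1 by simp
    show "runs w (sim r P) (R1, M) (30 * t) (\<lambda>(R', M'). same R1 R' \<and> rep X p M' \<sigma>' \<and> frame X p M M')"
      by (rule WhileT.IH(1)) (use WhileT.prems R1 sim_regs_same in auto)
    fix \<tau> assume *: "case \<tau> of (R', M') \<Rightarrow> same R1 R' \<and> rep X p M' \<sigma>' \<and> frame X p M M'"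
    obtain R' M' where \<tau>: "\<tau> = (R', M')" "same R1 R'" "rep X p M' \<sigma>'" "frame X p M M'"
      using * by (cases \<tau>) auto
    have RR: "same R R'" using R1 \<tau> same_trans by blast
    have "runs w (sim r (While i P)) (R', M') (30 * t') (\<lambda>(R'', M''). same R' R'' \<and> rep X p M'' \<sigma>'' \<and> frame X p M' M'')"
      by (rule WhileT.IH(2)) (use WhileT.prems RR \<tau> sim_regs_same in auto)
    then show "runs w (Seq (Seq (Const 40 i) (get 41 40)) ?W) \<tau> (30 * t')
        (\<lambda>(R', M'). same R R' \<and> rep X p M' \<sigma>'' \<and> frame X p M M')"
      unfolding \<tau>(1) sim.simps by (rule runs_weaken) (use \<tau> RR same_trans frame_trans in auto)
  qed
  show ?case using WhileT.prems(2) lt i by (auto intro!: get_runs[of X p] runs_weaken[OF W])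
qed

end


section \<open>Feeding the requests of a phase to the simulated data structure\<close>

section \<open>Serving requests from a buffer\<close>

text \<open>
  A request is stored together with the answer that signals unsatisfiability:
  kind, number of arguments, two arguments, expected answer.
\<close>

fun record_words :: "request \<times> nat \<Rightarrow> nat list" where
  "record_words (rq, e) = (let ws = request_words rq in
     [ws ! 0, length ws - 1, if 1 < length ws then ws ! 1 else 0, if 2 < length ws then ws ! 2 else 0, e])"

fun mismatch :: "'s dyn_problem \<Rightarrow> 's \<Rightarrow> request \<Rightarrow> nat \<Rightarrow> bool" where
  "mismatch Q s (Query a) e \<longleftrightarrow> ans Q s a \<noteq> e"
| "mismatch Q s _ e \<longleftrightarrow> False"

fun hits :: "'s dyn_problem \<Rightarrow> 's \<Rightarrow> (request \<times> nat) list \<Rightarrow> bool" where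
  "hits Q s [] \<longleftrightarrow> False"
| "hits Q s ((rq, e) # rs) \<longleftrightarrow> mismatch Q s rq e \<or> hits Q (upd Q s rq) rs"

text \<open>In contrast to \<open>serves\<close>, this names the final configuration, in which the
  next phase of an amortized run begins.\<close>

fun serves_to :: "nat \<Rightarrow> com \<Rightarrow> 's dyn_problem \<Rightarrow> config \<Rightarrow> 's \<Rightarrow> request list \<Rightarrow> nat list \<Rightarrow> config \<Rightarrow> bool" where
  "serves_to w P Q \<sigma> s [] ts \<tau> \<longleftrightarrow> ts = [] \<and> \<tau> = \<sigma>"
| "serves_to w P Q \<sigma> s (r # rs) ts \<tau> \<longleftrightarrow>
    (\<exists>t ts' \<sigma>'. ts = t # ts' \<and> exec w P (load_request w r \<sigma>) t \<sigma>' \<and>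
       correct_answer Q s r (result \<sigma>') \<and> serves_to w P Q \<sigma>' (upd Q s r) rs ts' \<tau>)"

definition short :: "request \<Rightarrow> bool" where
  "short rq \<longleftrightarrow> length (request_words rq) \<le> 3"

definition field :: "nat \<Rightarrow> nat \<Rightarrow> com" where
  "field k i = Seq (Const 40 k) (Seq (Op Add 40 26 40) (Load i 40))"

definition put_arg :: "nat \<Rightarrow> nat \<Rightarrow> com" where
  "put_arg k i = Seq (field k 41) (Seq (Op Mod 41 41 20) (Seq (Const 40 i) (set_at 40 41)))"

text \<open>\<open>load_request\<close> overwrites exactly as many registers as the request has
  words and keeps the others, so the stored number of arguments decides which copies are
  made.\<close>

definition put_args :: com where
  "put_args = Seq (put_arg 0 0) (Seq (field 1 29) (Cond 29 (Seq (put_arg 2 1)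
     (Seq (Const 30 1) (Seq (Op Less 29 30 29) (Cond 29 (put_arg 3 2) Skip)))) Skip))"

text \<open>After the two \<open>Eq\<close> instructions, register 29 says that the answer is the
  expected one and register 30 that the request is a query. On such 0/1 values
  \<open>Less 29 29 30\<close> means "a query with another answer". Register 28 accumulates these
  bits over all phases; adding 5 moves on to the next record.\<close>

definition check_answer :: com where
  "check_answer = Seq (Const 40 0) (Seq (get 29 40) (Seq (field 4 30) (Seq (Op Eq 29 29 30)
     (Seq (field 0 30) (Seq (Const 41 2) (Seq (Op Eq 30 30 41) (Seq (Op Less 29 29 30)
     (Seq (Op Or 28 28 29) (Seq (Const 40 5) (Op Add 26 26 40))))))))))"

definition serve_loop :: "nat \<Rightarrow> com \<Rightarrow> com" where
  "serve_loop r P = While 27 (Seq put_args (Seq (sim r P) (Seq check_answer (Op Less 27 26 25))))"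

lemma hits_append: "hits Q s (rs @ rs') \<longleftrightarrow> hits Q s rs \<or> hits Q (fold (\<lambda>r s. upd Q s r) (map fst rs) s) rs'"
  by (induction rs arbitrary: s) auto

context machine_sim
begin

definition regs29 :: "(nat \<Rightarrow> nat) \<Rightarrow> (nat \<Rightarrow> nat) \<Rightarrow> bool" where
  "regs29 R R' \<longleftrightarrow> (\<forall>v<29. R' v = R v)"

lemma same_regs29: "same R R' \<Longrightarrow> regs29 R R'"
  by (auto simp: same_def regs29_def)

lemma regs29_trans: "regs29 R R' \<Longrightarrow> regs29 R' R'' \<Longrightarrow> regs29 R R''"
  by (auto simp: regs29_def)

lemma sim_regs_regs29: "sim_regs X p R \<Longrightarrow> regs29 R R' \<Longrightarrow> sim_regs X p R'"
  by (auto simp: sim_regs_def regs29_def)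

lemma put_arg_runs:
  assumes "sim_regs X p R" "rep X p M \<sigma>" "R 26 + k < 2 ^ w" "i < r"
  shows "runs w (put_arg k i) (R, M) 9
    (\<lambda>(R', M'). same R R' \<and> rep X p M' ((fst \<sigma>)(i := M (R 26 + k) mod 2 ^ w'), snd \<sigma>) \<and> frame X p M M')"
proof -
  have X: "X \<in> {H, 2 * H}" "R 20 = 2 ^ w'" using assms(1) by (auto simp: sim_regs_def)
  have b: "k < 2 ^ w" "k + R 26 < 2 ^ w" "i < 2 ^ w" "i < H" using assms(3,4) r_le H_le by auto
  have lt: "z mod 2 ^ w' < 2 ^ w" for z :: nat
    using w'_le by (metis le_trans less_le_trans mod_less_divisor one_le_numeral pos2 power_increasing zero_less_power)
  have W: "rep X p (stamp_write X p M i (M (R 26 + k) mod 2 ^ w')) ((fst \<sigma>)(i := M (R 26 + k) mod 2 ^ w'), snd \<sigma>)"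
    using assms X by (intro rep_write_reg) auto
  have F: "frame X p M (stamp_write X p M i (M (R 26 + k) mod 2 ^ w'))"
    using b X by (intro frame_write) auto
  show ?thesis unfolding put_arg_def field_def using b X W F lt assms(1)
    by (auto intro!: set_runs_last[of X p])
qed

lemma put_args_runs:
  assumes "sim_regs X p R" "rep X p M \<sigma>" "R 26 + 5 < 2 ^ w" "3 \<le> r" "4 * H \<le> R 26" "short rq"
    and buf: "\<And>k. k < 5 \<Longrightarrow> M (R 26 + k) = record_words (rq, e) ! k"
  shows "runs w put_args (R, M) 40
    (\<lambda>(R', M'). regs29 R R' \<and> rep X p M' (load_request w' rq \<sigma>) \<and> frame X p M M')"
proof -
  let ?ws = "request_words rq"
  have X: "X \<in> {H, 2 * H}" using assms(1) by (auto simp: sim_regs_def)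
  have fr: "M' (R 26 + k) = M (R 26 + k)" if "frame X p M M'" for M' k
    using that X assms(5) H_pos unfolding frame_def by (auto dest: spec[of _ "R 26 + k"])
  have pos: "?ws \<noteq> []" by (cases rq) auto
  have v: "M (R 26) = ?ws ! 0" "M (R 26 + 1) = length ?ws - 1"
     "1 < length ?ws \<Longrightarrow> M (R 26 + 2) = ?ws ! 1" "2 < length ?ws \<Longrightarrow> M (R 26 + 3) = ?ws ! 2"
    using buf[of 0] buf[of 1] buf[of 2] buf[of 3] by (simp_all add: Let_def)
  have len: "length ?ws = 1 \<or> length ?ws = 2 \<or> length ?ws = 3" using assms(6) pos
    unfolding short_def length_greater_0_conv[symmetric] by arith
  have w2: "2 < (2::nat) ^ w" using H_le H_pos by linarith
  define \<sigma>1 where "\<sigma>1 = ((fst \<sigma>)(0 := ?ws ! 0 mod 2 ^ w'), snd \<sigma>)"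
  define \<sigma>2 where "\<sigma>2 = ((fst \<sigma>1)(1 := ?ws ! 1 mod 2 ^ w'), snd \<sigma>)"
  define \<sigma>3 where "\<sigma>3 = ((fst \<sigma>2)(2 := ?ws ! 2 mod 2 ^ w'), snd \<sigma>)"
  have L: "load_request w' rq \<sigma> = (if length ?ws = 1 then \<sigma>1 else if length ?ws = 2 then \<sigma>2 else \<sigma>3)"
    using len unfolding load_request_def \<sigma>1_def \<sigma>2_def \<sigma>3_def
    by (auto simp: fun_eq_iff less_Suc_eq numeral_2_eq_2 numeral_3_eq_3)
  let ?\<Phi> = "\<lambda>(R', M'). regs29 R R' \<and> rep X p M' (load_request w' rq \<sigma>) \<and> frame X p M M'"
  have C3: "runs w (put_arg 3 2) (R2, M2) 9 ?\<Phi>"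
    if "regs29 R R2" "rep X p M2 \<sigma>2" "frame X p M M2" "length ?ws = 3" for R2 M2
  proof (rule runs_weaken[OF put_arg_runs[of X p R2 M2 \<sigma>2]])
    show "sim_regs X p R2" using assms(1) that(1) by (rule sim_regs_regs29)
    have 26: "R2 26 = R 26" using that(1) by (simp add: regs29_def)
    then show "R2 26 + 3 < 2 ^ w" using assms(3) by simp
    have M: "M2 (R2 26 + 3) = ?ws ! 2" using fr[OF that(3), of 3] v(4) 26 that(4) by simp
    fix \<tau> assume *: "case \<tau> of (R', M') \<Rightarrow> same R2 R' \<and> rep X p M' ((fst \<sigma>2)(2 := M2 (R2 26 + 3) mod 2 ^ w'), snd \<sigma>2) \<and> frame X p M2 M'"
    obtain R' M' where \<tau>: "\<tau> = (R', M')" "same R2 R'" "rep X p M' \<sigma>3" "frame X p M2 M'"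
      using * M by (cases \<tau>) (auto simp: \<sigma>3_def \<sigma>2_def)
    show "?\<Phi> \<tau>" unfolding \<tau>(1) using regs29_trans[OF that(1) same_regs29[OF \<tau>(2)]]
      frame_trans[OF that(3) \<tau>(4)] \<tau>(3) L that(4) by simp
  qed (use that assms in auto)
  have C2: "runs w (Seq (put_arg 2 1) (Seq (Const 30 1) (Seq (Op Less 29 30 29) (Cond 29 (put_arg 3 2) Skip))))
      (R1, M1) 25 ?\<Phi>"
    if R1: "regs29 R R1" "rep X p M1 \<sigma>1" "frame X p M M1" "1 < length ?ws" "R1 29 = length ?ws - 1" for R1 M1
  proof (rule runs_Seq'[OF put_arg_runs[of X p R1 M1 \<sigma>1], where n' = 16])
    show "sim_regs X p R1" using assms(1) R1(1) by (rule sim_regs_regs29)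
    have 26: "R1 26 = R 26" using R1(1) by (simp add: regs29_def)
    then show "R1 26 + 2 < 2 ^ w" using assms(3) by simp
    have M: "M1 (R1 26 + 2) = ?ws ! 1" using fr[OF R1(3), of 2] v(3) 26 R1(4) by simp
    fix \<tau> assume *: "case \<tau> of (R', M') \<Rightarrow> same R1 R' \<and> rep X p M' ((fst \<sigma>1)(1 := M1 (R1 26 + 2) mod 2 ^ w'), snd \<sigma>1) \<and> frame X p M1 M'"
    obtain R2 M2 where \<tau>: "\<tau> = (R2, M2)" "same R1 R2" "rep X p M2 \<sigma>2" "frame X p M1 M2"
      using * M by (cases \<tau>) (auto simp: \<sigma>2_def \<sigma>1_def)
    have 29: "R2 29 = length ?ws - 1" using \<tau>(2) R1(5) by (simp add: same_def)
    have r: "regs29 R (R2(30 := Suc 0, 29 := z))" for z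
      using regs29_trans[OF R1(1) same_regs29[OF \<tau>(2)]] by (simp add: regs29_def)
    have f: "frame X p M M2" using R1(3) \<tau>(4) by (rule frame_trans)
    show "runs w (Seq (Const 30 1) (Seq (Op Less 29 30 29) (Cond 29 (put_arg 3 2) Skip))) \<tau> 16 ?\<Phi>"
    proof (cases "length ?ws = 3")
      case True
      then have "runs w (put_arg 3 2) (R2(30 := Suc 0, 29 := Suc 0), M2) 13 ?\<Phi>"
        by (intro runs_weaken[OF C3[OF r \<tau>(3) f]]) auto
      then show ?thesis unfolding \<tau>(1) using w2 29 True w_pos by simp
    next
      case False
      then have "length ?ws = 2" using R1(4) len by simp
      then show ?thesis unfolding \<tau>(1) using w2 29 r[of 0] \<tau>(3) f L w_pos by simp
    qed
  qed (use R1 assms in auto)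
  show ?thesis unfolding put_args_def
  proof (rule runs_Seq'[OF put_arg_runs[OF assms(1,2)], where n' = 31])
    fix \<tau> assume *: "case \<tau> of (R', M') \<Rightarrow> same R R' \<and> rep X p M' ((fst \<sigma>)(0 := M (R 26 + 0) mod 2 ^ w'), snd \<sigma>) \<and> frame X p M M'"
    obtain R1 M1 where \<tau>: "\<tau> = (R1, M1)" "same R R1" "rep X p M1 \<sigma>1" "frame X p M M1"
      using * v(1) by (cases \<tau>) (auto simp: \<sigma>1_def)
    have 26: "R1 26 = R 26" using \<tau>(2) by (simp add: same_def)
    have M: "M1 (R 26 + 1) = length ?ws - 1" using fr[OF \<tau>(4), of 1] v(2) by simp
    have r: "regs29 R (R1(40 := y, 29 := z))" for y z
      using same_regs29[OF \<tau>(2)] by (simp add: regs29_def)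
    show "runs w (Seq (field 1 29) (Cond 29 (Seq (put_arg 2 1)
     (Seq (Const 30 1) (Seq (Op Less 29 30 29) (Cond 29 (put_arg 3 2) Skip)))) Skip)) \<tau> 31 ?\<Phi>"
    proof (cases "1 < length ?ws")
      case True
      have "runs w (Seq (put_arg 2 1) (Seq (Const 30 1) (Seq (Op Less 29 30 29) (Cond 29 (put_arg 3 2) Skip))))
        (R1(40 := Suc (R 26), 29 := length ?ws - 1), M1) 27 ?\<Phi>"
        by (rule runs_weaken[OF C2[OF r \<tau>(3,4) True]]) auto
      then show ?thesis unfolding \<tau>(1) field_def using w2 True w_pos M assms(3) 26 by simp
    next
      case False
      then have "length ?ws = 1" using len by auto
      then show ?thesis unfolding \<tau>(1) field_def using w2 w_pos M assms(3) 26 r \<tau>(3,4) L by simp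
    qed
  qed (use assms in auto)
qed

lemma check_answer_runs:
  assumes "sim_regs X p R" "rep X p M \<sigma>" "R 26 + 5 < 2 ^ w" "0 < r" "R 28 = of_bool fd"
    and buf: "\<And>k. k < 5 \<Longrightarrow> M (R 26 + k) = record_words (rq, e) ! k"
  shows "runs w check_answer (R, M) 20
    (\<lambda>(R', M'). (\<forall>v<28. v \<noteq> 26 \<longrightarrow> R' v = R v) \<and> R' 26 = R 26 + 5 \<and> M' = M \<and>
       R' 28 = of_bool (fd \<or> (\<exists>a. rq = Query a) \<and> result \<sigma> \<noteq> e))"
proof -
  have b: "R 26 + 5 < 2 ^ w" "2 < (2::nat) ^ w" "R 26 + 4 < 2 ^ w" "5 < (2::nat) ^ w" "4 < (2::nat) ^ w" "R 26 < 2 ^ w"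
    using assms(3) H_le H_pos by auto
  have v: "M (R 26) = request_words rq ! 0" "M (4 + R 26) = e"
    using buf[of 0] buf[of 4] by (simp_all add: Let_def add.commute)
  have q: "request_words rq ! 0 = 2 \<longleftrightarrow> (\<exists>a. rq = Query a)" by (cases rq) auto
  have g: "view H X p M 0 = result \<sigma>" using rep_reg(1)[OF assms(2), of 0] assms(4) by (simp add: result_def)
  define \<Phi> where "\<Phi> = (\<lambda>(R', M'). (\<forall>v<28. v \<noteq> 26 \<longrightarrow> R' v = R v) \<and> R' 26 = R 26 + 5 \<and> M' = M \<and>
       R' 28 = of_bool (fd \<or> (\<exists>a. rq = Query a) \<and> result \<sigma> \<noteq> e))"
  have R0: "(0::nat) mod 2 ^ w = 0" by simp
  have sr: "sim_regs X p (R(40 := 0))" using assms(1) by simp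
  have "runs w check_answer (R, M) 20 \<Phi>" unfolding check_answer_def runs_Seq_Const R0
  proof (intro conjI get_runs[OF sr])
    fix z
    have fin: "\<Phi> (R1, M)" if "\<And>v. v < 28 \<Longrightarrow> v \<noteq> 26 \<Longrightarrow> R1 v = R v" "R1 26 = R 26 + 5"
        "R1 28 = of_bool (fd \<or> (\<exists>a. rq = Query a) \<and> result \<sigma> \<noteq> e)" for R1
      using that unfolding \<Phi>_def by simp
    show "runs w (Seq (field 4 30) (Seq (Op Eq 29 29 30)
     (Seq (field 0 30) (Seq (Const 41 2) (Seq (Op Eq 30 30 41) (Seq (Op Less 29 29 30)
     (Seq (Op Or 28 28 29) (Seq (Const 40 5) (Op Add 26 26 40))))))))) (R(40 := 0, 43 := z, 29 := view H X p M ((R(40 := 0)) 40)), M) (20 - 1 - 6) \<Phi>"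
      using b w_pos v q g assms(5) unfolding field_def
      by (simp add: add.commute[of "R 26"]) (auto intro!: fin)
  qed (use H_pos in auto)
  then show ?thesis unfolding \<Phi>_def .
qed

text \<open>The buffer lies above all four banks, so by \<open>frame\<close> neither the loading of
  arguments nor the simulation can damage records that are still to be read. The overhead 62 is 40
  for the arguments, 20 for the check, 1 for the comparison and 1 for the loop test.\<close>

lemma serve_loop_runs:
  assumes "serves_to w' P Q \<sigma> s (map fst rs) ts \<sigma>'" "below_regs r P" "3 \<le> r"
    and "\<forall>(rq, e) \<in> set rs. short rq"
    and "sim_regs X p R" "rep X p M \<sigma>" "R 28 = of_bool fd" "4 * H \<le> R 26"
    and "R 25 = R 26 + 5 * length rs" "R 25 < 2 ^ w" "R 27 = of_bool (R 26 < R 25)"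
    and "\<And>k. k < 5 * length rs \<Longrightarrow> M (R 26 + k) = concat (map record_words rs) ! k"
  shows "runs w (serve_loop r P) (R, M) (30 * sum_list ts + 62 * length rs + 1)
    (\<lambda>(R', M'). (\<forall>v<26. R' v = R v) \<and> rep X p M' \<sigma>' \<and> frame X p M M' \<and> R' 28 = of_bool (fd \<or> hits Q s rs))"
  using assms
proof (induction rs arbitrary: \<sigma> s ts R M fd)
  case Nil
  then show ?case unfolding serve_loop_def by (auto intro!: runs_While_done)
next
  case (Cons r0 rs)
  obtain rq e where r0: "r0 = (rq, e)" by (cases r0)
  from Cons.prems(1) r0 obtain t ts' \<sigma>1 where ts: "ts = t # ts'" and ex: "exec w' P (load_request w' rq \<sigma>) t \<sigma>1"
    and ca: "correct_answer Q s rq (result \<sigma>1)" and sv: "serves_to w' P Q \<sigma>1 (upd Q s rq) (map fst rs) ts' \<sigma>'"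
    by auto
  have X: "X \<in> {H, 2 * H}" using Cons.prems(5) by (auto simp: sim_regs_def)
  have fr: "M2 a = M1 a" if "frame X p M1 M2" "4 * H \<le> a" for M1 M2 a
    using that X H_pos unfolding frame_def by (auto dest: spec[of _ a])
  have len: "length (record_words (rq, e)) = 5" by (simp add: Let_def)
  have buf: "M (R 26 + k) = record_words (rq, e) ! k" if "k < 5" for k
    using Cons.prems(12)[of k] that len by (simp add: r0 nth_append del: record_words.simps)
  have buf': "M (R 26 + 5 + k) = concat (map record_words rs) ! k" if "k < 5 * length rs" for k
    using Cons.prems(12)[of "5 + k"] that len by (simp add: r0 nth_append add.assoc del: record_words.simps)
  have lt: "R 26 + 5 < 2 ^ w" using Cons.prems(9,10) by simp
  have sh: "short rq" using Cons.prems(4) r0 by auto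
  let ?\<Phi> = "\<lambda>(R', M'). (\<forall>v<26. R' v = R v) \<and> rep X p M' \<sigma>' \<and> frame X p M M' \<and> R' 28 = of_bool (fd \<or> hits Q s (r0 # rs))"
  let ?body = "Seq put_args (Seq (sim r P) (Seq check_answer (Op Less 27 26 25)))"
  let ?\<Psi> = "\<lambda>(R', M'). (\<forall>v<26. R' v = R v) \<and> R' 26 = R 26 + 5 \<and> R' 27 = of_bool (R 26 + 5 < R 25) \<and>
      rep X p M' \<sigma>1 \<and> frame X p M M' \<and> R' 28 = of_bool (fd \<or> mismatch Q s rq e)"
  have body: "runs w ?body (R, M) (40 + (30 * t + 21)) ?\<Psi>"
  proof (rule runs_Seq)
    show "runs w put_args (R, M) 40 (\<lambda>(R', M'). regs29 R R' \<and> rep X p M' (load_request w' rq \<sigma>) \<and> frame X p M M')"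
      using Cons.prems lt sh buf by (intro put_args_runs) auto
    fix \<tau> assume *: "case \<tau> of (R', M') \<Rightarrow> regs29 R R' \<and> rep X p M' (load_request w' rq \<sigma>) \<and> frame X p M M'"
    obtain R1 M1 where \<tau>: "\<tau> = (R1, M1)" "regs29 R R1" "rep X p M1 (load_request w' rq \<sigma>)" "frame X p M M1"
      using * by (cases \<tau>) auto
    have s1: "sim_regs X p R1" using Cons.prems(5) \<tau>(2) by (rule sim_regs_regs29)
    show "runs w (Seq (sim r P) (Seq check_answer (Op Less 27 26 25))) \<tau> (30 * t + 21) ?\<Psi>"
      unfolding \<tau>(1)
    proof (rule runs_Seq[OF sim_runs[OF ex Cons.prems(2) s1 \<tau>(3)]])
      fix \<tau>' assume *: "case \<tau>' of (R', M') \<Rightarrow> same R1 R' \<and> rep X p M' \<sigma>1 \<and> frame X p M1 M'"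
      obtain R2 M2 where \<tau>': "\<tau>' = (R2, M2)" "same R1 R2" "rep X p M2 \<sigma>1" "frame X p M1 M2"
        using * by (cases \<tau>') auto
      have s2: "sim_regs X p R2" using s1 \<tau>'(2) by (rule sim_regs_same)
      have rr: "regs29 R R2" using \<tau>(2) same_regs29[OF \<tau>'(2)] by (rule regs29_trans)
      then have R2: "R2 26 = R 26" "R2 28 = of_bool fd" "\<And>v. v < 26 \<Longrightarrow> R2 v = R v"
        using Cons.prems(7) by (auto simp: regs29_def)
      have f2: "frame X p M M2" using \<tau>(4) \<tau>'(4) by (rule frame_trans)
      have b2: "M2 (R2 26 + k) = record_words (rq, e) ! k" if "k < 5" for k
        using fr[OF f2, of "R 26 + k"] buf[OF that] Cons.prems(8) R2(1) by simp
      have mm: "mismatch Q s rq e \<longleftrightarrow> (\<exists>a. rq = Query a) \<and> result \<sigma>1 \<noteq> e"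
        using ca by (cases rq) auto
      have ck: "runs w check_answer (R2, M2) 20 (\<lambda>(R', M'). (\<forall>v<28. v \<noteq> 26 \<longrightarrow> R' v = R2 v) \<and> R' 26 = R2 26 + 5 \<and> M' = M2 \<and>
       R' 28 = of_bool (fd \<or> (\<exists>a. rq = Query a) \<and> result \<sigma>1 \<noteq> e))"
        using s2 \<tau>'(3) R2 lt b2 Cons.prems(3) by (intro check_answer_runs) auto
      show "runs w (Seq check_answer (Op Less 27 26 25)) \<tau>' 21 ?\<Psi>" unfolding \<tau>'(1)
      proof (rule runs_Seq'[OF ck, where n' = 1])
        fix \<tau>'' assume *: "case \<tau>'' of (R', M') \<Rightarrow> (\<forall>v<28. v \<noteq> 26 \<longrightarrow> R' v = R2 v) \<and> R' 26 = R2 26 + 5 \<and> M' = M2 \<and>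
            R' 28 = of_bool (fd \<or> (\<exists>a. rq = Query a) \<and> result \<sigma>1 \<noteq> e)"
        obtain R3 where \<tau>'': "\<tau>'' = (R3, M2)" "\<And>v. v < 28 \<Longrightarrow> v \<noteq> 26 \<Longrightarrow> R3 v = R2 v" "R3 26 = R 26 + 5"
          "R3 28 = of_bool (fd \<or> mismatch Q s rq e)"
          using * R2 mm by (cases \<tau>'') auto
        have 25: "R3 25 = R 25" using \<tau>''(2)[of 25] R2(3)[of 25] by simp
        show "runs w (Op Less 27 26 25) \<tau>'' 1 ?\<Psi>" unfolding \<tau>''(1)
          using \<tau>''(2,3,4) R2(3) \<tau>'(3) f2 25 w_pos by simp
      qed simp
    qed
  qed
  have "runs w (serve_loop r P) (R, M) (1 + (40 + (30 * t + 21)) + (30 * sum_list ts' + 62 * length rs + 1)) ?\<Phi>"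
    unfolding serve_loop_def
  proof (rule runs_While_step[OF _ body])
    show "fst (R, M) 27 \<noteq> 0" using Cons.prems(9,11) by simp
    fix \<tau> assume *: "?\<Psi> \<tau>"
    obtain R1 M1 where \<tau>: "\<tau> = (R1, M1)" "\<And>v. v < 26 \<Longrightarrow> R1 v = R v" "R1 26 = R 26 + 5"
      "R1 27 = of_bool (R 26 + 5 < R 25)" "rep X p M1 \<sigma>1" "frame X p M M1" "R1 28 = of_bool (fd \<or> mismatch Q s rq e)"
      using * by (cases \<tau>) auto
    have s1: "sim_regs X p R1" using Cons.prems(5) \<tau>(2) by (simp add: sim_regs_def)
    have 25: "R1 25 = R 25" using \<tau>(2)[of 25] by simp
    have b1: "M1 (R1 26 + k) = concat (map record_words rs) ! k" if "k < 5 * length rs" for k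
      using fr[OF \<tau>(6), of "R1 26 + k"] buf'[OF that] Cons.prems(8) \<tau>(3) by simp
    have "runs w (serve_loop r P) (R1, M1) (30 * sum_list ts' + 62 * length rs + 1)
      (\<lambda>(R', M'). (\<forall>v<26. R' v = R1 v) \<and> rep X p M' \<sigma>' \<and> frame X p M1 M' \<and>
         R' 28 = of_bool ((fd \<or> mismatch Q s rq e) \<or> hits Q (upd Q s rq) rs))"
      using sv s1 \<tau> 25 Cons.prems b1 by (intro Cons.IH) auto
    then show "runs w (While 27 ?body) \<tau> (30 * sum_list ts' + 62 * length rs + 1) ?\<Phi>"
      unfolding serve_loop_def[symmetric] \<tau>(1)
      by (rule runs_weaken) (use \<tau> frame_trans r0 in auto)
  qed
  then show ?case by (rule runs_weaken) (auto simp: ts)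
qed

end


section \<open>Running all phases in succession\<close>

section \<open>The sequence of phases\<close>

text \<open>Register 25 is the write pointer of the generator and afterwards marks the end of the
  buffer; register 26 then reads from \<open>4 * H\<close>. Every phase reuses the same
  buffer.\<close>

definition phase :: "bool \<Rightarrow> gen \<Rightarrow> nat \<Rightarrow> com \<Rightarrow> com" where
  "phase wc gr r P = Seq (if wc then Seq (Const 29 1) (Op Add 22 22 29) else Skip)
    (Seq (Op Add 25 24 23) (Seq (comp_gen 25 50 gr) (Seq (Op Add 26 24 23) (Seq (Op Less 27 26 25)
    (Seq (serve_loop r P) (Seq (Const 29 1) (Seq (Op Add 5 5 29) (Op Less 27 5 10))))))))"

text \<open>\<open>\<sigma>s b\<close> and \<open>\<sigma>e b\<close> are the configurations of the
  data structure before and after phase \<open>b\<close>. In the worst-case mode all phases begin in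
  the same configuration; otherwise each continues where its predecessor ended.\<close>

locale phase_setup = machine_sim w w' r H + input_memory m H V 20 w
  for w w' r H :: nat and m V +
  fixes wc :: bool and gr :: gen and P :: com and Q :: "'s dyn_problem" and env :: "nat \<Rightarrow> nat"
    and XL Nb :: nat and rs :: "nat \<Rightarrow> (request \<times> nat) list" and ss :: "nat \<Rightarrow> 's"
    and \<sigma>s \<sigma>e :: "nat \<Rightarrow> config" and ts :: "nat \<Rightarrow> nat list"
  assumes gr_vars: "vars_below_gen 20 gr" and gr_degree: "V ^ degree_gen gr < H" and V_less: "V < H"
    and P_regs: "below_regs r P" and r3: "3 \<le> r"
    and env_le: "\<And>v. v < 20 \<Longrightarrow> env v \<le> V" and env10: "env 10 = Nb"
    and gr_list: "\<And>b. b < Nb \<Longrightarrow> gl m (env(5 := b)) gr = concat (map record_words (rs b))"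
    and gr_loops: "\<And>u. u \<in> loop_vars_gen gr \<Longrightarrow> u \<noteq> 5 \<and> env u \<le> XL"
    and rs_short: "\<And>b. b < Nb \<Longrightarrow> \<forall>(rq, e) \<in> set (rs b). short rq"
    and rs_len: "\<And>b. b < Nb \<Longrightarrow> 4 * H + 5 * length (rs b) < 2 ^ w"
    and serves: "\<And>b. b < Nb \<Longrightarrow> serves_to w' P Q (\<sigma>s b) (ss b) (map fst (rs b)) (ts b) (\<sigma>e b)"
    and next_wc: "\<And>b. wc \<Longrightarrow> \<sigma>s b = \<sigma>s 0"
    and next_am: "\<And>b. \<not> wc \<Longrightarrow> Suc b < Nb \<Longrightarrow> \<sigma>s (Suc b) = \<sigma>e b"
begin

text \<open>No stamp exceeds the current epoch, so advancing the epoch makes all of them stale.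
  Reads then fall back to the base bank, which writes at \<open>2 * H\<close> never touch. The undo
  thus costs one addition, however much was written.\<close>

lemma rollback:
  assumes "\<forall>a<H. M (3 * H + a) < p" "frame (2 * H) p M M'" "rep (2 * H) p M \<sigma>"
  shows "rep (2 * H) (Suc p) M' \<sigma>" "\<forall>a<H. M' (3 * H + a) < Suc p"
proof -
  have base: "M' (H + a) = M (H + a)" if "a < H" for a
    using assms(2) that unfolding frame_def by (auto dest: spec[of _ "H + a"])
  have st: "M' (3 * H + a) < Suc p" if a: "a < H" for a
  proof -
    from assms(2) have "M' (3 * H + a) = M (3 * H + a) \<or> M' (3 * H + a) = p"
      unfolding frame_def using a by (auto dest: spec[of _ "3 * H + a"])
    then show ?thesis using assms(1) a by auto
  qed
  then show "\<forall>a<H. M' (3 * H + a) < Suc p" by blast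
  have v: "view H (2 * H) (Suc p) M' a = view H (2 * H) p M a" if "a < H" for a
    using base[OF that] st[OF that] assms(1) that by (auto simp: view_def)
  have "r + a < H" if "a < 2 ^ w'" for a using that r_le by linarith
  moreover have "j < H" if "j < r" for j using that r_le by linarith
  ultimately show "rep (2 * H) (Suc p) M' \<sigma>" using assms(3) unfolding rep_def by (simp add: v)
qed

text \<open>In the worst-case mode the epoch register holds \<open>b\<close> while the
  representation refers to epoch \<open>Suc b\<close>, because a phase begins with the
  increment.\<close>

definition phase_inv :: "nat \<Rightarrow> config \<Rightarrow> bool" where
  "phase_inv b = (\<lambda>(R, M). (\<forall>v<20. R v = (env(5 := b)) v) \<and> R 28 = of_bool (\<exists>b'<b. hits Q (ss b') (rs b')) \<and>
     (\<forall>a<H. M a = m a) \<and> R 27 = of_bool (b < Nb) \<and>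
     (if wc then sim_regs (2 * H) b R \<and> (\<forall>a<H. M (3 * H + a) < Suc b) \<and> rep (2 * H) (Suc b) M (\<sigma>s 0)
      else sim_regs H 0 R \<and> (b < Nb \<longrightarrow> rep H 0 M (\<sigma>s b))))"

lemma phase_runs:
  assumes b: "b < Nb" and inv: "phase_inv b (R, M)"
  shows "runs w (phase wc gr r P) (R, M)
    (time_gen XL gr + 30 * sum_list (ts b) + 62 * length (rs b) + 20) (phase_inv (Suc b))"
proof -
  define X where "X = (if wc then 2 * H else H)"
  define p where "p = (if wc then Suc b else 0)"
  note INV = inv[unfolded phase_inv_def prod.case]
  have XH: "X \<in> {H, 2 * H}" by (simp add: X_def)
  have Rv: "\<And>v. v < 20 \<Longrightarrow> R v = (env(5 := b)) v" and fd: "R 28 = of_bool (\<exists>b'<b. hits Q (ss b') (rs b'))"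
    and Mm: "\<And>a. a < H \<Longrightarrow> M a = m a" using INV by auto
  have rep: "rep X p M (\<sigma>s b)"
    using INV b next_wc[of b] by (auto simp: X_def p_def split: if_splits)
  have NbV: "Nb \<le> V" using env_le[of 10] env10 by simp
  have Vw: "V < 2 ^ w" using V_less H_le by linarith
  have RV: "R v \<le> V" if "v < 20" for v using Rv[OF that] env_le[OF that] b NbV by auto
  have sr: "runs w (if wc then Seq (Const 29 1) (Op Add 22 22 29) else Skip) (R, M) 2
    (\<lambda>(R', M'). (\<forall>v. v \<noteq> 29 \<longrightarrow> v \<noteq> 22 \<longrightarrow> R' v = R v) \<and> sim_regs X p R' \<and> M' = M)"
  proof (cases wc)
    case True
    then have "sim_regs (2 * H) b R" using INV by simp
    moreover have "Suc b < 2 ^ w" using b NbV Vw by linarith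
    ultimately show ?thesis using True w_pos by (simp add: X_def p_def sim_regs_def)
  next
    case False
    then show ?thesis using INV by (auto simp: X_def p_def)
  qed
  let ?\<Phi> = "phase_inv (Suc b)"
  let ?ys = "concat (map record_words (rs b))"
  have len5: "length (record_words x) = 5" for x by (cases x) (simp add: Let_def)
  have ylen: "length ?ys = 5 * length (rs b)" by (induction "rs b") (simp_all add: length_concat comp_def len5 sum_list_triv del: record_words.simps)
  have lw: "4 * H + 5 * length (rs b) < 2 ^ w" by (rule rs_len[OF b])
  show ?thesis unfolding phase_def
  proof (rule runs_Seq'[OF sr, where n' = "time_gen XL gr + 30 * sum_list (ts b) + 62 * length (rs b) + 18"])
    fix \<tau> assume *: "case \<tau> of (R', M') \<Rightarrow> (\<forall>v. v \<noteq> 29 \<longrightarrow> v \<noteq> 22 \<longrightarrow> R' v = R v) \<and> sim_regs X p R' \<and> M' = M"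
    obtain R1 where \<tau>: "\<tau> = (R1, M)" "\<And>v. v \<noteq> 29 \<Longrightarrow> v \<noteq> 22 \<Longrightarrow> R1 v = R v" "sim_regs X p R1"
      using * by (cases \<tau>) auto
    have R1: "R1 23 = H" "R1 24 = 3 * H" using \<tau>(3) by (simp_all add: sim_regs_def)
    define R2 where "R2 = R1(25 := 4 * H)"
    have R2v: "R2 v = (env(5 := b)) v" if "v < 20" for v using Rv[OF that] \<tau>(2)[of v] that by (simp add: R2_def)
    have g2: "gl m R2 gr = ?ys"
      using gl_cong[OF gr_vars, of R2 "env(5 := b)" m] R2v gr_list[OF b] by simp
    have lv: "R2 u \<le> XL" if "u \<in> loop_vars_gen gr" for u
      using gr_loops[OF that] R2v[of u] loop_vars_gen_below[OF gr_vars] that by auto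
    have gen: "runs w (comp_gen 25 50 gr) (R2, M) (time_gen XL gr)
     (\<lambda>(R', M'). R' 25 = R2 25 + length (gl m R2 gr) \<and> (\<forall>v<50. v \<noteq> 25 \<longrightarrow> R' v = R2 v) \<and> M' = put M (R2 25) (gl m R2 gr))"
    proof (rule comp_gen_runs[OF gr_vars _ _ gr_degree])
      show "R2 v \<le> V" if "v < 20" for v using RV[OF that] Rv[OF that] R2v[OF that] by simp
      show "R2 25 + length (gl m R2 gr) < 2 ^ w" using lw by (simp add: R2_def g2[unfolded R2_def] ylen)
      show "1 < H" using V_less V2 by linarith
    qed (use lv Mm V_less H_le in \<open>auto simp: R2_def\<close>)
    have "runs w (Seq (comp_gen 25 50 gr) (Seq (Op Add 26 24 23) (Seq (Op Less 27 26 25)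
      (Seq (serve_loop r P) (Seq (Const 29 1) (Seq (Op Add 5 5 29) (Op Less 27 5 10)))))))
      (R2, M) (time_gen XL gr + (30 * sum_list (ts b) + 62 * length (rs b) + 16)) ?\<Phi>"
    proof (rule runs_Seq[OF gen])
      fix \<tau>' assume *: "case \<tau>' of (R', M') \<Rightarrow> R' 25 = R2 25 + length (gl m R2 gr) \<and>
        (\<forall>v<50. v \<noteq> 25 \<longrightarrow> R' v = R2 v) \<and> M' = put M (R2 25) (gl m R2 gr)"
      define M1 where "M1 = put M (4 * H) ?ys"
      obtain R3 where \<tau>': "\<tau>' = (R3, M1)" "R3 25 = 4 * H + 5 * length (rs b)"
          "\<And>v. v < 50 \<Longrightarrow> v \<noteq> 25 \<Longrightarrow> R3 v = R1 v"
        using * ylen by (cases \<tau>') (auto simp: R2_def M1_def g2[unfolded R2_def])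
      define R4 where "R4 = R3(26 := 4 * H, 27 := of_bool (4 * H < R3 25))"
      have s4: "sim_regs X p R4" using \<tau>(3) \<tau>'(3) by (simp add: sim_regs_def R4_def)
      have M1: "M1 a = M a" if "a < 4 * H" for a using that by (simp add: M1_def put_below)
      have v1: "view H X p M1 a = view H X p M a" if "a < H" for a
        using M1[of "3 * H + a"] M1[of "X + a"] M1[of "H + a"] that XH by (auto simp: view_def)
      have "r + a < H" if "a < 2 ^ w'" for a using that r_le by linarith
      moreover have "j < H" if "j < r" for j using that r_le by linarith
      ultimately have rep1: "rep X p M1 (\<sigma>s b)" using rep unfolding rep_def by (simp add: v1)
      have loop: "runs w (serve_loop r P) (R4, M1) (30 * sum_list (ts b) + 62 * length (rs b) + 1)
        (\<lambda>(R', M'). (\<forall>v<26. R' v = R4 v) \<and> rep X p M' (\<sigma>e b) \<and> frame X p M1 M' \<and>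
           R' 28 = of_bool ((\<exists>b'<b. hits Q (ss b') (rs b')) \<or> hits Q (ss b) (rs b)))"
      proof (rule serve_loop_runs[OF serves[OF b] P_regs r3 rs_short[OF b] s4 rep1])
        show "R4 28 = of_bool (\<exists>b'<b. hits Q (ss b') (rs b'))"
          using \<tau>'(3)[of 28] \<tau>(2)[of 28] fd by (simp add: R4_def)
        show "M1 (R4 26 + k) = ?ys ! k" if "k < 5 * length (rs b)" for k
          using that ylen by (simp add: R4_def M1_def put_def del: record_words.simps)
      qed (use \<tau>'(2) lw in \<open>auto simp: R4_def\<close>)
      have "runs w (Seq (serve_loop r P) (Seq (Const 29 1) (Seq (Op Add 5 5 29) (Op Less 27 5 10)))) (R4, M1)
         (30 * sum_list (ts b) + 62 * length (rs b) + 1 + 3) ?\<Phi>"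
      proof (rule runs_Seq[OF loop])
        fix \<tau>'' assume *: "case \<tau>'' of (R', M') \<Rightarrow> (\<forall>v<26. R' v = R4 v) \<and> rep X p M' (\<sigma>e b) \<and> frame X p M1 M' \<and>
           R' 28 = of_bool ((\<exists>b'<b. hits Q (ss b') (rs b')) \<or> hits Q (ss b) (rs b))"
        obtain R5 M5 where \<tau>'': "\<tau>'' = (R5, M5)" "\<And>v. v < 26 \<Longrightarrow> R5 v = R4 v" "rep X p M5 (\<sigma>e b)" "frame X p M1 M5"
           "R5 28 = of_bool ((\<exists>b'<b. hits Q (ss b') (rs b')) \<or> hits Q (ss b) (rs b))"
          using * by (cases \<tau>'') auto
        have R5: "R5 v = (env(5 := b)) v" if "v < 20" for v
          using \<tau>''(2)[of v] \<tau>'(3)[of v] \<tau>(2)[of v] Rv[OF that] that by (simp add: R4_def)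
        have ex: "(\<exists>b'<Suc b. hits Q (ss b') (rs b')) \<longleftrightarrow> (\<exists>b'<b. hits Q (ss b') (rs b')) \<or> hits Q (ss b) (rs b)"
          by (auto simp: less_Suc_eq)
        have s5: "sim_regs X p R5" using s4 \<tau>''(2) by (simp add: sim_regs_def)
        have m5: "M5 a = m a" if "a < H" for a
        proof -
          have "M5 a = M1 a" using \<tau>''(4) that XH unfolding frame_def by (auto dest: spec[of _ a])
          then show ?thesis using M1[of a] Mm[OF that] that by simp
        qed
        have bw: "Suc b < 2 ^ w" using b NbV Vw by linarith
        have fin: "phase_inv (Suc b) (R6, M5)"
          if "\<And>v. v < 20 \<Longrightarrow> R6 v = (env(5 := Suc b)) v" "R6 27 = of_bool (Suc b < Nb)" "R6 28 = R5 28"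
             "\<And>v. 20 \<le> v \<Longrightarrow> v < 26 \<Longrightarrow> R6 v = R5 v" for R6
        proof (cases wc)
          case True
          have st: "\<forall>a<H. M1 (3 * H + a) < p" using INV True M1 by (simp add: p_def)
          have "rep (2 * H) p M1 (\<sigma>s 0)" using rep1 True next_wc[OF True, of b] by (simp add: X_def)
          from rollback[OF st _ this, of M5] \<tau>''(4) True
          have "rep (2 * H) (Suc (Suc b)) M5 (\<sigma>s 0)" "\<forall>a<H. M5 (3 * H + a) < Suc (Suc b)"
            by (simp_all add: X_def p_def)
          moreover have "sim_regs (2 * H) (Suc b) R6" using s5 that True by (simp add: X_def p_def sim_regs_def)
          ultimately show ?thesis unfolding phase_inv_def using that \<tau>''(5) ex m5 True by simp
        next
          case False
          then have "sim_regs H 0 R6" using s5 that by (simp add: X_def p_def sim_regs_def)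
          then show ?thesis unfolding phase_inv_def using that \<tau>''(3,5) ex m5 False next_am[OF False, of b] by (simp add: X_def p_def)
        qed
        show "runs w (Seq (Const 29 1) (Seq (Op Add 5 5 29) (Op Less 27 5 10))) \<tau>'' 3 ?\<Phi>"
          unfolding \<tau>''(1) using R5[of 5] R5[of 10] env10 bw w_pos
          by simp (intro conjI impI; rule fin; use R5 in simp)
      qed
      then have T: "runs w (Seq (serve_loop r P) (Seq (Const 29 1) (Seq (Op Add 5 5 29) (Op Less 27 5 10)))) (R4, M1)
         (30 * sum_list (ts b) + 62 * length (rs b) + 16 - 1 - 1) ?\<Phi>"
        by (rule runs_weaken) auto
      show "runs w (Seq (Op Add 26 24 23) (Seq (Op Less 27 26 25) (Seq (serve_loop r P)
        (Seq (Const 29 1) (Seq (Op Add 5 5 29) (Op Less 27 5 10)))))) \<tau>' (30 * sum_list (ts b) + 62 * length (rs b) + 16) ?\<Phi>"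
        unfolding \<tau>'(1) using \<tau>'(3)[of 24] \<tau>'(3)[of 23] R1 lw w_pos
        by (cases "4 * H < R3 25") (use T in \<open>simp_all add: R4_def\<close>)
    qed
    then have T: "runs w (Seq (comp_gen 25 50 gr) (Seq (Op Add 26 24 23) (Seq (Op Less 27 26 25)
      (Seq (serve_loop r P) (Seq (Const 29 1) (Seq (Op Add 5 5 29) (Op Less 27 5 10)))))))
      (R2, M) (time_gen XL gr + 30 * sum_list (ts b) + 62 * length (rs b) + 18 - 1) ?\<Phi>"
      by (rule runs_weaken) auto
    show "runs w (Seq (Op Add 25 24 23) (Seq (comp_gen 25 50 gr) (Seq (Op Add 26 24 23) (Seq (Op Less 27 26 25)
      (Seq (serve_loop r P) (Seq (Const 29 1) (Seq (Op Add 5 5 29) (Op Less 27 5 10))))))))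
      \<tau> (time_gen XL gr + 30 * sum_list (ts b) + 62 * length (rs b) + 18) ?\<Phi>"
      unfolding \<tau>(1) using R1 lw T by (simp add: R2_def)
  qed simp
qed

theorem phases_runs:
  assumes "phase_inv 0 \<sigma>"
  shows "runs w (While 27 (phase wc gr r P)) \<sigma>
    ((\<Sum>b<Nb. time_gen XL gr + 30 * sum_list (ts b) + 62 * length (rs b) + 20 + 1) + 1)
    (\<lambda>(R, M). R 28 = of_bool (\<exists>b<Nb. hits Q (ss b) (rs b)))"
proof (rule runs_While_count[where I = phase_inv, OF assms])
  fix b \<sigma> assume "b < Nb" "phase_inv b \<sigma>"
  then show "fst \<sigma> 27 \<noteq> 0 \<and> runs w (phase wc gr r P) \<sigma>
     (time_gen XL gr + 30 * sum_list (ts b) + 62 * length (rs b) + 20) (phase_inv (Suc b))"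
    using phase_runs[of b "fst \<sigma>" "snd \<sigma>"] by (cases \<sigma>) (auto simp: phase_inv_def)
next
  show "fst \<sigma> 27 = 0 \<and> (case \<sigma> of (R, M) \<Rightarrow> R 28 = of_bool (\<exists>b<Nb. hits Q (ss b) (rs b)))" if "phase_inv Nb \<sigma>" for \<sigma>
    using that by (cases \<sigma>) (auto simp: phase_inv_def)
qed

end


section \<open>The complete SAT program and its side conditions\<close>

section \<open>The satisfiability algorithm\<close>

text \<open>
  Variables: 0 number of variables \<open>n\<close>, 1 number of clauses \<open>q\<close>, 2 \<open>L = n div D\<close>, 3 \<open>2 ^ L\<close>, 4 \<open>2 ^ (g * L)\<close>,
  5 current phase, 6 \<open>h * (n + 1)\<close>, 7 and 8 size parameters of the instance, 9 \<open>q + \<kappa>\<close>,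
  10 number of phases, 11 to 18 bound variables, 19 \<open>2 ^ w'\<close>.
\<close>

definition assign :: "nat \<Rightarrow> ex \<Rightarrow> com" where
  "assign v e = Seq (comp_ex 50 e) (Op And v 50 50)"

definition assign_pow :: "nat \<Rightarrow> nat \<Rightarrow> com" where
  "assign_pow v u = Seq (Const 50 1) (Op Shl v 50 u)"

text \<open>The number of binary digits of \<open>N + M + 1\<close>, obtained by counting the shifts
  that leave a nonzero word. Variable 6 is a long enough range since \<open>N + M + 1 < H\<close>
  and \<open>H = 2 ^ ((n + 1) * h)\<close>.\<close>

definition log_ex :: ex where
  "log_ex = Sum 11 6 (Bin BLess (Cn 0) (Bin BShr (Bin BAdd (Bin BAdd (Vr 7) (Vr 8)) (Cn 1)) (Vr 11)))"

text \<open>\<open>boot\<close> truncates the input words to the word size of the data structure;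
  variable 19 holds the corresponding power of 2.\<close>

fun mod_gen :: "gen \<Rightarrow> gen" where
  "mod_gen (Emit e) = Emit (Bin BMod e (Vr 19))"
| "mod_gen Nop = Nop"
| "mod_gen (Sq g h) = Sq (mod_gen g) (mod_gen h)"
| "mod_gen (For v u g) = For v u (mod_gen g)"
| "mod_gen (Iff e g h) = Iff e (mod_gen g) (mod_gen h)"

lemma gl_mod_gen: "vars_below_gen 19 g \<Longrightarrow> gl m s (mod_gen g) = map (\<lambda>x. x mod s 19) (gl m s g)"
  by (induction g arbitrary: s) (auto simp: map_concat comp_def)

lemma loop_vars_mod_gen [simp]: "loop_vars_gen (mod_gen g) = loop_vars_gen g"
  by (induction g) auto

lemma vars_below_mono: "vars_below B e \<Longrightarrow> B \<le> B' \<Longrightarrow> vars_below B' e"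
  by (induction e) auto

lemma vars_below_mod_gen: "vars_below_gen 19 g \<Longrightarrow> vars_below_gen 20 (mod_gen g)"
  by (induction g) (auto intro: vars_below_mono)

lemma floorlog_sum:
  assumes "x < 2 ^ hb"
  shows "(\<Sum>i<hb. of_bool (0 < drop_bit i x)) = floorlog 2 (x::nat)"
proof (cases "x = 0")
  case True
  then show ?thesis by (simp add: floorlog_def)
next
  case False
  let ?k = "floorlog 2 x"
  have k: "2 ^ i \<le> x \<longleftrightarrow> i < ?k" for i
  proof -
    have "floorlog 2 x \<le> i \<longleftrightarrow> x < 2 ^ i" using floorlog_le_iff[of 2 x i] by simp
    then show ?thesis by (meson not_le)
  qed
  have "?k \<le> hb" using assms k[of hb] by simp
  moreover have "0 < drop_bit i x \<longleftrightarrow> i < ?k" for i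
    using k[of i] by (simp add: drop_bit_eq_div div_greater_zero_iff)
  ultimately show ?thesis
    by (simp add: of_bool_def sum.If_cases Int_absorb1 Collect_conv_if lessThan_def[symmetric])
qed

context input_memory
begin

definition St :: "(nat \<Rightarrow> nat) \<Rightarrow> (nat \<Rightarrow> nat) \<Rightarrow> config \<Rightarrow> bool" where
  "St M f = (\<lambda>(R, M'). (\<forall>v<50. R v = f v) \<and> M' = M)"

definition trans_to :: "(nat \<Rightarrow> nat) \<Rightarrow> (nat \<Rightarrow> nat) \<Rightarrow> com \<Rightarrow> nat \<Rightarrow> (nat \<Rightarrow> nat) \<Rightarrow> bool" where
  "trans_to M f P c f' \<longleftrightarrow> (\<forall>\<sigma>. St M f \<sigma> \<longrightarrow> runs w P \<sigma> c (St M f'))"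

lemma trans_to_Seq: "trans_to M f P c f' \<Longrightarrow> trans_to M f' Q c' f'' \<Longrightarrow> trans_to M f (Seq P Q) (c + c') f''"
  unfolding trans_to_def by (blast intro: runs_Seq)

lemma trans_to_assign:
  assumes "vars_below B e" "B \<le> 20" "V ^ degree_ex e < H" "H \<le> 2 ^ w" "\<And>v. v < B \<Longrightarrow> f v \<le> V"
    and "\<And>a. a < H \<Longrightarrow> M a = m a" "\<And>u. u \<in> loop_vars e \<Longrightarrow> f u \<le> X" "ev m f e = y" "v < 50"
  shows "trans_to M f (assign v e) (time_ex X e + 1) (f(v := y))"
  unfolding trans_to_def
proof (intro allI impI)
  fix \<sigma> assume "St M f \<sigma>"
  then obtain R where \<sigma>: "\<sigma> = (R, M)" "\<And>v. v < 50 \<Longrightarrow> R v = f v" by (cases \<sigma>) (auto simp: St_def)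
  have lv: "u < 50" if "u \<in> loop_vars e" for u using loop_vars_below[OF assms(1)] that assms(2) by auto
  have y: "ev m R e = y" using ev_cong[OF assms(1), of R f m] \<sigma>(2) assms(2,8) by simp
  have "y \<le> V ^ degree_ex e" using ev_le[OF V2 m_le scan_le assms(1), of f] assms(5,8) by simp
  then have yw: "y < 2 ^ w" using assms(3,4) by linarith
  have "runs w (comp_ex 50 e) (R, M) (time_ex X e) (\<lambda>(R', M'). R' 50 = ev m R e \<and> (\<forall>v<50. R' v = R v) \<and> M' = M)"
    by (rule comp_ex_runs[OF assms(1)]) (use assms \<sigma> lv in auto)
  then show "runs w (assign v e) \<sigma> (time_ex X e + 1) (St M (f(v := y)))"
    unfolding \<sigma>(1) assign_def
    by (rule runs_Seq) (use \<sigma>(2) y yw assms(9) in \<open>auto simp: St_def\<close>)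
qed

lemma trans_to_assign_pow:
  assumes "0 < w" "f u = y" "2 ^ y < (2::nat) ^ w" "v < 50" "u < 50"
  shows "trans_to M f (assign_pow v u) 2 (f(v := 2 ^ y))"
  unfolding trans_to_def assign_pow_def St_def using assms by auto

lemma trans_to_Const:
  assumes "c < 2 ^ w" "i < 50"
  shows "trans_to M f (Const i c) 1 (f(i := c))"
  unfolding trans_to_def St_def using assms by auto

lemma trans_to_Op:
  assumes "binop_val w c (f j) (f k) = y" "i < 50" "j < 50" "k < 50"
  shows "trans_to M f (Op c i j k) 1 (f(i := y))"
  unfolding trans_to_def St_def using assms by auto

end

text \<open>Expressions have no subtraction, so variable 10 first receives \<open>2 ^ n\<close> and
  is then divided by \<open>2 ^ (g * L)\<close>. The factor \<open>h\<close> is multiplied by plain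
  instructions: as an expression, \<open>Cn h\<close> would have degree \<open>Suc h\<close>, and
  \<open>V ^ Suc h < H\<close> fails for the choice \<open>V = B ^ u\<close>,
  \<open>H = B ^ h\<close> made in \<open>reduction_runs\<close>.\<close>

definition prologue :: "nat \<Rightarrow> nat \<Rightarrow> nat \<Rightarrow> nat \<Rightarrow> nat \<Rightarrow> ex \<Rightarrow> ex \<Rightarrow> com" where
  "prologue D g h \<kappa> cw eN eM =
    Seq (assign 0 (Inp (Cn 0))) (Seq (assign 1 (Inp (Cn 1))) (Seq (assign 2 (Bin BDiv (Vr 0) (Cn D)))
    (Seq (assign_pow 3 2) (Seq (assign 4 (Bin BMul (Vr 2) (Cn g))) (Seq (assign_pow 4 4)
    (Seq (assign_pow 10 0) (Seq (assign 10 (Bin BDiv (Vr 10) (Vr 4)))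
    (Seq (Seq (assign 6 (Bin BAdd (Vr 0) (Cn 1))) (Seq (Const 29 h) (Seq (Op Mul 6 6 29) (Const 29 0)))) (Seq (assign 9 (Bin BAdd (Vr 1) (Cn \<kappa>)))
    (Seq (assign 7 eN) (Seq (assign 8 eM) (Seq (assign 19 (Bin BMul (Cn cw) log_ex)) (Seq (assign_pow 19 19)
    (Seq (assign_pow 23 6) (Seq (assign 20 (Vr 19)) (Seq (Op And 21 23 23) (Seq (Op Add 24 23 23)
    (Op Add 24 24 23))))))))))))))))))"

text \<open>Within the bank at \<open>H\<close> the \<open>r\<close> simulated registers come first.
  So the input words start at \<open>H + r\<close>, and their number is put into simulated register
  0 at address \<open>H\<close>. The rest of the bank is still 0, as \<open>boot\<close>
  demands.\<close>

definition write_input :: "nat \<Rightarrow> gen \<Rightarrow> com" where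
  "write_input r gi = Seq (Const 29 r) (Seq (Op Add 25 23 29) (Seq (comp_gen 25 50 (mod_gen gi))
    (Seq (Const 29 r) (Seq (Op Sub 29 25 29) (Seq (Op Sub 29 29 23) (Seq (Op Mod 29 29 20) (Store 23 29)))))))"

text \<open>The preprocessing runs with \<open>X = H\<close>, so what it writes becomes the base.
  The worst-case mode then switches to \<open>X = 2 * H\<close>, so that phases write to a bank that
  can be invalidated; the amortized mode continues in place.\<close>

definition solver :: "bool \<Rightarrow> nat \<Rightarrow> nat \<Rightarrow> nat \<Rightarrow> nat \<Rightarrow> nat \<Rightarrow> ex \<Rightarrow> ex \<Rightarrow> gen \<Rightarrow> gen \<Rightarrow> nat \<Rightarrow> com \<Rightarrow> com \<Rightarrow> com" where
  "solver wc D g h \<kappa> cw eN eM gi gr r P0 P = Seq (prologue D g h \<kappa> cw eN eM) (Seq (write_input r gi) (Seq (sim r P0)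
    (Seq (if wc then Op Add 21 23 23 else Skip) (Seq (Const 28 0) (Seq (Op Less 27 5 10)
    (Seq (While 27 (phase wc gr r P)) (Op And 0 28 28)))))))"

definition the_env :: "nat \<Rightarrow> nat \<Rightarrow> nat \<Rightarrow> nat \<Rightarrow> nat \<Rightarrow> nat \<Rightarrow> nat \<Rightarrow> nat \<Rightarrow> nat" where
  "the_env n q D g h \<kappa> N = (\<lambda>_. 0)(0 := n, 1 := q, 2 := n div D, 3 := 2 ^ (n div D), 4 := 2 ^ (g * (n div D)),
     10 := 2 ^ (n - g * (n div D)), 6 := (n + 1) * h, 9 := q + \<kappa>, 7 := N)"

text \<open>Gathers the arithmetic conditions that link the instance, the simulated machine and the
  word size; \<open>reduction_runs\<close> discharges them by comparing exponents.\<close>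

locale solver_setup = phase_setup w w' r H m V wc gr P Q
    "(the_env n q D g h \<kappa> N)(8 := Mm, 19 := 2 ^ w')" XL "2 ^ (n - g * (n div D))" rs ss \<sigma>s \<sigma>e ts
  for w w' r H :: nat and m V wc gr P and Q :: "'s dyn_problem" and n q D g h \<kappa> N Mm XL rs ss \<sigma>s \<sigma>e ts +
  fixes cw XI :: nat and eN eM :: ex and gi :: gen and P0 :: com and t0 :: nat and inp :: "nat list"
  assumes H_eq: "H = 2 ^ ((n + 1) * h)" and D_pos: "0 < D" and gL: "g * (n div D) \<le> n"
    and w_eq: "w = (h + 3) * (n + 1)"
    and m_inp: "m = (\<lambda>i. if i < length inp then inp ! i else 0)" and inp0: "inp ! 0 = n" and inp1: "inp ! 1 = q" "2 \<le> length inp"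
    and inp_len: "length inp \<le> V"
    and V_n: "2 ^ n \<le> V"
    and degs: "\<And>e. e \<in> {Bin BDiv (Vr 0) (Cn D), Bin BMul (Vr 2) (Cn g), Bin BAdd (Vr 0) (Cn 1),
       Bin BAdd (Vr 1) (Cn \<kappa>), eN, eM, Bin BMul (Cn cw) log_ex, Bin BDiv (Vr 10) (Vr 4), Inp (Cn 1), Vr 19} \<Longrightarrow> V ^ degree_ex e < H"
    and deg_gi: "V ^ degree_gen (mod_gen gi) < H"
    and eN: "vars_below 20 eN" "ev m (the_env n q D g h \<kappa> 0) eN = N"
    and eM: "vars_below 20 eM" "ev m (the_env n q D g h \<kappa> N) eM = Mm"
    and XI: "\<And>u. u \<in> loop_vars eN \<union> loop_vars eM \<union> loop_vars_gen gi \<Longrightarrow> u \<notin> {7, 8, 19} \<and> the_env n q D g h \<kappa> 0 u \<le> XI" "(n + 1) * h \<le> XI"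
    and w'_eq: "w' = cw * floorlog 2 (N + Mm + 1)"
    and NM: "N + Mm + 1 < H"
    and gi: "vars_below_gen 19 gi"
    and len_gi: "r + length (gl m ((the_env n q D g h \<kappa> N)(8 := Mm, 19 := 2 ^ w')) gi) \<le> H"
    and exec0: "exec w' P0 (boot w' (gl m ((the_env n q D g h \<kappa> N)(8 := Mm, 19 := 2 ^ w')) gi)) t0 (\<sigma>s 0)"
    and P0_regs: "below_regs r P0"
begin

lemma boot_inp: "boot w inp = ((\<lambda>_. 0)(0 := length inp), m)"
proof -
  have "V < 2 ^ w" using V_less H_le by linarith
  moreover have "inp ! i \<le> V" if "i < length inp" for i using m_le[of i] that by (simp add: m_inp)
  ultimately have "inp ! i mod 2 ^ w = inp ! i" if "i < length inp" for i using that by (metis le_less_trans mod_less)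
  then show ?thesis using inp_len \<open>V < 2 ^ w\<close> by (auto simp: boot_def m_inp fun_eq_iff)
qed

lemma prologue_runs:
  "trans_to m ((\<lambda>_. 0)(0 := length inp)) (prologue D g h \<kappa> cw eN eM)
     (60 + time_ex XI eN + time_ex XI eM + time_ex XI log_ex)
     ((the_env n q D g h \<kappa> N)(8 := Mm, 19 := 2 ^ w', 23 := H, 20 := 2 ^ w', 21 := H, 24 := 3 * H))"
proof -
  let ?L = "n div D"
  let ?E = "(the_env n q D g h \<kappa> N)(8 := Mm, 19 := 2 ^ w')"
  note tra = trans_to_assign[where X = XI]
  have Hw: "H \<le> 2 ^ w" using H_le by simp
  have E: "?E v \<le> V" if "v < 20" for v using env_le[OF that] .
  have b: "n \<le> V" "q \<le> V" "?L \<le> V" "2 ^ ?L \<le> V" "2 ^ (g * ?L) \<le> V" "2 ^ (n - g * ?L) \<le> V" "(n + 1) * h \<le> V"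
     "q + \<kappa> \<le> V" "N \<le> V" "Mm \<le> V" "2 ^ w' \<le> V"
    using E[of 0] E[of 1] E[of 2] E[of 3] E[of 4] E[of 10] E[of 6] E[of 9] E[of 7] E[of 8] E[of 19]
    by (simp_all add: the_env_def)
  have gLV: "g * ?L \<le> V" using gL b(1) by linarith
  have w'V: "w' \<le> V" using b(11) less_exp[of w'] by (metis le_trans less_imp_le)
  define f0 where "f0 = (\<lambda>_::nat. 0::nat)(0 := length inp)"
  define f1 where "f1 = f0(0 := n)"
  define f2 where "f2 = f1(1 := q)"
  define f3 where "f3 = f2(2 := ?L)"
  define f4 where "f4 = f3(3 := 2 ^ ?L)"
  define f5 where "f5 = f4(4 := g * ?L)"
  define f6 where "f6 = f5(4 := 2 ^ (g * ?L))"
  define f7 where "f7 = f6(10 := 2 ^ n)"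
  define f8 where "f8 = f7(10 := 2 ^ (n - g * ?L))"
  define f9 where "f9 = f8(6 := (n + 1) * h)"
  define f10 where "f10 = f9(9 := q + \<kappa>)"
  define f11 where "f11 = f10(7 := N)"
  define f12 where "f12 = f11(8 := Mm)"
  define f13 where "f13 = f12(19 := w')"
  define f14 where "f14 = f13(19 := 2 ^ w')"
  define f15 where "f15 = f14(23 := H)"
  define f16 where "f16 = f15(20 := 2 ^ w')"
  have up: "(f(a := y)) v \<le> V" if "\<And>v. f v \<le> V" "y \<le> V" for f :: "nat \<Rightarrow> nat" and a y v
    using that by simp
  have B0: "f0 v \<le> V" for v using inp_len by (simp add: f0_def)
  have B1: "f1 v \<le> V" for v unfolding f1_def by (rule up[OF B0 b(1)])
  have B2: "f2 v \<le> V" for v unfolding f2_def by (rule up[OF B1 b(2)])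
  have B3: "f3 v \<le> V" for v unfolding f3_def by (rule up[OF B2 b(3)])
  have B4: "f4 v \<le> V" for v unfolding f4_def by (rule up[OF B3 b(4)])
  have B5: "f5 v \<le> V" for v unfolding f5_def by (rule up[OF B4 gLV])
  have B6: "f6 v \<le> V" for v unfolding f6_def by (rule up[OF B5 b(5)])
  have B7: "f7 v \<le> V" for v unfolding f7_def by (rule up[OF B6 V_n])
  have B8: "f8 v \<le> V" for v unfolding f8_def by (rule up[OF B7 b(6)])
  have B9: "f9 v \<le> V" for v unfolding f9_def by (rule up[OF B8 b(7)])
  have B10: "f10 v \<le> V" for v unfolding f10_def by (rule up[OF B9 b(8)])
  have B11: "f11 v \<le> V" for v unfolding f11_def by (rule up[OF B10 b(9)])
  have B12: "f12 v \<le> V" for v unfolding f12_def by (rule up[OF B11 b(10)])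
  have B13: "f13 v \<le> V" for v unfolding f13_def by (rule up[OF B12 w'V])
  have B14: "f14 v \<le> V" for v unfolding f14_def by (rule up[OF B13 b(11)])
  note B = B0 B1 B2 B3 B4 B5 B6 B7 B8 B9 B10 B11 B12 B13 B14
  have e10: "f10 = the_env n q D g h \<kappa> 0"
    unfolding the_env_def f0_def f1_def f2_def f3_def f4_def f5_def f6_def f7_def f8_def f9_def f10_def
    by (simp add: fun_eq_iff)
  have e11: "f11 = the_env n q D g h \<kappa> N"
    unfolding f11_def e10 by (simp add: the_env_def fun_eq_iff)
  have pw: "2 ^ a < (2::nat) ^ w" if "2 ^ a \<le> V" for a using that V_less H_le by linarith
  have D2: "V ^ degree_ex (Inp (Cn 1)) < H" by (rule degs) simp
  have D3: "V ^ degree_ex (Bin BDiv (Vr 0) (Cn D)) < H" by (rule degs) simp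
  have D5: "V ^ degree_ex (Bin BMul (Vr 2) (Cn g)) < H" by (rule degs) simp
  have D8: "V ^ degree_ex (Bin BDiv (Vr 10) (Vr 4)) < H" by (rule degs) simp
  have D9: "V ^ degree_ex (Bin BAdd (Vr 0) (Cn 1)) < H" by (rule degs) simp
  have D10: "V ^ degree_ex (Bin BAdd (Vr 1) (Cn \<kappa>)) < H" by (rule degs) simp
  have D11: "V ^ degree_ex (eN) < H" by (rule degs) simp
  have D12: "V ^ degree_ex (eM) < H" by (rule degs) simp
  have D13: "V ^ degree_ex (Bin BMul (Cn cw) log_ex) < H" by (rule degs) simp
  have D16: "V ^ degree_ex (Vr 19) < H" by (rule degs) simp
  have D1: "V ^ degree_ex (Inp (Cn 0)) < H" using pow_mono_H[OF D2, of 1] by simp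
  have m01: "m 0 = n" "m 1 = q" using inp0 inp1 by (auto simp: m_inp)
  have lx: "ev m f12 log_ex = floorlog 2 (N + Mm + 1)"
    using NM floorlog_sum[of "N + Mm + 1" "(n + 1) * h"] unfolding H_eq
    by (simp add: log_ex_def f12_def f11_def f10_def f9_def)
  have t1: "trans_to m f0 (assign 0 (Inp (Cn 0))) (time_ex XI (Inp (Cn 0)) + 1) f1"
    unfolding f1_def by (rule tra[OF _ _ D1 Hw]) (use B0 m01 in auto)
  have t2: "trans_to m f1 (assign 1 (Inp (Cn 1))) (time_ex XI (Inp (Cn 1)) + 1) f2"
    unfolding f2_def by (rule tra[OF _ _ D2 Hw]) (use B1 m01 in auto)
  have t3: "trans_to m f2 (assign 2 (Bin BDiv (Vr 0) (Cn D))) (time_ex XI (Bin BDiv (Vr 0) (Cn D)) + 1) f3"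
    unfolding f3_def by (rule tra[OF _ _ D3 Hw]) (use B2 in \<open>auto simp: f2_def f1_def\<close>)
  have t4: "trans_to m f3 (assign_pow 3 2) 2 f4"
    unfolding f4_def by (rule trans_to_assign_pow) (use w_pos b pw in \<open>auto simp: f3_def\<close>)
  have t5: "trans_to m f4 (assign 4 (Bin BMul (Vr 2) (Cn g))) (time_ex XI (Bin BMul (Vr 2) (Cn g)) + 1) f5"
    unfolding f5_def by (rule tra[OF _ _ D5 Hw]) (use B4 in \<open>auto simp: f4_def f3_def\<close>)
  have t6: "trans_to m f5 (assign_pow 4 4) 2 f6"
    unfolding f6_def by (rule trans_to_assign_pow) (use w_pos b pw in \<open>auto simp: f5_def\<close>)
  have t7: "trans_to m f6 (assign_pow 10 0) 2 f7"
    unfolding f7_def by (rule trans_to_assign_pow) (use w_pos V_n pw in \<open>auto simp: f6_def f5_def f4_def f3_def f2_def f1_def\<close>)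
  have t8: "trans_to m f7 (assign 10 (Bin BDiv (Vr 10) (Vr 4))) (time_ex XI (Bin BDiv (Vr 10) (Vr 4)) + 1) f8"
    unfolding f8_def by (rule tra[OF _ _ D8 Hw]) (use B7 gL in \<open>auto simp: f7_def f6_def power_diff\<close>)
  have hV: "(n + 1) * h < 2 ^ w" using b(7) V_less H_le by linarith
  then have h: "h < 2 ^ w" by (rule le_less_trans[rotated]) simp
  have t9a: "trans_to m f8 (assign 6 (Bin BAdd (Vr 0) (Cn 1))) (time_ex XI (Bin BAdd (Vr 0) (Cn 1)) + 1) (f8(6 := n + 1))"
    by (rule tra[OF _ _ D9 Hw]) (use B8 in
      \<open>auto simp: f8_def f7_def f6_def f5_def f4_def f3_def f2_def f1_def\<close>)
  have t9b: "trans_to m (f8(6 := n + 1)) (Const 29 h) 1 (f8(6 := n + 1, 29 := h))"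
    by (rule trans_to_Const) (use h in auto)
  have t9c: "trans_to m (f8(6 := n + 1, 29 := h)) (Op Mul 6 6 29) 1 (f8(6 := n + 1, 29 := h, 6 := (n + 1) * h))"
    by (rule trans_to_Op) (use hV in auto)
  have t9d: "trans_to m (f8(6 := n + 1, 29 := h, 6 := (n + 1) * h)) (Const 29 0) 1 (f8(6 := n + 1, 29 := h, 6 := (n + 1) * h, 29 := 0))"
    by (rule trans_to_Const) auto
  have e9: "f8(6 := n + 1, 29 := h, 6 := (n + 1) * h, 29 := 0) = f9"
    by (simp add: fun_eq_iff f9_def f8_def f7_def f6_def f5_def f4_def f3_def f2_def f1_def f0_def)
  note t9 = trans_to_Seq[OF t9a trans_to_Seq[OF t9b trans_to_Seq[OF t9c t9d]], unfolded e9]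
  have t10: "trans_to m f9 (assign 9 (Bin BAdd (Vr 1) (Cn \<kappa>))) (time_ex XI (Bin BAdd (Vr 1) (Cn \<kappa>)) + 1) f10"
    unfolding f10_def by (rule tra[OF _ _ D10 Hw]) (use B9 in
      \<open>auto simp: f9_def f8_def f7_def f6_def f5_def f4_def f3_def f2_def\<close>)
  have t11: "trans_to m f10 (assign 7 eN) (time_ex XI eN + 1) f11"
    unfolding f11_def by (rule tra[OF _ _ D11 Hw]) (use B10 eN XI e10 in auto)
  have lvM: "\<And>u. u \<in> loop_vars eM \<Longrightarrow> f11 u \<le> XI" using XI(1) e10 by (simp add: f11_def)
  have t12: "trans_to m f11 (assign 8 eM) (time_ex XI eM + 1) f12"
    unfolding f12_def by (rule tra[OF _ _ D12 Hw]) (use B11 eM lvM e11 in auto)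
  have t13: "trans_to m f12 (assign 19 (Bin BMul (Cn cw) log_ex)) (time_ex XI (Bin BMul (Cn cw) log_ex) + 1) f13"
    unfolding f13_def
  proof (rule tra[OF _ _ D13 Hw])
    show "ev m f12 (Bin BMul (Cn cw) log_ex) = w'" using lx w'_eq by simp
    show "vars_below 20 (Bin BMul (Cn cw) log_ex)" by (simp add: log_ex_def)
    show "f12 u \<le> XI" if "u \<in> loop_vars (Bin BMul (Cn cw) log_ex)" for u
      using that XI(2) by (simp add: log_ex_def f12_def f11_def f10_def f9_def)
  qed (use B12 in auto)
  have t14: "trans_to m f13 (assign_pow 19 19) 2 f14"
    unfolding f14_def by (rule trans_to_assign_pow) (use w_pos b pw in \<open>auto simp: f13_def\<close>)
  have "(2::nat) ^ ((n + 1) * h) < 2 ^ w" using H_le H_pos unfolding H_eq[symmetric] by linarith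
  then have hw: "(n + 1) * h < w" by simp
  have t15: "trans_to m f14 (assign_pow 23 6) 2 f15"
    unfolding f15_def H_eq
    by (rule trans_to_assign_pow) (use w_pos hw in \<open>auto simp: f14_def f13_def f12_def f11_def f10_def f9_def\<close>)
  have t16: "trans_to m f15 (assign 20 (Vr 19)) (time_ex XI (Vr 19) + 1) f16"
    unfolding f16_def
  proof (rule tra[OF _ _ D16 Hw])
    show "f15 v \<le> V" if "v < 20" for v using B14[of v] that by (simp add: f15_def)
  qed (use B14 in \<open>auto simp: f15_def f14_def\<close>)
  have t17: "trans_to m f16 (Op And 21 23 23) 1 (f16(21 := H))"
    by (rule trans_to_Op) (use H_le H_pos in \<open>auto simp: f16_def f15_def\<close>)
  have t18: "trans_to m (f16(21 := H)) (Op Add 24 23 23) 1 (f16(21 := H, 24 := 2 * H))"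
    by (rule trans_to_Op) (use H_le H_pos in \<open>auto simp: f16_def f15_def\<close>)
  have t19: "trans_to m (f16(21 := H, 24 := 2 * H)) (Op Add 24 24 23) 1 (f16(21 := H, 24 := 2 * H, 24 := 3 * H))"
    by (rule trans_to_Op) (use H_le H_pos in \<open>auto simp: f16_def f15_def\<close>)
  note T = trans_to_Seq[OF t1 trans_to_Seq[OF t2 trans_to_Seq[OF t3 trans_to_Seq[OF t4 trans_to_Seq[OF t5
    trans_to_Seq[OF t6 trans_to_Seq[OF t7 trans_to_Seq[OF t8 trans_to_Seq[OF t9 trans_to_Seq[OF t10
    trans_to_Seq[OF t11 trans_to_Seq[OF t12 trans_to_Seq[OF t13 trans_to_Seq[OF t14 trans_to_Seq[OF t15
    trans_to_Seq[OF t16 trans_to_Seq[OF t17 trans_to_Seq[OF t18 t19]]]]]]]]]]]]]]]]]]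
  have fin: "f16(21 := H, 24 := 2 * H, 24 := 3 * H) = ?E(23 := H, 20 := 2 ^ w', 21 := H, 24 := 3 * H)"
    unfolding f16_def f15_def f14_def f13_def f12_def e11 by (simp add: fun_upd_upd)
  note T' = T[folded prologue_def, unfolded fin]
  show ?thesis unfolding f0_def[symmetric] trans_to_def
  proof (intro allI impI)
    fix \<sigma> assume "St m f0 \<sigma>"
    from T'[unfolded trans_to_def, rule_format, OF this]
    show "runs w (prologue D g h \<kappa> cw eN eM) \<sigma> (60 + time_ex XI eN + time_ex XI eM + time_ex XI log_ex)
       (St m (?E(23 := H, 20 := 2 ^ w', 21 := H, 24 := 3 * H)))"
      by (rule runs_weaken) simp_all
  qed
qed

lemma write_input_runs:
  assumes "St m ((the_env n q D g h \<kappa> N)(8 := Mm, 19 := 2 ^ w', 23 := H, 20 := 2 ^ w', 21 := H, 24 := 3 * H)) \<sigma>"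
  shows "runs w (write_input r gi) \<sigma> (time_gen XI (mod_gen gi) + 7)
    (\<lambda>(R, M). (\<forall>v<20. R v = ((the_env n q D g h \<kappa> N)(8 := Mm, 19 := 2 ^ w')) v) \<and> sim_regs H 0 R \<and>
       rep H 0 M (boot w' (gl m ((the_env n q D g h \<kappa> N)(8 := Mm, 19 := 2 ^ w')) gi)) \<and>
       (\<forall>a<H. M a = m a) \<and> (\<forall>a<H. M (3 * H + a) = 0))"
proof -
  let ?E = "(the_env n q D g h \<kappa> N)(8 := Mm, 19 := 2 ^ w')"
  let ?xs = "gl m ?E gi" and ?ys = "map (\<lambda>x. x mod 2 ^ w') (gl m ?E gi)"
  from assms obtain R where \<sigma>: "\<sigma> = (R, m)" and R50: "\<And>v. v < 50 \<Longrightarrow>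
      R v = (?E(23 := H, 20 := 2 ^ w', 21 := H, 24 := 3 * H)) v"
    by (cases \<sigma>) (auto simp: St_def)
  have R20: "R v = ?E v" if "v < 20" for v using R50[of v] that by simp
  have R2: "R 20 = 2 ^ w'" "R 21 = H" "R 23 = H" "R 24 = 3 * H" "R 22 = 0"
    using R50[of 20] R50[of 21] R50[of 23] R50[of 24] R50[of 22] by (simp_all add: the_env_def)
  have len: "r + length ?xs \<le> H" by (rule len_gi)
  have w2: "H + (r + length ?xs) < 2 ^ w" "r < 2 ^ w" "H < 2 ^ w" using len H_le H_pos by linarith+
  define R1 where "R1 = R(29 := r, 25 := H + r)"
  have g1: "gl m R1 (mod_gen gi) = ?ys"
  proof -
    have "gl m R1 (mod_gen gi) = gl m ?E (mod_gen gi)"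
      by (rule gl_cong[OF vars_below_mod_gen[OF gi]]) (use R20 in \<open>simp add: R1_def\<close>)
    then show ?thesis using gl_mod_gen[OF gi, of m ?E] by simp
  qed
  have lv: "R1 u \<le> XI" if u: "u \<in> loop_vars_gen (mod_gen gi)" for u
  proof -
    have "u < 20" using loop_vars_gen_below[OF vars_below_mod_gen[OF gi]] u by auto
    then have "R1 u = ?E u" using R20[of u] by (simp add: R1_def)
    moreover have "u \<notin> {7, 8, 19}" "the_env n q D g h \<kappa> 0 u \<le> XI" using XI(1)[of u] u by auto
    ultimately show ?thesis by (simp add: the_env_def)
  qed
  have gen: "runs w (comp_gen 25 50 (mod_gen gi)) (R1, m) (time_gen XI (mod_gen gi))
     (\<lambda>(R', M'). R' 25 = R1 25 + length (gl m R1 (mod_gen gi)) \<and> (\<forall>v<50. v \<noteq> 25 \<longrightarrow> R' v = R1 v) \<and>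
       M' = put m (R1 25) (gl m R1 (mod_gen gi)))"
  proof (rule comp_gen_runs[OF vars_below_mod_gen[OF gi] _ _ deg_gi])
    show "R1 v \<le> V" if "v < 20" for v using R20[OF that] env_le[OF that] that by (simp add: R1_def)
    show "R1 25 + length (gl m R1 (mod_gen gi)) < 2 ^ w" using w2 g1 by (simp add: R1_def add.assoc)
    show "1 < H" using V_less V2 by linarith
  qed (use lv V_less H_le in \<open>auto simp: R1_def\<close>)
  define M1 where "M1 = put m (H + r) ?ys"
  define M2 where "M2 = M1(H := length ?xs mod 2 ^ w')"
  let ?\<Phi> = "\<lambda>(R, M). (\<forall>v<20. R v = ?E v) \<and> sim_regs H 0 R \<and> rep H 0 M (boot w' ?xs) \<and>
       (\<forall>a<H. M a = m a) \<and> (\<forall>a<H. M (3 * H + a) = 0)"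
  have m0: "m a = 0" if "H \<le> a" for a using that inp_len V_less by (simp add: m_inp)
  have M2v: "M2 a = (if a = H then length ?xs mod 2 ^ w' else if H + r \<le> a \<and> a < H + r + length ?xs then ?ys ! (a - (H + r)) else m a)" for a
    by (simp add: M2_def M1_def put_def)
  have view: "view H H 0 M2 a = M2 (H + a)" for a by (simp add: view_def)
  have "rep H 0 M2 (boot w' ?xs)" unfolding rep_def view
  proof (intro conjI allI impI)
    show "M2 (H + i) = fst (boot w' ?xs) i" if "i < r" for i
      using that by (simp add: M2v boot_def m0)
    show "fst (boot w' ?xs) i < 2 ^ w'" if "i < r" for i by (simp add: boot_def)
    show "M2 (H + (r + a)) = snd (boot w' ?xs) a" if "a < 2 ^ w'" for a
      using r3 by (simp add: M2v boot_def m0)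
    show "snd (boot w' ?xs) a < 2 ^ w'" if "a < 2 ^ w'" for a by (simp add: boot_def)
  qed
  moreover have "M2 a = m a" if "a < H" for a using that by (simp add: M2v)
  moreover have "M2 (3 * H + a) = 0" for a using H_pos len by (simp add: M2v m0)
  ultimately have M2: "rep H 0 M2 (boot w' ?xs)" "\<forall>a<H. M2 a = m a" "\<forall>a<H. M2 (3 * H + a) = 0" by auto
  have "runs w (Seq (comp_gen 25 50 (mod_gen gi)) (Seq (Const 29 r) (Seq (Op Sub 29 25 29) (Seq (Op Sub 29 29 23)
     (Seq (Op Mod 29 29 20) (Store 23 29)))))) (R1, m) (time_gen XI (mod_gen gi) + 5) ?\<Phi>"
  proof (rule runs_Seq[OF gen])
    fix \<tau> assume *: "case \<tau> of (R', M') \<Rightarrow> R' 25 = R1 25 + length (gl m R1 (mod_gen gi)) \<and> (\<forall>v<50. v \<noteq> 25 \<longrightarrow> R' v = R1 v) \<and>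
       M' = put m (R1 25) (gl m R1 (mod_gen gi))"
    obtain R3 where \<tau>: "\<tau> = (R3, M1)" "R3 25 = H + r + length ?xs" "\<And>v. v < 25 \<Longrightarrow> R3 v = R v"
      using * g1 by (cases \<tau>) (auto simp: M1_def R1_def)
    have R3: "R3 20 = 2 ^ w'" "R3 23 = H" using \<tau>(3)[of 20] \<tau>(3)[of 23] R2 by simp_all
    have a1: "(H + r + length ?xs + 2 ^ w - r) mod 2 ^ w = H + length ?xs"
      using w2 add_power_diff[of r "H + r + length ?xs" w] by simp
    have a2: "(H + length ?xs + 2 ^ w - H) mod 2 ^ w = length ?xs"
      using w2 add_power_diff[of H "H + length ?xs" w] by simp
    have a3: "length ?xs mod 2 ^ w' mod 2 ^ w = length ?xs mod 2 ^ w'"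
      by (rule mod_less, rule le_less_trans[OF mod_less_eq_dividend]) (use w2 in linarith)
    have fin: "?\<Phi> (R4, M2)" if "\<And>v. v < 25 \<Longrightarrow> R4 v = R v" for R4
      using that M2 R20 R2 by (simp add: sim_regs_def)
    have "runs w (Seq (Const 29 r) (Seq (Op Sub 29 25 29) (Seq (Op Sub 29 29 23)
     (Seq (Op Mod 29 29 20) (Store 23 29))))) (R3, M1) 5 (\<lambda>\<sigma>. snd \<sigma> = M2 \<and> (\<forall>v<25. fst \<sigma> v = R v))"
      using R3 \<tau>(2,3) a1 a2 a3 w2 by (simp add: M2_def)
    then show "runs w (Seq (Const 29 r) (Seq (Op Sub 29 25 29) (Seq (Op Sub 29 29 23)
     (Seq (Op Mod 29 29 20) (Store 23 29))))) \<tau> 5 ?\<Phi>" unfolding \<tau>(1)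
      by (rule runs_weaken) (use fin in \<open>auto split: prod.splits\<close>)
  qed
  then have T: "runs w (Seq (comp_gen 25 50 (mod_gen gi)) (Seq (Const 29 r) (Seq (Op Sub 29 25 29) (Seq (Op Sub 29 29 23)
     (Seq (Op Mod 29 29 20) (Store 23 29)))))) (R1, m) (time_gen XI (mod_gen gi) + 7 - 1 - 1) ?\<Phi>"
    by (rule runs_weaken) auto
  have R1: "R(29 := r mod 2 ^ w, 25 := binop_val w Add ((R(29 := r mod 2 ^ w)) 23) ((R(29 := r mod 2 ^ w)) 29)) = R1"
    using w2 R2 by (simp add: R1_def)
  show ?thesis unfolding write_input_def \<sigma> runs_Seq_Const runs_Seq_Op R1
    using T by (intro conjI) (assumption | simp)+
qed

theorem solver_runs:
  "runs w (solver wc D g h \<kappa> cw eN eM gi gr r P0 P) (boot w inp)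
    (80 + time_ex XI eN + time_ex XI eM + time_ex XI log_ex + time_gen XI (mod_gen gi) + 30 * t0 +
     (\<Sum>b<2 ^ (n - g * (n div D)). time_gen XL gr + 30 * sum_list (ts b) + 62 * length (rs b) + 20 + 1))
    (\<lambda>\<sigma>. result \<sigma> = of_bool (\<exists>b<2 ^ (n - g * (n div D)). hits Q (ss b) (rs b)))"
    (is "runs w _ _ (80 + ?a + ?b + ?c + ?d + ?e + ?S) ?\<Phi>")
proof -
  let ?E = "(the_env n q D g h \<kappa> N)(8 := Mm, 19 := 2 ^ w')"
  let ?Nb = "2 ^ (n - g * (n div D)) :: nat"
  have St0: "St m ((\<lambda>_. 0)(0 := length inp)) (boot w inp)" by (simp add: St_def boot_inp)
  have W: "runs w (Seq (While 27 (phase wc gr r P)) (Op And 0 28 28)) \<sigma> (?S + 2) ?\<Phi>" if i: "phase_inv 0 \<sigma>" for \<sigma>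
    by (rule runs_Seq'[OF phases_runs[OF i], where n' = 1]) (use w_pos in \<open>auto simp: result_def\<close>)
  have V1: "V < 2 ^ w" using V_less H_le by linarith
  have "runs w (Seq (if wc then Op Add 21 23 23 else Skip) (Seq (Const 28 0) (Seq (Op Less 27 5 10)
    (Seq (While 27 (phase wc gr r P)) (Op And 0 28 28))))) (R, M) (?S + 5) ?\<Phi>"
    if R: "\<forall>v<20. R v = ?E v" "sim_regs H 0 R" "rep H 0 M (\<sigma>s 0)" "\<forall>a<H. M a = m a" "\<forall>a<H. M (3 * H + a) = 0" for R M
  proof -
    have "R 5 = 0" "R 10 = ?Nb" using R(1) by (simp_all add: the_env_def)
    note r = this
    have inv: "phase_inv 0 (R', M)" if "\<forall>v<20. R' v = R v" "R' 28 = 0" "R' 27 = 1"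
       "R' 20 = R 20" "R' 22 = R 22" "R' 23 = R 23" "R' 24 = R 24" "R' 21 = (if wc then 2 * H else H)" for R'
    proof -
      \<comment> \<open>All stamps are still 0. In epoch 1 every read therefore goes to the base
        bank, where the preprocessing left its result.\<close>
      have v: "view H (2 * H) 1 M a = view H H 0 M a" if "a < H" for a using R(5) that by (simp add: view_def)
      have "r + a < H" if "a < 2 ^ w'" for a using that r_le by linarith
      moreover have "j < H" if "j < r" for j using that r_le by linarith
      ultimately have "rep (2 * H) 1 M (\<sigma>s 0)" using R(3) unfolding rep_def by (simp add: v[simplified])
      then show ?thesis using that R r unfolding phase_inv_def by (auto simp: sim_regs_def the_env_def)
    qed
    have s: "R 23 = H" "R 21 = H" using R(2) by (auto simp: sim_regs_def)
    have HH: "H + H < 2 ^ w" using H_le H_pos by linarith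
    have "runs w (Seq (While 27 (phase wc gr r P)) (Op And 0 28 28)) (R(21 := H + H, 28 := 0, 27 := Suc 0), M) (?S + 2) ?\<Phi>" if wc
      by (rule W, rule inv) (use that in auto)
    moreover have "runs w (Seq (While 27 (phase wc gr r P)) (Op And 0 28 28)) (R(28 := 0, 27 := Suc 0), M) (?S + 2) ?\<Phi>" if "\<not> wc"
      by (rule W, rule inv) (use that s in auto)
    ultimately show ?thesis using r s HH w_pos by (cases wc) simp_all
  qed
  note fin = this
  have P0: "runs w (Seq (sim r P0) (Seq (if wc then Op Add 21 23 23 else Skip) (Seq (Const 28 0) (Seq (Op Less 27 5 10)
    (Seq (While 27 (phase wc gr r P)) (Op And 0 28 28)))))) (R, M) (30 * t0 + (?S + 5)) ?\<Phi>"
    if R: "\<forall>v<20. R v = ?E v" "sim_regs H 0 R" "rep H 0 M (boot w' (gl m ?E gi))" "\<forall>a<H. M a = m a" "\<forall>a<H. M (3 * H + a) = 0" for R M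
  proof (rule runs_Seq[OF sim_runs[OF exec0 P0_regs R(2,3)]])
    fix \<tau> assume *: "case \<tau> of (R', M') \<Rightarrow> same R R' \<and> rep H 0 M' (\<sigma>s 0) \<and> frame H 0 M M'"
    obtain R' M' where \<tau>: "\<tau> = (R', M')" "same R R'" "rep H 0 M' (\<sigma>s 0)" "frame H 0 M M'" using * by (cases \<tau>) auto
    have m1: "M' a = m a" if "a < H" for a using \<tau>(4) R(4) that unfolding frame_def by (auto dest: spec[of _ a])
    have m2: "M' (3 * H + a) = 0" if "a < H" for a
      using \<tau>(4) R(5) that unfolding frame_def by (auto dest: spec[of _ "3 * H + a"])
    show "runs w (Seq (if wc then Op Add 21 23 23 else Skip) (Seq (Const 28 0) (Seq (Op Less 27 5 10)
    (Seq (While 27 (phase wc gr r P)) (Op And 0 28 28))))) \<tau> (?S + 5) ?\<Phi>"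
      unfolding \<tau>(1) by (rule fin) (use R \<tau> m1 m2 sim_regs_same in \<open>auto simp: same_def\<close>)
  qed
  have "runs w (solver wc D g h \<kappa> cw eN eM gi gr r P0 P) (boot w inp)
     ((60 + ?a + ?b + ?c) + ((?d + 7) + (30 * t0 + (?S + 5)))) ?\<Phi>"
    unfolding solver_def
  proof (rule runs_Seq)
    show "runs w (prologue D g h \<kappa> cw eN eM) (boot w inp) (60 + ?a + ?b + ?c)
       (St m ((the_env n q D g h \<kappa> N)(8 := Mm, 19 := 2 ^ w', 23 := H, 20 := 2 ^ w', 21 := H, 24 := 3 * H)))"
      using prologue_runs St0 unfolding trans_to_def by blast
    fix \<sigma> assume "St m ((the_env n q D g h \<kappa> N)(8 := Mm, 19 := 2 ^ w', 23 := H, 20 := 2 ^ w', 21 := H, 24 := 3 * H)) \<sigma>"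
    from runs_Seq[OF write_input_runs[OF this], where n' = "30 * t0 + (?S + 5)" and \<Phi> = ?\<Phi>]
    show "runs w (Seq (write_input r gi) (Seq (sim r P0) (Seq (if wc then Op Add 21 23 23 else Skip) (Seq (Const 28 0) (Seq (Op Less 27 5 10)
      (Seq (While 27 (phase wc gr r P)) (Op And 0 28 28))))))) \<sigma> ((?d + 7) + (30 * t0 + (?S + 5))) ?\<Phi>"
      using P0 by blast
  qed
  then show ?thesis by (rule runs_weaken) auto
qed

end


section \<open>The input formula as expressions see it\<close>

section \<open>Formulas in memory\<close>

definition input_fun :: "nat list \<Rightarrow> nat \<Rightarrow> nat" where
  "input_fun xs = (\<lambda>i. if i < length xs then xs ! i else 0)"

lemma kcnf_clause: "kcnf k n F \<Longrightarrow> cl \<in> set F \<Longrightarrow> length cl \<le> k \<and> distinct cl \<and> (\<forall>(v, b) \<in> set cl. v < n)"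
  by (auto simp: kcnf_def)

lemma kcnf_subset:
  "{F. kcnf k n F} \<subseteq> {F. set F \<subseteq> {cl. set cl \<subseteq> {..<n} \<times> UNIV \<and> length cl \<le> k} \<and> distinct F}"
  by (auto simp: kcnf_def distinct_map)

lemma finite_kcnf: "finite {F. kcnf k n F}"
proof (rule finite_subset[OF kcnf_subset])
  let ?A = "{cl :: (nat \<times> bool) list. set cl \<subseteq> {..<n} \<times> UNIV \<and> length cl \<le> k}"
  have "finite ?A" by (rule finite_lists_length_le) simp
  then show "finite {F. set F \<subseteq> ?A \<and> distinct F}" by (rule finite_subset_distinct)
qed

text \<open>The clauses are distinct lists of at most \<open>k\<close> of the \<open>2 * n\<close>
  literals. There are \<open>(2 * n) ^ i\<close> lists of length \<open>i\<close>, and the sum of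
  these powers is bounded term by term by the binomial expansion of
  \<open>(2 * n + 1) ^ k\<close>.\<close>

lemma kcnf_length_le:
  assumes "kcnf k n F"
  shows "length F \<le> (2 * n + 1) ^ k"
proof -
  let ?A = "{..<n} \<times> (UNIV :: bool set)"
  let ?B = "{cl. set cl \<subseteq> ?A \<and> length cl \<le> k}"
  have F: "set F \<subseteq> ?B" "distinct F" using kcnf_subset[of k n] assms by auto
  have "length F = card (set F)" using F(2) by (simp add: distinct_card)
  also have "\<dots> \<le> card ?B" by (rule card_mono[OF _ F(1)]) (rule finite_lists_length_le, simp)
  also have "card ?B = (\<Sum>i\<le>k. (2 * n) ^ i)" by (subst card_lists_length_le) (simp_all add: card_cartesian_product mult.commute)
  also have "\<dots> \<le> (\<Sum>i\<le>k. of_nat (k choose i) * (2 * n) ^ i * 1 ^ (k - i))"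
    by (rule sum_mono) (auto simp: Suc_leI zero_less_binomial)
  also have "\<dots> = (2 * n + 1) ^ k" by (rule binomial_ring[symmetric])
  finally show ?thesis .
qed

locale cnf_memory =
  fixes k n :: nat and F :: cnf and m :: "nat \<Rightarrow> nat"
  assumes kcnf: "kcnf k n F" and m_def: "m = input_fun (enc_cnf n F)"
begin

definition lit :: "nat \<times> bool \<Rightarrow> nat" where
  "lit = (\<lambda>(v, b). 2 * v + of_bool b)"

definition adr :: "nat \<Rightarrow> nat" where
  "adr c = 2 + (\<Sum>cl\<leftarrow>take c F. length cl + 1)"

lemma enc_cnf_eq: "enc_cnf n F = n # length F # concat (map (\<lambda>cl. length cl # map lit cl) F)"
  by (simp add: enc_cnf_def enc_lists_def enc_list_def comp_def lit_def)

lemma length_enc: "length (enc_cnf n F) = adr (length F)"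
  by (simp add: enc_cnf_eq adr_def length_concat comp_def)

lemma enc_split:
  assumes "c < length F"
  shows "\<exists>xs ys. enc_cnf n F = xs @ (length (F ! c) # map lit (F ! c)) @ ys \<and> length xs = adr c"
proof -
  let ?f = "\<lambda>cl. length cl # map lit cl"
  have "F = take c F @ F ! c # drop (Suc c) F" using assms by (rule id_take_nth_drop)
  then have "concat (map ?f F) = concat (map ?f (take c F @ F ! c # drop (Suc c) F))"
    by (rule arg_cong[of _ _ "\<lambda>G. concat (map ?f G)"])
  then have "concat (map ?f F) = concat (map ?f (take c F)) @ ?f (F ! c) @ concat (map ?f (drop (Suc c) F))"
    unfolding map_append concat_append list.map concat.simps .
  then have "enc_cnf n F = (n # length F # concat (map ?f (take c F))) @ ?f (F ! c) @ concat (map ?f (drop (Suc c) F))"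
    by (simp add: enc_cnf_eq)
  moreover have "length (n # length F # concat (map ?f (take c F))) = adr c"
    by (simp add: adr_def length_concat comp_def)
  ultimately show ?thesis by blast
qed

lemma m_clause:
  assumes "c < length F"
  shows "m (adr c) = length (F ! c)" "j < length (F ! c) \<Longrightarrow> m (adr c + 1 + j) = lit (F ! c ! j)"
proof -
  obtain xs ys where e: "enc_cnf n F = xs @ (length (F ! c) # map lit (F ! c)) @ ys" "length xs = adr c"
    using enc_split[OF assms] by blast
  show "m (adr c) = length (F ! c)" using e by (simp add: m_def input_fun_def nth_append)
  show "m (adr c + 1 + j) = lit (F ! c ! j)" if "j < length (F ! c)"
    using e that by (simp add: m_def input_fun_def nth_append)
qed

lemma scan_eq: "c \<le> length F \<Longrightarrow> scan m c = adr c"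
proof (induction c)
  case 0
  then show ?case by (simp add: adr_def)
next
  case (Suc c)
  then show ?case using m_clause(1)[of c] by (simp add: adr_def take_Suc_conv_app_nth)
qed

text \<open>Behind the last clause the cells read as 0, so \<open>scan\<close> only advances by 1.
  This gives the linear bound that \<open>input_memory\<close> asks for at all arguments, including
  those that are no clause numbers.\<close>

lemma scan_beyond: "scan m (length F + i) = adr (length F) + i"
proof (induction i)
  case 0
  then show ?case using scan_eq[of "length F"] by simp
next
  case (Suc i)
  then show ?case using length_enc by (simp add: m_def input_fun_def)
qed

lemma adr_le: "adr c \<le> adr (length F)"
proof (cases "c \<le> length F")
  case True
  have "(\<Sum>cl\<leftarrow>take c F @ drop c F. length cl + 1) = (\<Sum>cl\<leftarrow>take c F. length cl + 1) + (\<Sum>cl\<leftarrow>drop c F. length cl + 1)"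
    unfolding map_append sum_list_append ..
  then show ?thesis unfolding adr_def append_take_drop_id by simp
next
  case False
  then show ?thesis by (simp add: adr_def)
qed

lemma scan_le: "scan m c \<le> length (enc_cnf n F) + c"
proof (cases "c \<le> length F")
  case True
  then show ?thesis using scan_eq adr_le[of c] length_enc by simp
next
  case False
  then show ?thesis using scan_beyond[of "c - length F"] length_enc by simp
qed

lemma length_enc_le: "length (enc_cnf n F) \<le> 2 + length F * (k + 1)"
proof -
  have "(\<Sum>cl\<leftarrow>F. length cl + 1) \<le> (\<Sum>cl\<leftarrow>F. k + 1)"
    using kcnf_clause[OF kcnf] by (intro sum_list_mono) auto
  then show ?thesis by (simp add: length_enc adr_def sum_list_triv)
qed

lemma m_le: "m a \<le> 2 * n + length F + k + 1"
proof (cases "a < length (enc_cnf n F)")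
  case True
  then have "m a \<in> set (enc_cnf n F)" by (simp add: m_def input_fun_def)
  then consider "m a = n" | "m a = length F" | cl where "cl \<in> set F" "m a = length cl"
    | cl v b where "cl \<in> set F" "(v, b) \<in> set cl" "m a = lit (v, b)"
    by (auto simp: enc_cnf_eq)
  then show ?thesis
  proof cases
    case 3
    then show ?thesis using kcnf_clause[OF kcnf 3(1)] by simp
  next
    case 4
    then have "v < n" using kcnf_clause[OF kcnf 4(1)] by auto
    then show ?thesis using 4 by (simp add: lit_def)
  qed auto
next
  case False
  then show ?thesis by (simp add: m_def input_fun_def)
qed

end

section \<open>Splitting assignments into blocks of variables\<close>

section \<open>Partial assignments\<close>

text \<open>Bit \<open>v\<close> of \<open>\<gamma>\<close> is the value of variable
  \<open>v\<close>, so the assignment of a later block is a number shifted to its position. The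
  condition is vacuous for a clause without variables in the block; hence a clause is false under a
  combined assignment iff \<open>pfals\<close> holds for every block.\<close>

definition pfals :: "nat \<Rightarrow> nat \<Rightarrow> nat \<Rightarrow> (nat \<times> bool) list \<Rightarrow> bool" where
  "pfals lo hi \<gamma> cl \<longleftrightarrow> (\<forall>(v, b) \<in> set cl. lo \<le> v \<and> v < hi \<longrightarrow> bit \<gamma> v \<noteq> b)"

lemma ex_bits: "\<exists>b<2 ^ (hi - lo). \<forall>v. lo \<le> v \<and> v < hi \<longrightarrow> bit (b * 2 ^ lo :: nat) v = \<alpha> v"
proof -
  let ?b = "horner_sum of_bool 2 (map (\<lambda>i. \<alpha> (lo + i)) [0..<hi - lo]) :: nat"
  have "horner_sum of_bool 2 bs < (2::nat) ^ length bs" for bs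
  proof (induction bs)
    case (Cons x bs)
    then show ?case by (cases x) simp_all
  qed simp
  from this[of "map (\<lambda>i. \<alpha> (lo + i)) [0..<hi - lo]"] have "?b < 2 ^ (hi - lo)" by simp
  moreover have "bit (?b * 2 ^ lo) v = \<alpha> v" if "lo \<le> v" "v < hi" for v
    using that by (auto simp: push_bit_eq_mult[symmetric] bit_push_bit_iff_nat bit_horner_sum_bit_iff)
  ultimately show ?thesis by blast
qed

lemma satisfiable_split:
  assumes "kcnf k n F" "L \<le> n"
  shows "satisfiable F \<longleftrightarrow> (\<exists>b<2 ^ (n - L). \<exists>a<2 ^ L. \<forall>cl \<in> set F. \<not> (pfals 0 L a cl \<and> pfals L n (b * 2 ^ L) cl))"
    (is "_ \<longleftrightarrow> ?R")
proof
  assume "satisfiable F"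
  then obtain \<alpha> where \<alpha>: "\<forall>cl \<in> set F. \<exists>(v, b) \<in> set cl. \<alpha> v = b" by (auto simp: satisfiable_def)
  obtain a where a: "a < (2::nat) ^ L" "\<And>v. v < L \<Longrightarrow> bit a v = \<alpha> v" using ex_bits[of L 0 \<alpha>] by auto
  obtain b where b: "b < (2::nat) ^ (n - L)" "\<And>v. L \<le> v \<Longrightarrow> v < n \<Longrightarrow> bit (b * 2 ^ L) v = \<alpha> v" using ex_bits[of n L \<alpha>] by auto
  have "\<not> (pfals 0 L a cl \<and> pfals L n (b * 2 ^ L) cl)" if cl: "cl \<in> set F" for cl
  proof -
    obtain v x where v: "(v, x) \<in> set cl" "\<alpha> v = x" using \<alpha> cl by auto
    have "v < n" using kcnf_clause[OF assms(1) cl] v by auto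
    then show ?thesis using v a(2)[of v] b(2)[of v] unfolding pfals_def by (cases "v < L") (auto dest!: bspec)
  qed
  then show ?R using a(1) b(1) by blast
next
  assume ?R
  then obtain a b where ab: "\<And>cl. cl \<in> set F \<Longrightarrow> \<not> (pfals 0 L a cl \<and> pfals L n (b * 2 ^ L) cl)" by blast
  let ?\<alpha> = "\<lambda>v. if v < L then bit a v else bit (b * 2 ^ L) v"
  have "\<exists>(v, x) \<in> set cl. ?\<alpha> v = x" if "cl \<in> set F" for cl
    using ab[OF that] unfolding pfals_def by (fastforce split: if_splits)
  then show "satisfiable F" unfolding satisfiable_def by (intro exI[of _ ?\<alpha>]) simp
qed

lemma satisfiable_split2:
  assumes "kcnf k n F" "2 * L \<le> n"
  shows "satisfiable F \<longleftrightarrow> (\<exists>b<2 ^ (n - 2 * L). \<exists>a1<2 ^ L. \<exists>a2<2 ^ L. \<forall>cl \<in> set F.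
     \<not> (pfals 0 L a1 cl \<and> pfals L (2 * L) (a2 * 2 ^ L) cl \<and> pfals (2 * L) n (b * 2 ^ (2 * L)) cl))"
    (is "_ \<longleftrightarrow> ?R")
proof
  assume "satisfiable F"
  then obtain \<alpha> where \<alpha>: "\<forall>cl \<in> set F. \<exists>(v, b) \<in> set cl. \<alpha> v = b" by (auto simp: satisfiable_def)
  obtain a where a: "a < (2::nat) ^ L" "\<And>v. v < L \<Longrightarrow> bit a v = \<alpha> v" using ex_bits[of L 0 \<alpha>] by auto
  obtain a2 where a2: "a2 < (2::nat) ^ L" "\<And>v. L \<le> v \<Longrightarrow> v < 2 * L \<Longrightarrow> bit (a2 * 2 ^ L) v = \<alpha> v"
    using ex_bits[of "2 * L" L \<alpha>] by auto
  obtain b where b: "b < (2::nat) ^ (n - 2 * L)" "\<And>v. 2 * L \<le> v \<Longrightarrow> v < n \<Longrightarrow> bit (b * 2 ^ (2 * L)) v = \<alpha> v"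
    using ex_bits[of n "2 * L" \<alpha>] by auto
  have "\<not> (pfals 0 L a cl \<and> pfals L (2 * L) (a2 * 2 ^ L) cl \<and> pfals (2 * L) n (b * 2 ^ (2 * L)) cl)" if cl: "cl \<in> set F" for cl
  proof -
    obtain v x where v: "(v, x) \<in> set cl" "\<alpha> v = x" using \<alpha> cl by auto
    have vn: "v < n" using kcnf_clause[OF assms(1) cl] v by auto
    consider "v < L" | "L \<le> v" "v < 2 * L" | "2 * L \<le> v" by linarith
    then show ?thesis
    proof cases
      case 1
      then have "\<not> pfals 0 L a cl" using v a(2)[of v] unfolding pfals_def by (auto intro!: bexI[of _ "(v, x)"])
      then show ?thesis by blast
    next
      case 2
      then have "\<not> pfals L (2 * L) (a2 * 2 ^ L) cl" using v a2(2)[of v] unfolding pfals_def by (auto intro!: bexI[of _ "(v, x)"])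
      then show ?thesis by blast
    next
      case 3
      then have "\<not> pfals (2 * L) n (b * 2 ^ (2 * L)) cl" using v b(2)[of v] vn unfolding pfals_def by (auto intro!: bexI[of _ "(v, x)"])
      then show ?thesis by blast
    qed
  qed
  then show ?R using a(1) a2(1) b(1) by blast
next
  assume ?R
  then obtain a a2 b where ab: "\<And>cl. cl \<in> set F \<Longrightarrow> \<not> (pfals 0 L a cl \<and> pfals L (2 * L) (a2 * 2 ^ L) cl \<and> pfals (2 * L) n (b * 2 ^ (2 * L)) cl)" by blast
  let ?\<alpha> = "\<lambda>v. if v < L then bit a v else if v < 2 * L then bit (a2 * 2 ^ L) v else bit (b * 2 ^ (2 * L)) v"
  have "\<exists>(v, x) \<in> set cl. ?\<alpha> v = x" if "cl \<in> set F" for cl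
    using ab[OF that] unfolding pfals_def by (fastforce split: if_splits)
  then show "satisfiable F" unfolding satisfiable_def by (intro exI[of _ ?\<alpha>]) simp
qed

text \<open>Counts the literals of clause \<open>c\<close> that the block satisfies and compares the
  count with 0. The loop runs up to variable 9, an upper bound on the clause length, because the
  expression must not depend on \<open>k\<close>; positions beyond the end of the clause contribute
  0. \<open>BLess lo (v + 1)\<close> expresses \<open>lo \<le> v\<close>.\<close>

definition fals_ex :: "ex \<Rightarrow> ex \<Rightarrow> ex \<Rightarrow> nat \<Rightarrow> ex" where
  "fals_ex lo hi \<gamma> c = (let code = Inp (Bin BAdd (Bin BAdd (Scan c) (Cn 1)) (Vr 18)); v = Bin BDiv code (Cn 2) in
    Bin BEq (Cn 0) (Sum 18 9 (Bin BMul (Bin BLess (Vr 18) (Inp (Scan c)))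
      (Bin BMul (Bin BLess lo (Bin BAdd v (Cn 1))) (Bin BMul (Bin BLess v hi)
       (Bin BEq (Bin BMod (Bin BShr \<gamma> v) (Cn 2)) (Bin BMod code (Cn 2))))))))"

lemma vars_below_fals_ex [simp]:
  "18 < B \<Longrightarrow> vars_below B (fals_ex lo hi \<gamma> c) \<longleftrightarrow> c < B \<and> vars_below B lo \<and> vars_below B hi \<and> vars_below B \<gamma>"
  by (auto simp: fals_ex_def Let_def)

lemma loop_vars_fals_ex [simp]:
  "loop_vars (fals_ex lo hi \<gamma> c) = {c, 9} \<union> loop_vars lo \<union> loop_vars hi \<union> loop_vars \<gamma>"
  by (auto simp: fals_ex_def Let_def)

lemma (in cnf_memory) ev_fals_ex:
  assumes "vars_below 18 lo" "vars_below 18 hi" "vars_below 18 \<gamma>" "c < 18" "s c < length F" "k \<le> s 9"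
  shows "ev m s (fals_ex lo hi \<gamma> c) = of_bool (pfals (ev m s lo) (ev m s hi) (ev m s \<gamma>) (F ! s c))"
proof -
  let ?cl = "F ! s c"
  have cong: "ev m (s(18 := j)) e = ev m s e" if "vars_below 18 e" for e j
    by (rule ev_cong[OF that]) simp
  have ad: "scan m (s c) = adr (s c)" using assms(5) by (simp add: scan_eq)
  have len: "length ?cl \<le> s 9" using kcnf_clause[OF kcnf, of ?cl] assms(5,6) by simp
  let ?v = "\<lambda>j. fst (?cl ! j)" and ?b = "\<lambda>j. snd (?cl ! j)"
  have code: "m (adr (s c) + 1 + j) div 2 = ?v j" "m (adr (s c) + 1 + j) mod 2 = of_bool (?b j)" if "j < length ?cl" for j
    using m_clause(2)[OF assms(5) that] by (auto simp: lit_def split: prod.splits)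
  have "(\<Sum>j<s 9. of_bool (j < length ?cl) * (of_bool (ev m s lo < m (adr (s c) + 1 + j) div 2 + 1) *
       (of_bool (m (adr (s c) + 1 + j) div 2 < ev m s hi) *
        of_bool (drop_bit (m (adr (s c) + 1 + j) div 2) (ev m s \<gamma>) mod 2 = m (adr (s c) + 1 + j) mod 2)))) = (0::nat)
    \<longleftrightarrow> (\<forall>j<length ?cl. ev m s lo \<le> ?v j \<and> ?v j < ev m s hi \<longrightarrow> bit (ev m s \<gamma>) (?v j) \<noteq> ?b j)"
  proof -
    have t: "of_bool (j < length ?cl) * (of_bool (ev m s lo < m (adr (s c) + 1 + j) div 2 + 1) *
       (of_bool (m (adr (s c) + 1 + j) div 2 < ev m s hi) *
        of_bool (drop_bit (m (adr (s c) + 1 + j) div 2) (ev m s \<gamma>) mod 2 = m (adr (s c) + 1 + j) mod 2))) = (0::nat) \<longleftrightarrow>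
       (j < length ?cl \<longrightarrow> ev m s lo \<le> ?v j \<and> ?v j < ev m s hi \<longrightarrow> bit (ev m s \<gamma>) (?v j) \<noteq> ?b j)" for j
    proof (cases "j < length ?cl")
      case True
      have "drop_bit (?v j) (ev m s \<gamma>) mod 2 = of_bool (?b j) \<longleftrightarrow> bit (ev m s \<gamma>) (?v j) = ?b j"
        by (cases "?b j") (auto simp: bit_iff_odd_drop_bit odd_iff_mod_2_eq_one even_iff_mod_2_eq_zero)
      then show ?thesis unfolding code[OF True] using True by (auto simp: less_Suc_eq_le)
    qed simp
    show ?thesis unfolding sum_eq_0_iff[OF finite_lessThan] t using len by auto
  qed
  also have "\<dots> \<longleftrightarrow> pfals (ev m s lo) (ev m s hi) (ev m s \<gamma>) ?cl"
    unfolding pfals_def case_prod_beta by (simp add: all_set_conv_all_nth)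
  finally show ?thesis using assms(4)
    by (simp add: fals_ex_def Let_def cong assms(1-3) ad m_clause(1)[OF assms(5)] del: of_bool_eq_0_iff)
qed


section \<open>What a reduction provides, and how it refutes SETH\<close>

section \<open>Reductions\<close>

definition std_env :: "nat \<Rightarrow> nat \<Rightarrow> nat \<Rightarrow> nat \<Rightarrow> nat \<Rightarrow> (nat \<Rightarrow> nat) \<Rightarrow> bool" where
  "std_env n q L g \<kappa> s \<longleftrightarrow> s 0 = n \<and> s 1 = q \<and> s 2 = L \<and> s 3 = 2 ^ L \<and> s 4 = 2 ^ (g * L) \<and>
     s 9 = q + \<kappa> \<and> s 10 = 2 ^ (n - g * L)"

definition valid_phases :: "bool \<Rightarrow> mode \<Rightarrow> 's dyn_problem \<Rightarrow> 's \<Rightarrow> nat \<Rightarrow> (nat \<Rightarrow> (request \<times> nat) list) \<Rightarrow> (nat \<Rightarrow> 's) \<Rightarrow> bool" where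
  "valid_phases wc Mo Q s0 Nb rs ss \<longleftrightarrow>
    (if wc then \<forall>b<Nb. ss b = s0 \<and> valid_seq Mo Q s0 (map fst (rs b))
     else valid_seq Mo Q s0 (concat (map (\<lambda>b. map fst (rs b)) [0..<Nb])) \<and>
       (\<forall>b<Nb. ss b = fold (\<lambda>r s. upd Q s r) (concat (map (\<lambda>b. map fst (rs b)) [0..<b])) s0))"

text \<open>\<open>Y\<close> is polynomial in \<open>n\<close> for fixed \<open>k\<close>, so each
  bound is a power of 2 times a polynomial. The lower bounds on \<open>N\<close> and
  \<open>M\<close> push both beyond the threshold from which the assumed times hold.
  \<open>M\<close> may be as large as \<open>2 ^ n * Y ^ a\<close> because in \<open>EmptyPP\<close>
  it counts the sets created by all phases; there \<open>f\<close> depends on \<open>N\<close>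
  only.\<close>

definition reduction_instance :: "bool \<Rightarrow> mode \<Rightarrow> (nat \<Rightarrow> nat \<Rightarrow> 's dyn_problem) \<Rightarrow> nat \<Rightarrow> (nat \<Rightarrow> nat \<Rightarrow> real) \<Rightarrow> real \<Rightarrow>
    ex \<Rightarrow> ex \<Rightarrow> gen \<Rightarrow> gen \<Rightarrow> nat \<Rightarrow> nat \<Rightarrow> nat \<Rightarrow> cnf \<Rightarrow> nat \<Rightarrow> bool" where
  "reduction_instance wc Mo Q g f \<epsilon> eN eM gi gr \<kappa> a n F L \<longleftrightarrow>
    (let m = input_fun (enc_cnf n F); q = length F; Y = n + q + \<kappa> + 2; Nb = 2 ^ (n - g * L) in
      \<exists>N M xs s0 rs ss.
        (\<forall>s. std_env n q L g \<kappa> s \<longrightarrow> ev m s eN = N \<and> (s 7 = N \<longrightarrow> ev m s eM = M) \<and>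
           (s 7 = N \<and> s 8 = M \<longrightarrow> gl m s gi = xs \<and> (s 5 < Nb \<longrightarrow> gl m s gr = concat (map record_words (rs (s 5)))))) \<and>
        (xs, s0) \<in> start (Q N M) \<and> valid_phases wc Mo (Q N M) s0 Nb rs ss \<and>
        (\<forall>b<Nb. (\<forall>(rq, e) \<in> set (rs b). short rq) \<and> length (rs b) \<le> Y ^ a) \<and>
        (satisfiable F \<longleftrightarrow> (\<exists>b<Nb. hits (Q N M) (ss b) (rs b))) \<and>
        2 ^ L \<le> N \<and> 2 ^ L \<le> M \<and> N \<le> 2 ^ L * Y ^ a \<and>
        M \<le> 2 ^ n * Y ^ a \<and> length xs \<le> 2 ^ n * Y ^ a \<and>
        f N M \<le> (2 ^ L * real Y ^ a) powr (real g - \<epsilon>))"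

text \<open>
  A reduction is given by expressions and list generators that produce the size parameters, the
  input words, and the requests of phase \<open>b\<close>.  They must not depend on \<open>k\<close>; only the value
  of variable 9 does.  The loops of the request generator are short.
\<close>

definition reduces :: "bool \<Rightarrow> mode \<Rightarrow> (nat \<Rightarrow> nat \<Rightarrow> 's dyn_problem) \<Rightarrow> nat \<Rightarrow> (nat \<Rightarrow> nat \<Rightarrow> real) \<Rightarrow> real \<Rightarrow> bool" where
  "reduces wc Mo Q g f \<epsilon> \<longleftrightarrow> (\<exists>eN eM gi gr.
    vars_below 19 eN \<and> vars_below 19 eM \<and> vars_below_gen 19 gi \<and> vars_below_gen 19 gr \<and>
    loop_vars eN \<union> loop_vars eM \<union> loop_vars_gen gi \<subseteq> {0, 1, 2, 3, 9} \<union> {11..18} \<and>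
    loop_vars_gen gr \<subseteq> {0, 1, 2, 9} \<union> {11..18} \<and>
    (\<forall>k. \<exists>\<kappa> a. \<forall>n F L. kcnf k n F \<and> g * L \<le> n \<longrightarrow> reduction_instance wc Mo Q g f \<epsilon> eN eM gi gr \<kappa> a n F L))"

lemma serves_append:
  "serves_to w P Q \<sigma> s (rs @ rs') ts \<tau> \<Longrightarrow>
    \<exists>ts1 ts2 \<rho>. ts = ts1 @ ts2 \<and> serves_to w P Q \<sigma> s rs ts1 \<rho> \<and>
      serves_to w P Q \<rho> (fold (\<lambda>r s. upd Q s r) rs s) rs' ts2 \<tau>"
proof (induction rs arbitrary: \<sigma> s ts)
  case (Cons r rs)
  then obtain t ts' \<sigma>' where 1: "ts = t # ts'" "exec w P (load_request w r \<sigma>) t \<sigma>'"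
    "correct_answer Q s r (result \<sigma>')" "serves_to w P Q \<sigma>' (upd Q s r) (rs @ rs') ts' \<tau>" by auto
  from Cons.IH[OF 1(4)] obtain ts1 ts2 \<rho> where "ts' = ts1 @ ts2" "serves_to w P Q \<sigma>' (upd Q s r) rs ts1 \<rho>"
      "serves_to w P Q \<rho> (fold (\<lambda>r s. upd Q s r) rs (upd Q s r)) rs' ts2 \<tau>" by blast
  then have "serves_to w P Q \<sigma> s (r # rs) (t # ts1) \<rho>" unfolding serves_to.simps using 1 by blast
  then show ?case using 1(1) \<open>ts' = ts1 @ ts2\<close> \<open>serves_to w P Q \<rho> _ rs' ts2 \<tau>\<close>
    by (metis append_Cons fold_simps(2))
qed simp

lemma serves_serves_to: "serves w P Q \<sigma> s rs ts \<Longrightarrow> \<exists>\<tau>. serves_to w P Q \<sigma> s rs ts \<tau>"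
proof (induction rs arbitrary: \<sigma> s ts)
  case Nil
  then show ?case by (intro exI[of _ \<sigma>]) simp
next
  case (Cons r rs)
  then obtain t ts' \<sigma>' where 1: "ts = t # ts'" "exec w P (load_request w r \<sigma>) t \<sigma>'"
    "correct_answer Q s r (result \<sigma>')" "serves w P Q \<sigma>' (upd Q s r) rs ts'" by auto
  from Cons.IH[OF 1(4)] 1 show ?case unfolding serves_to.simps by blast
qed

lemma serves_to_length: "serves_to w P Q \<sigma> s rs ts \<tau> \<Longrightarrow> length ts = length rs"
  by (induction rs arbitrary: \<sigma> s ts) auto

lemma serves_concat:
  "serves_to w P Q \<sigma> s (concat (map f [0..<K])) ts \<tau> \<Longrightarrow>
    \<exists>\<rho> tf. \<rho> 0 = \<sigma> \<and> (\<forall>b<K. serves_to w P Q (\<rho> b) (fold (\<lambda>r s. upd Q s r) (concat (map f [0..<b])) s) (f b) (tf b) (\<rho> (Suc b))) \<and>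
      sum_list ts = (\<Sum>b<K. sum_list (tf b)) \<and> \<rho> K = \<tau>"
proof (induction K arbitrary: ts \<tau>)
  case 0
  then show ?case by (intro exI[of _ "\<lambda>_. \<sigma>"]) auto
next
  case (Suc K)
  then have "serves_to w P Q \<sigma> s (concat (map f [0..<K]) @ f K) ts \<tau>" by simp
  from serves_append[OF this] obtain ts1 ts2 \<mu> where 1: "ts = ts1 @ ts2"
    "serves_to w P Q \<sigma> s (concat (map f [0..<K])) ts1 \<mu>"
    "serves_to w P Q \<mu> (fold (\<lambda>r s. upd Q s r) (concat (map f [0..<K])) s) (f K) ts2 \<tau>" by blast
  from Suc.IH[OF 1(2)] obtain \<rho> tf where 2: "\<rho> 0 = \<sigma>"
    "\<And>b. b < K \<Longrightarrow> serves_to w P Q (\<rho> b) (fold (\<lambda>r s. upd Q s r) (concat (map f [0..<b])) s) (f b) (tf b) (\<rho> (Suc b))"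
    "sum_list ts1 = (\<Sum>b<K. sum_list (tf b))" "\<rho> K = \<mu>" by blast
  have "\<forall>b<Suc K. serves_to w P Q ((\<rho>(Suc K := \<tau>)) b) (fold (\<lambda>r s. upd Q s r) (concat (map f [0..<b])) s) (f b)
      ((tf(K := ts2)) b) ((\<rho>(Suc K := \<tau>)) (Suc b))"
    using 2 1(3) by (auto simp: less_Suc_eq)
  moreover have "sum_list ts = (\<Sum>b<Suc K. sum_list ((tf(K := ts2)) b))" using 1(1) 2(3) by simp
  ultimately show ?case using 2(1) by (intro exI[of _ "\<rho>(Suc K := \<tau>)"] exI[of _ "tf(K := ts2)"]) simp
qed

text \<open>In the worst-case mode the algorithm is run on each phase separately, and determinism
  gives all these runs the same configuration after preprocessing. In the amortized mode it is run
  once on the concatenation, and the run is cut at the phase boundaries.\<close>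

lemma phases_served:
  fixes C :: real and Q :: "'s dyn_problem"
  assumes v: "valid_phases wc Mo Q s0 Nb rs ss" and "0 < Nb" and C: "0 \<le> C" "0 \<le> B"
    and alg: "\<And>rs. valid_seq Mo Q s0 rs \<Longrightarrow> \<exists>t0 \<sigma> ts. exec w P0 (boot w xs) t0 \<sigma> \<and> serves w P Q \<sigma> s0 rs ts \<and>
       (big \<longrightarrow> real t0 \<le> A \<and> (if wc then \<forall>\<tau> \<in> set ts. real \<tau> \<le> B
          else real (t0 + sum_list ts) \<le> A + real (length rs) * B))"
  obtains t0 \<sigma>s \<sigma>e tf where "exec w P0 (boot w xs) t0 (\<sigma>s 0)"
    and "\<And>b. b < Nb \<Longrightarrow> serves_to w P Q (\<sigma>s b) (ss b) (map fst (rs b)) (tf b) (\<sigma>e b)"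
    and "\<And>b. wc \<Longrightarrow> \<sigma>s b = \<sigma>s (0::nat)" and "\<And>b. \<not> wc \<Longrightarrow> \<sigma>s (Suc b) = \<sigma>e b"
    and "big \<Longrightarrow> real (t0 + (\<Sum>b<Nb. sum_list (tf b))) \<le> A + real (\<Sum>b<Nb. length (rs b)) * B"
proof (cases wc)
  case True
  have vb: "valid_seq Mo Q s0 (map fst (rs b))" "ss b = s0" if "b < Nb" for b
    using v that True by (auto simp: valid_phases_def)
  from alg[OF vb(1)[OF assms(2)]] obtain t0 \<sigma> where 0: "exec w P0 (boot w xs) t0 \<sigma>" "big \<longrightarrow> real t0 \<le> A" by blast
  have "\<exists>ts \<tau>. serves_to w P Q \<sigma> (ss b) (map fst (rs b)) ts \<tau> \<and> (big \<longrightarrow> (\<forall>\<tau> \<in> set ts. real \<tau> \<le> B))" if b: "b < Nb" for b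
  proof -
    from alg[OF vb(1)[OF b]] True obtain t1 \<sigma>1 ts where 1: "exec w P0 (boot w xs) t1 \<sigma>1"
       "serves w P Q \<sigma>1 s0 (map fst (rs b)) ts" "big \<longrightarrow> (\<forall>\<tau> \<in> set ts. real \<tau> \<le> B)" by auto
    have "\<sigma>1 = \<sigma>" using exec_deterministic[OF 0(1) 1(1)] by simp
    then show ?thesis using serves_serves_to[OF 1(2)] 1(3) vb(2)[OF b] by blast
  qed
  then obtain tf \<sigma>e where 2: "\<And>b. b < Nb \<Longrightarrow> serves_to w P Q \<sigma> (ss b) (map fst (rs b)) (tf b) (\<sigma>e b)"
     "\<And>b. b < Nb \<Longrightarrow> big \<Longrightarrow> \<forall>\<tau> \<in> set (tf b). real \<tau> \<le> B" by metis
  show ?thesis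
  proof (rule that[of t0 "\<lambda>_. \<sigma>" tf \<sigma>e])
    assume big
    have "real (sum_list (tf b)) \<le> real (length (rs b)) * B" if b: "b < Nb" for b
    proof -
      have "real (sum_list ts) \<le> real (length ts) * B" if "\<forall>\<tau> \<in> set ts. real \<tau> \<le> B" for ts
        using that by (induction ts) (auto simp: algebra_simps)
      from this[of "tf b"] 2(2)[OF b \<open>big\<close>] serves_to_length[OF 2(1)[OF b]] show ?thesis by simp
    qed
    then have "(\<Sum>b<Nb. real (sum_list (tf b))) \<le> (\<Sum>b<Nb. real (length (rs b)) * B)" by (intro sum_mono) simp
    then show "real (t0 + (\<Sum>b<Nb. sum_list (tf b))) \<le> A + real (\<Sum>b<Nb. length (rs b)) * B"
      using 0(2) \<open>big\<close> by (simp add: sum_distrib_right)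
  qed (use 0 2 True in auto)
next
  case False
  let ?f = "\<lambda>b. map fst (rs b)"
  have v': "valid_seq Mo Q s0 (concat (map ?f [0..<Nb]))"
    "\<And>b. b < Nb \<Longrightarrow> ss b = fold (\<lambda>r s. upd Q s r) (concat (map ?f [0..<b])) s0"
    using v False by (auto simp: valid_phases_def)
  from alg[OF v'(1)] False obtain t0 \<sigma> ts where 1: "exec w P0 (boot w xs) t0 \<sigma>"
       "serves w P Q \<sigma> s0 (concat (map ?f [0..<Nb])) ts"
       "big \<longrightarrow> real (t0 + sum_list ts) \<le> A + real (length (concat (map ?f [0..<Nb]))) * B" by auto
  from serves_serves_to[OF 1(2)] obtain \<tau> where "serves_to w P Q \<sigma> s0 (concat (map ?f [0..<Nb])) ts \<tau>" by blast
  from serves_concat[OF this] obtain \<rho> tf where 2: "\<rho> 0 = \<sigma>"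
     "\<And>b. b < Nb \<Longrightarrow> serves_to w P Q (\<rho> b) (fold (\<lambda>r s. upd Q s r) (concat (map ?f [0..<b])) s0) (?f b) (tf b) (\<rho> (Suc b))"
     "sum_list ts = (\<Sum>b<Nb. sum_list (tf b))" by blast
  have len: "length (concat (map ?f [0..<Nb])) = (\<Sum>b<Nb. length (rs b))"
    by (simp add: length_concat comp_def interv_sum_list_conv_sum_set_nat atLeast0LessThan)
  show ?thesis
    by (rule that[of t0 \<rho> tf "\<lambda>b. \<rho> (Suc b)"]) (use 1 2 v'(2) len False in auto)
qed

text \<open>The exponent depends on the syntax of the expression alone, so it is the same for all
  \<open>n\<close>, formulas and \<open>k\<close>. It enters the choice of \<open>D\<close>.\<close>

lemma time_ex_poly: "\<exists>z. \<forall>X\<ge>2. time_ex X e \<le> X ^ z"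
proof (induction e)
  case (Cn c)
  show ?case by (intro exI[of _ 0]) simp
next
  case (Vr v)
  show ?case by (intro exI[of _ 0]) simp
next
  case (Bin f a b)
  then obtain z1 z2 where z: "\<And>X. 2 \<le> X \<Longrightarrow> time_ex X a \<le> X ^ z1" "\<And>X. 2 \<le> X \<Longrightarrow> time_ex X b \<le> X ^ z2" by blast
  have "time_ex X (Bin f a b) \<le> X ^ (z1 + z2 + 2)" if X: "2 \<le> X" for X
  proof -
    have "X ^ z1 \<le> X ^ (z1 + z2)" "X ^ z2 \<le> X ^ (z1 + z2)" "1 \<le> X ^ (z1 + z2)" using X by (auto intro: power_increasing)
    then have "time_ex X (Bin f a b) \<le> 4 * X ^ (z1 + z2)" using z[OF X] by simp
    also have "\<dots> \<le> X ^ 2 * X ^ (z1 + z2)" using power_mono[OF X, of 2] by simp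
    finally show ?thesis by (simp add: power_add power2_eq_square mult_ac)
  qed
  then show ?case by blast
next
  case (Inp a)
  then obtain z where z: "\<And>X. 2 \<le> X \<Longrightarrow> time_ex X a \<le> X ^ z" by blast
  have "time_ex X (Inp a) \<le> X ^ (z + 1)" if X: "2 \<le> X" for X
  proof -
    have "1 \<le> X ^ z" using X by simp
    then have "time_ex X (Inp a) \<le> 2 * X ^ z" using z[OF X] by simp
    also have "\<dots> \<le> X * X ^ z" using X by simp
    finally show ?thesis by simp
  qed
  then show ?case by blast
next
  case (Scan u)
  have "time_ex X (Scan u) \<le> X ^ 4" if X: "2 \<le> X" for X
  proof -
    have "5 * X + 4 \<le> 8 * X" using X by simp
    also have "\<dots> \<le> X ^ 3 * X" using power_mono[OF X, of 3] by simp
    finally show ?thesis by (simp add: eval_nat_numeral)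
  qed
  then show ?case by blast
next
  case (Sum v u b)
  then obtain z where z: "\<And>X. 2 \<le> X \<Longrightarrow> time_ex X b \<le> X ^ z" by blast
  have "time_ex X (Sum v u b) \<le> X ^ (z + 5)" if X: "2 \<le> X" for X
  proof -
    have p: "1 \<le> X ^ z" using X by simp
    have "X * time_ex X b \<le> X * X ^ z" using z[OF X] by simp
    moreover have "4 * X \<le> 4 * (X * X ^ z)" "7 \<le> 7 * (X * X ^ z)" using p X by simp_all
    moreover have "time_ex X (Sum v u b) = X * time_ex X b + 4 * X + 7" by (simp add: distrib_left)
    ultimately have "time_ex X (Sum v u b) \<le> 12 * (X * X ^ z)" by linarith
    also have "\<dots> \<le> X ^ 4 * (X * X ^ z)" using power_mono[OF X, of 4] by (intro mult_right_mono) simp_all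
    finally show ?thesis by (simp add: power_add mult_ac eval_nat_numeral)
  qed
  then show ?case by blast
qed

lemma time_gen_poly: "\<exists>z. \<forall>X\<ge>2. time_gen X g \<le> X ^ z"
proof (induction g)
  case (Emit e)
  obtain z where z: "\<And>X. 2 \<le> X \<Longrightarrow> time_ex X e \<le> X ^ z" using time_ex_poly[of e] by blast
  have "time_gen X (Emit e) \<le> X ^ (z + 2)" if X: "2 \<le> X" for X
  proof -
    have "1 \<le> X ^ z" using X by simp
    then have "time_gen X (Emit e) \<le> 4 * X ^ z" using z[OF X] by simp
    also have "\<dots> \<le> X ^ 2 * X ^ z" using power_mono[OF X, of 2] by simp
    finally show ?thesis by (simp add: power_add power2_eq_square mult_ac)
  qed
  then show ?case by blast
next
  case Nop
  show ?case by (intro exI[of _ 0]) simp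
next
  case (Sq g h)
  then obtain z1 z2 where z: "\<And>X. 2 \<le> X \<Longrightarrow> time_gen X g \<le> X ^ z1" "\<And>X. 2 \<le> X \<Longrightarrow> time_gen X h \<le> X ^ z2" by blast
  have "time_gen X (Sq g h) \<le> X ^ (z1 + z2 + 1)" if X: "2 \<le> X" for X
  proof -
    have "X ^ z1 \<le> X ^ (z1 + z2)" "X ^ z2 \<le> X ^ (z1 + z2)" using X by (auto intro: power_increasing)
    then have "time_gen X (Sq g h) \<le> 2 * X ^ (z1 + z2)" using z[OF X] by simp
    also have "\<dots> \<le> X * X ^ (z1 + z2)" using X by simp
    finally show ?thesis by simp
  qed
  then show ?case by blast
next
  case (For v u g)
  then obtain z where z: "\<And>X. 2 \<le> X \<Longrightarrow> time_gen X g \<le> X ^ z" by blast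
  have "time_gen X (For v u g) \<le> X ^ (z + 5)" if X: "2 \<le> X" for X
  proof -
    have p: "1 \<le> X ^ z" using X by simp
    have "X * time_gen X g \<le> X * X ^ z" using z[OF X] by simp
    moreover have "3 * X \<le> 3 * (X * X ^ z)" "6 \<le> 6 * (X * X ^ z)" using p X by simp_all
    moreover have "time_gen X (For v u g) = X * time_gen X g + 3 * X + 6" by (simp add: distrib_left)
    ultimately have "time_gen X (For v u g) \<le> 10 * (X * X ^ z)" by linarith
    also have "\<dots> \<le> X ^ 4 * (X * X ^ z)" using power_mono[OF X, of 4] by (intro mult_right_mono) simp_all
    finally show ?thesis by (simp add: power_add mult_ac eval_nat_numeral)
  qed
  then show ?case by blast
next
  case (Iff e g h)
  obtain z0 where z0: "\<And>X. 2 \<le> X \<Longrightarrow> time_ex X e \<le> X ^ z0" using time_ex_poly[of e] by blast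
  from Iff obtain z1 z2 where z: "\<And>X. 2 \<le> X \<Longrightarrow> time_gen X g \<le> X ^ z1" "\<And>X. 2 \<le> X \<Longrightarrow> time_gen X h \<le> X ^ z2" by blast
  have "time_gen X (Iff e g h) \<le> X ^ (z0 + z1 + z2 + 2)" if X: "2 \<le> X" for X
  proof -
    let ?z = "z0 + z1 + z2"
    have "X ^ z1 \<le> X ^ ?z" "X ^ z2 \<le> X ^ ?z" "X ^ z0 \<le> X ^ ?z" "1 \<le> X ^ ?z" using X by (auto intro: power_increasing)
    then have "time_gen X (Iff e g h) \<le> 4 * X ^ ?z" using z[OF X] z0[OF X] by simp
    also have "\<dots> \<le> X ^ 2 * X ^ ?z" using power_mono[OF X, of 2] by simp
    finally show ?thesis by (simp add: power_add power2_eq_square mult_ac)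
  qed
  then show ?case by blast
qed

lemma vars_below_gen_mono: "vars_below_gen B g \<Longrightarrow> B \<le> B' \<Longrightarrow> vars_below_gen B' g"
  by (induction g) (auto intro: vars_below_mono)

lemma pow_add_le: "2 \<le> B \<Longrightarrow> x \<le> B ^ i \<Longrightarrow> y \<le> B ^ j \<Longrightarrow> x + y \<le> B ^ (max i j + 1)" for B :: nat
proof -
  assume a: "2 \<le> B" "x \<le> B ^ i" "y \<le> B ^ j"
  have "B ^ i \<le> B ^ max i j" "B ^ j \<le> B ^ max i j" using a(1) by (auto intro: power_increasing)
  then have "x + y \<le> 2 * B ^ max i j" using a by linarith
  also have "\<dots> \<le> B * B ^ max i j" using a(1) by simp
  finally show ?thesis by simp
qed

lemma le_pow_self: "2 \<le> B \<Longrightarrow> x \<le> B ^ x" for B x :: nat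
  by (meson le_trans less_exp less_imp_le power_mono zero_le)

text \<open>With \<open>V = B ^ u\<close> and \<open>H = B ^ h\<close> for
  \<open>B = 2 ^ (n + 1)\<close>, each size condition becomes an inequality between exponents. Here
  \<open>y\<close> is an exponent for \<open>Y\<close>, \<open>e1\<close> one for \<open>N\<close>,
  \<open>M\<close> and the input length, and \<open>cw * (e1 + 3)\<close> one for
  \<open>2 ^ w'\<close>; \<open>u\<close> exceeds all of them and \<open>h\<close> exceeds
  \<open>u\<close> times every degree. Three more units in the word size make room for the banks and
  the buffer: \<open>8 * H \<le> 2 ^ w\<close>.\<close>

lemma reduction_runs:
  fixes Qp :: "'s dyn_problem"
  assumes kcnf: "kcnf k n F" and D: "0 < D" and g: "1 \<le> g" "g * (n div D) \<le> n"
    and q: "q = length F" and m: "m = input_fun (enc_cnf n F)" and Y: "Y = n + q + \<kappa> + 2"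
    and vars: "vars_below 19 eN" "vars_below 19 eM" "vars_below_gen 19 gi" "vars_below_gen 19 gr"
    and loops: "loop_vars eN \<union> loop_vars eM \<union> loop_vars_gen gi \<subseteq> {0, 1, 2, 3, 9} \<union> {11..18}"
      "loop_vars_gen gr \<subseteq> {0, 1, 2, 9} \<union> {11..18}"
    and evs: "\<And>s. std_env n q (n div D) g \<kappa> s \<Longrightarrow> ev m s eN = N \<and> (s 7 = N \<longrightarrow> ev m s eM = M) \<and>
           (s 7 = N \<and> s 8 = M \<longrightarrow> gl m s gi = xs \<and>
             (s 5 < 2 ^ (n - g * (n div D)) \<longrightarrow> gl m s gr = concat (map record_words (rs (s 5)))))"
    and rs: "\<And>b. b < 2 ^ (n - g * (n div D)) \<Longrightarrow> (\<forall>(rq, e) \<in> set (rs b). short rq) \<and> length (rs b) \<le> Y ^ a"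
    and sat: "satisfiable F \<longleftrightarrow> (\<exists>b<2 ^ (n - g * (n div D)). hits Qp (ss b) (rs b))"
    and size: "N \<le> 2 ^ (n div D) * Y ^ a" "M \<le> 2 ^ n * Y ^ a" "length xs \<le> 2 ^ n * Y ^ a"
    and r: "3 \<le> r" "below_regs r P0" "below_regs r P"
    and w': "w' = word_size cw N M"
    and ex: "exec w' P0 (boot w' xs) t0 (\<sigma>s 0)"
    and serves: "\<And>b. b < 2 ^ (n - g * (n div D)) \<Longrightarrow> serves_to w' P Qp (\<sigma>s b) (ss b) (map fst (rs b)) (tf b) (\<sigma>e b)"
    and wc: "\<And>b. wc \<Longrightarrow> \<sigma>s b = \<sigma>s (0::nat)" and am: "\<And>b. \<not> wc \<Longrightarrow> \<sigma>s (Suc b) = \<sigma>e b"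
    and y: "y = 2 * k + \<kappa> + 4" and e1: "e1 = 1 + y * a"
    and u: "y + k + e1 + cw * (e1 + 3) + 8 \<le> u" and hu: "h \<le> 2 ^ (u - 1)"
    and h: "u + r + 4 \<le> h" "u * degree_gen gr < h" "u * degree_gen (mod_gen gi) < h"
      "\<And>e. e \<in> {Bin BDiv (Vr 0) (Cn D), Bin BMul (Vr 2) (Cn g), Bin BAdd (Vr 0) (Cn 1),
       Bin BAdd (Vr 1) (Cn \<kappa>), eN, eM, Bin BMul (Cn cw) log_ex, Bin BDiv (Vr 10) (Vr 4), Inp (Cn 1), Vr 19} \<Longrightarrow> u * degree_ex e < h"
    and XI: "XI = 2 ^ (n div D) * Y * (h + 1)"
  shows "runs ((h + 3) * (n + 1)) (solver wc D g h \<kappa> cw eN eM gi gr r P0 P) (boot ((h + 3) * (n + 1)) (enc_cnf n F))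
    (80 + time_ex XI eN + time_ex XI eM + time_ex XI log_ex + time_gen XI (mod_gen gi) + 30 * t0 +
     (\<Sum>b<2 ^ (n - g * (n div D)). time_gen Y gr + 30 * sum_list (tf b) + 62 * length (rs b) + 20 + 1))
    (\<lambda>\<sigma>. result \<sigma> = of_bool (satisfiable F))"
proof -
  let ?L = "n div D"
  define B :: nat where "B = 2 ^ (n + 1)"
  define V where "V = B ^ u"
  define H where "H = B ^ h"
  let ?w = "(h + 3) * (n + 1)"
  let ?E = "(the_env n q D g h \<kappa> N)(8 := M, 19 := 2 ^ w')"
  interpret cnf_memory k n F m by unfold_locales (use kcnf m in auto)
  have B2: "2 \<le> B" by (simp add: B_def)
  have mono: "B ^ i \<le> B ^ j" if "i \<le> j" for i j using that B2 by (simp add: power_increasing)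
  have VI: "x \<le> V" if "x \<le> B ^ i" "i \<le> u" for x i using that mono[of i u] by (simp add: V_def)
  have HH: "H = 2 ^ ((n + 1) * h)" by (simp only: H_def B_def power_mult)
  have w8: "8 * H \<le> 2 ^ ?w"
  proof -
    have "(2::nat) ^ ?w = B ^ (h + 3)" unfolding B_def power_mult[symmetric] by (simp only: mult.commute)
    then have "(2::nat) ^ ?w = B ^ 3 * H" by (simp add: H_def power_add)
    moreover have "2 ^ 3 \<le> B ^ 3" using B2 by (rule power_mono) simp
    ultimately show ?thesis by simp
  qed
  have Hpos: "0 < H" using B2 by (simp add: H_def)
  have nB: "n + 1 \<le> B" "2 ^ n \<le> B" using less_exp[of "n + 1"] by (simp_all add: B_def)
  have "(2 * n + 1) \<le> B ^ 2"
  proof -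
    have "2 * n + 1 \<le> 2 * (n + 1)" by simp
    also have "\<dots> \<le> B * B" using nB(1) B2 by (intro mult_le_mono) auto
    finally show ?thesis by (simp add: power2_eq_square)
  qed
  then have "q \<le> (B ^ 2) ^ k" using kcnf_length_le[OF kcnf] power_mono[of "2 * n + 1" "B ^ 2" k] q by simp
  then have qB: "q \<le> B ^ (2 * k)" by (simp add: power_mult)
  have kB: "\<kappa> + 2 \<le> B ^ (\<kappa> + 2)" using B2 by (rule le_pow_self)
  have YB: "Y \<le> B ^ y"
  proof -
    have "q + (\<kappa> + 2) \<le> B ^ (max (2 * k) (\<kappa> + 2) + 1)" by (rule pow_add_le[OF B2 qB kB])
    also have "\<dots> \<le> B ^ (2 * k + \<kappa> + 3)" by (rule mono) simp
    finally have "q + (\<kappa> + 2) \<le> B ^ (2 * k + \<kappa> + 3)" .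
    from pow_add_le[OF B2 _ this, of n 1] nB have "n + (q + (\<kappa> + 2)) \<le> B ^ (max 1 (2 * k + \<kappa> + 3) + 1)" by simp
    also have "\<dots> \<le> B ^ y" by (rule mono) (simp add: y)
    finally show ?thesis by (simp add: Y)
  qed
  have YaB: "Y ^ a \<le> B ^ (y * a)" using power_mono[OF YB, of a] by (simp add: power_mult)
  have LN: "?L \<le> n" "(2::nat) ^ ?L \<le> 2 ^ n" by simp_all
  have pn: "2 ^ n * Y ^ a \<le> B ^ e1" unfolding e1 using mult_le_mono[OF nB(2) YaB] by simp
  have NB: "N \<le> B ^ e1" using size(1) mult_le_mono1[OF LN(2), of "Y ^ a"] pn by linarith
  have MB: "M \<le> B ^ e1" and xB: "length xs \<le> B ^ e1" using size(2,3) pn by linarith+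
  have N1: "N + 1 \<le> B ^ (e1 + 1)" using pow_add_le[OF B2 NB, of 1 0] by simp
  have NMB: "N + M + 1 \<le> B ^ (e1 + 2)" using pow_add_le[OF B2 N1 MB] by simp
  have fl: "floorlog 2 (N + M + 1) \<le> (n + 1) * (e1 + 3)"
  proof -
    have "B ^ (e1 + 2) < B ^ (e1 + 3)" by (rule power_strict_increasing) (use B2 in auto)
    also have "B ^ (e1 + 3) = 2 ^ ((n + 1) * (e1 + 3))" by (simp only: B_def power_mult)
    finally have "N + M + 1 < 2 ^ ((n + 1) * (e1 + 3))" using NMB by linarith
    then show ?thesis using floorlog_le_iff[of 2 "N + M + 1"] by simp
  qed
  have w'B: "2 ^ w' \<le> B ^ (cw * (e1 + 3))"
  proof -
    have "w' \<le> (n + 1) * (cw * (e1 + 3))" using mult_le_mono2[OF fl, of cw] by (simp add: w' word_size_def mult_ac)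
    then have "(2::nat) ^ w' \<le> 2 ^ ((n + 1) * (cw * (e1 + 3)))" by (rule power_increasing) simp
    then show ?thesis by (simp only: B_def power_mult)
  qed
  have lenB: "length (enc_cnf n F) \<le> B ^ (y + k + 1)"
  proof -
    have "length (enc_cnf n F) \<le> Y * (k + 1)" using length_enc_le by (simp add: Y q algebra_simps)
    also have "\<dots> \<le> B ^ y * B ^ (k + 1)" by (rule mult_le_mono[OF YB le_pow_self[OF B2]])
    finally show ?thesis by (simp add: power_add mult_ac)
  qed
  have mB: "m x \<le> B ^ (y + k + 2)" for x
  proof -
    have "m x \<le> Y * (k + 2)" using m_le[of x] by (simp add: Y q algebra_simps)
    also have "\<dots> \<le> B ^ y * B ^ (k + 2)" by (rule mult_le_mono[OF YB le_pow_self[OF B2]])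
    finally show ?thesis by (simp add: power_add mult_ac)
  qed
  have VH: "V ^ d < H" if "u * d < h" for d
    using that B2 by (simp add: V_def H_def power_mult[symmetric] power_strict_increasing)
  have VH8: "8 * V \<le> H"
  proof -
    have "2 ^ 3 * V \<le> B ^ 3 * B ^ u" unfolding V_def using B2 by (intro mult_le_mono power_mono) auto
    also have "\<dots> = B ^ (u + 3)" by (simp add: power_add)
    also have "\<dots> \<le> H" unfolding H_def by (rule mono) (use h(1) in simp)
    finally show ?thesis by simp
  qed
  have rV: "r + V \<le> H"
  proof -
    have "r + V \<le> B ^ (max r u + 1)" unfolding V_def by (rule pow_add_le[OF B2 le_pow_self[OF B2]]) simp
    also have "\<dots> \<le> H" unfolding H_def by (rule mono) (use h(1) in simp)
    finally show ?thesis .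
  qed
  \<comment> \<open>The number \<open>(n + 1) * h\<close> is itself the value of a variable and must
    not exceed \<open>V\<close>. This forces \<open>h\<close> to be at most exponential in
    \<open>u\<close>.\<close>
  have hV: "(n + 1) * h \<le> V"
  proof -
    have "h \<le> B ^ (u - 1)" using hu power_mono[OF B2, of "u - 1"] by linarith
    then have "(n + 1) * h \<le> B * B ^ (u - 1)" using nB by (intro mult_le_mono) auto
    also have "\<dots> = V" using u by (cases u) (simp_all add: V_def)
    finally show ?thesis .
  qed
  have V1: "1 \<le> V" "2 \<le> V" using VI[of 1 0] VI[of 2 1] B2 u by simp_all
  have VY: "Y \<le> V" by (rule VI[OF YB]) (use u in simp)
  have Vn: "2 ^ n \<le> V" by (rule VI[of _ 1]) (use nB u in simp_all)
  have nV: "n \<le> V" using VY Y by linarith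
  have VN: "N \<le> V" "M \<le> V" "length xs \<le> V" "2 ^ w' \<le> V" "Y ^ a \<le> V"
    by (rule VI[OF NB] VI[OF MB] VI[OF xB] VI[OF w'B] VI[OF YaB]; use e1 u in simp)+
  have LV: "?L \<le> V" using LN(1) nV by (rule le_trans)
  have env_le: "?E v \<le> V" for v
    using VN Vn hV nV VY LV order_trans[OF LN(2) Vn] order_trans[OF power_increasing[OF g(2), of 2] Vn]
      order_trans[OF power_increasing[of "n - g * ?L" n 2] Vn]
    by (auto simp: the_env_def Y)
  have std0: "std_env n q ?L g \<kappa> (the_env n q D g h \<kappa> 0)" and stdN: "std_env n q ?L g \<kappa> (the_env n q D g h \<kappa> N)"
    and stdE: "std_env n q ?L g \<kappa> ?E" and stdb: "std_env n q ?L g \<kappa> (?E(5 := b))" for b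
    by (simp_all add: std_env_def the_env_def)
  have E7: "the_env n q D g h \<kappa> N 7 = N" by (simp add: the_env_def)
  have ev_std: "ev m (the_env n q D g h \<kappa> 0) eN = N" "ev m (the_env n q D g h \<kappa> N) eM = M" "gl m ?E gi = xs"
    using evs[OF std0] evs[OF stdN] evs[OF stdE] E7 by simp_all
  \<comment> \<open>\<open>XI\<close> covers the loop bounds of the instance generation. Among them
    only variable 3 is exponential, with value \<open>2 ^ L\<close>.\<close>
  have XI': "the_env n q D g h \<kappa> 0 v \<le> XI \<and> v \<notin> {7, 8, 19}" if "v \<in> {0, 1, 2, 3, 9} \<union> {11..18}" for v
  proof -
    have p1: "2 ^ ?L \<le> XI"
    proof -
      have "2 ^ ?L * 1 \<le> 2 ^ ?L * (Y * (h + 1))" by (intro mult_le_mono) (simp_all add: Y)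
      then show ?thesis by (simp only: XI mult.assoc mult_1_right)
    qed
    have p2: "x \<le> XI" if "x \<le> Y" for x
    proof -
      have "1 * (x * 1) \<le> 2 ^ ?L * (Y * (h + 1))" using that by (intro mult_le_mono) simp_all
      then show ?thesis by (simp only: XI mult.assoc mult_1_right mult_1)
    qed
    have "?L \<le> Y" "n \<le> Y" "q \<le> Y" "q + \<kappa> \<le> Y" using LN(1) unfolding Y by linarith+
    then show ?thesis using that p1 by (auto simp: the_env_def intro!: p2)
  qed
  have "solver_setup ?w w' r H m V wc gr P Qp n q D g h \<kappa> N M Y rs ss \<sigma>s \<sigma>e tf cw XI eN eM gi P0 t0 (enc_cnf n F)"
  proof unfold_locales
    show "r + 2 ^ w' \<le> H" using rV VN by linarith
    show "4 * H \<le> 2 ^ ?w" using w8 by linarith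
    show "m a \<le> V" for a by (rule VI[OF mB]) (use u in simp)
    show "scan m c \<le> V + c" for c using scan_le[of c] VI[OF lenB] u by simp
    show "V < H" using VH8 V1 by linarith
    show "4 * H + 5 * length (rs b) < 2 ^ ?w" if "b < 2 ^ (n - g * ?L)" for b
      using rs[OF that] VN(5) VH8 w8 Hpos V1 by linarith
    show "N + M + 1 < H" using VI[OF NMB] u VH8 V1 by simp
    show "r + length (gl m ?E gi) \<le> H" using rV VN(3) ev_std by simp
    show "length (enc_cnf n F) \<le> V" by (rule VI[OF lenB]) (use u in simp)
    show "gl m (?E(5 := b)) gr = concat (map record_words (rs b))" if "b < 2 ^ (n - g * ?L)" for b
      using evs[OF stdb[of b]] that E7 by simp
    show "v \<noteq> 5 \<and> ?E v \<le> Y" if "v \<in> loop_vars_gen gr" for v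
    proof -
      have "?L \<le> Suc (Suc (n + q + \<kappa>))" using LN(1) by linarith
      then show ?thesis using loops(2) that by (auto simp: the_env_def Y)
    qed
    show "v \<notin> {7, 8, 19} \<and> the_env n q D g h \<kappa> 0 v \<le> XI" if "v \<in> loop_vars eN \<union> loop_vars eM \<union> loop_vars_gen gi" for v
      using XI'[of v] loops(1) that by blast
    show "(n + 1) * h \<le> XI"
    proof -
      have "(n + 1) * h \<le> Y * (h + 1)" by (rule mult_le_mono) (simp_all add: Y)
      then show ?thesis unfolding XI by (simp only: mult.assoc) (metis le_trans mult_le_mono1 nat_mult_1 one_le_numeral one_le_power)
    qed
    show "V ^ degree_ex e < H" if "e \<in> {Bin BDiv (Vr 0) (Cn D), Bin BMul (Vr 2) (Cn g), Bin BAdd (Vr 0) (Cn 1),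
       Bin BAdd (Vr 1) (Cn \<kappa>), eN, eM, Bin BMul (Cn cw) log_ex, Bin BDiv (Vr 10) (Vr 4), Inp (Cn 1), Vr 19}" for e
      by (rule VH, rule h(4)[OF that])
    show "w' = cw * floorlog 2 (N + M + 1)" by (simp add: w' word_size_def)
    show "?E 10 = 2 ^ (n - g * ?L)" by (simp add: the_env_def)
    show "exec w' P0 (boot w' (gl m ?E gi)) t0 (\<sigma>s 0)" using ex ev_std by simp
    show "m = (\<lambda>i. if i < length (enc_cnf n F) then enc_cnf n F ! i else 0)" by (simp add: m input_fun_def)
    show "enc_cnf n F ! 0 = n" "enc_cnf n F ! 1 = q" "2 \<le> length (enc_cnf n F)" by (simp_all add: enc_cnf_eq q)
    show "H = 2 ^ ((n + 1) * h)" by (rule HH)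
    show "\<And>b. b < 2 ^ (n - g * ?L) \<Longrightarrow> \<forall>(rq, e)\<in>set (rs b). short rq" using rs by blast
    show "2 \<le> V" by (rule V1)
    show "vars_below_gen 20 gr" by (rule vars_below_gen_mono[OF vars(4)]) simp
    show "V ^ degree_gen gr < H" by (rule VH[OF h(2)])
    show "V ^ degree_gen (mod_gen gi) < H" by (rule VH[OF h(3)])
    show "below_regs r P" "below_regs r P0" "3 \<le> r" by (rule r)+
    show "?E v \<le> V" for v by (rule env_le)
    show "serves_to w' P Qp (\<sigma>s b) (ss b) (map fst (rs b)) (tf b) (\<sigma>e b)" if "b < 2 ^ (n - g * ?L)" for b
      by (rule serves[OF that])
    show "\<sigma>s b = \<sigma>s 0" if wc for b by (rule wc[OF that])
    show "\<sigma>s (Suc b) = \<sigma>e b" if "\<not> wc" for b by (rule am[OF that])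
    show "0 < D" "g * ?L \<le> n" by (rule D, rule g)
    show "2 ^ n \<le> V" by (rule Vn)
    show "vars_below 20 eN" by (rule vars_below_mono[OF vars(1)]) simp
    show "vars_below 20 eM" by (rule vars_below_mono[OF vars(2)]) simp
    show "ev m (the_env n q D g h \<kappa> 0) eN = N" "ev m (the_env n q D g h \<kappa> N) eM = M" by (rule ev_std)+
    show "vars_below_gen 19 gi" by (rule vars)
  qed (rule refl)
  from solver_setup.solver_runs[OF this] show ?thesis unfolding sat .
qed


text \<open>The time bound may fail for small \<open>n\<close>, but for fixed \<open>k\<close> only
  finitely many formulas have fewer than \<open>nmin\<close> variables. The sum of their running
  times is absorbed by the constant.\<close>

lemma ksat_solvableI:
  assumes "\<And>n F. kcnf k n F \<Longrightarrow> \<exists>t \<sigma>. exec (c * (n + 1)) P (boot (c * (n + 1)) (enc_cnf n F)) t \<sigma> \<and>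
      result \<sigma> = of_bool (satisfiable F) \<and>
      (nmin \<le> n \<longrightarrow> real t \<le> 2 powr ((1 - e) * real n) * (C * (real n + 1) ^ d))"
    and e: "e \<le> 1" and C: "0 \<le> C"
  shows "ksat_solvable k e"
proof -
  have "\<forall>x. \<exists>t. kcnf k (fst x) (snd x) \<longrightarrow> (\<exists>\<sigma>. exec (c * (fst x + 1)) P (boot (c * (fst x + 1)) (enc_cnf (fst x) (snd x))) t \<sigma> \<and>
      result \<sigma> = of_bool (satisfiable (snd x)) \<and>
      (nmin \<le> fst x \<longrightarrow> real t \<le> 2 powr ((1 - e) * real (fst x)) * (C * (real (fst x) + 1) ^ d)))"
    using assms(1) by blast
  from choice[OF this] obtain T where T0: "\<forall>x. kcnf k (fst x) (snd x) \<longrightarrow> (\<exists>\<sigma>. exec (c * (fst x + 1)) P (boot (c * (fst x + 1)) (enc_cnf (fst x) (snd x))) (T x) \<sigma> \<and>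
      result \<sigma> = of_bool (satisfiable (snd x)) \<and>
      (nmin \<le> fst x \<longrightarrow> real (T x) \<le> 2 powr ((1 - e) * real (fst x)) * (C * (real (fst x) + 1) ^ d)))" by blast
  have T: "\<And>n F. kcnf k n F \<Longrightarrow> \<exists>\<sigma>. exec (c * (n + 1)) P (boot (c * (n + 1)) (enc_cnf n F)) (T (n, F)) \<sigma> \<and>
      result \<sigma> = of_bool (satisfiable F) \<and>
      (nmin \<le> n \<longrightarrow> real (T (n, F)) \<le> 2 powr ((1 - e) * real n) * (C * (real n + 1) ^ d))"
    using spec[OF T0, of "(n, F)" for n F] by simp
  let ?S = "SIGMA n:{..<nmin}. {F. kcnf k n F}"
  define C1 where "C1 = (\<Sum>x\<in>?S. T x)"
  have fin: "finite ?S" using finite_kcnf by (intro finite_SigmaI) auto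
  have small: "T (n, F) \<le> C1" if "n < nmin" "kcnf k n F" for n F
    unfolding C1_def by (rule member_le_sum) (use that fin in auto)
  have "real (T (n, F)) \<le> 2 powr ((1 - e) * real n) * ((C + real C1) * (real n + 1) ^ d)" if F: "kcnf k n F" for n F
  proof -
    have p: "1 \<le> 2 powr ((1 - e) * real n)" using e by (intro ge_one_powr_ge_zero) auto
    have q: "1 \<le> (real n + 1) ^ d" by simp
    show ?thesis
    proof (cases "nmin \<le> n")
      case True
      then have "real (T (n, F)) \<le> 2 powr ((1 - e) * real n) * (C * (real n + 1) ^ d)" using T[OF F] by blast
      also have "\<dots> \<le> 2 powr ((1 - e) * real n) * ((C + real C1) * (real n + 1) ^ d)"
        by (intro mult_left_mono mult_right_mono) auto
      finally show ?thesis .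
    next
      case False
      then have "real (T (n, F)) \<le> real C1" using small F by simp
      also have "\<dots> \<le> 1 * ((C + real C1) * 1)" using C by simp
      also have "\<dots> \<le> 2 powr ((1 - e) * real n) * ((C + real C1) * (real n + 1) ^ d)"
        using p q C by (intro mult_mono) auto
      finally show ?thesis .
    qed
  qed
  then show ?thesis unfolding ksat_solvable_def
    by (intro exI[of _ P] exI[of _ c] exI[of _ "C + real C1"] exI[of _ d]) (use T in blast)
qed

text \<open>Resolves a circular demand: \<open>h\<close> has to exceed \<open>u\<close> times all
  degrees, while \<open>(n + 1) * h \<le> B ^ u\<close> requires \<open>h \<le> 2 ^ (u - 1)\<close>.
  The exponential wins for large \<open>u\<close>.\<close>

lemma ex_large_exponent: "\<exists>u\<ge>u0. u * c + c' \<le> 2 ^ (u - 1)" for c c' :: nat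
proof -
  define v where "v = u0 + c + c' + 3"
  have 1: "2 * v + 1 \<le> 2 ^ v"
  proof -
    have "2 * x + 1 \<le> 2 ^ x" if "3 \<le> x" for x :: nat using that by (induction x rule: dec_induct) auto
    moreover have "3 \<le> v" by (simp add: v_def)
    ultimately show ?thesis by blast
  qed
  have "c + c' \<le> v" by (simp add: v_def)
  then have 2: "c + c' \<le> 2 ^ v" using less_exp[of v] by linarith
  have "(2 * v + 1) * c + c' \<le> (2 * v + 1) * (c + c')" by (simp add: distrib_left)
  also have "\<dots> \<le> 2 ^ v * 2 ^ v" by (rule mult_le_mono[OF 1 2])
  also have "\<dots> = 2 ^ (2 * v + 1 - 1)" by (simp add: mult_2 power_add)
  finally show ?thesis by (intro exI[of _ "2 * v + 1"]) (simp add: v_def)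
qed

text \<open>Two estimates carry the proof: \<open>half\<close> for generation and preprocessing,
  \<open>nb\<close> for the phases. The constant 252 is 80 + 4 + 2 * 84 with 84 = 1 + 62 + 21, and
  90 is 30 * 3.\<close>

lemma total_time_bound:
  fixes n D g L z t a E h Y :: nat and \<epsilon> e C N lenB fN T :: real
  assumes D: "2 * (z + t + 1) * g \<le> D" and g: "1 \<le> g" and L: "L = n div D" and \<epsilon>: "0 < \<epsilon>" "\<epsilon> \<le> 1"
    and e: "e = \<epsilon> / D" and E: "E = z + a * t + a + a * g" and Y1: "1 \<le> Y"
    and N: "0 \<le> N" "N \<le> 2 ^ L * real Y ^ a" and fN: "0 \<le> fN" "fN \<le> (2 ^ L * real Y ^ a) powr (real g - \<epsilon>)"
    and lenB: "0 \<le> lenB" "lenB \<le> 2 ^ (n - g * L) * real Y ^ a" and C: "0 \<le> C"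
    and T: "T \<le> 80 + 4 * (2 ^ L * real Y * (real h + 1)) ^ z + 30 * (C * N ^ t + lenB * (C * fN)) +
       2 ^ (n - g * L) * (real Y ^ z + 62 * real Y ^ a + 21)"
  shows "T \<le> 2 powr ((1 - e) * real n) * ((252 + 90 * C) * (real Y * (real h + 1)) ^ E)"
proof -
  define W where "W = 2 powr ((1 - e) * real n)"
  define Z where "Z = real Y * (real h + 1)"
  have D2: "2 \<le> D" using D g by (cases g) auto
  have YZ: "real Y \<le> Z" "1 \<le> real Y" "1 \<le> Z" "real h + 1 \<le> Z"
  proof -
    show "1 \<le> real Y" using Y1 by simp
    then have "real Y * 1 \<le> real Y * (real h + 1)" "1 * (real h + 1) \<le> real Y * (real h + 1)" by (intro mult_mono; simp)+
    then show "real Y \<le> Z" "real h + 1 \<le> Z" by (simp_all add: Z_def)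
    then show "1 \<le> Z" using \<open>1 \<le> real Y\<close> by linarith
  qed
  have YE: "real Y ^ j \<le> Z ^ E" "Z ^ j \<le> Z ^ E" if "j \<le> E" for j
  proof -
    show "Z ^ j \<le> Z ^ E" using that YZ by (intro power_increasing) auto
    moreover have "real Y ^ j \<le> Z ^ j" using YZ by (intro power_mono) auto
    ultimately show "real Y ^ j \<le> Z ^ E" by linarith
  qed
  have ZE1: "1 \<le> Z ^ E" using YZ by simp
  have e2: "e \<le> 1 / 2"
  proof -
    have "\<epsilon> / D \<le> 1 / 2" using \<epsilon> D2 by (intro frac_le) auto
    then show ?thesis by (simp add: e)
  qed
  have LD: "L * D \<le> n" by (simp add: L)
  \<comment> \<open>As \<open>2 * j \<le> D\<close>, such a power is at most 2^(n/2), and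
    \<open>e \<le> 1 / 2\<close> makes this at most \<open>W\<close>.\<close>
  have half: "(2::real) ^ (L * j) \<le> W" if "j \<le> z + t" for j
  proof -
    have "2 * (L * j) \<le> L * D"
    proof -
      have "2 * j * 1 \<le> 2 * (z + t + 1) * g" using that g by (intro mult_le_mono) auto
      then have "2 * j \<le> D" using D by linarith
      then have "L * (2 * j) \<le> L * D" by (rule mult_le_mono2)
      then show ?thesis by (simp add: mult_ac)
    qed
    then have "2 * (L * j) \<le> n" using LD by linarith
    then have "real (2 * (L * j)) \<le> real n" by (rule of_nat_mono)
    then have "real (L * j) \<le> 1 / 2 * real n" by simp
    also have "\<dots> \<le> (1 - e) * real n" using e2 by (intro mult_right_mono) auto
    finally have "2 powr real (L * j) \<le> W" unfolding W_def by (rule powr_mono) simp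
    then show ?thesis using powr_realpow[of 2 "L * j"] by simp
  qed
  have gL: "g * L \<le> n"
  proof -
    have "g * 1 \<le> 2 * (z + t + 1) * g" by simp
    then have "g \<le> D" using D by linarith
    then have "L * g \<le> L * D" by (rule mult_le_mono2)
    then have "L * g \<le> n" using LD by (rule le_trans)
    then show ?thesis by (simp add: mult.commute)
  qed
  \<comment> \<open>The product is 2^(n - \<epsilon> L). Rounding in \<open>L = n div D\<close>
    loses less than 1 against n / D, which costs a factor of at most 2^\<epsilon> \<le> 2.\<close>
  have nb: "2 ^ (n - g * L) * (2 ^ L) powr (real g - \<epsilon>) \<le> 2 * W"
  proof -
    have "real n < D * (real L + 1)"
    proof -
      have "n < D * (L + 1)" unfolding L using dividend_less_times_div[of D n] D2 by (simp add: algebra_simps)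
      then have "real n < real (D * (L + 1))" by (rule of_nat_less_iff[THEN iffD2])
      then show ?thesis by (simp add: algebra_simps)
    qed
    then have "\<epsilon> * (real n / D) \<le> \<epsilon> * (real L + 1)" using \<epsilon> D2 by (intro mult_left_mono) (simp_all add: field_simps)
    then have x: "real n - \<epsilon> * real L \<le> (1 - e) * real n + 1" using \<epsilon>(2) by (simp add: e algebra_simps)
    have "(2::real) ^ (n - g * L) = 2 powr (real n - real g * real L)" using gL by (simp add: powr_realpow[symmetric] of_nat_diff)
    moreover have "(2 ^ L) powr (real g - \<epsilon>) = 2 powr (real L * (real g - \<epsilon>))" by (simp add: powr_realpow[symmetric] powr_powr)
    ultimately have "2 ^ (n - g * L) * (2 ^ L) powr (real g - \<epsilon>) = 2 powr (real n - \<epsilon> * real L)"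
      by (simp add: powr_add[symmetric] algebra_simps)
    also have "\<dots> \<le> 2 powr ((1 - e) * real n + 1)" using x by (rule powr_mono) simp
    also have "\<dots> = 2 * W" by (simp add: W_def powr_add)
    finally show ?thesis .
  qed
  have p1: "1 \<le> (2 ^ L) powr (real g - \<epsilon>)" using g \<epsilon> by (intro ge_one_powr_ge_zero) auto
  have nb1: "(2::real) ^ (n - g * L) \<le> 2 * W"
  proof -
    have "(2::real) ^ (n - g * L) * 1 \<le> 2 ^ (n - g * L) * (2 ^ L) powr (real g - \<epsilon>)"
      using p1 by (intro mult_left_mono) auto
    then show ?thesis using nb by linarith
  qed
  have W0: "0 \<le> W" by (simp add: W_def)
  have W1: "1 \<le> W" using half[of 0] by simp
  have WZ: "1 \<le> W * Z ^ E" using mult_mono[OF W1 ZE1] W0 by simp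
  have A1: "(2 ^ L * real Y * (real h + 1)) ^ z \<le> W * Z ^ E"
  proof -
    have "(2 ^ L * real Y * (real h + 1)) ^ z = 2 ^ (L * z) * Z ^ z" by (simp add: Z_def power_mult_distrib power_mult mult.assoc)
    also have "\<dots> \<le> W * Z ^ E" using half[of z] YE(2)[of z] W0 YZ by (intro mult_mono) (auto simp: E)
    finally show ?thesis .
  qed
  have A2: "N ^ t \<le> W * Z ^ E"
  proof -
    have "N ^ t \<le> (2 ^ L * real Y ^ a) ^ t" using N by (intro power_mono) auto
    also have "\<dots> = 2 ^ (L * t) * real Y ^ (a * t)" by (simp add: power_mult_distrib power_mult)
    also have "\<dots> \<le> W * Z ^ E" using half[of t] YE(1)[of "a * t"] W0 YZ by (intro mult_mono) (auto simp: E)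
    finally show ?thesis .
  qed
  have A3: "lenB * fN \<le> 2 * (W * Z ^ E)"
  proof -
    have "fN \<le> (2 ^ L) powr (real g - \<epsilon>) * (real Y ^ a) powr (real g - \<epsilon>)" using fN(2) by (simp add: powr_mult)
    also have "(real Y ^ a) powr (real g - \<epsilon>) \<le> (real Y ^ a) powr real g" using YZ \<epsilon> by (intro powr_mono) auto
    also have "(real Y ^ a) powr real g = real Y ^ (a * g)" using YZ by (subst powr_realpow) (auto simp: power_mult)
    finally have f: "fN \<le> (2 ^ L) powr (real g - \<epsilon>) * real Y ^ (a * g)" by (simp add: mult_left_mono)
    have "lenB * fN \<le> (2 ^ (n - g * L) * real Y ^ a) * ((2 ^ L) powr (real g - \<epsilon>) * real Y ^ (a * g))"
      using lenB fN(1) f by (intro mult_mono) auto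
    also have "\<dots> = (2 ^ (n - g * L) * (2 ^ L) powr (real g - \<epsilon>)) * real Y ^ (a + a * g)" by (simp add: power_add)
    also have "\<dots> \<le> (2 * W) * Z ^ E" by (rule mult_mono[OF nb YE(1)]) (use W0 YZ in \<open>auto simp: E\<close>)
    finally show ?thesis by simp
  qed
  have A4: "2 ^ (n - g * L) * (real Y ^ z + 62 * real Y ^ a + 21) \<le> (2 * W) * (84 * Z ^ E)"
  proof (rule mult_mono[OF nb1])
    show "real Y ^ z + 62 * real Y ^ a + 21 \<le> 84 * Z ^ E"
      using YE(1)[of z] YE(1)[of a] ZE1 by (simp add: E)
  qed (use W0 in auto)
  have A5: "C * N ^ t + lenB * (C * fN) \<le> 3 * (C * (W * Z ^ E))"
    using mult_left_mono[OF A2 C] mult_left_mono[OF A3 C] by (simp add: algebra_simps)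
  have A0: "80 \<le> 80 * (W * Z ^ E)" using WZ by simp
  note T
  also have "80 + 4 * (2 ^ L * real Y * (real h + 1)) ^ z + 30 * (C * N ^ t + lenB * (C * fN)) +
       2 ^ (n - g * L) * (real Y ^ z + 62 * real Y ^ a + 21) \<le> 80 * (W * Z ^ E) + 4 * (W * Z ^ E) + 30 * (3 * (C * (W * Z ^ E))) + (2 * W) * (84 * Z ^ E)"
    using A0 A1 A4 A5 by (intro add_mono mult_left_mono) auto
  also have "\<dots> = W * ((252 + 90 * C) * Z ^ E)" by (simp add: algebra_simps)
  finally show ?thesis by (simp add: W_def Z_def)
qed

text \<open>The order of choices is essential. The generators determine \<open>z\<close>; then
  \<open>z\<close>, \<open>t\<close> and \<open>g\<close> determine \<open>D\<close> and the saving
  \<open>e\<close>. Only afterwards is \<open>k\<close> fixed, and with it \<open>\<kappa>\<close>,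
  \<open>a\<close> and the machine constants \<open>u\<close> and \<open>h\<close>.\<close>

theorem reduces_refutes_SETH:
  fixes Q :: "nat \<Rightarrow> nat \<Rightarrow> 's dyn_problem"
  assumes red: "reduces wc Mo Q g f \<epsilon>" and \<epsilon>: "0 < \<epsilon>" "\<epsilon> \<le> 1" and g: "1 \<le> g" and f0: "\<And>N M. 0 \<le> f N M"
    and solv: "if wc then solvable_worst_case Mo Q t f else solvable_amortized Mo Q t f"
  shows "\<not> SETH"
proof -
  from red[unfolded reduces_def] obtain eN eM gi gr where
    vars: "vars_below 19 eN" "vars_below 19 eM" "vars_below_gen 19 gi" "vars_below_gen 19 gr"
    and loops: "loop_vars eN \<union> loop_vars eM \<union> loop_vars_gen gi \<subseteq> {0, 1, 2, 3, 9} \<union> {11..18}"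
      "loop_vars_gen gr \<subseteq> {0, 1, 2, 9} \<union> {11..18}"
    and inst: "\<forall>k. \<exists>\<kappa> a. \<forall>n F L. kcnf k n F \<and> g * L \<le> n \<longrightarrow> reduction_instance wc Mo Q g f \<epsilon> eN eM gi gr \<kappa> a n F L"
    by (elim exE conjE) (rule that)
  obtain z1 where z1: "\<And>X. 2 \<le> X \<Longrightarrow> time_ex X eN \<le> X ^ z1" using time_ex_poly by blast
  obtain z2 where z2: "\<And>X. 2 \<le> X \<Longrightarrow> time_ex X eM \<le> X ^ z2" using time_ex_poly by blast
  obtain z3 where z3: "\<And>X. 2 \<le> X \<Longrightarrow> time_ex X log_ex \<le> X ^ z3" using time_ex_poly by blast
  obtain z4 where z4: "\<And>X. 2 \<le> X \<Longrightarrow> time_gen X (mod_gen gi) \<le> X ^ z4" using time_gen_poly by blast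
  obtain z5 where z5: "\<And>X. 2 \<le> X \<Longrightarrow> time_gen X gr \<le> X ^ z5" using time_gen_poly by blast
  define z where "z = z1 + z2 + z3 + z4 + z5"
  have pz: "X ^ i \<le> X ^ z" if "2 \<le> X" "i \<le> z" for X i :: nat using that by (intro power_increasing) auto
  have zz1: "time_ex X eN \<le> X ^ z" if "2 \<le> X" for X by (rule order_trans[OF z1[OF that] pz[OF that]]) (simp add: z_def)
  have zz2: "time_ex X eM \<le> X ^ z" if "2 \<le> X" for X by (rule order_trans[OF z2[OF that] pz[OF that]]) (simp add: z_def)
  have zz3: "time_ex X log_ex \<le> X ^ z" if "2 \<le> X" for X by (rule order_trans[OF z3[OF that] pz[OF that]]) (simp add: z_def)
  have zz4: "time_gen X (mod_gen gi) \<le> X ^ z" if "2 \<le> X" for X by (rule order_trans[OF z4[OF that] pz[OF that]]) (simp add: z_def)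
  have zz5: "time_gen X gr \<le> X ^ z" if "2 \<le> X" for X by (rule order_trans[OF z5[OF that] pz[OF that]]) (simp add: z_def)
  \<comment> \<open>Twice the sum of the exponents, so that generation and preprocessing stay below
    2^(n/2); the factor \<open>g\<close> ensures that all blocks fit, that is
    \<open>g * L \<le> n\<close>.\<close>
  define D where "D = 2 * (z + t + 1) * g"
  have D0: "0 < D" using g by (simp add: D_def)
  define e where "e = \<epsilon> / D"
  have e: "0 < e" "e \<le> 1"
  proof -
    show "0 < e" using \<epsilon> D0 by (simp add: e_def)
    have "1 \<le> real D" using D0 by simp
    then have "\<epsilon> \<le> real D" using \<epsilon>(2) by linarith
    then show "e \<le> 1" using D0 by (simp add: e_def)
  qed
  obtain P0 P cw C0 Nt where alg: "\<And>N M xs s rs. (xs, s) \<in> start (Q N M) \<Longrightarrow> valid_seq Mo (Q N M) s rs \<Longrightarrow>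
      \<exists>t0 \<sigma> ts. exec (word_size cw N M) P0 (boot (word_size cw N M) xs) t0 \<sigma> \<and>
         serves (word_size cw N M) P (Q N M) \<sigma> s rs ts \<and>
         (Nt \<le> N \<and> Nt \<le> M \<longrightarrow> real t0 \<le> C0 * real N ^ t \<and> (if wc then \<forall>\<tau> \<in> set ts. real \<tau> \<le> C0 * f N M
           else real (t0 + sum_list ts) \<le> C0 * real N ^ t + real (length rs) * (C0 * f N M)))"
  proof (cases wc)
    case True
    with solv have "solvable_worst_case Mo Q t f" by simp
    then obtain P0 P cw C0 Nt where "\<forall>n m xs s rs. (xs, s) \<in> start (Q n m) \<and> valid_seq Mo (Q n m) s rs \<longrightarrow>
       (\<exists>t\<^sub>0 \<sigma> ts. exec (word_size cw n m) P0 (boot (word_size cw n m) xs) t\<^sub>0 \<sigma> \<and>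
          serves (word_size cw n m) P (Q n m) \<sigma> s rs ts \<and>
          (n \<ge> Nt \<and> m \<ge> Nt \<longrightarrow> real t\<^sub>0 \<le> C0 * real n ^ t \<and> (\<forall>\<tau> \<in> set ts. real \<tau> \<le> C0 * f n m)))"
      unfolding solvable_worst_case_def by blast
    then show ?thesis using that[of cw P0 P Nt C0] True by simp
  next
    case False
    with solv have "solvable_amortized Mo Q t f" by simp
    then obtain P0 P cw C0 Nt where "\<forall>n m xs s rs. (xs, s) \<in> start (Q n m) \<and> valid_seq Mo (Q n m) s rs \<longrightarrow>
       (\<exists>t\<^sub>0 \<sigma> ts. exec (word_size cw n m) P0 (boot (word_size cw n m) xs) t\<^sub>0 \<sigma> \<and>
          serves (word_size cw n m) P (Q n m) \<sigma> s rs ts \<and>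
          (n \<ge> Nt \<and> m \<ge> Nt \<longrightarrow> real t\<^sub>0 \<le> C0 * real n ^ t \<and>
             real (t\<^sub>0 + sum_list ts) \<le> C0 * real n ^ t + real (length rs) * (C0 * f n m)))"
      unfolding solvable_amortized_def by blast
    then show ?thesis using that[of cw P0 P Nt C0] False by simp
  qed
  \<comment> \<open>The assumed constant may be negative; the absolute value keeps later estimates
    monotone.\<close>
  define C where "C = \<bar>C0\<bar>"
  have C0: "0 \<le> C" by (simp add: C_def)
  obtain r0 r1 where "below_regs r0 P0" "below_regs r1 P" using ex_below_regs by blast
  then obtain r where r: "3 \<le> r" "below_regs r P0" "below_regs r P"
    using below_regs_mono[of r0 P0 "r0 + r1 + 3"] below_regs_mono[of r1 P "r0 + r1 + 3"] by (meson le_add1 le_add2 order_trans)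
  have "ksat_solvable k e" for k
  proof -
    from inst obtain \<kappa> a where inst: "\<And>n F L. kcnf k n F \<Longrightarrow> g * L \<le> n \<Longrightarrow>
        reduction_instance wc Mo Q g f \<epsilon> eN eM gi gr \<kappa> a n F L" by blast
    let ?es = "{Bin BDiv (Vr 0) (Cn D), Bin BMul (Vr 2) (Cn g), Bin BAdd (Vr 0) (Cn 1),
       Bin BAdd (Vr 1) (Cn \<kappa>), eN, eM, Bin BMul (Cn cw) log_ex, Bin BDiv (Vr 10) (Vr 4), Inp (Cn 1), Vr 19}"
    define dg where "dg = degree_gen gr + degree_gen (mod_gen gi) + (\<Sum>e\<in>?es. degree_ex e)"
    define y where "y = 2 * k + \<kappa> + 4"
    define e1 where "e1 = 1 + y * a"
    obtain u where u: "y + k + e1 + cw * (e1 + 3) + 8 \<le> u" "u * (dg + 1) + (r + 4) \<le> 2 ^ (u - 1)"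
      using ex_large_exponent[of "y + k + e1 + cw * (e1 + 3) + 8" "dg + 1" "r + 4"] by blast
    \<comment> \<open>\<open>dg\<close> bounds every degree that occurs, and
      \<open>u * (dg + 1)\<close> is more than \<open>u\<close> times any of them;
      \<open>r + 4\<close> accounts for the simulated registers and a margin for the banks.\<close>
    define h where "h = u * (dg + 1) + (r + 4)"
    have hd: "u * d < h" if "d \<le> dg" for d
    proof -
      have "u * d \<le> u * (dg + 1)" using that by (intro mult_le_mono2) simp
      then show ?thesis by (simp add: h_def)
    qed
    have he: "u * degree_ex x < h" if "x \<in> ?es" for x
    proof (rule hd)
      have "degree_ex x \<le> (\<Sum>e\<in>?es. degree_ex e)" by (rule member_le_sum[OF that]) auto
      then show "degree_ex x \<le> dg" by (simp add: dg_def)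
    qed
    define E where "E = z + a * t + a + a * g"
    define K where "K = (2 ^ k + real \<kappa> + 3) * (real h + 1)"
    show ?thesis
    proof (rule ksat_solvableI[where c = "h + 3" and nmin = "D * Nt" and d = "(k + 1) * E" and C = "(252 + 90 * C) * K ^ E"])
      show "e \<le> 1" by (rule e)
      show "0 \<le> (252 + 90 * C) * K ^ E" using C0 by (simp add: K_def)
      fix n F assume F: "kcnf k n F"
      define q where "q = length F"
      define L where "L = n div D"
      define Y where "Y = n + q + \<kappa> + 2"
      define m where "m = input_fun (enc_cnf n F)"
      define Nb :: nat where "Nb = 2 ^ (n - g * L)"
      have gL: "g * L \<le> n"
      proof -
        have "g * 1 \<le> D" by (simp add: D_def)
        then have "g * L \<le> D * L" by simp
        also have "\<dots> \<le> n" by (simp add: L_def)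
        finally show ?thesis .
      qed
      from inst[OF F gL, unfolded reduction_instance_def Let_def, folded q_def m_def, folded Y_def, folded Nb_def] obtain N M xs s0 rs ss where
        evs: "\<forall>s. std_env n q L g \<kappa> s \<longrightarrow> ev m s eN = N \<and> (s 7 = N \<longrightarrow> ev m s eM = M) \<and>
           (s 7 = N \<and> s 8 = M \<longrightarrow> gl m s gi = xs \<and> (s 5 < Nb \<longrightarrow> gl m s gr = concat (map record_words (rs (s 5)))))"
        and st: "(xs, s0) \<in> start (Q N M)" and vp: "valid_phases wc Mo (Q N M) s0 Nb rs ss"
        and rs: "\<forall>b<Nb. (\<forall>(rq, e) \<in> set (rs b). short rq) \<and> length (rs b) \<le> Y ^ a"
        and sat: "satisfiable F \<longleftrightarrow> (\<exists>b<Nb. hits (Q N M) (ss b) (rs b))"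
        and low: "2 ^ L \<le> N" "2 ^ L \<le> M" and size: "N \<le> 2 ^ L * Y ^ a" "M \<le> 2 ^ n * Y ^ a" "length xs \<le> 2 ^ n * Y ^ a"
        and fb: "f N M \<le> (2 ^ L * real Y ^ a) powr (real g - \<epsilon>)"
        by (elim exE conjE) (rule that)
      define w' where "w' = word_size cw N M"
      have cf: "C0 * x \<le> C * x" if "0 \<le> x" for x using that by (auto simp: C_def intro: mult_right_mono)
      obtain t0 \<sigma>s \<sigma>e tf where ph: "exec w' P0 (boot w' xs) t0 (\<sigma>s 0)"
        "\<And>b. b < Nb \<Longrightarrow> serves_to w' P (Q N M) (\<sigma>s b) (ss b) (map fst (rs b)) (tf b) (\<sigma>e b)"
        "\<And>b. wc \<Longrightarrow> \<sigma>s b = \<sigma>s (0::nat)" "\<And>b. \<not> wc \<Longrightarrow> \<sigma>s (Suc b) = \<sigma>e b"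
        "Nt \<le> N \<and> Nt \<le> M \<Longrightarrow> real (t0 + (\<Sum>b<Nb. sum_list (tf b))) \<le> C * real N ^ t + real (\<Sum>b<Nb. length (rs b)) * (C * f N M)"
      proof (rule phases_served[OF vp, of C "C * f N M" w' P0 xs P "Nt \<le> N \<and> Nt \<le> M" "C * real N ^ t"])
        show "0 < Nb" by (simp add: Nb_def)
        show "0 \<le> C" by (rule C0)
        show "0 \<le> C * f N M" using C0 f0 by simp
        fix rs' assume "valid_seq Mo (Q N M) s0 rs'"
        from alg[OF st this] obtain t0 \<sigma> ts where 1: "exec w' P0 (boot w' xs) t0 \<sigma>" "serves w' P (Q N M) \<sigma> s0 rs' ts"
          "Nt \<le> N \<and> Nt \<le> M \<longrightarrow> real t0 \<le> C0 * real N ^ t \<and> (if wc then \<forall>\<tau> \<in> set ts. real \<tau> \<le> C0 * f N M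
           else real (t0 + sum_list ts) \<le> C0 * real N ^ t + real (length rs') * (C0 * f N M))"
          unfolding w'_def by blast
        have c1: "C0 * real N ^ t \<le> C * real N ^ t" by (rule cf) simp
        have c2: "C0 * f N M \<le> C * f N M" by (rule cf[OF f0])
        have c3: "real (length rs') * (C0 * f N M) \<le> real (length rs') * (C * f N M)" using c2 by (rule mult_left_mono) simp
        have "Nt \<le> N \<and> Nt \<le> M \<longrightarrow> real t0 \<le> C * real N ^ t \<and> (if wc then \<forall>\<tau> \<in> set ts. real \<tau> \<le> C * f N M
           else real (t0 + sum_list ts) \<le> C * real N ^ t + real (length rs') * (C * f N M))"
          using 1(3) c1 c2 c3 by (auto split: if_splits intro: order_trans)
        then show "\<exists>t0 \<sigma> ts. exec w' P0 (boot w' xs) t0 \<sigma> \<and> serves w' P (Q N M) \<sigma> s0 rs' ts \<and>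
          (Nt \<le> N \<and> Nt \<le> M \<longrightarrow> real t0 \<le> C * real N ^ t \<and> (if wc then \<forall>\<tau> \<in> set ts. real \<tau> \<le> C * f N M
           else real (t0 + sum_list ts) \<le> C * real N ^ t + real (length rs') * (C * f N M)))"
          using 1 by blast
      qed (use that in blast)
      define XI where "XI = 2 ^ L * Y * (h + 1)"
      have run: "runs ((h + 3) * (n + 1)) (solver wc D g h \<kappa> cw eN eM gi gr r P0 P) (boot ((h + 3) * (n + 1)) (enc_cnf n F))
        (80 + time_ex XI eN + time_ex XI eM + time_ex XI log_ex + time_gen XI (mod_gen gi) + 30 * t0 +
         (\<Sum>b<2 ^ (n - g * (n div D)). time_gen Y gr + 30 * sum_list (tf b) + 62 * length (rs b) + 20 + 1))
        (\<lambda>\<sigma>. result \<sigma> = of_bool (satisfiable F))"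
      proof (rule reduction_runs[OF F D0 g gL[unfolded L_def] q_def m_def Y_def vars loops])
        show "h \<le> 2 ^ (u - 1)" using u(2) by (simp add: h_def)
        show "u + r + 4 \<le> h" by (simp add: h_def)
        show "u * degree_gen gr < h" "u * degree_gen (mod_gen gi) < h" by (rule hd; simp add: dg_def)+
        show "u * degree_ex x < h" if "x \<in> ?es" for x by (rule he[OF that])
        show "3 \<le> r" "below_regs r P0" "below_regs r P" by (rule r)+
        show "\<And>b. wc \<Longrightarrow> \<sigma>s b = \<sigma>s 0" by (rule ph(3))
        show "\<And>b. \<not> wc \<Longrightarrow> \<sigma>s (Suc b) = \<sigma>e b" by (rule ph(4))
        show "y + k + e1 + cw * (e1 + 3) + 8 \<le> u" by (rule u)
        show "\<And>s. std_env n q (n div D) g \<kappa> s \<Longrightarrow> ev m s eN = N \<and> (s 7 = N \<longrightarrow> ev m s eM = M) \<and>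
           (s 7 = N \<and> s 8 = M \<longrightarrow> gl m s gi = xs \<and>
             (s 5 < 2 ^ (n - g * (n div D)) \<longrightarrow> gl m s gr = concat (map record_words (rs (s 5)))))"
          using evs unfolding Nb_def L_def by blast
        show "(\<forall>(rq, e) \<in> set (rs b). short rq) \<and> length (rs b) \<le> Y ^ a" if "b < 2 ^ (n - g * (n div D))" for b
          using rs that unfolding Nb_def L_def by blast
      qed (use sat size ph(1,2) in \<open>simp_all only: Nb_def L_def w'_def y_def e1_def XI_def\<close>)
      then obtain T \<sigma> where T: "exec ((h + 3) * (n + 1)) (solver wc D g h \<kappa> cw eN eM gi gr r P0 P)
          (boot ((h + 3) * (n + 1)) (enc_cnf n F)) T \<sigma>" "result \<sigma> = of_bool (satisfiable F)"
        and Tle: "T \<le> 80 + time_ex XI eN + time_ex XI eM + time_ex XI log_ex + time_gen XI (mod_gen gi) + 30 * t0 +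
         (\<Sum>b<Nb. time_gen Y gr + 30 * sum_list (tf b) + 62 * length (rs b) + 20 + 1)"
        unfolding runs_def Nb_def L_def by blast
      have "real T \<le> 2 powr ((1 - e) * real n) * ((252 + 90 * C) * K ^ E * (real n + 1) ^ ((k + 1) * E))" if n: "D * Nt \<le> n"
      proof -
        \<comment> \<open>Large \<open>n\<close> makes \<open>L\<close>, hence \<open>2 ^ L\<close>,
          and hence both size parameters of the instance exceed the threshold of the
          algorithm.\<close>
        have "Nt \<le> L" using n D0 by (simp add: L_def less_eq_div_iff_mult_less_eq mult.commute)
        then have "Nt \<le> 2 ^ L" using less_exp[of L] by linarith
        then have big: "Nt \<le> N \<and> Nt \<le> M" using low by linarith
        have Y2: "2 \<le> Y" by (simp add: Y_def)
        have X2: "2 \<le> XI"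
        proof -
          have "1 * (2 * 1) \<le> 2 ^ L * (Y * (h + 1))" using Y2 by (intro mult_le_mono) auto
          then show ?thesis by (simp only: XI_def mult.assoc mult_1 mult_1_right)
        qed
        have XIr: "real XI = 2 ^ L * real Y * (real h + 1)" by (simp add: XI_def algebra_simps)
        have lenle: "(\<Sum>b<Nb. length (rs b)) \<le> Nb * Y ^ a"
          using sum_bounded_above[of "{..<Nb}" "\<lambda>b. length (rs b)" "Y ^ a"] rs by simp
        have "(\<Sum>b<Nb. time_gen Y gr + 30 * sum_list (tf b) + 62 * length (rs b) + 20 + 1) =
            Nb * (time_gen Y gr + 21) + 30 * (\<Sum>b<Nb. sum_list (tf b)) + 62 * (\<Sum>b<Nb. length (rs b))"
          unfolding sum.distrib sum_distrib_left[symmetric] by (simp add: distrib_left)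
        also have "\<dots> \<le> Nb * (Y ^ z + 21) + 30 * (\<Sum>b<Nb. sum_list (tf b)) + 62 * (Nb * Y ^ a)"
          using zz5[OF Y2] lenle by (intro add_mono mult_le_mono) auto
        finally have "T \<le> 80 + 4 * XI ^ z + 30 * (t0 + (\<Sum>b<Nb. sum_list (tf b))) + Nb * (Y ^ z + 62 * Y ^ a + 21)"
          using Tle zz1[OF X2] zz2[OF X2] zz3[OF X2] zz4[OF X2] by (simp add: algebra_simps)
        then have "real T \<le> real (80 + 4 * XI ^ z + 30 * (t0 + (\<Sum>b<Nb. sum_list (tf b))) + Nb * (Y ^ z + 62 * Y ^ a + 21))"
          by (rule of_nat_mono)
        then have "real T \<le> 80 + 4 * (2 ^ L * real Y * (real h + 1)) ^ z + 30 * real (t0 + (\<Sum>b<Nb. sum_list (tf b))) +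
            2 ^ (n - g * L) * (real Y ^ z + 62 * real Y ^ a + 21)"
          unfolding XIr[symmetric] by (simp add: Nb_def)
        also have "\<dots> \<le> 80 + 4 * (2 ^ L * real Y * (real h + 1)) ^ z +
            30 * (C * real N ^ t + real (\<Sum>b<Nb. length (rs b)) * (C * f N M)) +
            2 ^ (n - g * L) * (real Y ^ z + 62 * real Y ^ a + 21)"
          using ph(5)[OF big] by (intro add_mono mult_left_mono) auto
        finally have TT: "real T \<le> 80 + 4 * (2 ^ L * real Y * (real h + 1)) ^ z +
            30 * (C * real N ^ t + real (\<Sum>b<Nb. length (rs b)) * (C * f N M)) +
            2 ^ (n - g * L) * (real Y ^ z + 62 * real Y ^ a + 21)" .
        have "real T \<le> 2 powr ((1 - e) * real n) * ((252 + 90 * C) * (real Y * (real h + 1)) ^ E)"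
        proof (rule total_time_bound[OF _ g L_def \<epsilon> e_def E_def _ _ _ _ _ _ _ C0 TT])
          show "2 * (z + t + 1) * g \<le> D" by (simp add: D_def)
          show "1 \<le> Y" using Y2 by simp
          have "real N \<le> real (2 ^ L * Y ^ a)" using size(1) by (rule of_nat_mono)
          then show "real N \<le> 2 ^ L * real Y ^ a" by simp
          have "real (\<Sum>b<Nb. length (rs b)) \<le> real (Nb * Y ^ a)" using lenle by (rule of_nat_mono)
          then show "real (\<Sum>b<Nb. length (rs b)) \<le> 2 ^ (n - g * L) * real Y ^ a" by (simp add: Nb_def)
        qed (use f0 fb in \<open>auto intro: sum_nonneg\<close>)
        also have "\<dots> \<le> 2 powr ((1 - e) * real n) * ((252 + 90 * C) * (K ^ E * (real n + 1) ^ ((k + 1) * E)))"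
        proof -
          let ?n = "real n + 1"
          have "real q \<le> real ((2 * n + 1) ^ k)" using kcnf_length_le[OF F] unfolding q_def by (rule of_nat_mono)
          also have "\<dots> \<le> (2 * ?n) ^ k" by (simp add: power_mono)
          finally have "real q \<le> 2 ^ k * ?n ^ k" by (simp only: power_mult_distrib)
          also have "\<dots> \<le> 2 ^ k * ?n ^ (k + 1)" by (intro mult_left_mono power_increasing) auto
          finally have qn: "real q \<le> 2 ^ k * ?n ^ (k + 1)" .
          have n1: "1 \<le> ?n ^ (k + 1)" by (rule one_le_power) simp
          have n2: "?n ^ 1 \<le> ?n ^ (k + 1)" by (intro power_increasing) auto
          have kn: "(real \<kappa> + 1) * 1 \<le> (real \<kappa> + 1) * ?n ^ (k + 1)" using n1 by (intro mult_left_mono) auto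
          have "real Y = (real n + 1) + real q + (real \<kappa> + 1)" by (simp add: Y_def)
          also have "\<dots> \<le> ?n ^ (k + 1) + 2 ^ k * ?n ^ (k + 1) + (real \<kappa> + 1) * ?n ^ (k + 1)"
            by (intro add_mono) (use qn n2 kn in \<open>simp_all only: power_one_right mult_1_right\<close>)
          also have "\<dots> \<le> (2 ^ k + real \<kappa> + 3) * ?n ^ (k + 1)" using n1 by (simp add: algebra_simps)
          finally have "real Y * (real h + 1) \<le> (2 ^ k + real \<kappa> + 3) * ?n ^ (k + 1) * (real h + 1)" by (rule mult_right_mono) simp
          also have "\<dots> = K * ?n ^ (k + 1)" by (simp add: K_def)
          finally have "(real Y * (real h + 1)) ^ E \<le> (K * ?n ^ (k + 1)) ^ E" by (rule power_mono) simp
          also have "\<dots> = K ^ E * ?n ^ ((k + 1) * E)" by (simp only: power_mult_distrib power_mult)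
          finally show ?thesis using C0 by (intro mult_left_mono) auto
        qed
        finally show ?thesis by (simp only: mult.assoc)
      qed
      then show "\<exists>T \<sigma>. exec ((h + 3) * (n + 1)) (solver wc D g h \<kappa> cw eN eM gi gr r P0 P)
          (boot ((h + 3) * (n + 1)) (enc_cnf n F)) T \<sigma> \<and> result \<sigma> = of_bool (satisfiable F) \<and>
          (D * Nt \<le> n \<longrightarrow> real T \<le> 2 powr ((1 - e) * real n) * ((252 + 90 * C) * K ^ E * (real n + 1) ^ ((k + 1) * E)))"
        using T by blast
    qed
  qed
  then show ?thesis unfolding SETH_def using e(1) by blast
qed


section \<open>Phases that switch on toggles of the falsified clauses\<close>

section \<open>Reductions that switch toggles on and off\<close>

definition mk_request :: "nat \<Rightarrow> nat list \<Rightarrow> request" where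
  "mk_request tag a = (if tag = 0 then Ins a else if tag = 1 then Del a else Query a)"

definition req_gen :: "nat \<Rightarrow> ex list \<Rightarrow> ex \<Rightarrow> gen" where
  "req_gen tag es e = Sq (Emit (Cn tag)) (Sq (Emit (Cn (length es)))
     (Sq (Emit (if 0 < length es then es ! 0 else Cn 0)) (Sq (Emit (if 1 < length es then es ! 1 else Cn 0)) (Emit e))))"

definition tog_gen :: "nat \<Rightarrow> ex \<Rightarrow> ex list option \<Rightarrow> ex list option \<Rightarrow> gen" where
  "tog_gen tag f xs ys = For 12 1 (Iff f (case xs of Some es \<Rightarrow> req_gen tag es (Cn 0) | None \<Rightarrow> Nop)
     (case ys of Some es \<Rightarrow> req_gen tag es (Cn 0) | None \<Rightarrow> Nop))"

text \<open>Clause \<open>c\<close> contributes its toggle from \<open>xs\<close> if the current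
  assignment falsifies it, and from \<open>ys\<close> otherwise. A fully dynamic phase inserts
  these, queries and deletes them again. A decremental one starts with all toggles present and
  deletes the opposite choice; therefore \<open>xs\<close> and \<open>ys\<close> are
  swapped.\<close>

fun phase_gen :: "mode \<Rightarrow> ex \<Rightarrow> ex list option \<Rightarrow> ex list option \<Rightarrow> ex list \<Rightarrow> ex \<Rightarrow> gen" where
  "phase_gen Fully_Dynamic f xs ys qs e = Sq (tog_gen 0 f xs ys) (Sq (req_gen 2 qs e) (tog_gen 1 f xs ys))"
| "phase_gen Incremental f xs ys qs e = Sq (tog_gen 0 f xs ys) (req_gen 2 qs e)"
| "phase_gen Decremental f xs ys qs e = Sq (tog_gen 1 f ys xs) (req_gen 2 qs e)"

definition togs :: "nat \<Rightarrow> (nat \<Rightarrow> bool) \<Rightarrow> (nat \<Rightarrow> nat list option) \<Rightarrow> (nat \<Rightarrow> nat list option) \<Rightarrow> nat list list" where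
  "togs q D x y = concat (map (\<lambda>c. case if D c then x c else y c of Some a \<Rightarrow> [a] | None \<Rightarrow> []) [0..<q])"

fun phase_reqs :: "mode \<Rightarrow> nat \<Rightarrow> (nat \<Rightarrow> bool) \<Rightarrow> (nat \<Rightarrow> nat list option) \<Rightarrow> (nat \<Rightarrow> nat list option) \<Rightarrow>
    nat list \<Rightarrow> nat \<Rightarrow> (request \<times> nat) list" where
  "phase_reqs Fully_Dynamic q D x y qa e = map (\<lambda>a. (Ins a, 0)) (togs q D x y) @ (Query qa, e) # map (\<lambda>a. (Del a, 0)) (togs q D x y)"
| "phase_reqs Incremental q D x y qa e = map (\<lambda>a. (Ins a, 0)) (togs q D x y) @ [(Query qa, e)]"
| "phase_reqs Decremental q D x y qa e = map (\<lambda>a. (Del a, 0)) (togs q D y x) @ [(Query qa, e)]"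

lemma gl_req_gen:
  assumes "length es \<le> 2" "tag < 3"
  shows "gl m s (req_gen tag es e) = record_words (mk_request tag (map (ev m s) es), ev m s e)"
proof -
  consider "es = []" | a where "es = [a]" | a b where "es = [a, b]"
    using assms(1) by (cases es rule: remdups_adj.cases) auto
  moreover consider "tag = 0" | "tag = 1" | "tag = 2" using assms(2) by linarith
  ultimately show ?thesis by cases (auto simp: req_gen_def mk_request_def Let_def)
qed

lemma gl_tog_gen:
  assumes "tag < 2" "\<And>es. xs = Some es \<Longrightarrow> length es \<le> 2" "\<And>es. ys = Some es \<Longrightarrow> length es \<le> 2"
    and "s 1 = q" "\<And>c. c < q \<Longrightarrow> ev m (s(12 := c)) f = of_bool (D c)"
    and "\<And>c. c < q \<Longrightarrow> map_option (map (ev m (s(12 := c)))) xs = x c"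
    and "\<And>c. c < q \<Longrightarrow> map_option (map (ev m (s(12 := c)))) ys = y c"
  shows "gl m s (tog_gen tag f xs ys) = concat (map record_words (map (\<lambda>a. (mk_request tag a, 0)) (togs q D x y)))"
proof -
  have "gl m (s(12 := c)) (Iff f (case xs of Some es \<Rightarrow> req_gen tag es (Cn 0) | None \<Rightarrow> Nop)
     (case ys of Some es \<Rightarrow> req_gen tag es (Cn 0) | None \<Rightarrow> Nop)) =
     concat (map record_words (map (\<lambda>a. (mk_request tag a, 0)) (case if D c then x c else y c of Some a \<Rightarrow> [a] | None \<Rightarrow> [])))"
    if "c < q" for c
    using assms(5)[OF that] assms(6,7)[OF that, symmetric] assms(1,2,3)
    by (cases xs; cases ys) (auto simp: gl_req_gen simp del: record_words.simps)
  then have E: "map (\<lambda>c. gl m (s(12 := c)) (Iff f (case xs of Some es \<Rightarrow> req_gen tag es (Cn 0) | None \<Rightarrow> Nop)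
     (case ys of Some es \<Rightarrow> req_gen tag es (Cn 0) | None \<Rightarrow> Nop))) [0..<q] =
     map (\<lambda>c. concat (map record_words (map (\<lambda>a. (mk_request tag a, 0)) (case if D c then x c else y c of Some a \<Rightarrow> [a] | None \<Rightarrow> [])))) [0..<q]"
    by (intro map_cong) auto
  have CC: "concat (map (\<lambda>c. concat (map record_words (map (\<lambda>a. (mk_request tag a, 0)) (g c)))) cs) =
     concat (map record_words (map (\<lambda>a. (mk_request tag a, 0)) (concat (map g cs))))" for g cs
    by (induction cs) simp_all
  show ?thesis unfolding tog_gen_def togs_def gl.simps(4) assms(4) E CC ..
qed

lemma set_togs: "set (togs q D x y) = {a. \<exists>c<q. (if D c then x c else y c) = Some a}"
  by (auto simp: togs_def split: option.splits if_splits)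

lemma length_togs: "length (togs q D x y) \<le> q"
proof -
  have "length (togs q D x y) = (\<Sum>c\<leftarrow>[0..<q]. length (case if D c then x c else y c of Some a \<Rightarrow> [a] | None \<Rightarrow> []))"
    by (simp add: togs_def length_concat comp_def)
  also have "\<dots> \<le> (\<Sum>c\<leftarrow>[0..<q]. 1)" by (rule sum_list_mono) (auto split: option.splits)
  finally show ?thesis by (simp add: sum_list_triv)
qed

definition toggles_distinct :: "nat \<Rightarrow> (nat \<Rightarrow> nat list option) \<Rightarrow> (nat \<Rightarrow> nat list option) \<Rightarrow> bool" where
  "toggles_distinct q x y \<longleftrightarrow> (\<forall>c<q. \<forall>d<q. \<forall>a. (x c = Some a \<and> x d = Some a \<longrightarrow> c = d) \<and>
     (y c = Some a \<and> y d = Some a \<longrightarrow> c = d) \<and> \<not> (x c = Some a \<and> y d = Some a))"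

definition all_toggles :: "nat \<Rightarrow> (nat \<Rightarrow> nat list option) \<Rightarrow> (nat \<Rightarrow> nat list option) \<Rightarrow> nat list set" where
  "all_toggles q x y = {a. \<exists>c<q. x c = Some a \<or> y c = Some a}"

lemma distinct_togs:
  assumes "toggles_distinct q x y"
  shows "distinct (togs q D x y)"
proof -
  have "distinct (togs p D x y)" if "p \<le> q" for p
    using that
  proof (induction p)
    case (Suc p)
    have s: "togs (Suc p) D x y = togs p D x y @ (case if D p then x p else y p of Some a \<Rightarrow> [a] | None \<Rightarrow> [])"
      by (simp add: togs_def)
    have "a \<notin> set (togs p D x y)" if a: "(if D p then x p else y p) = Some a" for a
    proof
      assume "a \<in> set (togs p D x y)"
      then obtain c where c: "c < p" "(if D c then x c else y c) = Some a" by (auto simp: set_togs)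
      then show False using a assms Suc.prems unfolding toggles_distinct_def
        by (auto split: if_splits) (metis Suc_le_lessD less_irrefl less_trans)+
    qed
    then show ?case unfolding s using Suc by (auto split: option.splits)
  qed (simp add: togs_def)
  then show ?thesis by simp
qed

text \<open>Each toggle belongs to one clause and one side. So deleting the opposite choice from the
  set of all toggles leaves precisely the desired one.\<close>

lemma togs_complement:
  assumes "toggles_distinct q x y"
  shows "set (togs q D y x) = all_toggles q x y - set (togs q D x y)"
proof -
  have T: "(x c = Some a \<and> x d = Some a \<longrightarrow> c = d) \<and> (y c = Some a \<and> y d = Some a \<longrightarrow> c = d) \<and>
      \<not> (x c = Some a \<and> y d = Some a)" if "c < q" "d < q" for c d a
    using assms that unfolding toggles_distinct_def by blast
  have "a \<in> set (togs q D y x) \<longleftrightarrow> a \<in> all_toggles q x y \<and> a \<notin> set (togs q D x y)" for a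
  proof
    assume "a \<in> set (togs q D y x)"
    then obtain c where c: "c < q" "(if D c then y c else x c) = Some a" by (auto simp: set_togs)
    have "a \<notin> set (togs q D x y)"
    proof
      assume "a \<in> set (togs q D x y)"
      then obtain d where d: "d < q" "(if D d then x d else y d) = Some a" by (auto simp: set_togs)
      show False using T[OF c(1) d(1), of a] T[OF d(1) c(1), of a] c(2) d(2) by (auto split: if_splits)
    qed
    moreover have "a \<in> all_toggles q x y" using c by (auto simp: all_toggles_def split: if_splits)
    ultimately show "a \<in> all_toggles q x y \<and> a \<notin> set (togs q D x y)" by blast
  next
    assume *: "a \<in> all_toggles q x y \<and> a \<notin> set (togs q D x y)"
    then obtain c where c: "c < q" "x c = Some a \<or> y c = Some a" by (auto simp: all_toggles_def)
    have "(if D c then x c else y c) \<noteq> Some a" using * c(1) by (auto simp: set_togs)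
    then have "(if D c then y c else x c) = Some a" using c(2) by (auto split: if_splits)
    then show "a \<in> set (togs q D y x)" using c(1) by (auto simp: set_togs)
  qed
  then show ?thesis by blast
qed

text \<open>\<open>stt S\<close> is the state in which exactly the toggles in \<open>S\<close> are
  present; the static part of the instance is hidden inside \<open>stt\<close>.\<close>

locale toggling =
  fixes Q :: "'s dyn_problem" and q :: nat and x y :: "nat \<Rightarrow> nat list option" and stt :: "nat list set \<Rightarrow> 's"
  assumes distinct: "toggles_distinct q x y"
    and ins: "\<And>S a. S \<subseteq> all_toggles q x y \<Longrightarrow> a \<in> all_toggles q x y \<Longrightarrow> a \<notin> S \<Longrightarrow>
       can_ins Q (stt S) a \<and> ins Q (stt S) a = stt (insert a S)"
    and del: "\<And>S a. S \<subseteq> all_toggles q x y \<Longrightarrow> a \<in> S \<Longrightarrow> can_del Q (stt S) a \<and> del Q (stt S) a = stt (S - {a})"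
begin

lemma ins_list:
  assumes "distinct ts" "set ts \<subseteq> all_toggles q x y" "S \<subseteq> all_toggles q x y" "S \<inter> set ts = {}" "Mo \<noteq> Decremental"
  shows "(valid_seq Mo Q (stt S) (map Ins ts @ rs) \<longleftrightarrow> valid_seq Mo Q (stt (S \<union> set ts)) rs) \<and>
    fold (\<lambda>r s. upd Q s r) (map Ins ts) (stt S) = stt (S \<union> set ts)"
  using assms
proof (induction ts arbitrary: S)
  case (Cons a ts)
  have i: "can_ins Q (stt S) a \<and> ins Q (stt S) a = stt (insert a S)" by (rule ins) (use Cons.prems in auto)
  have "(valid_seq Mo Q (stt (insert a S)) (map Ins ts @ rs) \<longleftrightarrow> valid_seq Mo Q (stt (insert a S \<union> set ts)) rs) \<and>
    fold (\<lambda>r s. upd Q s r) (map Ins ts) (stt (insert a S)) = stt (insert a S \<union> set ts)"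
    by (rule Cons.IH) (use Cons.prems in auto)
  then show ?case using i Cons.prems(5) by (cases Mo) auto
qed simp

lemma del_list:
  assumes "distinct ts" "set ts \<subseteq> S" "S \<subseteq> all_toggles q x y" "Mo \<noteq> Incremental"
  shows "(valid_seq Mo Q (stt S) (map Del ts @ rs) \<longleftrightarrow> valid_seq Mo Q (stt (S - set ts)) rs) \<and>
    fold (\<lambda>r s. upd Q s r) (map Del ts) (stt S) = stt (S - set ts)"
  using assms
proof (induction ts arbitrary: S)
  case (Cons a ts)
  have i: "can_del Q (stt S) a \<and> del Q (stt S) a = stt (S - {a})" by (rule del) (use Cons.prems in auto)
  have e: "S - {a} - set ts = S - set (a # ts)" by auto
  have "(valid_seq Mo Q (stt (S - {a})) (map Del ts @ rs) \<longleftrightarrow> valid_seq Mo Q (stt (S - {a} - set ts)) rs) \<and>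
    fold (\<lambda>r s. upd Q s r) (map Del ts) (stt (S - {a})) = stt (S - {a} - set ts)"
    by (rule Cons.IH) (use Cons.prems in auto)
  then show ?case unfolding e using i Cons.prems(4) by (cases Mo) auto
qed simp

definition start_set :: "mode \<Rightarrow> nat list set" where
  "start_set Mo = (if Mo = Decremental then all_toggles q x y else {})"

lemma hits_updates: "(\<And>r e. (r, e) \<in> set rs \<Longrightarrow> \<forall>a. r \<noteq> Query a) \<Longrightarrow> \<not> hits Q s rs"
proof (induction rs arbitrary: s)
  case (Cons p rs)
  obtain r e where p: "p = (r, e)" by (cases p)
  have "\<not> mismatch Q s r e" using Cons.prems[of r e] p by (cases r) auto
  moreover have "\<not> hits Q (upd Q s r) rs" by (rule Cons.IH, rule Cons.prems, erule list.set_intros(2))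
  ultimately show ?case using p by simp
qed simp

text \<open>In every mode the query meets the same state \<open>stt (set (togs q D x y))\<close>,
  reached from below by insertions or from above by deletions.\<close>

lemma phase:
  assumes "can_ask Q (stt (set (togs q D x y))) qa"
  shows "valid_seq Mo Q (stt (start_set Mo)) (map fst (phase_reqs Mo q D x y qa e))"
    and "Mo = Fully_Dynamic \<Longrightarrow> fold (\<lambda>r s. upd Q s r) (map fst (phase_reqs Mo q D x y qa e)) (stt {}) = stt {}"
    and "hits Q (stt (start_set Mo)) (phase_reqs Mo q D x y qa e) \<longleftrightarrow> ans Q (stt (set (togs q D x y))) qa \<noteq> e"
proof -
  let ?t = "togs q D x y" and ?t' = "togs q D y x" and ?U = "all_toggles q x y"
  have t: "distinct ?t" "set ?t \<subseteq> ?U" by (rule distinct_togs[OF distinct]) (auto simp: set_togs all_toggles_def split: if_splits)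
  have d': "toggles_distinct q y x" using distinct unfolding toggles_distinct_def by metis
  have t': "distinct ?t'" "set ?t' \<subseteq> ?U" "?U - set ?t' = set ?t"
    using distinct_togs[OF d'] togs_complement[OF distinct, of D] t(2) by auto
  have c: "map (\<lambda>a. Ins a) = map Ins" "map (\<lambda>a. Del a) = map Del" by simp_all
  have comp: "fst \<circ> (\<lambda>a. (Ins a, 0::nat)) = Ins" "fst \<circ> (\<lambda>a. (Del a, 0::nat)) = Del" by auto
  note I = ins_list[OF t, of "{}" Mo, simplified]
  note D' = del_list[OF t'(1,2), of Mo, simplified t'(3), simplified]
  note D = del_list[OF t(1) order_refl t(2), of Mo "[]", simplified]
  have no1: "\<not> hits Q s (map (\<lambda>a. (Ins a, 0)) ts)" "\<not> hits Q s (map (\<lambda>a. (Del a, 0)) ts)" for s ts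
    by (rule hits_updates; auto)+
  show "valid_seq Mo Q (stt (start_set Mo)) (map fst (phase_reqs Mo q D x y qa e))"
    using I D' D assms by (cases Mo) (simp_all add: start_set_def comp)
  show "fold (\<lambda>r s. upd Q s r) (map fst (phase_reqs Mo q D x y qa e)) (stt {}) = stt {}" if "Mo = Fully_Dynamic"
    using I D that by (simp add: comp)
  show "hits Q (stt (start_set Mo)) (phase_reqs Mo q D x y qa e) \<longleftrightarrow> ans Q (stt (set (togs q D x y))) qa \<noteq> e"
    using I D' no1 by (cases Mo) (simp_all add: start_set_def comp hits_append)
qed

end

text \<open>A fully dynamic phase undoes its own insertions, so the concatenation visits
  \<open>s0\<close> at every phase boundary. In the other modes each phase starts afresh by
  definition.\<close>

lemma valid_phases_restoring:
  assumes "wc \<longleftrightarrow> Mo \<noteq> Fully_Dynamic"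
    and "\<And>b. b < Nb \<Longrightarrow> valid_seq Mo Q s0 (map fst (rs b))"
    and "\<And>b. b < Nb \<Longrightarrow> Mo = Fully_Dynamic \<Longrightarrow> fold (\<lambda>r s. upd Q s r) (map fst (rs b)) s0 = s0"
  shows "valid_phases wc Mo Q s0 Nb rs (\<lambda>_. s0)"
proof (cases "Mo = Fully_Dynamic")
  case False
  then show ?thesis using assms by (simp add: valid_phases_def)
next
  case True
  have va: "valid_seq Mo Q s (rs1 @ rs2) \<longleftrightarrow> valid_seq Mo Q s rs1 \<and> valid_seq Mo Q (fold (\<lambda>r s. upd Q s r) rs1 s) rs2" for s rs1 rs2
    by (induction rs1 arbitrary: s) auto
  have f: "fold (\<lambda>r s. upd Q s r) (concat (map (\<lambda>b. map fst (rs b)) [0..<K])) s0 = s0" if "K \<le> Nb" for K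
    using that by (induction K) (simp_all add: assms(3) True)
  have v: "valid_seq Mo Q s0 (concat (map (\<lambda>b. map fst (rs b)) [0..<K]))" if "K \<le> Nb" for K
    using that by (induction K) (simp_all add: va f assms(2))
  show ?thesis using True assms(1) f v by (simp add: valid_phases_def)
qed


text \<open>Loop bounds of at most \<open>Y\<close>. Request generators run once per phase,
  exponentially often, so they may loop over these only; variable 3 with value \<open>2 ^ L\<close>
  is reserved for the instance generators.\<close>

definition small_loops :: "nat set" where "small_loops = {0, 1, 2, 9} \<union> {11..18}"

text \<open>The product of variables 5 and 4 is \<open>b * 2 ^ (g * L)\<close>: the phase number,
  shifted to the variables outside the blocks.\<close>

definition beta_fals :: "nat \<Rightarrow> ex" where
  "beta_fals g = fals_ex (Bin BMul (Cn g) (Vr 2)) (Vr 0) (Bin BMul (Vr 5) (Vr 4)) 12"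

definition small_ex :: "ex \<Rightarrow> bool" where
  "small_ex e \<longleftrightarrow> vars_below 19 e \<and> loop_vars e \<subseteq> small_loops"

definition toggle_syntax :: "ex \<Rightarrow> ex \<Rightarrow> gen \<Rightarrow> ex list option \<Rightarrow> ex list option \<Rightarrow> ex list \<Rightarrow> ex \<Rightarrow> bool" where
  "toggle_syntax eN eM gi xs ys qs e \<longleftrightarrow> vars_below 19 eN \<and> vars_below 19 eM \<and> vars_below_gen 19 gi \<and>
     loop_vars eN \<union> loop_vars eM \<union> loop_vars_gen gi \<subseteq> insert 3 small_loops \<and>
     (\<forall>z. xs = Some z \<or> ys = Some z \<longrightarrow> length z \<le> 2 \<and> (\<forall>t \<in> set z. small_ex t)) \<and>
     length qs \<le> 2 \<and> (\<forall>t \<in> set qs. small_ex t) \<and> small_ex e"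

text \<open>The part of \<open>reduction_instance\<close> that is specific to a problem with
  toggles: \<open>qa b\<close> is the argument of the only query of phase \<open>b\<close>, and
  \<open>eb b\<close> its answer in the unsatisfiable case. Here \<open>M\<close> must be within
  \<open>2 ^ L * Y ^ a\<close>, since the time bound is a power of \<open>m\<close>.\<close>

definition toggle_instance :: "mode \<Rightarrow> (nat \<Rightarrow> nat \<Rightarrow> 's dyn_problem) \<Rightarrow> nat \<Rightarrow>
    ex \<Rightarrow> ex \<Rightarrow> gen \<Rightarrow> ex list option \<Rightarrow> ex list option \<Rightarrow> ex list \<Rightarrow> ex \<Rightarrow> nat \<Rightarrow> nat \<Rightarrow> nat \<Rightarrow> cnf \<Rightarrow> nat \<Rightarrow> bool" where
  "toggle_instance Mo Q g eN eM gi xs ys qs e \<kappa> a n F L \<longleftrightarrow>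
    (let m = input_fun (enc_cnf n F); q = length F; Y = n + q + \<kappa> + 2; Nb = 2 ^ (n - g * L);
         D = (\<lambda>b c. pfals (g * L) n (b * 2 ^ (g * L)) (F ! c)) in
      \<exists>N M inp stt x y qa eb.
        (\<forall>s. std_env n q L g \<kappa> s \<longrightarrow> ev m s eN = N \<and> (s 7 = N \<longrightarrow> ev m s eM = M) \<and>
           (s 7 = N \<and> s 8 = M \<longrightarrow> gl m s gi = inp \<and>
             (s 5 < Nb \<longrightarrow> map (ev m s) qs = qa (s 5) \<and> ev m s e = eb (s 5)) \<and>
             (\<forall>c<q. map_option (map (ev m (s(12 := c)))) xs = x c \<and> map_option (map (ev m (s(12 := c)))) ys = y c))) \<and>
        toggling (Q N M) q x y stt \<and> (inp, stt (toggling.start_set q x y Mo)) \<in> start (Q N M) \<and>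
        (\<forall>b<Nb. can_ask (Q N M) (stt (set (togs q (D b) x y))) (qa b)) \<and>
        (satisfiable F \<longleftrightarrow> (\<exists>b<Nb. ans (Q N M) (stt (set (togs q (D b) x y))) (qa b) \<noteq> eb b)) \<and>
        2 ^ L \<le> N \<and> 2 ^ L \<le> M \<and> N \<le> 2 ^ L * Y ^ a \<and> M \<le> 2 ^ L * Y ^ a \<and> length inp \<le> 2 ^ L * Y ^ a)"

lemma loop_vars_req_gen: "loop_vars_gen (req_gen tag es e) \<subseteq> (\<Union>t \<in> set es. loop_vars t) \<union> loop_vars e"
  unfolding req_gen_def by (cases es; cases "tl es") auto

lemma vars_below_req_gen: "(\<And>t. t \<in> set es \<Longrightarrow> vars_below B t) \<Longrightarrow> vars_below B e \<Longrightarrow> vars_below_gen B (req_gen tag es e)"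
  unfolding req_gen_def by (cases es; cases "tl es") auto

lemma small_req_gen:
  assumes "\<forall>t \<in> set es. small_ex t" "small_ex e"
  shows "vars_below_gen 19 (req_gen tag es e) \<and> loop_vars_gen (req_gen tag es e) \<subseteq> small_loops"
  using assms loop_vars_req_gen[of tag es e] vars_below_req_gen[of es 19 e tag] unfolding small_ex_def by blast

lemma small_tog_gen:
  assumes "\<forall>z. xs = Some z \<or> ys = Some z \<longrightarrow> (\<forall>t \<in> set z. small_ex t)" "small_ex f"
  shows "vars_below_gen 19 (tog_gen tag f xs ys) \<and> loop_vars_gen (tog_gen tag f xs ys) \<subseteq> small_loops"
proof -
  have c0: "small_ex (Cn 0)" by (simp add: small_ex_def)
  have *: "vars_below_gen 19 (case zs of None \<Rightarrow> Nop | Some es \<Rightarrow> req_gen tag es (Cn 0)) \<and>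
     loop_vars_gen (case zs of None \<Rightarrow> Nop | Some es \<Rightarrow> req_gen tag es (Cn 0)) \<subseteq> small_loops" if "zs = xs \<or> zs = ys" for zs
  proof (cases zs)
    case (Some z)
    then have "\<forall>t \<in> set z. small_ex t" using assms(1) that by metis
    from small_req_gen[OF this c0] show ?thesis using Some by simp
  qed simp
  have "1 \<in> small_loops" by (simp add: small_loops_def)
  then show ?thesis using *[of xs] *[of ys] assms(2) unfolding tog_gen_def small_ex_def by simp
qed

lemma small_phase_gen:
  assumes "toggle_syntax eN eM gi xs ys qs e" "small_ex f"
  shows "vars_below_gen 19 (phase_gen Mo f xs ys qs e) \<and> loop_vars_gen (phase_gen Mo f xs ys qs e) \<subseteq> small_loops"
proof -
  have 1: "\<forall>z. xs = Some z \<or> ys = Some z \<longrightarrow> (\<forall>t \<in> set z. small_ex t)" "\<forall>t \<in> set qs. small_ex t" "small_ex e"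
    using assms(1) by (auto simp: toggle_syntax_def)
  have 2: "\<forall>z. ys = Some z \<or> xs = Some z \<longrightarrow> (\<forall>t \<in> set z. small_ex t)" using 1(1) by blast
  show ?thesis
    using small_tog_gen[OF 1(1) assms(2)] small_tog_gen[OF 2 assms(2)] small_req_gen[OF 1(2,3)] by (cases Mo) simp_all
qed

lemma small_beta_fals: "small_ex (beta_fals g)"
  by (simp add: small_ex_def beta_fals_def small_loops_def)

lemma length_phase_reqs: "length (phase_reqs Mo q D x y qa e) \<le> 2 * q + 1"
  using length_togs[of q D x y] length_togs[of q D y x] by (cases Mo) auto

theorem toggle_reduces:
  assumes syn: "toggle_syntax eN eM gi xs ys qs e" and \<epsilon>: "\<epsilon> \<le> real g" and wc: "wc \<longleftrightarrow> Mo \<noteq> Fully_Dynamic"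
    and inst: "\<And>k. \<exists>\<kappa> a. 2 \<le> a \<and> k \<le> \<kappa> \<and> (\<forall>n F L. kcnf k n F \<and> g * L \<le> n \<and> L \<le> n \<longrightarrow> toggle_instance Mo Q g eN eM gi xs ys qs e \<kappa> a n F L)"
    and g: "1 \<le> g"
  shows "reduces wc Mo Q g (m_pow (real g - \<epsilon>)) \<epsilon>"
proof -
  let ?gr = "phase_gen Mo (beta_fals g) xs ys qs e"
  have gr: "vars_below_gen 19 ?gr" "loop_vars_gen ?gr \<subseteq> {0, 1, 2, 9} \<union> {11..18}"
    using small_phase_gen[OF syn small_beta_fals[of g], of Mo] by (auto simp: small_loops_def)
  have l: "insert 3 small_loops = {0, 1, 2, 3, 9} \<union> {11..18}" by (auto simp: small_loops_def)
  have "\<exists>\<kappa> a. \<forall>n F L. kcnf k n F \<and> g * L \<le> n \<longrightarrow> reduction_instance wc Mo Q g (m_pow (real g - \<epsilon>)) \<epsilon> eN eM gi ?gr \<kappa> a n F L" for k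
  proof -
    from inst[of k] obtain \<kappa> a where a2: "2 \<le> a" and \<kappa>: "k \<le> \<kappa>" and
      ti: "\<And>n F L. kcnf k n F \<Longrightarrow> g * L \<le> n \<Longrightarrow> L \<le> n \<Longrightarrow> toggle_instance Mo Q g eN eM gi xs ys qs e \<kappa> a n F L" by blast
    have "reduction_instance wc Mo Q g (m_pow (real g - \<epsilon>)) \<epsilon> eN eM gi ?gr \<kappa> a n F L"
      if F: "kcnf k n F" and gL: "g * L \<le> n" for n F L
    proof -
      define m where "m = input_fun (enc_cnf n F)"
      define q where "q = length F"
      define Y where "Y = n + q + \<kappa> + 2"
      define Nb :: nat where "Nb = 2 ^ (n - g * L)"
      define D where "D b = (\<lambda>c. pfals (g * L) n (b * 2 ^ (g * L)) (F ! c))" for b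
      interpret cnf_memory k n F m by unfold_locales (use F m_def in auto)
      have Ln: "L \<le> n" using gL g by (metis le_trans mult_le_mono1 nat_mult_1)
      from ti[OF F gL Ln, unfolded toggle_instance_def Let_def, folded m_def q_def D_def, folded Y_def Nb_def]
      obtain N M inp stt x y qa eb where
        evs: "\<forall>s. std_env n q L g \<kappa> s \<longrightarrow> ev m s eN = N \<and> (s 7 = N \<longrightarrow> ev m s eM = M) \<and>
           (s 7 = N \<and> s 8 = M \<longrightarrow> gl m s gi = inp \<and>
             (s 5 < Nb \<longrightarrow> map (ev m s) qs = qa (s 5) \<and> ev m s e = eb (s 5)) \<and>
             (\<forall>c<q. map_option (map (ev m (s(12 := c)))) xs = x c \<and> map_option (map (ev m (s(12 := c)))) ys = y c))"
        and tg: "toggling (Q N M) q x y stt" and st: "(inp, stt (toggling.start_set q x y Mo)) \<in> start (Q N M)"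
        and ask: "\<forall>b<Nb. can_ask (Q N M) (stt (set (togs q (D b) x y))) (qa b)"
        and sat: "satisfiable F \<longleftrightarrow> (\<exists>b<Nb. ans (Q N M) (stt (set (togs q (D b) x y))) (qa b) \<noteq> eb b)"
        and size: "2 ^ L \<le> N" "2 ^ L \<le> M" "N \<le> 2 ^ L * Y ^ a" "M \<le> 2 ^ L * Y ^ a" "length inp \<le> 2 ^ L * Y ^ a"
        by (elim exE conjE) (rule that)
      interpret toggling "Q N M" q x y stt by (rule tg)
      define rs where "rs b = phase_reqs Mo q (D b) x y (qa b) (eb b)" for b
      let ?s0 = "stt (start_set Mo)"
      have len2: "\<And>z. xs = Some z \<Longrightarrow> length z \<le> 2" "\<And>z. ys = Some z \<Longrightarrow> length z \<le> 2" "length qs \<le> 2"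
        using syn by (auto simp: toggle_syntax_def)
      have gl_gr: "gl m s ?gr = concat (map record_words (rs (s 5)))"
        if s: "std_env n q L g \<kappa> s" "s 7 = N" "s 8 = M" "s 5 < Nb" for s
      proof -
        have e1: "map (ev m s) qs = qa (s 5)" "ev m s e = eb (s 5)" and
          e2: "\<And>c. c < q \<Longrightarrow> map_option (map (ev m (s(12 := c)))) xs = x c" "\<And>c. c < q \<Longrightarrow> map_option (map (ev m (s(12 := c)))) ys = y c"
          using evs s by blast+
        have s1: "s 1 = q" using s(1) by (simp add: std_env_def)
        have f: "ev m (s(12 := c)) (beta_fals g) = of_bool (D (s 5) c)" if "c < q" for c
        proof -
          have "ev m (s(12 := c)) (beta_fals g) = of_bool (pfals (ev m (s(12 := c)) (Bin BMul (Cn g) (Vr 2)))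
             (ev m (s(12 := c)) (Vr 0)) (ev m (s(12 := c)) (Bin BMul (Vr 5) (Vr 4))) (F ! (s(12 := c)) 12))"
            unfolding beta_fals_def by (rule ev_fals_ex) (use that s(1) \<kappa> in \<open>auto simp: q_def std_env_def\<close>)
          then show ?thesis using s(1) by (simp add: std_env_def D_def)
        qed
        have t: "gl m s (tog_gen tag (beta_fals g) xs ys) = concat (map record_words (map (\<lambda>a. (mk_request tag a, 0)) (togs q (D (s 5)) x y)))"
          "gl m s (tog_gen tag (beta_fals g) ys xs) = concat (map record_words (map (\<lambda>a. (mk_request tag a, 0)) (togs q (D (s 5)) y x)))"
          if "tag < 2" for tag
          by (rule gl_tog_gen[OF that len2(1,2) s1 f e2], assumption+) (rule gl_tog_gen[OF that len2(2,1) s1 f e2(2,1)], assumption+)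
        have r: "gl m s (req_gen 2 qs e) = record_words (Query (qa (s 5)), eb (s 5))"
          using gl_req_gen[OF len2(3), of 2 m s e] e1 by (simp add: mk_request_def del: record_words.simps)
        show ?thesis unfolding rs_def using t[of 0] t[of 1] r
          by (cases Mo) (simp_all add: mk_request_def del: record_words.simps)
      qed
      have short1: "short (Ins a)" "short (Del a)" if "a \<in> all_toggles q x y \<union> all_toggles q y x" for a
      proof -
        have "std_env n q L g \<kappa> s \<Longrightarrow> s 7 = N \<Longrightarrow> s 8 = M \<Longrightarrow> length a \<le> 2" for s
        proof -
          assume s: "std_env n q L g \<kappa> s" "s 7 = N" "s 8 = M"
          from that obtain c where c: "c < q" "x c = Some a \<or> y c = Some a" by (auto simp: all_toggles_def)
          have "map_option (map (ev m (s(12 := c)))) xs = x c" "map_option (map (ev m (s(12 := c)))) ys = y c"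
            using evs s c(1) by blast+
          then show "length a \<le> 2" using c(2) len2 by auto
        qed
        \<comment> \<open>Toggles are linked to their expressions only through environments that
          satisfy \<open>std_env\<close>; exhibiting one yields the bound on the number of
          arguments.\<close>
        from this[of "(\<lambda>_. 0)(0 := n, 1 := q, 2 := L, 3 := 2 ^ L, 4 := 2 ^ (g * L), 9 := q + \<kappa>, 10 := 2 ^ (n - g * L), 7 := N, 8 := M)"]
        have "length a \<le> 2" by (simp add: std_env_def)
        then show "short (Ins a)" "short (Del a)" by (simp_all add: short_def)
      qed
      have short2: "short (Query (qa b))" if "b < Nb" for b
      proof -
        let ?s = "(\<lambda>_::nat. 0::nat)(0 := n, 1 := q, 2 := L, 3 := 2 ^ L, 4 := 2 ^ (g * L), 9 := q + \<kappa>, 10 := 2 ^ (n - g * L), 7 := N, 8 := M, 5 := b)"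
        have "std_env n q L g \<kappa> ?s" "?s 7 = N" "?s 8 = M" "?s 5 = b" by (simp_all add: std_env_def)
        then have "map (ev m ?s) qs = qa b" using evs that by metis
        then have "length (qa b) = length qs" by (metis length_map)
        then show ?thesis using len2(3) by (simp add: short_def)
      qed
      have shorts: "\<forall>(rq, e) \<in> set (rs b). short rq" if "b < Nb" for b
      proof -
        have "set (togs q (D b) x y) \<subseteq> all_toggles q x y" "set (togs q (D b) y x) \<subseteq> all_toggles q y x"
          by (auto simp: set_togs all_toggles_def split: if_splits)
        then show ?thesis unfolding rs_def using short1 short2[OF that] by (cases Mo) auto
      qed
      have ask': "can_ask (Q N M) (stt (set (togs q (D b) x y))) (qa b)" if "b < Nb" for b using ask that by blast
      have vp: "valid_phases wc Mo (Q N M) ?s0 Nb rs (\<lambda>_. ?s0)"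
      proof (rule valid_phases_restoring[OF wc])
        show "valid_seq Mo (Q N M) ?s0 (map fst (rs b))" if "b < Nb" for b
          unfolding rs_def by (rule phase(1)[OF ask'[OF that]])
        show "fold (\<lambda>r s. upd (Q N M) s r) (map fst (rs b)) ?s0 = ?s0" if "b < Nb" "Mo = Fully_Dynamic" for b
          using phase(2)[OF ask'[OF that(1)] that(2)] that(2) unfolding rs_def by (simp add: start_set_def)
      qed
      have sat': "satisfiable F \<longleftrightarrow> (\<exists>b<Nb. hits (Q N M) ?s0 (rs b))"
        unfolding sat rs_def using phase(3)[OF ask'] by blast
      \<comment> \<open>At most \<open>q\<close> toggles, one query and \<open>q\<close> deletions;
        \<open>2 * q + 1 \<le> Y ^ 2\<close> explains the condition
        \<open>2 \<le> a\<close>.\<close>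
      have lenr: "length (rs b) \<le> Y ^ a" for b
      proof -
        have "length (rs b) \<le> 2 * q + 1" unfolding rs_def by (rule length_phase_reqs)
        also have "\<dots> \<le> Y ^ 2" by (simp add: Y_def power2_eq_square algebra_simps)
        also have "\<dots> \<le> Y ^ a" using a2 by (intro power_increasing) (auto simp: Y_def)
        finally show ?thesis .
      qed
      have L2: "(2::nat) ^ L * Y ^ a \<le> 2 ^ n * Y ^ a" using Ln by (intro mult_le_mono1 power_increasing) auto
      have M2: "m_pow (real g - \<epsilon>) N M \<le> (2 ^ L * real Y ^ a) powr (real g - \<epsilon>)"
      proof -
        have "real M \<le> real (2 ^ L * Y ^ a)" using size(4) by (rule of_nat_mono)
        then have "real M powr (real g - \<epsilon>) \<le> real (2 ^ L * Y ^ a) powr (real g - \<epsilon>)" using \<epsilon> by (intro powr_mono2) auto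
        then show ?thesis by (simp add: m_pow_def)
      qed
      show ?thesis unfolding reduction_instance_def Let_def m_def[symmetric] q_def[symmetric] Y_def[symmetric] Nb_def[symmetric]
      proof (rule exI[of _ N], rule exI[of _ M], rule exI[of _ inp], rule exI[of _ ?s0], rule exI[of _ rs],
          rule exI[of _ "\<lambda>_. ?s0"], intro conjI)
        show "\<forall>s. std_env n q L g \<kappa> s \<longrightarrow> ev m s eN = N \<and> (s 7 = N \<longrightarrow> ev m s eM = M) \<and>
           (s 7 = N \<and> s 8 = M \<longrightarrow> gl m s gi = inp \<and> (s 5 < Nb \<longrightarrow> gl m s ?gr = concat (map record_words (rs (s 5)))))"
          using evs gl_gr by blast
        show "\<forall>b<Nb. (\<forall>(rq, e) \<in> set (rs b). short rq) \<and> length (rs b) \<le> Y ^ a" using shorts lenr by blast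
        show "M \<le> 2 ^ n * Y ^ a" "length inp \<le> 2 ^ n * Y ^ a" using size(4,5) L2 by linarith+
      qed (use vp sat' st size M2 in auto)
    qed
    then show ?thesis by blast
  qed
  then show ?thesis unfolding reduces_def
    using syn gr by (intro exI[of _ eN] exI[of _ eM] exI[of _ gi] exI[of _ ?gr]) (simp add: toggle_syntax_def l)
qed


section \<open>The gadget for reachability counts and strongly connected components\<close>

section \<open>Strongly connected components\<close>

lemma wf_digraph_of: "E \<subseteq> {..<n} \<times> {..<n} \<Longrightarrow> wf_digraph (digraph_of n E)"
  by unfold_locales (auto simp: digraph_of_def)

lemma arcs_ends_digraph_of: "arcs_ends (digraph_of n E) = E"
  by (simp add: digraph_of_def arcs_ends_conv)

lemma verts_digraph_of [simp]: "verts (digraph_of n E) = {..<n}"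
  by (simp add: digraph_of_def)

lemma reachable_digraph_of:
  assumes "E \<subseteq> {..<n} \<times> {..<n}"
  shows "reachable (digraph_of n E) u v \<longleftrightarrow> u < n \<and> (u, v) \<in> E\<^sup>*"
proof -
  interpret wf_digraph "digraph_of n E" using assms by (rule wf_digraph_of)
  show ?thesis
  proof (cases "u < n")
    case True
    then show ?thesis using reachable_conv'[of u v] by (simp add: arcs_ends_digraph_of)
  next
    case False
    then show ?thesis using reachable_in_verts(1)[of u v] by auto
  qed
qed

text \<open>If \<open>cls\<close> separates exactly the classes of mutual reachability, components
  are its fibres, and counting them means counting the values of \<open>cls\<close>.\<close>

lemma sccs_by_classes:
  assumes E: "E \<subseteq> {..<n} \<times> {..<n}"
    and cls: "\<And>u v. u < n \<Longrightarrow> v < n \<Longrightarrow> (u, v) \<in> E\<^sup>* \<and> (v, u) \<in> E\<^sup>* \<longleftrightarrow> cls u = cls v"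
  shows "verts ` pre_digraph.sccs (digraph_of n E) = (\<lambda>x. {v. v < n \<and> cls v = x}) ` cls ` {..<n}"
    and "num_sccs (digraph_of n E) = card (cls ` {..<n})"
proof -
  interpret wf_digraph "digraph_of n E" using E by (rule wf_digraph_of)
  have s: "scc_of u = {v. v < n \<and> cls v = cls u}" if "u < n" for u
  proof -
    have "v \<in> scc_of u \<longleftrightarrow> v < n \<and> cls v = cls u" for v
      using that cls[of u v] reachable_in_verts(2)[of u v] by (auto simp: scc_of_def reachable_digraph_of[OF E])
    then show ?thesis by blast
  qed
  have v: "sccs_verts = (\<lambda>x. {v. v < n \<and> cls v = x}) ` cls ` {..<n}"
    unfolding sccs_verts_conv_scc_of image_image by (rule image_cong) (simp_all add: s)
  then show "verts ` sccs = (\<lambda>x. {v. v < n \<and> cls v = x}) ` cls ` {..<n}" by (simp add: sccs_verts_conv)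
  have "inj_on (\<lambda>x. {v. v < n \<and> cls v = x}) (cls ` {..<n})"
    by (rule inj_onI) blast
  then show "num_sccs (digraph_of n E) = card (cls ` {..<n})"
    unfolding num_sccs_def card_sccs_verts[symmetric] v by (rule card_image)
qed

text \<open>
  Node 0 is the source, node 1 a sink, node \<open>2 + c\<close> stands for clause \<open>c\<close>, and \<open>K\<close> nodes stand for
  each partial assignment \<open>a < A\<close>.  The relation \<open>fa a c\<close> says that \<open>a\<close> falsifies
  clause \<open>c\<close>, and \<open>D c\<close> that the current assignment of the other variables does.
\<close>

locale scc_gadget =
  fixes q A K :: nat and fa :: "nat \<Rightarrow> nat \<Rightarrow> bool"
  assumes K: "q + 3 \<le> K" and A: "1 \<le> A"
begin

definition N :: nat where "N = 2 + q + A * K"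

definition nd :: "nat \<Rightarrow> nat \<Rightarrow> nat" where "nd a j = 2 + q + a * K + j"

definition arcs0 :: "(nat \<times> nat) list" where
  "arcs0 = concat (map (\<lambda>c. [(1, 2 + c), (2 + c, 0)]) [0..<q]) @
    concat (map (\<lambda>a. concat (map (\<lambda>c. if fa a c then map (\<lambda>j. (2 + c, nd a j)) [0..<K] else []) [0..<q])) [0..<A]) @
    concat (map (\<lambda>a. map (\<lambda>j. (nd a j, 0)) [0..<K]) [0..<A])"

text \<open>Each clause node lies on a path from 1 to 0. Its toggle closes a cycle through 0 if
  \<open>D c\<close> and through 1 otherwise, so the node joins the component of 0 or of 1. All
  copies of \<open>a\<close> have an arc to 0 and are entered from the clauses that \<open>a\<close>
  falsifies. They join the component of 0 iff one of these clauses satisfies \<open>D\<close>;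
  otherwise each copy is a component by itself.\<close>

definition arcsD :: "(nat \<Rightarrow> bool) \<Rightarrow> (nat \<times> nat) set" where
  "arcsD D = {(0, 2 + c) | c. c < q \<and> D c} \<union> {(2 + c, 1) | c. c < q \<and> \<not> D c}"

lemma set_arcs0: "set arcs0 = {(1, 2 + c) | c. c < q} \<union> {(2 + c, 0) | c. c < q} \<union>
    {(2 + c, nd a j) | a c j. a < A \<and> c < q \<and> fa a c \<and> j < K} \<union> {(nd a j, 0) | a j. a < A \<and> j < K}"
  unfolding arcs0_def by (auto split: if_splits; force)

lemma K0: "0 < K" using K by simp

lemma nd_inj: "a < A \<Longrightarrow> j < K \<Longrightarrow> j' < K \<Longrightarrow> nd a j = nd a' j' \<longleftrightarrow> a = a' \<and> j = j'"
proof
  assume *: "j < K" "j' < K" "nd a j = nd a' j'"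
  then have e: "a * K + j = a' * K + j'" by (simp add: nd_def)
  have "(a * K + j) div K = a" "(a' * K + j') div K = a'" using * by simp_all
  then have "a = a'" using e by simp
  then show "a = a' \<and> j = j'" using e by simp
qed simp

lemma nd_ge: "2 + q \<le> nd a j" by (simp add: nd_def)

lemma nd_less:
  assumes "a < A" "j < K"
  shows "nd a j < N"
proof -
  have "a * K + j < (a + 1) * K" using assms by simp
  also have "\<dots> \<le> A * K" using assms by (intro mult_le_mono1) simp
  finally show ?thesis by (simp add: nd_def N_def)
qed

lemma nd_cases:
  assumes "v < N"
  obtains "v = 0" | "v = 1" | c where "c < q" "v = 2 + c" | a j where "a < A" "j < K" "v = nd a j"
proof -
  consider "v = 0" | "v = 1" | "2 \<le> v" "v < 2 + q" | "2 + q \<le> v" by linarith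
  then show thesis
  proof cases
    case 3
    then show ?thesis using that(3)[of "v - 2"] by simp
  next
    case 4
    define x where "x = v - (2 + q)"
    have x: "x < A * K" using 4 assms by (simp add: x_def N_def)
    have "x div K < A" using x K0 by (simp add: less_mult_imp_div_less)
    moreover have "v = nd (x div K) (x mod K)" using 4 by (simp add: nd_def x_def)
    ultimately show ?thesis using that(4)[of "x div K" "x mod K"] K0 by simp
  qed (use that in auto)
qed

lemma arcs_less: "set arcs0 \<union> arcsD D \<subseteq> {..<N} \<times> {..<N}"
  using nd_less unfolding set_arcs0 arcsD_def by (auto simp: N_def)

definition bad :: "(nat \<Rightarrow> bool) \<Rightarrow> nat \<Rightarrow> bool" where
  "bad D a \<longleftrightarrow> (\<exists>c<q. fa a c \<and> D c)"

definition cls :: "(nat \<Rightarrow> bool) \<Rightarrow> nat \<Rightarrow> nat" where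
  "cls D v = (if v < 2 then v else if v < 2 + q then (if D (v - 2) then 0 else 1)
     else if bad D ((v - 2 - q) div K) then 0 else v)"

lemma cls_simps [simp]: "cls D 0 = 0" "cls D (Suc 0) = 1" "c < q \<Longrightarrow> cls D (Suc (Suc c)) = (if D c then 0 else 1)"
  by (simp_all add: cls_def)

lemma cls_nd [simp]: "j < K \<Longrightarrow> cls D (nd a j) = (if bad D a then 0 else nd a j)"
  by (simp add: cls_def nd_def)

text \<open>A topological order of the condensation: from the component of 1 through the isolated
  copies down to the component of 0. Its strict decrease between classes shows that different
  classes are not mutually reachable.\<close>

definition rank :: "(nat \<Rightarrow> bool) \<Rightarrow> nat \<Rightarrow> nat" where
  "rank D v = (if cls D v = 0 then 0 else if cls D v = 1 then 2 else 1)"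

lemma reach_rank:
  assumes "(u, v) \<in> (set arcs0 \<union> arcsD D)\<^sup>*"
  shows "cls D u = cls D v \<or> rank D v < rank D u"
  using assms
proof (induction rule: rtrancl_induct)
  case (step v w)
  have "cls D v = cls D w \<or> rank D w < rank D v"
    using step(2) nd_ge unfolding set_arcs0 arcsD_def rank_def
    by (auto simp: bad_def split: if_splits)
  then show ?case using step(3) by (auto simp: rank_def split: if_splits)
qed simp

lemma from_classes:
  assumes "v < N"
  shows "cls D v = 0 \<Longrightarrow> (0, v) \<in> (set arcs0 \<union> arcsD D)\<^sup>* \<and> (v, 0) \<in> (set arcs0 \<union> arcsD D)\<^sup>*"
    and "cls D v = 1 \<Longrightarrow> (1, v) \<in> (set arcs0 \<union> arcsD D)\<^sup>* \<and> (v, 1) \<in> (set arcs0 \<union> arcsD D)\<^sup>*"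
proof -
  let ?E = "set arcs0 \<union> arcsD D"
  have b: "(0, nd a j) \<in> ?E\<^sup>*" if a: "a < A" "j < K" "bad D a" for a j
  proof -
    obtain c where c: "c < q" "fa a c" "D c" using a by (auto simp: bad_def)
    have "(0, 2 + c) \<in> ?E" "(2 + c, nd a j) \<in> ?E" using c a unfolding set_arcs0 arcsD_def by auto
    then show ?thesis by (meson r_into_rtrancl rtrancl_trans)
  qed
  have n1: "nd a j \<noteq> Suc 0" "nd a j \<noteq> 0" for a j by (simp_all add: nd_def)
  show "(0, v) \<in> ?E\<^sup>* \<and> (v, 0) \<in> ?E\<^sup>*" if z: "cls D v = 0"
    using assms
  proof (cases rule: nd_cases)
    case (3 c)
    then have "D c" using z by (simp split: if_splits)
    then show ?thesis using 3 by (auto simp: set_arcs0 arcsD_def)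
  next
    case (4 a j)
    then have "bad D a" using z n1(2)[of a j] by (auto split: if_splits)
    then show ?thesis using b[of a j] 4 by (auto simp: set_arcs0)
  qed (use z in auto)
  show "(1, v) \<in> ?E\<^sup>* \<and> (v, 1) \<in> ?E\<^sup>*" if z: "cls D v = 1"
    using assms
  proof (cases rule: nd_cases)
    case (3 c)
    then have "\<not> D c" using z by (simp split: if_splits)
    then show ?thesis using 3 by (auto simp: set_arcs0 arcsD_def)
  next
    case (4 a j)
    then show ?thesis using z n1 by (simp split: if_splits)
  qed (use z in auto)
qed

lemma mutual_reach:
  assumes "u < N" "v < N"
  shows "(u, v) \<in> (set arcs0 \<union> arcsD D)\<^sup>* \<and> (v, u) \<in> (set arcs0 \<union> arcsD D)\<^sup>* \<longleftrightarrow> cls D u = cls D v"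
proof
  assume "(u, v) \<in> (set arcs0 \<union> arcsD D)\<^sup>* \<and> (v, u) \<in> (set arcs0 \<union> arcsD D)\<^sup>*"
  then show "cls D u = cls D v" using reach_rank[of u v D] reach_rank[of v u D] by linarith
next
  assume e: "cls D u = cls D v"
  consider "cls D v = 0" | "cls D v = 1" | "cls D v = v" "cls D u = u"
  proof -
    have "cls D w = 0 \<or> cls D w = 1 \<or> cls D w = w" for w unfolding cls_def by (auto split: if_split)
    from this[of u] this[of v] show thesis using that e by metis
  qed
  then show "(u, v) \<in> (set arcs0 \<union> arcsD D)\<^sup>* \<and> (v, u) \<in> (set arcs0 \<union> arcsD D)\<^sup>*"
  proof cases
    case 1
    then show ?thesis using from_classes(1)[OF assms(1), of D] from_classes(1)[OF assms(2), of D] e by (auto intro: rtrancl_trans)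
  next
    case 2
    then show ?thesis using from_classes(2)[OF assms(1), of D] from_classes(2)[OF assms(2), of D] e by (auto intro: rtrancl_trans)
  next
    case 3
    then show ?thesis using e by simp
  qed
qed

lemma inj_nd: "inj_on (\<lambda>(a, j). nd a j) ({..<A} \<times> {..<K})"
  by (rule inj_onI) (auto simp: nd_inj)

lemma class0_card: "card {v. v < N \<and> cls D v = 0} = 1 + card {c. c < q \<and> D c} + K * card {a. a < A \<and> bad D a}"
proof -
  let ?B = "{a. a < A \<and> bad D a}" and ?C = "{c. c < q \<and> D c}"
  have n1: "nd a j \<noteq> Suc 0" "nd a j \<noteq> 0" for a j by (simp_all add: nd_def)
  have "{v. v < N \<and> cls D v = 0} = {0} \<union> (\<lambda>c. 2 + c) ` ?C \<union> (\<lambda>(a, j). nd a j) ` (?B \<times> {..<K})" (is "?L = ?R")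
  proof (intro set_eqI iffI)
    fix v assume "v \<in> ?L"
    then have v: "v < N" "cls D v = 0" by auto
    show "v \<in> ?R" using v(1) by (cases rule: nd_cases) (use v(2) n1 in \<open>auto split: if_splits\<close>)
  next
    fix v assume "v \<in> ?R"
    then show "v \<in> ?L" using nd_less by (auto simp: N_def)
  qed
  moreover have "card ((\<lambda>c. 2 + c) ` ?C) = card ?C" by (rule card_image) (simp add: inj_on_def)
  moreover have "card ((\<lambda>(a, j). nd a j) ` (?B \<times> {..<K})) = card ?B * K"
    by (subst card_image[OF inj_on_subset[OF inj_nd]]) (auto simp: card_cartesian_product)
  moreover have "card ({0} \<union> (\<lambda>c. 2 + c) ` ?C \<union> (\<lambda>(a, j). nd a j) ` (?B \<times> {..<K})) =
     card ({0::nat} \<union> (\<lambda>c. 2 + c) ` ?C) + card ((\<lambda>(a, j). nd a j) ` (?B \<times> {..<K}))"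
    by (rule card_Un_disjoint) (use nd_ge in \<open>auto simp: nd_def\<close>)
  moreover have "card ({0::nat} \<union> (\<lambda>c. 2 + c) ` ?C) = 1 + card ((\<lambda>c. 2 + c) ` ?C)"
    by (subst card_Un_disjoint) auto
  ultimately show ?thesis by (simp add: mult.commute)
qed

lemma classes: "cls D ` {..<N} = {0, 1} \<union> (\<lambda>(a, j). nd a j) ` ({a. a < A \<and> \<not> bad D a} \<times> {..<K})" (is "?L = ?R")
proof (intro set_eqI iffI)
  fix x assume "x \<in> ?L"
  then obtain v where v: "v < N" "x = cls D v" by auto
  show "x \<in> ?R" using v(1) by (cases rule: nd_cases) (use v(2) in \<open>auto split: if_splits\<close>)
next
  fix x assume "x \<in> ?R"
  then consider "x = 0" | "x = 1" | a j where "a < A" "\<not> bad D a" "j < K" "x = nd a j" by auto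
  then show "x \<in> ?L"
  proof cases
    case 1
    have "cls D 0 \<in> ?L" by (rule imageI) (simp add: N_def)
    then show ?thesis using 1 by simp
  next
    case 2
    have "cls D 1 \<in> ?L" by (rule imageI) (simp add: N_def)
    then show ?thesis using 2 by simp
  next
    case (3 a j)
    have "cls D (nd a j) \<in> ?L" by (rule imageI) (simp add: nd_less 3)
    then show ?thesis using 3 by simp
  qed
qed

lemma card_classes: "card (cls D ` {..<N}) = 2 + K * card {a. a < A \<and> \<not> bad D a}"
proof -
  let ?G = "{a. a < A \<and> \<not> bad D a}"
  have "card ((\<lambda>(a, j). nd a j) ` (?G \<times> {..<K})) = card ?G * K"
    by (subst card_image[OF inj_on_subset[OF inj_nd]]) (auto simp: card_cartesian_product)
  moreover have "card ({0, 1} \<union> (\<lambda>(a, j). nd a j) ` (?G \<times> {..<K})) = card {0::nat, 1} + card ((\<lambda>(a, j). nd a j) ` (?G \<times> {..<K}))"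
    by (rule card_Un_disjoint) (auto simp: nd_def)
  ultimately show ?thesis unfolding classes by (simp add: mult.commute)
qed

lemma good_card: "0 < card {a. a < A \<and> \<not> bad D a} \<longleftrightarrow> (\<exists>a<A. \<not> bad D a)"
  by (auto simp: card_gt_0_iff)

lemma bad_card: "card {a. a < A \<and> bad D a} < A \<longleftrightarrow> (\<exists>a<A. \<not> bad D a)" "card {a. a < A \<and> bad D a} \<le> A"
proof -
  have f: "{a. a < A \<and> bad D a} \<subseteq> {..<A}" by auto
  show "card {a. a < A \<and> bad D a} \<le> A" using card_mono[OF _ f] by simp
  show "card {a. a < A \<and> bad D a} < A \<longleftrightarrow> (\<exists>a<A. \<not> bad D a)"
  proof
    assume "card {a. a < A \<and> bad D a} < A"
    then have "{a. a < A \<and> bad D a} \<noteq> {..<A}" by (metis card_lessThan less_irrefl)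
    then show "\<exists>a<A. \<not> bad D a" by blast
  next
    assume "\<exists>a<A. \<not> bad D a"
    then have "{a. a < A \<and> bad D a} \<subset> {..<A}" by blast
    from psubset_card_mono[OF _ this] show "card {a. a < A \<and> bad D a} < A" by simp
  qed
qed

abbreviation scc_graph :: "(nat \<Rightarrow> bool) \<Rightarrow> (nat, nat \<times> nat) pre_digraph" where
  "scc_graph D \<equiv> digraph_of N (set arcs0 \<union> arcsD D)"

lemma num_sccs_scc_graph: "num_sccs (scc_graph D) = 2 + K * card {a. a < A \<and> \<not> bad D a}"
  using sccs_by_classes(2)[OF arcs_less mutual_reach] card_classes by simp

lemma reach_count: "card {v. reachable (scc_graph D) 0 v} = 1 + card {c. c < q \<and> D c} + K * card {a. a < A \<and> bad D a}"
proof -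
  interpret wf_digraph "scc_graph D" by (rule wf_digraph_of[OF arcs_less])
  have "reachable (scc_graph D) 0 v \<longleftrightarrow> v < N \<and> cls D v = 0" for v
  proof
    assume r: "reachable (scc_graph D) 0 v"
    then have "(0, v) \<in> (set arcs0 \<union> arcsD D)\<^sup>*" by (simp add: reachable_digraph_of[OF arcs_less])
    from reach_rank[OF this] have "cls D v = 0" by (auto simp: rank_def split: if_splits)
    moreover have "v < N" using reachable_in_verts(2)[OF r] by simp
    ultimately show "v < N \<and> cls D v = 0" by simp
  next
    assume "v < N \<and> cls D v = 0"
    moreover have "0 < N" by (simp add: N_def)
    ultimately show "reachable (scc_graph D) 0 v" using from_classes(1)[of v D] by (simp add: reachable_digraph_of[OF arcs_less])
  qed
  then show ?thesis using class0_card by simp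
qed

text \<open>The size of the component of 0 when every partial assignment is bad. It varies with the
  number of falsified clauses, so each phase computes it anew and uses it as query argument or as
  expected answer.\<close>

definition full :: "(nat \<Rightarrow> bool) \<Rightarrow> nat" where
  "full D = 1 + card {c. c < q \<and> D c} + K * A"

text \<open>The component of 1 has at most \<open>1 + q\<close> nodes and the other ones are
  singletons, so \<open>q + 3 \<le> K\<close> and \<open>1 \<le> A\<close> leave only the component
  of 0 to attain \<open>full D\<close>. It does so iff no partial assignment is good.\<close>

lemma max_scc: "Max ((\<lambda>H. card (verts H)) ` pre_digraph.sccs (scc_graph D)) \<noteq> full D \<longleftrightarrow> (\<exists>a<A. \<not> bad D a)"
proof -
  let ?S = "(\<lambda>x. {v. v < N \<and> cls D v = x}) ` cls D ` {..<N}"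
  have "(\<lambda>H. card (verts H)) ` pre_digraph.sccs (scc_graph D) = card ` verts ` pre_digraph.sccs (scc_graph D)" by (simp add: image_image)
  also have "verts ` pre_digraph.sccs (scc_graph D) = ?S" by (rule sccs_by_classes(1)[OF arcs_less mutual_reach])
  finally have M: "Max ((\<lambda>H. card (verts H)) ` pre_digraph.sccs (scc_graph D)) = Max (card ` ?S)" by simp
  have c0: "card {v. v < N \<and> cls D v = 0} \<in> card ` ?S" unfolding classes by blast
  have le: "card {v. v < N \<and> cls D v = x} < full D" if "x \<in> cls D ` {..<N}" "x \<noteq> 0" for x
  proof -
    have fin: "finite (insert 1 ((\<lambda>c. 2 + c) ` {..<q}))" by simp
    have "{v. v < N \<and> cls D v = x} \<subseteq> (if x = 1 then insert 1 ((\<lambda>c. 2 + c) ` {..<q}) else {x})"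
    proof
      fix v assume "v \<in> {v. v < N \<and> cls D v = x}"
      then have v: "v < N" "cls D v = x" by auto
      show "v \<in> (if x = 1 then insert 1 ((\<lambda>c. 2 + c) ` {..<q}) else {x})"
        using v(1)
      proof (cases rule: nd_cases)
        case (4 a j)
        then have "x = v" using v(2) that(2) by (auto split: if_splits)
        moreover have "nd a j \<noteq> Suc 0" by (simp add: nd_def)
        ultimately show ?thesis using 4 by auto
      qed (use v(2) that(2) in \<open>auto split: if_splits\<close>)
    qed
    then have "card {v. v < N \<and> cls D v = x} \<le> card (if x = 1 then insert 1 ((\<lambda>c. 2 + c) ` {..<q}) else {x})"
      by (intro card_mono) auto
    also have "\<dots> \<le> 1 + q" using card_image_le[of "{..<q}" "\<lambda>c. 2 + c"] card_insert_le_m1[of "1 + q"] by (auto simp: card_insert_if)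
    also have "\<dots> < full D"
    proof -
      have "K * 1 \<le> K * A" using A by (rule mult_le_mono2)
      then have "q + 3 \<le> K * A" using K by linarith
      then show ?thesis by (simp add: full_def)
    qed
    finally show ?thesis .
  qed
  have bd: "y < full D \<or> y = card {v. v < N \<and> cls D v = 0}" if "y \<in> card ` ?S" for y
  proof -
    from that obtain x where x: "x \<in> cls D ` {..<N}" "y = card {v. v < N \<and> cls D v = x}" by (elim imageE) (auto simp only:)
    show ?thesis using le[OF x(1)] x(2) by (cases "x = 0") simp_all
  qed
  have fin: "finite (card ` ?S)" by simp
  show ?thesis
  proof (cases "\<exists>a<A. \<not> bad D a")
    case True
    then have "card {a. a < A \<and> bad D a} < A" using bad_card by simp
    then have "K * card {a. a < A \<and> bad D a} < K * A" using K0 by simp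
    then have "card {v. v < N \<and> cls D v = 0} < full D" by (simp add: class0_card full_def)
    then have "y < full D" if "y \<in> card ` ?S" for y using bd[OF that] by (elim disjE) simp_all
    moreover have "Max (card ` ?S) \<in> card ` ?S" by (rule Max_in[OF fin]) (use c0 in blast)
    ultimately have "Max (card ` ?S) < full D" by blast
    then show ?thesis unfolding M using True by simp
  next
    case False
    then have "{a. a < A \<and> bad D a} = {..<A}" by blast
    then have "card {a. a < A \<and> bad D a} = A" by simp
    then have e: "card {v. v < N \<and> cls D v = 0} = full D" by (simp add: class0_card full_def)
    have "y \<le> full D" if "y \<in> card ` ?S" for y using bd[OF that] e by (elim disjE) simp_all
    moreover have "full D \<in> card ` ?S" using c0 unfolding e .
    ultimately have "Max (card ` ?S) = full D" using fin by (intro Max_eqI)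
    then show ?thesis unfolding M using False by blast
  qed
qed

end


section \<open>Edge insertions and deletions as toggles\<close>

section \<open>Toggling edges\<close>

text \<open>
  A problem on graphs with a dynamic edge set.  The map \<open>\<phi>\<close> is the identity for directed graphs and
  forgets the orientation for undirected ones; \<open>pre\<close> and \<open>wrap\<close> add the fixed part of the
  instance to the input and to the state.
\<close>

definition edge_dynamics :: "(nat \<times> nat \<Rightarrow> 'e) \<Rightarrow> nat \<Rightarrow> nat \<Rightarrow> 's dyn_problem \<Rightarrow> nat list \<Rightarrow> ('e set \<Rightarrow> 's) \<Rightarrow> bool" where
  "edge_dynamics \<phi> n m Q pre wrap \<longleftrightarrow>
    (\<forall>es. distinct (map \<phi> es) \<and> length es \<le> m \<and> (\<forall>(u, v) \<in> set es. u < n \<and> v < n \<and> u \<noteq> v) \<longrightarrow>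
       (n # m # pre @ enc_pairs es, wrap (\<phi> ` set es)) \<in> start Q) \<and>
    (\<forall>E u v. (u < n \<and> v < n \<and> u \<noteq> v \<and> \<phi> (u, v) \<notin> E \<and> card E < m \<longrightarrow> can_ins Q (wrap E) [u, v]) \<and>
       ins Q (wrap E) [u, v] = wrap (insert (\<phi> (u, v)) E) \<and>
       (\<phi> (u, v) \<in> E \<longrightarrow> can_del Q (wrap E) [u, v]) \<and> del Q (wrap E) [u, v] = wrap (E - {\<phi> (u, v)}))"

text \<open>\<open>\<phi>\<close> is injective on all edges that ever occur, so adding or removing a
  toggle commutes with taking images. As \<open>m\<close> admits all of them together, the insertion
  of a missing toggle never hits the limit.\<close>

lemma edge_toggling:
  assumes dyn: "edge_dynamics \<phi> n m Q pre wrap" and dist: "toggles_distinct q x y"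
    and d: "distinct (map \<phi> (es0 @ esT))" and r: "\<And>u v. (u, v) \<in> set (es0 @ esT) \<Longrightarrow> u < n \<and> v < n \<and> u \<noteq> v"
    and len: "length (es0 @ esT) \<le> m" and all: "all_toggles q x y = (\<lambda>(u, v). [u, v]) ` set esT"
  shows "toggling Q q x y (\<lambda>S. wrap (\<phi> ` (set es0 \<union> {(u, v). [u, v] \<in> S})))"
proof
  show "toggles_distinct q x y" by (rule dist)
  fix S a assume S: "S \<subseteq> all_toggles q x y"
  let ?T = "\<lambda>S. {(u, v). [u, v] \<in> S}"
  have inj: "inj_on \<phi> (set (es0 @ esT))" using d unfolding distinct_map by blast
  have sub: "?T S \<subseteq> set esT"
  proof
    fix e assume "e \<in> ?T S"
    then obtain u v where e: "e = (u, v)" "[u, v] \<in> all_toggles q x y" using S by blast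
    then show "e \<in> set esT" unfolding all by auto
  qed
  {
    assume a: "a \<in> all_toggles q x y" "a \<notin> S"
    then obtain u v where uv: "a = [u, v]" "(u, v) \<in> set esT" unfolding all by auto
    have "(u, v) \<notin> set es0" using d uv(2) by (auto simp: distinct_map)
    then have notin: "(u, v) \<notin> set es0 \<union> ?T S" using a(2) uv(1) by auto
    have sub': "set es0 \<union> ?T S \<subseteq> set (es0 @ esT)" using sub by auto
    have n': "\<phi> (u, v) \<notin> \<phi> ` (set es0 \<union> ?T S)"
      using inj_on_image_mem_iff[OF inj _ sub', of "(u, v)"] notin uv(2) by simp
    have "set es0 \<union> ?T S \<subset> set (es0 @ esT)" using sub' notin uv(2) by auto
    then have "card (set es0 \<union> ?T S) < card (set (es0 @ esT))" by (intro psubset_card_mono) auto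
    also have "\<dots> \<le> m" using card_length[of "es0 @ esT"] len by linarith
    finally have "card (\<phi> ` (set es0 \<union> ?T S)) < m"
      using card_image_le[of "set es0 \<union> ?T S" \<phi>] finite_subset[OF sub'] by (meson finite_set le_less_trans)
    moreover have "set es0 \<union> ?T (insert a S) = insert (u, v) (set es0 \<union> ?T S)" using uv(1) by auto
    ultimately show "can_ins Q (wrap (\<phi> ` (set es0 \<union> ?T S))) a \<and>
      ins Q (wrap (\<phi> ` (set es0 \<union> ?T S))) a = wrap (\<phi> ` (set es0 \<union> ?T (insert a S)))"
      using dyn n' r[of u v] uv unfolding edge_dynamics_def by simp
  }
  {
    assume a: "a \<in> S"
    then obtain u v where uv: "a = [u, v]" "(u, v) \<in> set esT" using S unfolding all by auto
    have sub': "set es0 \<union> ?T S \<subseteq> set (es0 @ esT)" using sub by auto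
    have i: "(u, v) \<in> set es0 \<union> ?T S" using a uv(1) by simp
    have "(u, v) \<notin> set es0" using d uv(2) by (auto simp: distinct_map)
    then have e: "set es0 \<union> ?T (S - {a}) = (set es0 \<union> ?T S) - {(u, v)}" using uv(1) by auto
    have "\<phi> ` ((set es0 \<union> ?T S) - {(u, v)}) = \<phi> ` (set es0 \<union> ?T S) - {\<phi> (u, v)}"
      using inj_on_image_set_diff[OF inj_on_subset[OF inj sub'], of "set es0 \<union> ?T S" "{(u, v)}"] i by auto
    then show "can_del Q (wrap (\<phi> ` (set es0 \<union> ?T S))) a \<and>
      del Q (wrap (\<phi> ` (set es0 \<union> ?T S))) a = wrap (\<phi> ` (set es0 \<union> ?T (S - {a})))"
      using dyn imageI[OF i, of \<phi>] uv(1) unfolding edge_dynamics_def e by simp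
  }
qed

definition flat :: "(nat \<times> nat) list \<Rightarrow> nat list" where
  "flat es = concat (map (\<lambda>(u, v). [u, v]) es)"

lemma flat_simps [simp]: "flat [] = []" "flat ((u, v) # es) = u # v # flat es" "flat (es @ es') = flat es @ flat es'"
  "flat (concat (map f xs)) = concat (map (\<lambda>i. flat (f i)) xs)" "flat (map (\<lambda>i. (f' i, h' i)) ys) = concat (map (\<lambda>i. [f' i, h' i]) ys)"
  unfolding flat_def by (simp_all add: comp_def map_concat flip: concat_append) (induction xs; simp)

lemma length_flat [simp]: "length (flat es) = 2 * length es"
  by (induction es) auto

lemma enc_pairs_flat: "enc_pairs es = length es # flat es"
  by (simp add: enc_pairs_def flat_def)

lemma concat_upt_cong: "(\<And>i. i < n \<Longrightarrow> f i = g i) \<Longrightarrow> concat (map f [0..<n]) = concat (map g [0..<n])"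
  by (rule arg_cong[of _ _ concat]) simp

lemma distinct_concat_upt:
  "(\<And>i. i < n \<Longrightarrow> distinct (f i)) \<Longrightarrow> (\<And>i j. i < j \<Longrightarrow> j < n \<Longrightarrow> set (f i) \<inter> set (f j) = {}) \<Longrightarrow>
    distinct (concat (map f [0..<n]))"
proof (induction n)
  case (Suc n)
  have "(\<Union>i<n. set (f i)) \<inter> set (f n) = {}" using Suc.prems(2)[of _ n] by blast
  then show ?case using Suc by (simp add: atLeast0LessThan)
qed simp

lemma length_concat_upt_le: "(\<And>i. i < n \<Longrightarrow> length (f i) \<le> B) \<Longrightarrow> length (concat (map f [0..<n])) \<le> n * B"
  by (induction n) (auto simp: add.commute add_mono)

lemma vars_below_len_ex: "vars_below_gen B g \<Longrightarrow> vars_below B (len_ex g)"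
  by (induction g) auto

lemma loop_vars_len_ex: "loop_vars (len_ex g) \<subseteq> loop_vars_gen g"
  by (induction g) auto

text \<open>A decremental instance starts with all toggles present. The edge count that precedes the
  list is half the number of generated words.\<close>

definition edge_gen :: "mode \<Rightarrow> gen \<Rightarrow> gen \<Rightarrow> gen \<Rightarrow> gen" where
  "edge_gen Mo gp G0 GT = (let G = if Mo = Decremental then Sq G0 GT else G0 in
     Sq (Emit (Vr 7)) (Sq (Emit (Vr 8)) (Sq gp (Sq (Emit (Bin BDiv (len_ex G) (Cn 2))) G))))"

lemma gl_edge_gen:
  assumes "s 7 = N" "s 8 = M" "gl m s gp = pre" "gl m s G0 = flat es0" "gl m s GT = flat esT"
  shows "gl m s (edge_gen Mo gp G0 GT) = N # M # pre @ enc_pairs (es0 @ (if Mo = Decremental then esT else []))"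
  using assms by (simp add: edge_gen_def Let_def ev_len_ex enc_pairs_flat)

lemma edge_gen_vars:
  assumes "vars_below_gen 19 gp" "vars_below_gen 19 G0" "vars_below_gen 19 GT"
    "loop_vars_gen gp \<union> loop_vars_gen G0 \<union> loop_vars_gen GT \<subseteq> X"
  shows "vars_below_gen 19 (edge_gen Mo gp G0 GT) \<and> loop_vars_gen (edge_gen Mo gp G0 GT) \<subseteq> X"
  using assms vars_below_len_ex[of 19 G0] vars_below_len_ex[of 19 GT] loop_vars_len_ex[of G0] loop_vars_len_ex[of GT]
  by (auto simp: edge_gen_def Let_def)

lemma edge_toggle_instance:
  assumes defs: "m = input_fun (enc_cnf n F)" "q = length F" "Y = n + q + \<kappa> + 2" "Nb = 2 ^ (n - g * L)"
      "D = (\<lambda>b c. pfals (g * L) n (b * 2 ^ (g * L)) (F ! c))"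
    and evs: "\<And>s. std_env n q L g \<kappa> s \<Longrightarrow> ev m s eN = N" "\<And>s. std_env n q L g \<kappa> s \<Longrightarrow> s 7 = N \<Longrightarrow> ev m s eM = M"
      "\<And>s. std_env n q L g \<kappa> s \<Longrightarrow> s 7 = N \<Longrightarrow> s 8 = M \<Longrightarrow> gl m s gp = pre"
      "\<And>s. std_env n q L g \<kappa> s \<Longrightarrow> s 7 = N \<Longrightarrow> s 8 = M \<Longrightarrow> gl m s G0 = flat es0"
      "\<And>s. std_env n q L g \<kappa> s \<Longrightarrow> s 7 = N \<Longrightarrow> s 8 = M \<Longrightarrow> gl m s GT = flat esT"
      "\<And>s. std_env n q L g \<kappa> s \<Longrightarrow> s 7 = N \<Longrightarrow> s 8 = M \<Longrightarrow> s 5 < Nb \<Longrightarrow> map (ev m s) qs = qa (s 5) \<and> ev m s e = eb (s 5)"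
      "\<And>s c. std_env n q L g \<kappa> s \<Longrightarrow> c < q \<Longrightarrow> map_option (map (ev m (s(12 := c)))) xs = x c \<and> map_option (map (ev m (s(12 := c)))) ys = y c"
    and dyn: "edge_dynamics \<phi> N M (Q N M) pre wrap" and dist: "toggles_distinct q x y"
    and d: "distinct (map \<phi> (es0 @ esT))" and r: "\<And>u v. (u, v) \<in> set (es0 @ esT) \<Longrightarrow> u < N \<and> v < N \<and> u \<noteq> v"
    and len: "length (es0 @ esT) \<le> M" and all: "all_toggles q x y = (\<lambda>(u, v). [u, v]) ` set esT"
    and ask: "\<And>b. b < Nb \<Longrightarrow> can_ask (Q N M) (wrap (\<phi> ` (set es0 \<union> {(u, v). [u, v] \<in> set (togs q (D b) x y)}))) (qa b)"
    and sat: "satisfiable F \<longleftrightarrow> (\<exists>b<Nb. ans (Q N M) (wrap (\<phi> ` (set es0 \<union> {(u, v). [u, v] \<in> set (togs q (D b) x y)}))) (qa b) \<noteq> eb b)"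
    and size: "2 ^ L \<le> N" "2 ^ L \<le> M" "N \<le> 2 ^ L * Y ^ a" "length pre + 2 * M + 3 \<le> 2 ^ L * Y ^ a"
  shows "toggle_instance Mo Q g eN eM (edge_gen Mo gp G0 GT) xs ys qs e \<kappa> a n F L"
proof -
  let ?stt = "\<lambda>S. wrap (\<phi> ` (set es0 \<union> {(u, v). [u, v] \<in> S}))"
  let ?es = "es0 @ (if Mo = Decremental then esT else [])"
  let ?inp = "N # M # pre @ enc_pairs ?es"
  have tg: "toggling (Q N M) q x y ?stt" by (rule edge_toggling[OF dyn dist d r len all])
  have st: "(?inp, ?stt (toggling.start_set q x y Mo)) \<in> start (Q N M)"
  proof -
    have "{(u, v). [u, v] \<in> all_toggles q x y} = set esT" unfolding all by auto
    then have e: "\<phi> ` (set es0 \<union> {(u, v). [u, v] \<in> toggling.start_set q x y Mo}) = \<phi> ` set ?es"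
      unfolding toggling.start_set_def[OF tg] by simp
    have "(?inp, wrap (\<phi> ` set ?es)) \<in> start (Q N M)"
    proof -
      have "distinct (map \<phi> ?es) \<and> length ?es \<le> M \<and> (\<forall>(u, v) \<in> set ?es. u < N \<and> v < N \<and> u \<noteq> v)"
        using d r len by (auto split: if_splits)
      then show ?thesis using dyn unfolding edge_dynamics_def by blast
    qed
    then show ?thesis unfolding e .
  qed
  have E: "\<forall>s. std_env n q L g \<kappa> s \<longrightarrow> ev m s eN = N \<and> (s 7 = N \<longrightarrow> ev m s eM = M) \<and>
           (s 7 = N \<and> s 8 = M \<longrightarrow> gl m s (edge_gen Mo gp G0 GT) = ?inp \<and>
             (s 5 < Nb \<longrightarrow> map (ev m s) qs = qa (s 5) \<and> ev m s e = eb (s 5)) \<and>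
             (\<forall>c<q. map_option (map (ev m (s(12 := c)))) xs = x c \<and> map_option (map (ev m (s(12 := c)))) ys = y c))"
    using evs gl_edge_gen[of _ N M m gp pre G0 es0 GT esT Mo] by simp
  have li: "length ?inp \<le> 2 ^ L * Y ^ a" using len size(4) by (auto simp: enc_pairs_flat)
  show ?thesis unfolding toggle_instance_def Let_def defs[symmetric]
  proof (rule exI[of _ N], rule exI[of _ M], rule exI[of _ ?inp], rule exI[of _ ?stt], rule exI[of _ x], rule exI[of _ y],
      rule exI[of _ qa], rule exI[of _ eb], intro conjI)
    show "M \<le> 2 ^ L * Y ^ a" using size(4) by linarith
    show "\<forall>b<Nb. can_ask (Q N M) (?stt (set (togs q (D b) x y))) (qa b)" using ask by blast
  qed (use E tg st sat size li in auto)
qed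


section \<open>The component gadget as a reduction to four problems\<close>

definition pair_gen :: "ex \<Rightarrow> ex \<Rightarrow> gen" where
  "pair_gen a b = Sq (Emit a) (Emit b)"

lemma pair_gen_simps [simp]: "gl m s (pair_gen a b) = [ev m s a, ev m s b]"
  "vars_below_gen B (pair_gen a b) \<longleftrightarrow> vars_below B a \<and> vars_below B b"
  "loop_vars_gen (pair_gen a b) = loop_vars a \<union> loop_vars b"
  by (auto simp: pair_gen_def)

context scc_gadget
begin

definition arcsT :: "(nat \<times> nat) list" where
  "arcsT = concat (map (\<lambda>c. [(0, 2 + c), (2 + c, 1)]) [0..<q])"

lemma distinct_arcs: "distinct (arcs0 @ arcsT)"
proof -
  have 1: "distinct (concat (map (\<lambda>c. [(1, 2 + c), (2 + c, 0)]) [0..<q]))"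
    by (rule distinct_concat_upt) auto
  have 2: "distinct (concat (map (\<lambda>a. concat (map (\<lambda>c. if fa a c then map (\<lambda>j. (2 + c, nd a j)) [0..<K] else []) [0..<q])) [0..<A]))"
    by (intro distinct_concat_upt) (auto simp: distinct_map inj_on_def nd_inj split: if_splits)
  have 3: "distinct (concat (map (\<lambda>a. map (\<lambda>j. (nd a j, 0::nat)) [0..<K]) [0..<A]))"
    by (intro distinct_concat_upt) (auto simp: distinct_map inj_on_def nd_inj)
  have 4: "distinct arcsT" unfolding arcsT_def by (rule distinct_concat_upt) auto
  show ?thesis unfolding arcs0_def using 1 2 3 4
    by (auto simp: arcsT_def nd_def split: if_splits)
qed

lemma length_arcs: "length (arcs0 @ arcsT) \<le> N * (q + 4)"
proof -
  have 1: "length (concat (map (\<lambda>c. [(1, 2 + c), (2 + c, 0)]) [0..<q])) \<le> q * 2"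
    by (rule length_concat_upt_le) simp
  have 2: "length (concat (map (\<lambda>a. concat (map (\<lambda>c. if fa a c then map (\<lambda>j. (2 + c, nd a j)) [0..<K] else []) [0..<q])) [0..<A])) \<le> A * (q * K)"
    by (intro length_concat_upt_le) simp
  have 3: "length (concat (map (\<lambda>a. map (\<lambda>j. (nd a j, 0::nat)) [0..<K]) [0..<A])) \<le> A * K"
    by (intro length_concat_upt_le) simp
  have 4: "length arcsT \<le> q * 2" unfolding arcsT_def by (rule length_concat_upt_le) simp
  have "length (arcs0 @ arcsT) \<le> q * 4 + A * (q * K) + A * K" unfolding arcs0_def using 1 2 3 4 by simp
  also have "\<dots> \<le> N * (q + 4)" by (simp add: N_def algebra_simps)
  finally show ?thesis .
qed

lemma arcs_range: "(u, v) \<in> set (arcs0 @ arcsT) \<Longrightarrow> u < N \<and> v < N \<and> u \<noteq> v"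
  using nd_less unfolding set_append set_arcs0 arcsT_def by (auto simp: N_def nd_def)

lemma full_le: "full D \<le> N"
proof -
  have "card {c. c < q \<and> D c} \<le> card {..<q}" by (intro card_mono) auto
  then show ?thesis by (simp add: full_def N_def mult.commute)
qed

end

definition clause_node :: ex where "clause_node = Bin BAdd (Cn 2) (Vr 12)"

definition assignment_node :: ex where
  "assignment_node = Bin BAdd (Bin BAdd (Cn 2) (Vr 1)) (Bin BAdd (Bin BMul (Vr 13) (Vr 9)) (Vr 14))"

definition scc_gen :: gen where
  "scc_gen = Sq (For 12 1 (Sq (pair_gen (Cn 1) clause_node) (pair_gen clause_node (Cn 0))))
     (Sq (For 13 3 (For 12 1 (Iff (fals_ex (Cn 0) (Vr 2) (Vr 13) 12) (For 14 9 (pair_gen clause_node assignment_node)) Nop)))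
       (For 13 3 (For 14 9 (pair_gen assignment_node (Cn 0)))))"

definition scc_toggle_gen :: gen where
  "scc_toggle_gen = For 12 1 (Sq (pair_gen (Cn 0) clause_node) (pair_gen clause_node (Cn 1)))"

definition full_ex :: ex where
  "full_ex = Bin BAdd (Cn 1) (Bin BAdd (Sum 12 1 (beta_fals 1)) (Bin BMul (Vr 9) (Vr 3)))"

lemma gl_scc_gen:
  assumes "cnf_memory k n F m" "scc_gadget (length F) (2 ^ L) K"
    and s: "s 1 = length F" "s 2 = L" "s 3 = 2 ^ L" "s 9 = K" "k \<le> K"
  shows "gl m s scc_gen = flat (scc_gadget.arcs0 (length F) (2 ^ L) K (\<lambda>a c. pfals 0 L a (F ! c)))"
    and "gl m s scc_toggle_gen = flat (scc_gadget.arcsT (length F))"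
proof -
  interpret cnf_memory k n F m by (rule assms(1))
  interpret S: scc_gadget "length F" "2 ^ L" K "\<lambda>a c. pfals 0 L a (F ! c)" by (rule assms(2))
  have f: "ev m (s(13 := a, 12 := c)) (fals_ex (Cn 0) (Vr 2) (Vr 13) 12) = of_bool (pfals 0 L a (F ! c))"
    if "c < length F" for a c
    by (subst ev_fals_ex) (use that s in auto)
  have s1: "s (Suc 0) = length F" using s(1) by simp
  have 2: "gl m s (For 13 3 (For 12 1 (Iff (fals_ex (Cn 0) (Vr 2) (Vr 13) 12) (For 14 9 (pair_gen clause_node assignment_node)) Nop))) =
     flat (concat (map (\<lambda>a. concat (map (\<lambda>c. if pfals 0 L a (F ! c) then map (\<lambda>j. (2 + c, S.nd a j)) [0..<K] else []) [0..<length F])) [0..<2 ^ L]))"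
    by (simp add: s s1, intro concat_upt_cong, simp add: f s s1 S.nd_def clause_node_def assignment_node_def add.assoc)
  show "gl m s scc_gen = flat S.arcs0"
    unfolding scc_gen_def S.arcs0_def flat_simps(3) gl.simps(3)[of m s "For 12 1 _"] gl.simps(3)[of m s "For 13 3 _"] 2
    by (simp add: s s1 S.nd_def clause_node_def assignment_node_def add.assoc)
  show "gl m s scc_toggle_gen = flat S.arcsT"
    by (simp add: s s1 scc_toggle_gen_def S.arcsT_def clause_node_def)
qed

lemma ev_beta_fals:
  assumes "cnf_memory k n F m" "std_env n (length F) L g \<kappa> s" "k \<le> \<kappa>" "c < length F"
  shows "ev m (s(12 := c)) (beta_fals g) = of_bool (pfals (g * L) n (s 5 * 2 ^ (g * L)) (F ! c))"
proof -
  interpret cnf_memory k n F m by (rule assms(1))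
  show ?thesis unfolding beta_fals_def by (subst ev_fals_ex) (use assms(2-4) in \<open>auto simp: std_env_def\<close>)
qed

text \<open>\<open>uq\<close> and \<open>ue\<close> tell whether \<open>full D\<close> is the query
  argument, as for \<open>CountSSR\<close>, or the expected answer, as for \<open>MaxSCC\<close>.
  \<open>k0\<close> forces enough copies for the gap of \<open>AppxSCC\<close>.\<close>

lemma scc_reduces:
  assumes \<epsilon>: "\<epsilon> \<le> 1" and wc: "wc \<longleftrightarrow> Mo \<noteq> Fully_Dynamic"
    and dyn: "\<And>N M. 0 < N \<Longrightarrow> edge_dynamics id N M (Q N M) pre wrap"
    and gp: "\<And>m s. gl m s gp = pre" "vars_below_gen 19 gp" "loop_vars_gen gp = {}" "length pre \<le> 1"
    and ask: "\<And>q A K fa D M. scc_gadget q A K \<Longrightarrow> k0 < K \<Longrightarrow>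
       can_ask (Q (scc_gadget.N q A K) M) (wrap (set (scc_gadget.arcs0 q A K fa) \<union> scc_gadget.arcsD q D)) (if uq then [scc_gadget.full q A K D] else []) \<and>
       (ans (Q (scc_gadget.N q A K) M) (wrap (set (scc_gadget.arcs0 q A K fa) \<union> scc_gadget.arcsD q D)) (if uq then [scc_gadget.full q A K D] else [])
          \<noteq> (if ue then scc_gadget.full q A K D else 0) \<longleftrightarrow> (\<exists>a<A. \<not> scc_gadget.bad q fa D a))"
  shows "reduces wc Mo Q 1 (m_pow (1 - \<epsilon>)) \<epsilon>"
proof -
  let ?eN = "Bin BAdd (Bin BAdd (Cn 2) (Vr 1)) (Bin BMul (Vr 3) (Vr 9))"
  let ?eM = "Bin BMul (Vr 7) (Bin BAdd (Vr 1) (Cn 4))"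
  let ?gi = "edge_gen Mo gp scc_gen scc_toggle_gen"
  let ?xs = "Some [Cn 0, clause_node]" and ?ys = "Some [clause_node, Cn 1]"
  let ?qs = "if uq then [full_ex] else []" and ?e = "if ue then full_ex else Cn 0"
  have sm: "small_ex full_ex" "small_ex clause_node" "\<And>i. small_ex (Cn i)"
    using small_beta_fals[of 1] by (auto simp: small_ex_def full_ex_def clause_node_def small_loops_def)
  have vg: "vars_below_gen 19 ?gi \<and> loop_vars_gen ?gi \<subseteq> insert 3 small_loops"
    by (rule edge_gen_vars)
      (use gp in \<open>auto simp: scc_gen_def scc_toggle_gen_def clause_node_def assignment_node_def small_loops_def\<close>)
  have syn: "toggle_syntax ?eN ?eM ?gi ?xs ?ys ?qs ?e"
    using sm vg by (auto simp: toggle_syntax_def)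
  have "toggle_instance Mo Q 1 ?eN ?eM ?gi ?xs ?ys ?qs ?e (k + k0 + 3) 6 n F L" if F: "kcnf k n F" and L: "L \<le> n" for k n F L
  proof -
    define q where "q = length F"
    \<comment> \<open>The value of variable 9: it serves both as a bound on clause lengths and as
      the number of copies.\<close>
    define K where "K = q + (k + k0 + 3)"
    define m where "m = input_fun (enc_cnf n F)"
    define fa where "fa a c = pfals 0 L a (F ! c)" for a c
    define D where "D b c = pfals (1 * L) n (b * 2 ^ (1 * L)) (F ! c)" for b c
    have cm: "cnf_memory k n F m" by unfold_locales (use F m_def in auto)
    have sg: "scc_gadget q (2 ^ L) K" by unfold_locales (auto simp: K_def)
    interpret S: scc_gadget q "2 ^ L" K fa by (rule sg)
    let ?x = "\<lambda>c. Some [0, 2 + c]" and ?y = "\<lambda>c. Some [2 + c, 1]"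
    define M where "M = S.N * (q + 4)"
    have D': "D = (\<lambda>b c. pfals (1 * L) n (b * 2 ^ (1 * L)) (F ! c))" by (simp add: D_def fun_eq_iff)
    have fa': "fa = (\<lambda>a c. pfals 0 L a (F ! c))" by (simp add: fa_def fun_eq_iff)
    have std: "s 1 = q" "s (Suc 0) = q" "s 2 = L" "s 3 = 2 ^ L" "s 9 = K" if "std_env n q L 1 (k + k0 + 3) s" for s
      using that by (simp_all add: std_env_def K_def)
    have E: "{(u, v). [u, v] \<in> set (togs q D ?x ?y)} = S.arcsD D" for D
      unfolding set_togs S.arcsD_def by (auto split: if_splits)
    have full: "ev m s full_ex = S.full (D (s 5))" if s: "std_env n q L 1 (k + k0 + 3) s" for s
    proof -
      have "(\<Sum>c<q. ev m (s(12 := c)) (beta_fals 1)) = (\<Sum>c<q. of_bool (D (s 5) c))"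
        by (rule sum.cong) (use ev_beta_fals[OF cm s[unfolded q_def]] in \<open>auto simp: D_def q_def\<close>)
      also have "\<dots> = card {c. c < q \<and> D (s 5) c}" by (simp add: Int_def)
      finally show ?thesis by (simp add: full_ex_def std[OF s] S.full_def)
    qed
    have N1: "S.N \<le> 2 ^ L * (n + q + (k + k0 + 3) + 2) ^ 2"
    proof -
      have "(2 + q) * 1 \<le> (2 + q) * 2 ^ L" by (rule mult_le_mono2) simp
      then have "S.N \<le> 2 ^ L * (2 + q + K)" unfolding S.N_def by (simp add: algebra_simps)
      also have "\<dots> \<le> 2 ^ L * (n + q + (k + k0 + 3) + 2) ^ 2"
        by (intro mult_le_mono2) (simp add: power2_eq_square K_def algebra_simps)
      finally show ?thesis .
    qed
    have M1: "M \<le> 2 ^ L * (n + q + (k + k0 + 3) + 2) ^ 3"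
    proof -
      have "M \<le> (2 ^ L * (n + q + (k + k0 + 3) + 2) ^ 2) * (n + q + (k + k0 + 3) + 2)"
        unfolding M_def by (rule mult_le_mono[OF N1]) simp
      then show ?thesis by (simp add: power3_eq_cube power2_eq_square mult.assoc)
    qed
    have "(2::nat) ^ L * 1 \<le> 2 ^ L * K" using S.K0 by (intro mult_le_mono2) simp
    then have L1: "2 ^ L \<le> S.N" unfolding S.N_def by linarith
    have "S.N * 1 \<le> S.N * (q + 4)" by (rule mult_le_mono2) simp
    then have LM: "2 ^ L \<le> M" using L1 unfolding M_def by linarith
    have sz: "length pre + 2 * M + 3 \<le> 2 ^ L * (n + q + (k + k0 + 3) + 2) ^ 6"
    proof -
      let ?Y = "n + q + (k + k0 + 3) + 2"
      have "1 \<le> M" using LM by (metis le_trans one_le_numeral one_le_power)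
      then have "length pre + 2 * M + 3 \<le> 2 ^ 3 * M" using gp(4) by simp
      also have "\<dots> \<le> ?Y ^ 3 * (2 ^ L * ?Y ^ 3)" by (intro mult_le_mono power_mono M1) auto
      also have "\<dots> = 2 ^ L * ?Y ^ 6" by (simp add: power_add[symmetric])
      finally show ?thesis .
    qed
    have sat: "satisfiable F \<longleftrightarrow> (\<exists>b<2 ^ (n - 1 * L). \<exists>a<2 ^ L. \<not> S.bad (D b) a)"
    proof -
      have *: "(\<forall>cl\<in>set F. \<not> (pfals 0 L a cl \<and> pfals L n (b * 2 ^ L) cl)) \<longleftrightarrow> \<not> S.bad (D b) a" for a b
        unfolding S.bad_def unfolding fa_def D_def q_def by (auto simp: all_set_conv_all_nth)
      show ?thesis unfolding satisfiable_split[OF F L] * by simp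
    qed
    note q = S.arcs_range S.length_arcs S.distinct_arcs
    have ask1: "can_ask (Q S.N M) (wrap (set S.arcs0 \<union> S.arcsD D)) (if uq then [S.full D] else [])"
       "ans (Q S.N M) (wrap (set S.arcs0 \<union> S.arcsD D)) (if uq then [S.full D] else [])
          \<noteq> (if ue then S.full D else 0) \<longleftrightarrow> (\<exists>a<2 ^ L. \<not> S.bad D a)" for D
      using ask[OF sg, of M fa D] by (auto simp: K_def)
    show ?thesis
    proof (rule edge_toggle_instance[OF m_def q_def refl refl D', where N = S.N and M = M and ?es0.0 = S.arcs0 and esT = S.arcsT and \<phi> = id
          and x = ?x and y = ?y and qa = "\<lambda>b. if uq then [S.full (D b)] else []" and eb = "\<lambda>b. if ue then S.full (D b) else 0"
          and wrap = wrap and pre = pre])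
      show "edge_dynamics id S.N M (Q S.N M) pre wrap" by (rule dyn) (simp add: S.N_def)
      show "toggles_distinct q ?x ?y" by (auto simp: toggles_distinct_def)
      show "all_toggles q ?x ?y = (\<lambda>(u, v). [u, v]) ` set S.arcsT" by (auto simp: all_toggles_def S.arcsT_def)
      show "distinct (map id (S.arcs0 @ S.arcsT))" using S.distinct_arcs by simp
      show "length (S.arcs0 @ S.arcsT) \<le> M" using S.length_arcs by (simp add: M_def)
      show "u < S.N \<and> v < S.N \<and> u \<noteq> v" if "(u, v) \<in> set (S.arcs0 @ S.arcsT)" for u v using that by (rule S.arcs_range)
      fix s assume s: "std_env n q L 1 (k + k0 + 3) s"
      have k: "k \<le> K" by (simp add: K_def)
      show "ev m s ?eN = S.N" by (simp add: std[OF s] S.N_def)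
      show "s 7 = S.N \<Longrightarrow> ev m s ?eM = M" by (simp add: std[OF s] M_def)
      show "gl m s gp = pre" by (rule gp)
      show "gl m s scc_gen = flat S.arcs0" "gl m s scc_toggle_gen = flat S.arcsT"
        using gl_scc_gen[OF cm sg[unfolded q_def], of s] std[OF s] k by (simp_all add: q_def fa')
      show "map (ev m s) ?qs = (if uq then [S.full (D (s 5))] else []) \<and> ev m s ?e = (if ue then S.full (D (s 5)) else 0)"
        using full[OF s] by simp
      show "map_option (map (ev m (s(12 := c)))) ?xs = ?x c \<and> map_option (map (ev m (s(12 := c)))) ?ys = ?y c" for c
        by (simp add: clause_node_def)
    next
      have "(2::nat) ^ L * (n + q + (k + k0 + 3) + 2) ^ 2 \<le> 2 ^ L * (n + q + (k + k0 + 3) + 2) ^ 6"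
        by (intro mult_le_mono2 power_increasing) auto
      then show "S.N \<le> 2 ^ L * (n + q + (k + k0 + 3) + 2) ^ 6" using N1 by linarith
    qed (use ask1 sat L1 LM sz in \<open>simp_all add: E[simplified]\<close>)
  qed
  then have inst: "\<exists>\<kappa> a. 2 \<le> a \<and> k \<le> \<kappa> \<and> (\<forall>n F L. kcnf k n F \<and> 1 * L \<le> n \<and> L \<le> n \<longrightarrow>
      toggle_instance Mo Q 1 ?eN ?eM ?gi ?xs ?ys ?qs ?e \<kappa> a n F L)" for k
    by (intro exI[of _ "k + k0 + 3"] exI[of _ 6]) auto
  show ?thesis using toggle_reduces[OF syn _ wc inst] \<epsilon> by simp
qed

lemma edge_dynamics_digraph: "edge_dynamics id n m (digraph_problem P f n m) [] (\<lambda>E. E)"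
  by (auto simp: edge_dynamics_def digraph_problem_def arc_list_def can_ins_arc_def ins_arc_def can_del_arc_def del_arc_def)

lemma reduces_SC2: "\<epsilon> \<le> 1 \<Longrightarrow> (wc \<longleftrightarrow> Mo \<noteq> Fully_Dynamic) \<Longrightarrow> reduces wc Mo SC2 1 (m_pow (1 - \<epsilon>)) \<epsilon>"
proof (rule scc_reduces[where pre = "[]" and wrap = "\<lambda>E. E" and gp = Nop and uq = False and ue = False and ?k0.0 = 0], unfold SC2_def)
  fix q A K fa D M
  assume "scc_gadget q A K"
  then interpret S: scc_gadget q A K fa .
  show "can_ask (digraph_problem (\<lambda>G. True) (\<lambda>G. of_bool (num_sccs G > 2)) S.N M) (set S.arcs0 \<union> S.arcsD D) (if False then [S.full D] else []) \<and>
    (ans (digraph_problem (\<lambda>G. True) (\<lambda>G. of_bool (num_sccs G > 2)) S.N M) (set S.arcs0 \<union> S.arcsD D) (if False then [S.full D] else []) \<noteq>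
      (if False then S.full D else 0) \<longleftrightarrow> (\<exists>a<A. \<not> S.bad D a))"
    using S.good_card[of D] S.K by (simp add: digraph_problem_def S.num_sccs_scc_graph)
qed (simp_all add: edge_dynamics_digraph)

lemma reduces_AppxSCC:
  assumes "2 \<le> k"
  shows "\<epsilon> \<le> 1 \<Longrightarrow> (wc \<longleftrightarrow> Mo \<noteq> Fully_Dynamic) \<Longrightarrow> reduces wc Mo (AppxSCC k) 1 (m_pow (1 - \<epsilon>)) \<epsilon>"
proof (rule scc_reduces[where pre = "[]" and wrap = "\<lambda>E. E" and gp = Nop and uq = False and ue = False and ?k0.0 = k], unfold AppxSCC_def)
  fix q A K fa D M
  assume "scc_gadget q A K" and K: "k < K"
  then interpret S: scc_gadget q A K fa by simp
  let ?P = "digraph_problem (\<lambda>G. num_sccs G = 2 \<or> num_sccs G > k) (\<lambda>G. of_bool (num_sccs G > k))"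
  define r where "r = card {a. a < A \<and> \<not> S.bad D a}"
  \<comment> \<open>One good assignment already contributes \<open>K > k\<close> components, so the
    number is either 2 or more than \<open>k\<close>, as promised.\<close>
  have "r = 0 \<or> K \<le> K * r" by (cases r) simp_all
  then have r: "r = 0 \<or> k < K * r" using K by linarith
  have "0 < r \<longleftrightarrow> (\<exists>a<A. \<not> S.bad D a)" unfolding r_def by (rule S.good_card)
  moreover have "num_sccs (S.scc_graph D) = 2 + K * r" unfolding r_def by (rule S.num_sccs_scc_graph)
  ultimately show "can_ask (?P S.N M) (set S.arcs0 \<union> S.arcsD D) (if False then [S.full D] else []) \<and>
    (ans (?P S.N M) (set S.arcs0 \<union> S.arcsD D) (if False then [S.full D] else []) \<noteq>
      (if False then S.full D else 0) \<longleftrightarrow> (\<exists>a<A. \<not> S.bad D a))"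
    using r assms by (auto simp: digraph_problem_def)
qed (simp_all add: edge_dynamics_digraph)

lemma reduces_MaxSCC: "\<epsilon> \<le> 1 \<Longrightarrow> (wc \<longleftrightarrow> Mo \<noteq> Fully_Dynamic) \<Longrightarrow> reduces wc Mo MaxSCC 1 (m_pow (1 - \<epsilon>)) \<epsilon>"
proof (rule scc_reduces[where pre = "[]" and wrap = "\<lambda>E. E" and gp = Nop and uq = False and ue = True and ?k0.0 = 0], unfold MaxSCC_def)
  fix q A K fa D M
  assume "scc_gadget q A K"
  then interpret S: scc_gadget q A K fa .
  let ?P = "digraph_problem (\<lambda>G. verts G \<noteq> {}) (\<lambda>G. Max ((\<lambda>H. card (verts H)) ` pre_digraph.sccs G))"
  have "{..<S.N} \<noteq> {}" by (auto simp: S.N_def)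
  then show "can_ask (?P S.N M) (set S.arcs0 \<union> S.arcsD D) (if False then [S.full D] else []) \<and>
    (ans (?P S.N M) (set S.arcs0 \<union> S.arcsD D) (if False then [S.full D] else []) \<noteq>
      (if True then S.full D else 0) \<longleftrightarrow> (\<exists>a<A. \<not> S.bad D a))"
    using S.max_scc[of D] unfolding digraph_problem_def by simp
qed (simp_all add: edge_dynamics_digraph)

lemma reduces_CountSSR: "\<epsilon> \<le> 1 \<Longrightarrow> (wc \<longleftrightarrow> Mo \<noteq> Fully_Dynamic) \<Longrightarrow> reduces wc Mo CountSSR 1 (m_pow (1 - \<epsilon>)) \<epsilon>"
proof (rule scc_reduces[where pre = "[0]" and wrap = "\<lambda>E. (0, E)" and gp = "Emit (Cn 0)" and uq = True and ue = False and ?k0.0 = 0])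
  fix N M :: nat assume "0 < N"
  then show "edge_dynamics id N M (CountSSR N M) [0] (Pair 0)"
    by (auto simp: edge_dynamics_def CountSSR_def arc_list_def can_ins_arc_def ins_arc_def can_del_arc_def del_arc_def)
next
  fix q A K fa D M
  assume "scc_gadget q A K"
  then interpret S: scc_gadget q A K fa .
  have "card {v. reachable (S.scc_graph D) 0 v} < S.full D \<longleftrightarrow> (\<exists>a<A. \<not> S.bad D a)"
    using S.bad_card(1)[of D] S.K0 by (simp add: S.reach_count S.full_def)
  then show "can_ask (CountSSR S.N M) (0, set S.arcs0 \<union> S.arcsD D) (if True then [S.full D] else []) \<and>
    (ans (CountSSR S.N M) (0, set S.arcs0 \<union> S.arcsD D) (if True then [S.full D] else []) \<noteq>
      (if False then S.full D else 0) \<longleftrightarrow> (\<exists>a<A. \<not> S.bad D a))"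
    using S.full_le[of D] by (simp add: CountSSR_def)
qed simp_all


section \<open>The gadget for pairs of partial assignments\<close>

section \<open>Pairs of partial assignments\<close>

text \<open>
  Nodes \<open>a\<close> and \<open>A + a\<close> for the partial assignments of two blocks of variables, nodes \<open>2 A + c\<close> and
  \<open>2 A + q + c\<close> for the clauses, and three hubs, which are isolated in the directed version.
\<close>

locale pair_gadget =
  fixes q A :: nat and fa fb :: "nat \<Rightarrow> nat \<Rightarrow> bool"
  assumes A: "1 \<le> A"
begin

definition N :: nat where "N = 2 * A + 2 * q + 3"

definition arcs0 :: "(nat \<times> nat) list" where
  "arcs0 = concat (map (\<lambda>a. concat (map (\<lambda>c. if fa a c then [(a, 2 * A + c)] else []) [0..<q])) [0..<A]) @
    concat (map (\<lambda>a. concat (map (\<lambda>c. if fb a c then [(2 * A + q + c, A + a)] else []) [0..<q])) [0..<A])"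

text \<open>The hubs bring any two nodes within distance 4, and within 3 unless they are partial
  assignments of different blocks. So only such pairs decide the diameter.\<close>

definition hubs :: "(nat \<times> nat) list" where
  "hubs = map (\<lambda>a. (2 * A + 2 * q, a)) [0..<A] @ map (\<lambda>a. (2 * A + 2 * q + 1, A + a)) [0..<A] @
    [(2 * A + 2 * q + 2, 2 * A + 2 * q), (2 * A + 2 * q + 2, 2 * A + 2 * q + 1)] @
    map (\<lambda>c. (2 * A + 2 * q + 2, 2 * A + c)) [0..<q] @ map (\<lambda>c. (2 * A + 2 * q + 2, 2 * A + q + c)) [0..<q]"

definition arcsT :: "(nat \<times> nat) list" where
  "arcsT = map (\<lambda>c. (2 * A + c, 2 * A + q + c)) [0..<q]"

text \<open>A path from \<open>a\<close> to \<open>A + b\<close> uses one clause \<open>c\<close>: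
  the first arc says that \<open>a\<close> falsifies \<open>c\<close>, the toggle that the remaining
  variables do, the last arc that \<open>b\<close> does. It exists iff the combined assignment
  falsifies some clause.\<close>

definition arcsD :: "(nat \<Rightarrow> bool) \<Rightarrow> (nat \<times> nat) set" where
  "arcsD D = {(2 * A + c, 2 * A + q + c) | c. c < q \<and> D c}"

lemma set_arcs0: "set arcs0 = {(a, 2 * A + c) | a c. a < A \<and> c < q \<and> fa a c} \<union> {(2 * A + q + c, A + a) | a c. a < A \<and> c < q \<and> fb a c}"
  unfolding arcs0_def by (auto split: if_splits)

lemma set_hubs: "set hubs = {(2 * A + 2 * q, a) | a. a < A} \<union> {(2 * A + 2 * q + 1, A + a) | a. a < A} \<union>
    {(2 * A + 2 * q + 2, 2 * A + 2 * q), (2 * A + 2 * q + 2, 2 * A + 2 * q + 1)} \<union>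
    {(2 * A + 2 * q + 2, 2 * A + c) | c. c < q} \<union> {(2 * A + 2 * q + 2, 2 * A + q + c) | c. c < q}"
  unfolding hubs_def by auto

text \<open>All arcs go strictly upwards. Hence there are no loops and no opposite arcs, and
  forgetting the orientation is injective on the arcs.\<close>

definition level :: "nat \<Rightarrow> nat" where
  "level v = (if v < A then 2 else if v < 2 * A then 5 else if v < 2 * A + q then 3 else if v < 2 * A + 2 * q then 4
     else if v = 2 * A + 2 * q + 2 then 0 else 1)"

lemma level_arcs: "(u, v) \<in> set (arcs0 @ hubs @ arcsT) \<Longrightarrow> level u < level v"
  unfolding set_append set_arcs0 set_hubs arcsT_def by (auto simp: level_def)

lemma arcs_range: "(u, v) \<in> set (arcs0 @ hubs @ arcsT) \<Longrightarrow> u < N \<and> v < N \<and> u \<noteq> v"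
  using level_arcs[of u v] unfolding set_append set_arcs0 set_hubs arcsT_def by (auto simp: N_def)

lemma distinct_arcs: "distinct (arcs0 @ hubs @ arcsT)"
proof -
  have 1: "distinct (concat (map (\<lambda>a. concat (map (\<lambda>c. if fa a c then [(a, 2 * A + c)] else []) [0..<q])) [0..<A]))"
    by (intro distinct_concat_upt) (auto split: if_splits)
  have 2: "distinct (concat (map (\<lambda>a. concat (map (\<lambda>c. if fb a c then [(2 * A + q + c, A + a)] else []) [0..<q])) [0..<A]))"
    by (intro distinct_concat_upt) (auto split: if_splits)
  have 3: "distinct arcs0" unfolding arcs0_def using 1 2 by (auto split: if_splits)
  have 4: "distinct hubs" unfolding hubs_def by (auto simp: distinct_map inj_on_def)
  have 5: "distinct arcsT" unfolding arcsT_def by (auto simp: distinct_map inj_on_def)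
  have "set arcs0 \<inter> set hubs = {}" "set arcs0 \<inter> set arcsT = {}" "set hubs \<inter> set arcsT = {}"
    unfolding set_arcs0 set_hubs arcsT_def by auto
  then show ?thesis using 3 4 5 by auto
qed

lemma distinct_edges: "distinct (map (\<lambda>(u, v). {u, v}) (arcs0 @ hubs @ arcsT))"
  unfolding distinct_map
proof (intro conjI inj_onI)
  show "distinct (arcs0 @ hubs @ arcsT)" by (rule distinct_arcs)
  fix e f assume *: "e \<in> set (arcs0 @ hubs @ arcsT)" "f \<in> set (arcs0 @ hubs @ arcsT)" "(\<lambda>(u, v). {u, v}) e = (\<lambda>(u, v). {u, v}) f"
  obtain u v u' v' where e: "e = (u, v)" "f = (u', v')" by (cases e, cases f)
  have "level u < level v" "level u' < level v'" using level_arcs *(1,2) unfolding e by blast+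
  then show "e = f" using *(3) unfolding e by (auto simp: doubleton_eq_iff)
qed

lemma length_arcs: "length (arcs0 @ hubs @ arcsT) \<le> N * (q + 2)"
proof -
  have 1: "length (concat (map (\<lambda>a. concat (map (\<lambda>c. if fa a c then [(a, 2 * A + c)] else []) [0..<q])) [0..<A])) \<le> A * (q * 1)"
    by (intro length_concat_upt_le) simp
  have 2: "length (concat (map (\<lambda>a. concat (map (\<lambda>c. if fb a c then [(2 * A + q + c, A + a)] else []) [0..<q])) [0..<A])) \<le> A * (q * 1)"
    by (intro length_concat_upt_le) simp
  have "length (arcs0 @ hubs @ arcsT) \<le> 2 * (A * q) + 2 * A + 3 * q + 2"
    unfolding arcs0_def using 1 2 by (simp add: hubs_def arcsT_def)
  also have "\<dots> \<le> N * (q + 2)" by (simp add: N_def algebra_simps)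
  finally show ?thesis .
qed

definition good :: "(nat \<Rightarrow> bool) \<Rightarrow> nat \<Rightarrow> nat \<Rightarrow> bool" where
  "good D a b \<longleftrightarrow> (\<forall>c<q. \<not> (fa a c \<and> fb b c \<and> D c))"

lemma reach_pairs:
  assumes "a < A" "b < A"
  shows "reachable (digraph_of N (set arcs0 \<union> arcsD D)) a (A + b) \<longleftrightarrow> \<not> good D a b"
proof -
  let ?E = "set arcs0 \<union> arcsD D"
  have "?E \<subseteq> {..<N} \<times> {..<N}" unfolding set_arcs0 arcsD_def by (auto simp: N_def)
  then have r: "reachable (digraph_of N ?E) a (A + b) \<longleftrightarrow> (a, A + b) \<in> ?E\<^sup>*"
    using assms(1) by (simp add: reachable_digraph_of N_def)
  \<comment> \<open>The gadget is layered and toggles join the two nodes of the same clause, so a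
    reachable node is described by the clause that the path runs through.\<close>
  have inv: "v = a \<or> (\<exists>c<q. fa a c \<and> (v = 2 * A + c \<or> D c \<and> (v = 2 * A + q + c \<or> (\<exists>b<A. v = A + b \<and> fb b c))))"
    if "(a, v) \<in> ?E\<^sup>*" for v
    using that
  proof (induction rule: rtrancl_induct)
    case (step v w)
    from step(2) consider c where "v < A" "c < q" "w = 2 * A + c" "fa v c"
      | c b where "v = 2 * A + q + c" "w = A + b" "b < A" "c < q" "fb b c"
      | c where "v = 2 * A + c" "w = 2 * A + q + c" "c < q" "D c"
      unfolding set_arcs0 arcsD_def by blast
    then show ?case using step(3) assms(1) by cases auto
  qed simp
  show ?thesis
  proof
    assume "reachable (digraph_of N ?E) a (A + b)"
    then have "(a, A + b) \<in> ?E\<^sup>*" using r by simp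
    from inv[OF this] show "\<not> good D a b" using assms unfolding good_def by auto
  next
    assume "\<not> good D a b"
    then obtain c where "c < q" "fa a c" "fb b c" "D c" by (auto simp: good_def)
    then have "(a, 2 * A + c) \<in> ?E" "(2 * A + c, 2 * A + q + c) \<in> ?E" "(2 * A + q + c, A + b) \<in> ?E"
      using assms unfolding set_arcs0 arcsD_def by auto
    then have "(a, A + b) \<in> ?E\<^sup>*" by (meson r_into_rtrancl rtrancl_trans)
    then show "reachable (digraph_of N ?E) a (A + b)" using r by simp
  qed
qed

end

definition left_node :: ex where "left_node = Bin BAdd (Bin BMul (Cn 2) (Vr 3)) (Vr 12)"
definition right_node :: ex where "right_node = Bin BAdd (Bin BAdd (Bin BMul (Cn 2) (Vr 3)) (Vr 1)) (Vr 12)"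
definition hub_node :: "nat \<Rightarrow> ex" where
  "hub_node i = Bin BAdd (Bin BAdd (Bin BMul (Cn 2) (Vr 3)) (Bin BMul (Cn 2) (Vr 1))) (Cn i)"

definition pairs_gen :: gen where
  "pairs_gen = Sq
    (For 13 3 (For 12 1 (Iff (fals_ex (Cn 0) (Vr 2) (Vr 13) 12) (pair_gen (Vr 13) left_node) Nop)))
    (For 13 3 (For 12 1 (Iff (fals_ex (Vr 2) (Bin BMul (Cn 2) (Vr 2)) (Bin BMul (Vr 13) (Vr 3)) 12)
       (pair_gen right_node (Bin BAdd (Vr 3) (Vr 13))) Nop)))"

definition hubs_gen :: gen where
  "hubs_gen = Sq (For 13 3 (pair_gen (hub_node 0) (Vr 13))) (Sq (For 13 3 (pair_gen (hub_node 1) (Bin BAdd (Vr 3) (Vr 13))))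
     (Sq (Sq (pair_gen (hub_node 2) (hub_node 0)) (pair_gen (hub_node 2) (hub_node 1)))
       (Sq (For 12 1 (pair_gen (hub_node 2) left_node)) (For 12 1 (pair_gen (hub_node 2) right_node)))))"

lemma gl_pairs_gen:
  assumes "cnf_memory k n F m" "pair_gadget (2 ^ L)"
    and s: "s 1 = length F" "s 2 = L" "s 3 = 2 ^ L" "k \<le> s 9"
  shows "gl m s pairs_gen = flat (pair_gadget.arcs0 (length F) (2 ^ L) (\<lambda>a c. pfals 0 L a (F ! c)) (\<lambda>a c. pfals L (2 * L) (a * 2 ^ L) (F ! c)))"
    and "gl m s hubs_gen = flat (pair_gadget.hubs (length F) (2 ^ L))"
    and "gl m s (For 12 1 (pair_gen left_node right_node)) = flat (pair_gadget.arcsT (length F) (2 ^ L))"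
proof -
  interpret cnf_memory k n F m by (rule assms(1))
  interpret S: pair_gadget "length F" "2 ^ L" "\<lambda>a c. pfals 0 L a (F ! c)" "\<lambda>a c. pfals L (2 * L) (a * 2 ^ L) (F ! c)" by (rule assms(2))
  have s1: "s (Suc 0) = length F" using s(1) by simp
  have f: "ev m (s(13 := a, 12 := c)) (fals_ex (Cn 0) (Vr 2) (Vr 13) 12) = of_bool (pfals 0 L a (F ! c))"
    "ev m (s(13 := a, 12 := c)) (fals_ex (Vr 2) (Bin BMul (Cn 2) (Vr 2)) (Bin BMul (Vr 13) (Vr 3)) 12) = of_bool (pfals L (2 * L) (a * 2 ^ L) (F ! c))"
    if "c < length F" for a c
    by (subst ev_fals_ex; use that s in auto)+
  have 1: "gl m s (For 13 3 (For 12 1 (Iff (fals_ex (Cn 0) (Vr 2) (Vr 13) 12) (pair_gen (Vr 13) left_node) Nop))) =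
      flat (concat (map (\<lambda>a. concat (map (\<lambda>c. if pfals 0 L a (F ! c) then [(a, 2 * 2 ^ L + c)] else []) [0..<length F])) [0..<2 ^ L]))"
    by (simp add: s s1, intro concat_upt_cong, simp add: f s s1 left_node_def)
  have 2: "gl m s (For 13 3 (For 12 1 (Iff (fals_ex (Vr 2) (Bin BMul (Cn 2) (Vr 2)) (Bin BMul (Vr 13) (Vr 3)) 12)
       (pair_gen right_node (Bin BAdd (Vr 3) (Vr 13))) Nop))) =
      flat (concat (map (\<lambda>a. concat (map (\<lambda>c. if pfals L (2 * L) (a * 2 ^ L) (F ! c) then [(2 * 2 ^ L + length F + c, 2 ^ L + a)] else []) [0..<length F])) [0..<2 ^ L]))"
    by (simp add: s s1, intro concat_upt_cong, simp add: f[simplified] s s1 right_node_def)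
  show "gl m s pairs_gen = flat S.arcs0"
    unfolding pairs_gen_def S.arcs0_def flat_simps(3) gl.simps(3)[of m s "For 13 3 _"] 1 2 ..
  show "gl m s hubs_gen = flat S.hubs" "gl m s (For 12 1 (pair_gen left_node right_node)) = flat S.arcsT"
    by (simp_all add: s s1 hubs_gen_def S.hubs_def S.arcsT_def hub_node_def left_node_def right_node_def)
qed

text \<open>\<open>h\<close> says whether the hubs are joined to the rest, and \<open>e0\<close> is
  the answer to be expected when every pair is falsified. The prefix \<open>pre\<close> may depend
  on the block size because \<open>STReach\<close> lists its node sets there.\<close>

lemma pair_reduces:
  assumes \<epsilon>: "\<epsilon> \<le> 2" and wc: "wc \<longleftrightarrow> Mo \<noteq> Fully_Dynamic"
    and dyn: "\<And>A N M. 2 * A \<le> N \<Longrightarrow> edge_dynamics \<phi> N M (Q N M) (pre A) (wrap A)"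
    and \<phi>: "\<And>q A fa fb. pair_gadget A \<Longrightarrow> distinct (map \<phi> (pair_gadget.arcs0 q A fa fb @ (if h then pair_gadget.hubs q A else []) @ pair_gadget.arcsT q A))"
    and gp: "\<And>m s. gl m s gp = pre (s 3)" "vars_below_gen 19 gp" "loop_vars_gen gp \<subseteq> {3}" "\<And>A. length (pre A) \<le> 2 * A + 2"
    and ask: "\<And>q A fa fb D M. pair_gadget A \<Longrightarrow>
       can_ask (Q (pair_gadget.N q A) M) (wrap A (\<phi> ` (set (pair_gadget.arcs0 q A fa fb @ (if h then pair_gadget.hubs q A else [])) \<union> pair_gadget.arcsD q A D))) [] \<and>
       (ans (Q (pair_gadget.N q A) M) (wrap A (\<phi> ` (set (pair_gadget.arcs0 q A fa fb @ (if h then pair_gadget.hubs q A else [])) \<union> pair_gadget.arcsD q A D))) [] \<noteq> e0 \<longleftrightarrow>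
         (\<exists>a<A. \<exists>b<A. pair_gadget.good q fa fb D a b))"
  shows "reduces wc Mo Q 2 (m_pow (2 - \<epsilon>)) \<epsilon>"
proof -
  let ?eN = "Bin BAdd (Bin BAdd (Bin BMul (Cn 2) (Vr 3)) (Bin BMul (Cn 2) (Vr 1))) (Cn 3)"
  let ?eM = "Bin BMul (Vr 7) (Bin BAdd (Vr 1) (Cn 2))"
  let ?G0 = "Sq pairs_gen (if h then hubs_gen else Nop)" and ?GT = "For 12 1 (pair_gen left_node right_node)"
  let ?gi = "edge_gen Mo gp ?G0 ?GT"
  let ?xs = "Some [left_node, right_node]"
  have vg: "vars_below_gen 19 ?gi \<and> loop_vars_gen ?gi \<subseteq> insert 3 small_loops"
    by (rule edge_gen_vars)
      (use gp in \<open>auto simp: pairs_gen_def hubs_gen_def hub_node_def left_node_def right_node_def small_loops_def\<close>)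
  have syn: "toggle_syntax ?eN ?eM ?gi ?xs None [] (Cn e0)"
    using vg by (auto simp: toggle_syntax_def small_ex_def left_node_def right_node_def)
  have "toggle_instance Mo Q 2 ?eN ?eM ?gi ?xs None [] (Cn e0) (k + 3) 6 n F L" if F: "kcnf k n F" and L: "2 * L \<le> n" for k n F L
  proof -
    define q where "q = length F"
    define m where "m = input_fun (enc_cnf n F)"
    define fa where "fa a c = pfals 0 L a (F ! c)" for a c
    define fb where "fb a c = pfals L (2 * L) (a * 2 ^ L) (F ! c)" for a c
    define D where "D b c = pfals (2 * L) n (b * 2 ^ (2 * L)) (F ! c)" for b c
    define Y where "Y = n + q + (k + 3) + 2"
    have cm: "cnf_memory k n F m" by unfold_locales (use F m_def in auto)
    have sg: "pair_gadget (2 ^ L)" by unfold_locales auto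
    interpret S: pair_gadget q "2 ^ L" fa fb by (rule sg)
    define x where "x c = Some [2 * 2 ^ L + c, 2 * 2 ^ L + q + c]" for c
    define M where "M = S.N * (q + 2)"
    define es where "es = S.arcs0 @ (if h then S.hubs else [])"
    have D': "D = (\<lambda>b c. pfals (2 * L) n (b * 2 ^ (2 * L)) (F ! c))" by (simp add: D_def fun_eq_iff)
    have f': "fa = (\<lambda>a c. pfals 0 L a (F ! c))" "fb = (\<lambda>a c. pfals L (2 * L) (a * 2 ^ L) (F ! c))" by (simp_all add: fa_def fb_def fun_eq_iff)
    have std: "s 1 = q" "s (Suc 0) = q" "s 2 = L" "s 3 = 2 ^ L" "s 9 = q + (k + 3)" if "std_env n q L 2 (k + 3) s" for s
      using that by (simp_all add: std_env_def)
    have E: "{(u, v). [u, v] \<in> set (togs q D x (\<lambda>_. None))} = S.arcsD D" for D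
      unfolding set_togs S.arcsD_def x_def by (auto split: if_splits)
    have N1: "S.N \<le> 2 ^ L * Y ^ 2"
    proof -
      have "(2 * q + 3) * 1 \<le> (2 * q + 3) * 2 ^ L" by (rule mult_le_mono2) simp
      then have "S.N \<le> 2 ^ L * (2 * q + 5)" unfolding S.N_def by (simp add: algebra_simps)
      also have "\<dots> \<le> 2 ^ L * Y ^ 2"
        by (intro mult_le_mono2) (simp add: power2_eq_square Y_def algebra_simps)
      finally show ?thesis .
    qed
    have M1: "M \<le> 2 ^ L * Y ^ 3"
    proof -
      have "M \<le> (2 ^ L * Y ^ 2) * Y"
        unfolding M_def by (rule mult_le_mono[OF N1]) (simp add: Y_def)
      then show ?thesis by (simp add: power3_eq_cube power2_eq_square mult.assoc)
    qed
    have L1: "2 ^ L \<le> S.N" "5 \<le> S.N" using S.A unfolding S.N_def by linarith+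
    have "S.N * 1 \<le> S.N * (q + 2)" by (rule mult_le_mono2) simp
    then have LM: "2 ^ L \<le> M" "5 \<le> M" using L1 unfolding M_def by linarith+
    have sz: "length (pre (2 ^ L)) + 2 * M + 3 \<le> 2 ^ L * Y ^ 6"
    proof -
      have "length (pre (2 ^ L)) + 2 * M + 3 \<le> 2 ^ 3 * M" using LM gp(4)[of "2 ^ L"] by simp
      also have "\<dots> \<le> Y ^ 3 * (2 ^ L * Y ^ 3)" by (intro mult_le_mono power_mono M1) (auto simp: Y_def)
      also have "\<dots> = 2 ^ L * Y ^ 6" by (simp add: power_add[symmetric])
      finally show ?thesis .
    qed
    have "2 ^ L * Y ^ 2 \<le> 2 ^ L * Y ^ 6"
      by (intro mult_le_mono2 power_increasing) (auto simp: Y_def)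
    then have N6: "S.N \<le> 2 ^ L * Y ^ 6" using N1 by linarith
    have sat: "satisfiable F \<longleftrightarrow> (\<exists>b<2 ^ (n - 2 * L). \<exists>a<2 ^ L. \<exists>a'<2 ^ L. S.good (D b) a a')"
    proof -
      have *: "(\<forall>cl\<in>set F. \<not> (pfals 0 L a cl \<and> pfals L (2 * L) (a' * 2 ^ L) cl \<and> pfals (2 * L) n (b * 2 ^ (2 * L)) cl)) \<longleftrightarrow> S.good (D b) a a'" for a a' b
        unfolding S.good_def unfolding fa_def fb_def D_def q_def by (auto simp: all_set_conv_all_nth)
      show ?thesis unfolding satisfiable_split2[OF F L] * by simp
    qed
    have ask1: "can_ask (Q S.N M) (wrap (2 ^ L) (\<phi> ` (set es \<union> S.arcsD D))) []"
      "ans (Q S.N M) (wrap (2 ^ L) (\<phi> ` (set es \<union> S.arcsD D))) [] \<noteq> e0 \<longleftrightarrow> (\<exists>a<2 ^ L. \<exists>b<2 ^ L. S.good D a b)" for D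
      using ask[OF sg, of q M fa fb D] unfolding es_def by blast+
    show ?thesis
    proof (rule edge_toggle_instance[OF m_def q_def Y_def refl D', where N = S.N and M = M and ?es0.0 = es and esT = S.arcsT and \<phi> = \<phi>
          and x = x and y = "\<lambda>_. None" and qa = "\<lambda>b. []" and eb = "\<lambda>b. e0" and wrap = "wrap (2 ^ L)" and pre = "pre (2 ^ L)"])
      show "edge_dynamics \<phi> S.N M (Q S.N M) (pre (2 ^ L)) (wrap (2 ^ L))" by (rule dyn) (simp add: S.N_def)
      show "toggles_distinct q x (\<lambda>_. None)" by (auto simp: toggles_distinct_def x_def)
      show "all_toggles q x (\<lambda>_. None) = (\<lambda>(u, v). [u, v]) ` set S.arcsT" by (auto simp: all_toggles_def S.arcsT_def x_def)
      show "distinct (map \<phi> (es @ S.arcsT))" using \<phi>[OF sg, of q fa fb] by (simp add: es_def)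
      show "length (es @ S.arcsT) \<le> M" using S.length_arcs by (auto simp: M_def es_def)
      show "u < S.N \<and> v < S.N \<and> u \<noteq> v" if "(u, v) \<in> set (es @ S.arcsT)" for u v
        by (rule S.arcs_range) (use that in \<open>auto simp: es_def split: if_splits\<close>)
      fix s assume s: "std_env n q L 2 (k + 3) s"
      show "ev m s ?eN = S.N" by (simp add: std[OF s] S.N_def)
      show "s 7 = S.N \<Longrightarrow> ev m s ?eM = M" by (simp add: std[OF s] M_def)
      show "gl m s gp = pre (2 ^ L)" by (simp add: gp std[OF s])
      have k: "k \<le> s 9" by (simp add: std[OF s])
      show "gl m s ?G0 = flat es" "gl m s ?GT = flat S.arcsT"
        using gl_pairs_gen[OF cm sg, of s] std[OF s] k by (simp_all add: q_def f' es_def del: gl.simps(4))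
      show "map_option (map (ev m (s(12 := c)))) ?xs = x c \<and> map_option (map (ev m (s(12 := c)))) None = None" for c
        by (simp add: left_node_def right_node_def std[OF s] x_def)
    qed (use ask1 sat L1 LM sz N6 in \<open>simp_all add: E\<close>)
  qed
  then have inst: "\<exists>\<kappa> a. 2 \<le> a \<and> k \<le> \<kappa> \<and> (\<forall>n F L. kcnf k n F \<and> 2 * L \<le> n \<and> L \<le> n \<longrightarrow>
      toggle_instance Mo Q 2 ?eN ?eM ?gi ?xs None [] (Cn e0) \<kappa> a n F L)" for k
    by (intro exI[of _ "k + 3"] exI[of _ 6]) auto
  show ?thesis using toggle_reduces[OF syn _ wc inst] \<epsilon> by simp
qed

lemma reduces_STReach: "\<epsilon> \<le> 2 \<Longrightarrow> (wc \<longleftrightarrow> Mo \<noteq> Fully_Dynamic) \<Longrightarrow> reduces wc Mo STReach 2 (m_pow (2 - \<epsilon>)) \<epsilon>"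
proof (rule pair_reduces[where \<phi> = id and h = False and ?e0.0 = 0 and pre = "\<lambda>A. enc_list [0..<A] @ enc_list [A..<2 * A]"
      and wrap = "\<lambda>A E. ({..<A}, {A..<2 * A}, E)"
      and gp = "Sq (Emit (Vr 3)) (Sq (For 13 3 (Emit (Vr 13))) (Sq (Emit (Vr 3)) (For 13 3 (Emit (Bin BAdd (Vr 3) (Vr 13))))))"])
  fix A N M :: nat assume A: "2 * A \<le> N"
  have "(N # M # (enc_list [0..<A] @ enc_list [A..<2 * A]) @ enc_pairs es, ({..<A}, {A..<2 * A}, set es)) \<in> start (STReach N M)"
    if "arc_list N M es" for es
    unfolding STReach_def dyn_problem.select_convs mem_Collect_eq
    by (rule exI[of _ "[0..<A]"], rule exI[of _ "[A..<2 * A]"], rule exI[of _ es]) (use that A in \<open>auto simp: atLeast0LessThan\<close>)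
  then show "edge_dynamics id N M (STReach N M) (enc_list [0..<A] @ enc_list [A..<2 * A]) (\<lambda>E. ({..<A}, {A..<2 * A}, E))"
    unfolding edge_dynamics_def by (auto simp: STReach_def arc_list_def can_ins_arc_def ins_arc_def can_del_arc_def del_arc_def)
next
  fix q A :: nat and fa fb
  assume "pair_gadget A"
  then interpret S: pair_gadget q A fa fb .
  show "distinct (map id (S.arcs0 @ (if False then S.hubs else []) @ S.arcsT))" using S.distinct_arcs by auto
next
  fix m :: "nat \<Rightarrow> nat" and s :: "nat \<Rightarrow> nat"
  have "concat (map (\<lambda>i. [s 3 + i]) [0..<s 3]) = [s 3..<2 * s 3]"
    using map_add_upt[of "s 3" "s 3"] by (simp add: add.commute mult_2)
  then show "gl m s (Sq (Emit (Vr 3)) (Sq (For 13 3 (Emit (Vr 13))) (Sq (Emit (Vr 3)) (For 13 3 (Emit (Bin BAdd (Vr 3) (Vr 13))))))) =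
      enc_list [0..<s 3] @ enc_list [s 3..<2 * s 3]"
    by (simp add: enc_list_def)
next
  fix q A M :: nat and fa fb D
  assume "pair_gadget A"
  then interpret S: pair_gadget q A fa fb .
  have "(\<exists>u\<in>{..<A}. \<exists>v\<in>{A..<2 * A}. \<not> reachable (digraph_of S.N (set S.arcs0 \<union> S.arcsD D)) u v) \<longleftrightarrow> (\<exists>a<A. \<exists>b<A. S.good D a b)"
  proof
    assume "\<exists>u\<in>{..<A}. \<exists>v\<in>{A..<2 * A}. \<not> reachable (digraph_of S.N (set S.arcs0 \<union> S.arcsD D)) u v"
    then obtain u v where uv: "u < A" "A \<le> v" "v < 2 * A" "\<not> reachable (digraph_of S.N (set S.arcs0 \<union> S.arcsD D)) u v" by auto
    then have "S.good D u (v - A)" using S.reach_pairs[of u "v - A" D] by auto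
    then show "\<exists>a<A. \<exists>b<A. S.good D a b" using uv by (intro exI[of _ u] conjI exI[of _ "v - A"]) auto
  next
    assume "\<exists>a<A. \<exists>b<A. S.good D a b"
    then obtain a b where "a < A" "b < A" "S.good D a b" by blast
    then show "\<exists>u\<in>{..<A}. \<exists>v\<in>{A..<2 * A}. \<not> reachable (digraph_of S.N (set S.arcs0 \<union> S.arcsD D)) u v"
      using S.reach_pairs[of a b D] by (intro bexI[of _ a] bexI[of _ "A + b"]) auto
  qed
  then show "can_ask (STReach S.N M) ({..<A}, {A..<2 * A}, id ` (set (S.arcs0 @ (if False then S.hubs else [])) \<union> S.arcsD D)) [] \<and>
     (ans (STReach S.N M) ({..<A}, {A..<2 * A}, id ` (set (S.arcs0 @ (if False then S.hubs else [])) \<union> S.arcsD D)) [] \<noteq> 0 \<longleftrightarrow>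
       (\<exists>a<A. \<exists>b<A. S.good D a b))"
    by (simp add: STReach_def)
qed (simp_all add: enc_list_def)


section \<open>Distances, and the diameter of the undirected pair gadget\<close>

definition near :: "('a \<times> 'a) set \<Rightarrow> nat \<Rightarrow> 'a \<Rightarrow> 'a \<Rightarrow> bool" where
  "near R k u v \<longleftrightarrow> (\<exists>j\<le>k. (u, v) \<in> R ^^ j)"

lemma near_refl: "near R k u u"
  unfolding near_def by (rule exI[of _ 0]) simp

lemma near_1: "(u, v) \<in> R \<Longrightarrow> near R 1 u v"
  unfolding near_def by (rule exI[of _ 1]) simp

lemma near_mono: "near R k u v \<Longrightarrow> k \<le> l \<Longrightarrow> near R l u v"
  unfolding near_def using le_trans by blast

lemma near_trans: "near R k u v \<Longrightarrow> near R l v w \<Longrightarrow> near R (k + l) u w"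
  unfolding near_def by (metis add_le_mono relcomp.relcompI relpow_add)

lemma near_sym: "sym R \<Longrightarrow> near R k u v \<Longrightarrow> near R k v u"
proof -
  assume R: "sym R"
  have "(u, v) \<in> R ^^ j \<Longrightarrow> (v, u) \<in> R ^^ j" for j
  proof (induction j arbitrary: v)
    case (Suc j)
    then obtain w where w: "(u, w) \<in> R ^^ j" "(w, v) \<in> R" by auto
    show ?case using Suc.IH[OF w(1)] symD[OF R w(2)] by (rule relpow_Suc_I2[rotated])
  qed simp
  then show "near R k u v \<Longrightarrow> near R k v u" unfolding near_def by blast
qed

text \<open>A potential that rises by at most 1 along each arc bounds distances from below. The
  lower bounds on the diameter exhibit one, which avoids a case analysis of all short walks.\<close>

lemma relpow_potential:
  fixes h :: "'a \<Rightarrow> nat"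
  assumes "\<And>u v. (u, v) \<in> R \<Longrightarrow> h v \<le> h u + 1" "(u, v) \<in> R ^^ j"
  shows "h v \<le> h u + j"
  using assms(2)
proof (induction j arbitrary: v)
  case (Suc j)
  then obtain w where "(u, w) \<in> R ^^ j" "(w, v) \<in> R" by auto
  then show ?case using Suc.IH[of w] assms(1)[of w v] by linarith
qed simp

context wf_digraph
begin

lemma relpow_awalk: "u \<in> verts G \<Longrightarrow> (u, v) \<in> arcs_ends G ^^ j \<Longrightarrow> \<exists>p. awalk u p v \<and> length p = j"
proof (induction j arbitrary: u)
  case 0
  then show ?case by (auto simp: awalk_Nil_iff)
next
  case (Suc j)
  then obtain w where w: "(u, w) \<in> arcs_ends G" "(w, v) \<in> arcs_ends G ^^ j" by (meson relpow_Suc_D2)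
  then obtain e where e: "e \<in> arcs G" "tail G e = u" "head G e = w" by (auto simp: arcs_ends_conv)
  then have "w \<in> verts G" by auto
  from Suc.IH[OF this w(2)] obtain p where "awalk w p v" "length p = j" by blast
  then show ?case using e by (intro exI[of _ "e # p"]) (auto simp: awalk_Cons_iff)
qed

lemma awalk_relpow: "awalk u p v \<Longrightarrow> (u, v) \<in> arcs_ends G ^^ length p"
proof (induction p arbitrary: u)
  case (Cons e p)
  then have e: "e \<in> arcs G" "u = tail G e" "awalk (head G e) p v" by (auto simp: awalk_Cons_iff)
  have "(u, head G e) \<in> arcs_ends G" using e by (auto simp: arcs_ends_conv)
  from relpow_Suc_I2[OF this Cons.IH[OF e(3)]] show ?case by simp
qed (simp add: awalk_Nil_iff)

lemma awalk_cost_one: "awalk_cost (\<lambda>_. 1) p = real (length p)"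
  by (induction p) auto

lemma mu_le:
  assumes "u \<in> verts G" "near (arcs_ends G) k u v"
  shows "\<mu> (\<lambda>_. 1) u v \<le> ereal (real k)"
proof -
  from assms(2) obtain j where j: "j \<le> k" "(u, v) \<in> arcs_ends G ^^ j" by (auto simp: near_def)
  from relpow_awalk[OF assms(1) j(2)] obtain p where p: "awalk u p v" "length p = j" by blast
  have "\<mu> (\<lambda>_. 1) u v \<le> ereal (awalk_cost (\<lambda>_. 1) p)" unfolding \<mu>_def by (rule INF_lower) (use p in auto)
  also have "\<dots> \<le> ereal (real k)" using j p by (simp add: awalk_cost_one)
  finally show ?thesis .
qed

lemma le_mu:
  fixes h :: "'a \<Rightarrow> nat"
  assumes "\<And>u v. (u, v) \<in> arcs_ends G \<Longrightarrow> h v \<le> h u + 1" "h u + k \<le> h v"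
  shows "ereal (real k) \<le> \<mu> (\<lambda>_. 1) u v"
  unfolding \<mu>_def
proof (rule INF_greatest)
  fix p assume "p \<in> {p. awalk u p v}"
  then have p: "(u, v) \<in> arcs_ends G ^^ length p" using awalk_relpow by blast
  have "h v \<le> h u + length p" by (rule relpow_potential[OF _ p]) (rule assms(1))
  then show "ereal (real k) \<le> ereal (awalk_cost (\<lambda>_. 1) p)"
    using assms(2) by (simp add: awalk_cost_one)
qed

lemma diameter_le:
  assumes "\<And>u v. u \<in> verts G \<Longrightarrow> v \<in> verts G \<Longrightarrow> near (arcs_ends G) k u v"
  shows "diameter G \<le> ereal (real k)"
  unfolding diameter_def
proof (rule SUP_least, rule SUP_least)
  fix u v assume "u \<in> verts G" "v \<in> verts G"
  then show "\<mu> (\<lambda>_. 1) u v \<le> ereal (real k)" using mu_le assms by blast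
qed

lemma le_diameter:
  fixes h :: "'a \<Rightarrow> nat"
  assumes "\<And>u v. (u, v) \<in> arcs_ends G \<Longrightarrow> h v \<le> h u + 1" "h u + k \<le> h v" "u \<in> verts G" "v \<in> verts G"
  shows "ereal (real k) \<le> diameter G"
proof -
  have "ereal (real k) \<le> \<mu> (\<lambda>_. 1) u v" by (rule le_mu[where h = h]) (use assms in auto)
  then show ?thesis unfolding diameter_def by (intro SUP_upper2[OF assms(3)] SUP_upper2[OF assms(4)])
qed

end

lemma wf_ugraph_of:
  assumes "\<And>e. e \<in> E \<Longrightarrow> e \<subseteq> {..<n}"
  shows "wf_digraph (ugraph_of n E)"
proof
  fix e assume "e \<in> arcs (ugraph_of n E)"
  then have "{fst e, snd e} \<in> E" by (auto simp: ugraph_of_def)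
  from assms[OF this] show "tail (ugraph_of n E) e \<in> verts (ugraph_of n E)" "head (ugraph_of n E) e \<in> verts (ugraph_of n E)"
    by (simp_all add: ugraph_of_def)
qed

lemma arcs_ends_ugraph_of: "arcs_ends (ugraph_of n E) = {(u, v). u \<noteq> v \<and> {u, v} \<in> E}"
  by (simp add: ugraph_of_def arcs_ends_conv)

lemma verts_ugraph_of [simp]: "verts (ugraph_of n E) = {..<n}"
  by (simp add: ugraph_of_def)

context pair_gadget
begin

definition edges :: "(nat \<Rightarrow> bool) \<Rightarrow> (nat \<times> nat) set" where
  "edges D = set (arcs0 @ hubs) \<union> arcsD D"

definition pugraph :: "(nat \<Rightarrow> bool) \<Rightarrow> (nat, nat \<times> nat) pre_digraph" where
  "pugraph D = ugraph_of N ((\<lambda>(u, v). {u, v}) ` edges D)"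

lemma edges_sub: "edges D \<subseteq> set (arcs0 @ hubs @ arcsT)"
  unfolding edges_def arcsD_def arcsT_def by auto

lemma wf_pugraph: "wf_digraph (pugraph D)"
  unfolding pugraph_def
proof (rule wf_ugraph_of)
  fix e assume "e \<in> (\<lambda>(u, v). {u, v}) ` edges D"
  then obtain u v where "(u, v) \<in> edges D" "e = {u, v}" by auto
  then show "e \<subseteq> {..<N}" using arcs_range[of u v] edges_sub[of D] by auto
qed

lemma ends_pugraph: "arcs_ends (pugraph D) = edges D \<union> (edges D)\<inverse>"
proof -
  have "u \<noteq> v" if "(u, v) \<in> edges D" for u v using that arcs_range edges_sub by blast
  then show ?thesis unfolding pugraph_def arcs_ends_ugraph_of by (auto simp: doubleton_eq_iff; force)
qed

lemma edges_cases:
  assumes "(u, v) \<in> edges D"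
  obtains a c where "a < A" "c < q" "fa a c" "u = a" "v = 2 * A + c"
  | a c where "a < A" "c < q" "fb a c" "u = 2 * A + q + c" "v = A + a"
  | c where "c < q" "D c" "u = 2 * A + c" "v = 2 * A + q + c"
  | a where "a < A" "u = 2 * A + 2 * q" "v = a"
  | a where "a < A" "u = 2 * A + 2 * q + 1" "v = A + a"
  | "u = 2 * A + 2 * q + 2" "v = 2 * A + 2 * q"
  | "u = 2 * A + 2 * q + 2" "v = 2 * A + 2 * q + 1"
  | c where "c < q" "u = 2 * A + 2 * q + 2" "v = 2 * A + c"
  | c where "c < q" "u = 2 * A + 2 * q + 2" "v = 2 * A + q + c"
  using assms unfolding edges_def set_append set_arcs0 set_hubs arcsD_def by blast

lemma near_hub:
  assumes "v < N"
  shows "near (arcs_ends (pugraph D)) (if v < 2 * A then 2 else 1) v (2 * A + 2 * q + 2)"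
proof -
  let ?z = "2 * A + 2 * q + 2" and ?R = "arcs_ends (pugraph D)"
  have e: "(u, w) \<in> ?R" "(w, u) \<in> ?R" if "(u, w) \<in> set hubs" for u w
    using that unfolding ends_pugraph edges_def by auto
  consider "v < A" | "A \<le> v" "v < 2 * A" | "2 * A \<le> v" "v < ?z" | "v = ?z" using assms unfolding N_def by linarith
  then show ?thesis
  proof cases
    case 1
    have "(2 * A + 2 * q, v) \<in> set hubs" "(?z, 2 * A + 2 * q) \<in> set hubs" using 1 unfolding set_hubs by auto
    then show ?thesis using near_trans[OF near_1[OF e(2)] near_1[OF e(2)]] 1 by (fastforce simp: numeral_2_eq_2)
  next
    case 2
    then obtain b where "v = A + b" "b < A" using le_Suc_ex[of A v] by auto
    then have "(2 * A + 2 * q + 1, v) \<in> set hubs" "(?z, 2 * A + 2 * q + 1) \<in> set hubs" unfolding set_hubs by auto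
    then show ?thesis using near_trans[OF near_1[OF e(2)] near_1[OF e(2)]] 2 by (fastforce simp: numeral_2_eq_2)
  next
    case 3
    have "(?z, v) \<in> set hubs"
    proof -
      consider c where "c < q" "v = 2 * A + c" | c where "c < q" "v = 2 * A + q + c" | "v = 2 * A + 2 * q" | "v = 2 * A + 2 * q + 1"
      proof -
        have "v - 2 * A < q \<or> (2 * A + q \<le> v \<and> v - (2 * A + q) < q) \<or> v = 2 * A + 2 * q \<or> v = 2 * A + 2 * q + 1" using 3 by linarith
        then show thesis using 3 that(1)[of "v - 2 * A"] that(2)[of "v - (2 * A + q)"] that(3,4) by auto
      qed
      then show ?thesis unfolding set_hubs by cases auto
    qed
    then show ?thesis using near_1[OF e(2)] 3 by simp
  next
    case 4
    then show ?thesis using near_refl by simp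
  qed
qed

lemma sym_pugraph: "sym (arcs_ends (pugraph D))"
  unfolding ends_pugraph by (auto simp: sym_def)

lemma near_4:
  assumes "u < N" "v < N"
  shows "near (arcs_ends (pugraph D)) 4 u v"
    and "2 * A \<le> u \<or> 2 * A \<le> v \<Longrightarrow> near (arcs_ends (pugraph D)) 3 u v"
proof -
  have t: "near (arcs_ends (pugraph D)) ((if u < 2 * A then 2 else 1) + (if v < 2 * A then 2 else 1)) u v"
    by (rule near_trans[OF near_hub[OF assms(1)] near_sym[OF sym_pugraph near_hub[OF assms(2)]]])
  show "near (arcs_ends (pugraph D)) 4 u v" by (rule near_mono[OF t]) auto
  show "near (arcs_ends (pugraph D)) 3 u v" if "2 * A \<le> u \<or> 2 * A \<le> v" by (rule near_mono[OF t]) (use that in auto)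
qed

text \<open>For nodes of different blocks the falsified clause gives a path of length 3 through its
  two nodes; two nodes of the same block share a hub; the other cases are settled by
  \<open>near_4\<close>.\<close>

lemma near_3:
  assumes "u < N" "v < N" "\<forall>a<A. \<forall>b<A. \<not> good D a b"
  shows "near (arcs_ends (pugraph D)) 3 u v"
proof -
  let ?R = "arcs_ends (pugraph D)"
  have e: "(u, w) \<in> ?R" "(w, u) \<in> ?R" if "(u, w) \<in> edges D" for u w
    using that unfolding ends_pugraph by auto
  have p: "near ?R 3 a (A + b)" if ab: "a < A" "b < A" for a b
  proof -
    obtain c where c: "c < q" "fa a c" "fb b c" "D c" using assms(3) ab unfolding good_def by blast
    have "(a, 2 * A + c) \<in> edges D" "(2 * A + c, 2 * A + q + c) \<in> edges D" "(2 * A + q + c, A + b) \<in> edges D"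
      using c ab unfolding edges_def set_append set_arcs0 arcsD_def by auto
    from near_trans[OF near_1[OF e(1)[OF this(1)]] near_trans[OF near_1[OF e(1)[OF this(2)]] near_1[OF e(1)[OF this(3)]]]]
    show ?thesis by (simp add: numeral_3_eq_3)
  qed
  have tw: "near ?R 3 u v" if "(w, u) \<in> edges D" "(w, v) \<in> edges D" for w
    by (rule near_mono[OF near_trans[OF near_1[OF e(2)[OF that(1)]] near_1[OF e(1)[OF that(2)]]]]) simp
  consider "2 * A \<le> u \<or> 2 * A \<le> v" | "u < A" "v < A" | "A \<le> u" "u < 2 * A" "A \<le> v" "v < 2 * A"
    | "u < A" "A \<le> v" "v < 2 * A" | "v < A" "A \<le> u" "u < 2 * A" by linarith
  then show ?thesis
  proof cases
    case 1
    then show ?thesis using near_4(2)[OF assms(1,2)] by blast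
  next
    case 2
    show ?thesis by (rule tw[of "2 * A + 2 * q"]) (use 2 in \<open>auto simp: edges_def set_hubs\<close>)
  next
    case 3
    then obtain a b where "u = A + a" "v = A + b" "a < A" "b < A" using le_Suc_ex[of A u] le_Suc_ex[of A v] by auto
    then have "(2 * A + 2 * q + 1, u) \<in> edges D" "(2 * A + 2 * q + 1, v) \<in> edges D"
      unfolding edges_def set_append set_hubs by auto
    then show ?thesis by (rule tw)
  next
    case 4
    then show ?thesis using p[of u "v - A"] by simp
  next
    case 5
    then show ?thesis using near_sym[OF sym_pugraph p[of v "u - A"]] by simp
  qed
qed

text \<open>The potential separates the hub of the first block from \<open>A\<close>, the first node
  of the second block, which exists as \<open>1 \<le> A\<close>. It works for every
  \<open>D\<close>, so the diameter never drops below 3.\<close>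

lemma diameter_ge_3: "ereal (real 3) \<le> diameter (pugraph D)"
proof -
  interpret wf_digraph "pugraph D" by (rule wf_pugraph)
  define h :: "nat \<Rightarrow> nat" where "h v = (if v < A then 1 else if v < 2 * A then 3 else if v < 2 * A + 2 * q then 2
    else if v = 2 * A + 2 * q then 0 else if v = 2 * A + 2 * q + 1 then 2 else 1)" for v
  have h: "h v \<le> h u + 1 \<and> h u \<le> h v + 1" if "(u, v) \<in> edges D" for u v
    using that by (cases rule: edges_cases) (auto simp: h_def)
  show ?thesis
  proof (rule le_diameter[where h = h and u = "2 * A + 2 * q" and v = A])
    show "h v \<le> h u + 1" if "(u, v) \<in> arcs_ends (pugraph D)" for u v using that h unfolding ends_pugraph by auto
  qed (use A in \<open>auto simp: h_def pugraph_def N_def\<close>)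
qed

text \<open>The potential imitates the distance from \<open>a\<close>. The critical edges enter
  \<open>A + b\<close>, of potential 4, from clause nodes falsified by \<open>b\<close>: goodness
  excludes that \<open>a\<close> and \<open>D\<close> also falsify the clause, so the node has
  potential 3 and not 2.\<close>

lemma diameter_ge_4:
  assumes "a < A" "b < A" "good D a b"
  shows "ereal (real 4) \<le> diameter (pugraph D)"
proof -
  interpret wf_digraph "pugraph D" by (rule wf_pugraph)
  define h :: "nat \<Rightarrow> nat" where "h v = (if v = a then 0 else if v < A then 2 else if v = A + b then 4 else if v < 2 * A then 3
    else if v < 2 * A + q then (if fa a (v - 2 * A) then 1 else 2)
    else if v < 2 * A + 2 * q then (if fa a (v - (2 * A + q)) \<and> D (v - (2 * A + q)) then 2 else 3)
    else if v = 2 * A + 2 * q then 1 else if v = 2 * A + 2 * q + 1 then 3 else 2)" for v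
  have g: "\<not> (fa a c \<and> D c)" if "c < q" "fb b c" for c using assms(3) that unfolding good_def by blast
  have h: "h v \<le> h u + 1 \<and> h u \<le> h v + 1" if "(u, v) \<in> edges D" for u v
    using that
  proof (cases rule: edges_cases)
    case (2 a' c)
    then show ?thesis using g[of c] assms(1,2) by (auto simp: h_def)
  qed (use assms in \<open>auto simp: h_def\<close>)
  show ?thesis
  proof (rule le_diameter[where h = h and u = a and v = "A + b"])
    show "h v \<le> h u + 1" if "(u, v) \<in> arcs_ends (pugraph D)" for u v using that h unfolding ends_pugraph by auto
  qed (use assms in \<open>auto simp: h_def pugraph_def N_def\<close>)
qed

lemma diameter_pugraph: "diameter (pugraph D) = (if \<exists>a<A. \<exists>b<A. good D a b then 4 else 3)"
proof -
  interpret wf_digraph "pugraph D" by (rule wf_pugraph)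
  have v: "verts (pugraph D) = {..<N}" by (simp add: pugraph_def)
  show ?thesis
  proof (cases "\<exists>a<A. \<exists>b<A. good D a b")
    case True
    then obtain a b where "a < A" "b < A" "good D a b" by blast
    then have "ereal (real 4) \<le> diameter (pugraph D)" by (rule diameter_ge_4)
    moreover have "diameter (pugraph D) \<le> ereal (real 4)" by (rule diameter_le) (use near_4(1) v in auto)
    ultimately have "diameter (pugraph D) = ereal (real 4)" by (rule antisym[rotated])
    then show ?thesis using True by simp
  next
    case False
    have "diameter (pugraph D) \<le> ereal (real 3)" by (rule diameter_le) (use near_3 False v in auto)
    then have "diameter (pugraph D) = ereal (real 3)" using diameter_ge_3[of D] by (rule antisym)
    then show ?thesis using False by simp
  qed
qed

end

lemma reduces_Diam43: "\<epsilon> \<le> 2 \<Longrightarrow> (wc \<longleftrightarrow> Mo \<noteq> Fully_Dynamic) \<Longrightarrow> reduces wc Mo Diam43 2 (m_pow (2 - \<epsilon>)) \<epsilon>"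
proof (rule pair_reduces[where \<phi> = "\<lambda>(u, v). {u, v}" and h = True and ?e0.0 = 3 and pre = "\<lambda>A. []" and wrap = "\<lambda>A E. E" and gp = Nop])
  fix A N M :: nat
  show "edge_dynamics (\<lambda>(u, v). {u, v}) N M (Diam43 N M) [] (\<lambda>E. E)"
    by (auto simp: edge_dynamics_def Diam43_def edge_list_def edge_set_def)
next
  fix q A :: nat and fa fb
  assume "pair_gadget A"
  then interpret S: pair_gadget q A fa fb .
  show "distinct (map (\<lambda>(u, v). {u, v}) (S.arcs0 @ (if True then S.hubs else []) @ S.arcsT))" using S.distinct_edges by simp
next
  fix q A M :: nat and fa fb D
  assume "pair_gadget A"
  then interpret S: pair_gadget q A fa fb .
  have e: "ugraph_of S.N ((\<lambda>(u, v). {u, v}) ` (set (S.arcs0 @ (if True then S.hubs else [])) \<union> S.arcsD D)) = S.pugraph D"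
    by (simp add: S.pugraph_def S.edges_def)
  show "can_ask (Diam43 S.N M) ((\<lambda>(u, v). {u, v}) ` (set (S.arcs0 @ (if True then S.hubs else [])) \<union> S.arcsD D)) [] \<and>
     (ans (Diam43 S.N M) ((\<lambda>(u, v). {u, v}) ` (set (S.arcs0 @ (if True then S.hubs else [])) \<union> S.arcsD D)) [] \<noteq> 3 \<longleftrightarrow>
       (\<exists>a<A. \<exists>b<A. S.good D a b))"
    unfolding Diam43_def dyn_problem.select_convs e S.diameter_pugraph by simp
qed simp_all


section \<open>Set members as toggles: connected subgraphs and unions of subsets\<close>

section \<open>Toggling members of a set\<close>

lemma satisfiable_clauses:
  assumes "kcnf k n F" "L \<le> n"
  shows "satisfiable F \<longleftrightarrow> (\<exists>b<2 ^ (n - L). \<exists>a<2 ^ L. \<forall>c<length F.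
     \<not> (pfals 0 L a (F ! c) \<and> pfals L n (b * 2 ^ L) (F ! c)))"
  unfolding satisfiable_split[OF assms] by (simp add: all_set_conv_all_nth)

text \<open>The element \<open>base + c\<close> is present iff the current assignment falsifies
  clause \<open>c\<close>, and \<open>S0\<close> is always present. The answer 1 means that every
  partial assignment falsifies one of these clauses.\<close>

lemma set_reduces:
  fixes Q :: "nat \<Rightarrow> nat \<Rightarrow> ('x \<times> nat set) dyn_problem" and base :: nat and S0 :: "nat \<Rightarrow> nat \<Rightarrow> nat set"
  assumes \<epsilon>: "\<epsilon> \<le> 1" and wc: "wc \<longleftrightarrow> Mo \<noteq> Fully_Dynamic"
    and syn: "toggle_syntax eN eM gi (Some [ex]) None [] (Cn 1)"
    and evs: "\<And>k n F L m s. cnf_memory k n F m \<Longrightarrow> s (Suc 0) = length F \<Longrightarrow> s 2 = L \<Longrightarrow> s 3 = 2 ^ L \<Longrightarrow> k \<le> s 9 \<Longrightarrow>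
      let q = length F; fa = (\<lambda>a c. pfals 0 L a (F ! c)) in
      ev m s eN = N q (2 ^ L) \<and> (s 7 = N q (2 ^ L) \<longrightarrow> ev m s eM = M q (2 ^ L) fa) \<and>
      (s 7 = N q (2 ^ L) \<and> s 8 = M q (2 ^ L) fa \<longrightarrow> gl m s gi = inp q (2 ^ L) fa) \<and> (\<forall>c. ev m (s(12 := c)) ex = base + c)"
    and S0: "\<And>q A c. c < q \<Longrightarrow> base + c \<notin> S0 q A"
    and ins: "\<And>q A fa S c. c < q \<Longrightarrow> base + c \<notin> S \<Longrightarrow> can_ins (Q (N q A) (M q A fa)) (X q A fa, S) [base + c] \<and>
       ins (Q (N q A) (M q A fa)) (X q A fa, S) [base + c] = (X q A fa, insert (base + c) S)"
    and del: "\<And>q A fa S v. v \<in> S \<Longrightarrow> can_del (Q (N q A) (M q A fa)) (X q A fa, S) [v] \<and>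
       del (Q (N q A) (M q A fa)) (X q A fa, S) [v] = (X q A fa, S - {v})"
    and st: "\<And>q A fa. 1 \<le> A \<Longrightarrow> (inp q A fa, (X q A fa, S0 q A \<union> (if Mo = Decremental then {base + c | c. c < q} else {}))) \<in> start (Q (N q A) (M q A fa))"
    and ask: "\<And>q A fa D. 1 \<le> A \<Longrightarrow> can_ask (Q (N q A) (M q A fa)) (X q A fa, S0 q A \<union> {base + c | c. c < q \<and> D c}) [] \<and>
       (ans (Q (N q A) (M q A fa)) (X q A fa, S0 q A \<union> {base + c | c. c < q \<and> D c}) [] \<noteq> 1 \<longleftrightarrow> (\<exists>a<A. \<forall>c<q. \<not> (fa a c \<and> D c)))"
    and size: "\<And>q A fa. 1 \<le> A \<Longrightarrow> A \<le> N q A \<and> A \<le> M q A fa \<and> N q A \<le> A * (q + 2) ^ 6 \<and> M q A fa \<le> A * (q + 2) ^ 6 \<and>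
       length (inp q A fa) \<le> A * (q + 2) ^ 6"
  shows "reduces wc Mo Q 1 (m_pow (1 - \<epsilon>)) \<epsilon>"
proof -
  have "toggle_instance Mo Q 1 eN eM gi (Some [ex]) None [] (Cn 1) k 6 n F L" if F: "kcnf k n F" and L: "L \<le> n" for k n F L
  proof -
    define q where "q = length F"
    define m where "m = input_fun (enc_cnf n F)"
    define Y where "Y = n + q + k + 2"
    define fa where "fa = (\<lambda>a c. pfals 0 L a (F ! c))"
    define D where "D b = (\<lambda>c. pfals (1 * L) n (b * 2 ^ (1 * L)) (F ! c))" for b
    define Nb :: nat where "Nb = 2 ^ (n - 1 * L)"
    define A :: nat where "A = 2 ^ L"
    have A1: "1 \<le> A" by (simp add: A_def)
    have cm: "cnf_memory k n F m" by unfold_locales (use F m_def in auto)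
    define x where "x c = Some [base + c]" for c
    define stt where "stt S = (X q A fa, S0 q A \<union> {v. [v] \<in> S})" for S
    let ?Q = "Q (N q A) (M q A fa)"
    have all: "all_toggles q x (\<lambda>_. None) = {[base + c] | c. c < q}" unfolding all_toggles_def x_def by auto
    have tg: "toggling ?Q q x (\<lambda>_. None) stt"
    proof
      show "toggles_distinct q x (\<lambda>_. None)" by (auto simp: toggles_distinct_def x_def)
      fix S a assume S: "S \<subseteq> all_toggles q x (\<lambda>_. None)"
      {
        assume "a \<in> all_toggles q x (\<lambda>_. None)" "a \<notin> S"
        then obtain c where c: "c < q" "a = [base + c]" unfolding all by auto
        have "base + c \<notin> S0 q A \<union> {v. [v] \<in> S}" using S0[OF c(1)] \<open>a \<notin> S\<close> c(2) by simp
        note i = ins[OF c(1) this, of A fa]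
        have "S0 q A \<union> {v. [v] \<in> insert [base + c] S} = insert (base + c) (S0 q A \<union> {v. [v] \<in> S})" by auto
        then show "can_ins ?Q (stt S) a \<and> ins ?Q (stt S) a = stt (insert a S)" unfolding stt_def c(2) using i by (simp only:)
      }
      assume a: "a \<in> S"
      then obtain c where c: "c < q" "a = [base + c]" using S unfolding all by auto
      have "base + c \<in> S0 q A \<union> {v. [v] \<in> S}" using a c(2) by simp
      note i = del[OF this, of q A fa]
      have "S0 q A \<union> {v. [v] \<in> S - {[base + c]}} = (S0 q A \<union> {v. [v] \<in> S}) - {base + c}" using S0[OF c(1), of A] by auto
      then show "can_del ?Q (stt S) a \<and> del ?Q (stt S) a = stt (S - {a})" unfolding stt_def c(2) using i by (simp only:)
    qed
    have stT: "stt (set (togs q (D b) x (\<lambda>_. None))) = (X q A fa, S0 q A \<union> {base + c | c. c < q \<and> D b c})" for b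
      unfolding stt_def set_togs x_def by (auto split: if_splits)
    have st': "stt (toggling.start_set q x (\<lambda>_. None) Mo) = (X q A fa, S0 q A \<union> (if Mo = Decremental then {base + c | c. c < q} else {}))"
      unfolding toggling.start_set_def[OF tg] all stt_def by auto
    have st1: "(inp q A fa, stt (toggling.start_set q x (\<lambda>_. None) Mo)) \<in> start ?Q" unfolding st' by (rule st[OF A1])
    have E: "\<forall>s. std_env n q L 1 k s \<longrightarrow> ev m s eN = N q A \<and> (s 7 = N q A \<longrightarrow> ev m s eM = M q A fa) \<and>
           (s 7 = N q A \<and> s 8 = M q A fa \<longrightarrow> gl m s gi = inp q A fa \<and>
             (s 5 < Nb \<longrightarrow> map (ev m s) [] = [] \<and> ev m s (Cn 1) = 1) \<and>
             (\<forall>c<q. map_option (map (ev m (s(12 := c)))) (Some [ex]) = x c \<and> map_option (map (ev m (s(12 := c)))) None = None))"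
    proof (intro allI impI)
      fix s assume "std_env n q L 1 k s"
      then have "s (Suc 0) = length F" "s 2 = L" "s 3 = 2 ^ L" "k \<le> s 9" by (simp_all add: std_env_def q_def)
      from evs[OF cm this, unfolded Let_def, folded q_def fa_def A_def]
      show "ev m s eN = N q A \<and> (s 7 = N q A \<longrightarrow> ev m s eM = M q A fa) \<and>
           (s 7 = N q A \<and> s 8 = M q A fa \<longrightarrow> gl m s gi = inp q A fa \<and>
             (s 5 < Nb \<longrightarrow> map (ev m s) [] = [] \<and> ev m s (Cn 1) = 1) \<and>
             (\<forall>c<q. map_option (map (ev m (s(12 := c)))) (Some [ex]) = x c \<and> map_option (map (ev m (s(12 := c)))) None = None))"
        by (simp add: x_def)
    qed
    have sat: "satisfiable F \<longleftrightarrow> (\<exists>b<Nb. ans ?Q (stt (set (togs q (D b) x (\<lambda>_. None)))) [] \<noteq> 1)"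
      unfolding stT using ask[OF A1, of q fa "D _"] satisfiable_clauses[OF F L]
      by (simp add: Nb_def D_def fa_def A_def q_def)
    have "(q + 2) ^ 6 \<le> Y ^ 6" by (rule power_mono) (simp_all add: Y_def)
    then have "A * (q + 2) ^ 6 \<le> A * Y ^ 6" by (rule mult_le_mono2)
    then have sz: "A \<le> N q A" "A \<le> M q A fa" "N q A \<le> A * Y ^ 6" "M q A fa \<le> A * Y ^ 6" "length (inp q A fa) \<le> A * Y ^ 6"
      using size[OF A1, of q fa] by linarith+
    show ?thesis unfolding toggle_instance_def Let_def m_def[symmetric] q_def[symmetric] Y_def[symmetric] Nb_def[symmetric] D_def[symmetric] A_def[symmetric]
    proof (rule exI[of _ "N q A"], rule exI[of _ "M q A fa"], rule exI[of _ "inp q A fa"], rule exI[of _ stt], rule exI[of _ x], rule exI[of _ "\<lambda>_. None"],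
        rule exI[of _ "\<lambda>_. []"], rule exI[of _ "\<lambda>_. 1"], intro conjI)
      show "\<forall>b<Nb. can_ask ?Q (stt (set (togs q (D b) x (\<lambda>_. None)))) []"
        unfolding stT using ask[OF A1] by blast
    qed (rule E tg st1 sat sz)+
  qed
  then have inst: "\<exists>\<kappa> a. 2 \<le> a \<and> k \<le> \<kappa> \<and> (\<forall>n F L. kcnf k n F \<and> 1 * L \<le> n \<and> L \<le> n \<longrightarrow>
      toggle_instance Mo Q 1 eN eM gi (Some [ex]) None [] (Cn 1) \<kappa> a n F L)" for k
    by (intro exI[of _ k] exI[of _ 6]) auto
  show ?thesis using toggle_reduces[OF syn _ wc inst] \<epsilon> by simp
qed

lemma connected_induce:
  fixes E :: "nat set set"
  assumes "S \<subseteq> {..<n}"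
  defines "R \<equiv> {(u, v). u \<noteq> v \<and> {u, v} \<in> E \<and> u \<in> S \<and> v \<in> S}"
  shows "connected (induce_subgraph (ugraph_of n E) S) \<longleftrightarrow> S \<noteq> {} \<and> (\<forall>u\<in>S. \<forall>v\<in>S. (u, v) \<in> R\<^sup>*)"
proof -
  let ?G = "induce_subgraph (ugraph_of n E) S"
  have G: "mk_symmetric ?G = \<lparr> pverts = S, parcs = R \<rparr>"
    unfolding mk_symmetric_def R_def by (auto simp: ugraph_of_def insert_commute)
  interpret W: wf_digraph "with_proj \<lparr> pverts = S, parcs = R \<rparr>" by unfold_locales (auto simp: R_def)
  have "arcs_ends (with_proj \<lparr> pverts = S, parcs = R \<rparr>) = R" by (simp add: arcs_ends_conv)
  then have "reachable (with_proj \<lparr> pverts = S, parcs = R \<rparr>) u v \<longleftrightarrow> (u, v) \<in> R\<^sup>*" if "u \<in> S" for u v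
    using W.reachable_conv'[of u v] that by simp
  then show ?thesis unfolding connected_def strongly_connected_def G by simp
qed

text \<open>Node 0 is the centre, \<open>1 + c\<close> a clause, \<open>1 + q + a\<close> a partial
  assignment. Centre and assignments are always switched on; a clause node connects the assignments
  that falsify the clause to the centre.\<close>

definition star_edges :: "nat \<Rightarrow> nat \<Rightarrow> (nat \<Rightarrow> nat \<Rightarrow> bool) \<Rightarrow> (nat \<times> nat) list" where
  "star_edges q A fa = map (\<lambda>c. (0, 1 + c)) [0..<q] @
    concat (map (\<lambda>a. concat (map (\<lambda>c. if fa a c then [(1 + c, 1 + q + a)] else []) [0..<q])) [0..<A])"

lemma set_star_edges: "set (star_edges q A fa) = {(0, 1 + c) | c. c < q} \<union> {(1 + c, 1 + q + a) | a c. a < A \<and> c < q \<and> fa a c}"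
  unfolding star_edges_def by (auto split: if_splits)

lemma length_star_edges: "length (star_edges q A fa) \<le> (1 + q + A) * (q + 1)"
proof -
  have "length (concat (map (\<lambda>a. concat (map (\<lambda>c. if fa a c then [(1 + c, 1 + q + a)] else []) [0..<q])) [0..<A])) \<le> A * (q * 1)"
    by (intro length_concat_upt_le) simp
  then show ?thesis unfolding star_edges_def by (simp add: algebra_simps)
qed

lemma distinct_star_edges: "distinct (map (\<lambda>(u, v). {u, v}) (star_edges q A fa))"
proof -
  have 1: "distinct (concat (map (\<lambda>a. concat (map (\<lambda>c. if fa a c then [(1 + c, 1 + q + a)] else []) [0..<q])) [0..<A]))"
    by (intro distinct_concat_upt) (auto split: if_splits)
  have "distinct (star_edges q A fa)" unfolding star_edges_def using 1 by (auto simp: distinct_map inj_on_def split: if_splits)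
  moreover have "inj_on (\<lambda>(u, v). {u, v}) (set (star_edges q A fa))"
  proof (rule inj_onI)
    fix e f assume *: "e \<in> set (star_edges q A fa)" "f \<in> set (star_edges q A fa)" "(\<lambda>(u, v). {u, v}) e = (\<lambda>(u, v). {u, v}) f"
    have lt: "fst e < snd e" if "e \<in> set (star_edges q A fa)" for e using that unfolding set_star_edges by auto
    obtain u v u' v' where e: "e = (u, v)" "f = (u', v')" by (cases e, cases f)
    have "u < v" "u' < v'" using lt[OF *(1)] lt[OF *(2)] unfolding e by simp_all
    then show "e = f" using *(3) unfolding e by (auto simp: doubleton_eq_iff)
  qed
  ultimately show ?thesis by (simp add: distinct_map)
qed

text \<open>Active clause nodes hang on the centre directly. An assignment has only clause nodes as
  neighbours, so it is connected to the centre iff it falsifies an active clause.\<close>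

lemma connected_star:
  fixes q A :: nat and fa :: "nat \<Rightarrow> nat \<Rightarrow> bool" and D :: "nat \<Rightarrow> bool"
  defines "S \<equiv> insert 0 {1 + q..<1 + q + A} \<union> {1 + c | c. c < q \<and> D c}"
  shows "connected (induce_subgraph (ugraph_of (1 + q + A) (edge_set (star_edges q A fa))) S) \<longleftrightarrow> (\<forall>a<A. \<exists>c<q. fa a c \<and> D c)"
proof -
  let ?E = "edge_set (star_edges q A fa)"
  define R where "R = {(u, v). u \<noteq> v \<and> {u, v} \<in> ?E \<and> u \<in> S \<and> v \<in> S}"
  have sR: "sym R" unfolding R_def by (auto simp: sym_def insert_commute)
  have E: "{u, v} \<in> ?E \<longleftrightarrow> (u, v) \<in> set (star_edges q A fa) \<or> (v, u) \<in> set (star_edges q A fa)" for u v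
  proof -
    have "{u, v} \<in> ?E \<longleftrightarrow> (\<exists>e \<in> set (star_edges q A fa). {u, v} = {fst e, snd e})"
      unfolding edge_set_def by (simp add: image_iff case_prod_beta)
    then show ?thesis unfolding doubleton_eq_iff by (metis fst_conv prod.collapse snd_conv)
  qed
  have "S \<subseteq> {..<1 + q + A}" unfolding S_def by auto
  from connected_induce[OF this, of ?E] have c: "connected (induce_subgraph (ugraph_of (1 + q + A) ?E) S) \<longleftrightarrow> (\<forall>u\<in>S. \<forall>v\<in>S. (u, v) \<in> R\<^sup>*)"
    unfolding R_def S_def by blast
  show ?thesis unfolding c
  proof
    assume r: "\<forall>u\<in>S. \<forall>v\<in>S. (u, v) \<in> R\<^sup>*"
    show "\<forall>a<A. \<exists>c<q. fa a c \<and> D c"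
    proof (intro allI impI)
      fix a assume a: "a < A"
      have "1 + q + a \<in> S" "0 \<in> S" using a unfolding S_def by auto
      then have "(1 + q + a, 0) \<in> R\<^sup>*" using r by blast
      then obtain v where "(1 + q + a, v) \<in> R" by (cases rule: converse_rtranclE) auto
      then have v: "v \<in> S" "(v, 1 + q + a) \<in> set (star_edges q A fa) \<or> (1 + q + a, v) \<in> set (star_edges q A fa)"
        unfolding R_def E by auto
      then show "\<exists>c<q. fa a c \<and> D c" unfolding set_star_edges S_def by auto
    qed
  next
    assume b: "\<forall>a<A. \<exists>c<q. fa a c \<and> D c"
    have z: "(u, 0) \<in> R\<^sup>*" if u: "u \<in> S" for u
    proof -
      have c0: "(1 + c, 0) \<in> R" if "c < q" "D c" for c
        unfolding R_def E set_star_edges S_def using that by auto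
      consider "u = 0" | c where "c < q" "D c" "u = 1 + c" | a where "a < A" "u = 1 + q + a"
      proof -
        have "u = 0 \<or> (\<exists>c. c < q \<and> D c \<and> u = 1 + c) \<or> (1 + q \<le> u \<and> u - (1 + q) < A)" using u unfolding S_def by auto
        then show thesis using that(1,2) that(3)[of "u - (1 + q)"] by auto
      qed
      then show ?thesis
      proof cases
        case (3 a)
        then obtain c where c: "c < q" "fa a c" "D c" using b by blast
        have "(u, 1 + c) \<in> R" unfolding R_def E set_star_edges S_def using c 3 by auto
        then show ?thesis using c0[OF c(1,3)] by (meson r_into_rtrancl rtrancl_trans)
      qed (use c0 in auto)
    qed
    show "\<forall>u\<in>S. \<forall>v\<in>S. (u, v) \<in> R\<^sup>*"
    proof (intro ballI)
      fix u v assume "u \<in> S" "v \<in> S"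
      have "(0, v) \<in> R\<^sup>*" using z[OF \<open>v \<in> S\<close>] sym_rtrancl[OF sR] by (auto dest: symD)
      then show "(u, v) \<in> R\<^sup>*" using z[OF \<open>u \<in> S\<close>] by (rule rtrancl_trans[rotated])
    qed
  qed
qed


text \<open>A common form for the size estimates of both problems: their sizes are combinations of
  \<open>A\<close>, \<open>q\<close>, \<open>A * q\<close>, \<open>q * q\<close> and 1 with
  coefficients of at most 8. The exponent 6 is generous.\<close>

lemma poly_bound:
  fixes A q :: nat
  assumes A: "1 \<le> A" and n: "n \<le> 8 * (A + q + A * q + q * q + 1)"
  shows "n \<le> A * (q + 2) ^ 6"
proof -
  have "2 ^ 4 \<le> (q + 2) ^ 4" by (rule power_mono) auto
  then have "16 * (q + 2) ^ 2 \<le> (q + 2) ^ 4 * (q + 2) ^ 2" by (intro mult_le_mono1) simp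
  also have "\<dots> = (q + 2) ^ 6" by (simp add: power_add[symmetric])
  finally have "A * (16 * (q + 2) ^ 2) \<le> A * (q + 2) ^ 6" by (rule mult_le_mono2)
  moreover have e: "A * (16 * (q + 2) ^ 2) = 16 * (A * (q * q)) + 64 * (A * q) + 64 * A"
    by (simp add: power2_eq_square algebra_simps)
  ultimately have P: "16 * (A * (q * q)) + 64 * (A * q) + 64 * A \<le> A * (q + 2) ^ 6" unfolding e by simp
  have "1 * q \<le> A * q" "1 * (q * q) \<le> A * (q * q)" using A by (rule mult_le_mono1)+
  moreover have "n \<le> 16 * y + 64 * x + 64 * A" if "q \<le> x" "z \<le> y" "n \<le> 8 * (A + q + x + z + 1)" for x y z
    using that A by simp
  ultimately have "n \<le> 16 * (A * (q * q)) + 64 * (A * q) + 64 * A" using n unfolding mult_1 by blast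
  then show ?thesis using P by (rule le_trans)
qed

lemma (in cnf_memory) ev_fals_block:
  assumes "s (Suc 0) = length F" "s 2 = L" "k \<le> s 9" "c < length F"
  shows "ev m (s(13 := a, 12 := c)) (fals_ex (Cn 0) (Vr 2) (Vr 13) 12) = of_bool (pfals 0 L a (F ! c))"
    and "ev m (s(12 := c, 13 := a)) (fals_ex (Cn 0) (Vr 2) (Vr 13) 12) = of_bool (pfals 0 L a (F ! c))"
  using assms by (subst ev_fals_ex; auto)+

definition star_node :: ex where "star_node = Bin BAdd (Cn 1) (Vr 12)"
definition leaf_node :: ex where "leaf_node = Bin BAdd (Bin BAdd (Cn 1) (Vr 1)) (Vr 13)"

definition star_gen :: gen where
  "star_gen = Sq (For 12 1 (pair_gen (Cn 0) star_node))
     (For 13 3 (For 12 1 (Iff (fals_ex (Cn 0) (Vr 2) (Vr 13) 12) (pair_gen star_node leaf_node) Nop)))"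

definition members_gen :: "mode \<Rightarrow> gen" where
  "members_gen Mo = Sq (Emit (Cn 0)) (Sq (For 13 3 (Emit leaf_node)) (if Mo = Decremental then For 12 1 (Emit star_node) else Nop))"

lemma reduces_ConnSub:
  assumes "\<epsilon> \<le> 1" "wc \<longleftrightarrow> Mo \<noteq> Fully_Dynamic"
  shows "reduces wc Mo ConnSub 1 (m_pow (1 - \<epsilon>)) \<epsilon>"
proof -
  let ?gi = "Sq (Emit (Vr 7)) (Sq (Emit (Vr 8)) (Sq (Sq (Emit (Bin BDiv (len_ex star_gen) (Cn 2))) star_gen)
     (Sq (Emit (len_ex (members_gen Mo))) (members_gen Mo))))"
  let ?eN = "Bin BAdd (Bin BAdd (Cn 1) (Vr 1)) (Vr 3)" and ?eM = "Bin BMul (Vr 7) (Bin BAdd (Vr 1) (Cn 1))"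
  define vs where "vs q A = 0 # [1 + q..<1 + q + A] @ (if Mo = Decremental then [1..<1 + q] else [])" for q A
  define N where "N q A = 1 + q + A" for q A :: nat
  define M where "M q A fa = (1 + q + A) * (q + 1)" for q A :: nat and fa :: "nat \<Rightarrow> nat \<Rightarrow> bool"
  define inp where "inp q A fa = N q A # M q A fa # enc_pairs (star_edges q A fa) @ enc_list (vs q A)" for q A fa
  define X where "X q A fa = edge_set (star_edges q A fa)" for q A fa
  define S0 where "S0 q A = insert 0 {1 + q..<1 + q + A}" for q A :: nat
  have vg: "vars_below_gen 19 star_gen" "vars_below_gen 19 (members_gen Mo)"
    "loop_vars_gen star_gen \<subseteq> insert 3 small_loops" "loop_vars_gen (members_gen Mo) \<subseteq> insert 3 small_loops"
    by (auto simp: star_gen_def members_gen_def star_node_def leaf_node_def small_loops_def)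
  have syn: "toggle_syntax ?eN ?eM ?gi (Some [star_node]) None [] (Cn 1)"
    using vg vars_below_len_ex[OF vg(1)] vars_below_len_ex[OF vg(2)] loop_vars_len_ex[of star_gen] loop_vars_len_ex[of "members_gen Mo"]
    by (auto simp: toggle_syntax_def small_ex_def star_node_def)
  show ?thesis
  proof (rule set_reduces[OF assms syn, where base = 1 and N = N and M = M and inp = inp and X = X and ?S0.0 = S0])
    fix k n F L m s
    assume cm: "cnf_memory k n F m" and s: "s (Suc 0) = length F" "s 2 = L" "s 3 = 2 ^ L" "k \<le> s 9"
    interpret cnf_memory k n F m by (rule cm)
    define q where "q = length F"
    define fa where "fa = (\<lambda>a c. pfals 0 L a (F ! c))"
    have sg: "gl m s star_gen = flat (star_edges q (2 ^ L) fa)"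
    proof -
      have "gl m s (For 13 3 (For 12 1 (Iff (fals_ex (Cn 0) (Vr 2) (Vr 13) 12) (pair_gen star_node leaf_node) Nop))) =
        flat (concat (map (\<lambda>a. concat (map (\<lambda>c. if fa a c then [(1 + c, 1 + q + a)] else []) [0..<q])) [0..<2 ^ L]))"
        by (simp add: s q_def, intro concat_upt_cong, simp add: ev_fals_block[OF s(1,2,4)] s q_def fa_def star_node_def leaf_node_def)
      then show ?thesis unfolding star_gen_def star_edges_def gl.simps(3) flat_simps(3)
        by (simp add: s q_def star_node_def)
    qed
    have l: "map (\<lambda>i. Suc (length F + i)) [0..<2 ^ L] = [Suc (length F)..<Suc (length F + 2 ^ L)]" "map Suc [0..<length F] = [Suc 0..<Suc (length F)]"
      by (rule nth_equalityI; simp del: upt_Suc)+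
    have vg: "gl m s (members_gen Mo) = vs q (2 ^ L)"
      by (simp add: members_gen_def leaf_node_def star_node_def vs_def s q_def l del: upt_Suc)
    show "let q = length F; fa = (\<lambda>a c. pfals 0 L a (F ! c)) in
      ev m s ?eN = N q (2 ^ L) \<and> (s 7 = N q (2 ^ L) \<longrightarrow> ev m s ?eM = M q (2 ^ L) fa) \<and>
      (s 7 = N q (2 ^ L) \<and> s 8 = M q (2 ^ L) fa \<longrightarrow> gl m s ?gi = inp q (2 ^ L) fa) \<and> (\<forall>c. ev m (s(12 := c)) star_node = 1 + c)"
      unfolding Let_def q_def[symmetric] fa_def[symmetric]
      by (simp add: s N_def M_def inp_def ev_len_ex sg vg enc_pairs_flat enc_list_def star_node_def q_def[symmetric])
  next
    fix q A c :: nat assume "c < q"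
    then show "1 + c \<notin> S0 q A" by (simp add: S0_def)
  next
    fix q A c :: nat and fa S assume "c < q" "1 + c \<notin> S"
    then show "can_ins (ConnSub (N q A) (M q A fa)) (X q A fa, S) [1 + c] \<and>
       ins (ConnSub (N q A) (M q A fa)) (X q A fa, S) [1 + c] = (X q A fa, insert (1 + c) S)"
      by (simp add: ConnSub_def N_def)
  next
    fix q A v :: nat and fa S assume "v \<in> S"
    then show "can_del (ConnSub (N q A) (M q A fa)) (X q A fa, S) [v] \<and>
       del (ConnSub (N q A) (M q A fa)) (X q A fa, S) [v] = (X q A fa, S - {v})"
      by (simp add: ConnSub_def)
  next
    fix q A :: nat and fa
    have el: "edge_list (N q A) (M q A fa) (star_edges q A fa)"
      using distinct_star_edges[of q A fa] length_star_edges[of q A fa]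
      by (auto simp: edge_list_def N_def M_def set_star_edges)
    have e: "set (vs q A) = S0 q A \<union> (if Mo = Decremental then {1 + c | c. c < q} else {})"
    proof -
      have "set [1..<1 + q] = {1 + c | c. c < q}"
      proof (intro set_eqI iffI)
        fix v assume "v \<in> set [1..<1 + q]"
        then have "v = 1 + (v - 1)" "v - 1 < q" by auto
        then show "v \<in> {1 + c | c. c < q}" by blast
      qed auto
      then show ?thesis by (auto simp: vs_def S0_def)
    qed
    have v: "distinct (vs q A)" "set (vs q A) \<subseteq> {..<N q A}" by (auto simp: vs_def N_def)
    show "(inp q A fa, (X q A fa, S0 q A \<union> (if Mo = Decremental then {1 + c | c. c < q} else {}))) \<in> start (ConnSub (N q A) (M q A fa))"
      unfolding ConnSub_def dyn_problem.select_convs mem_Collect_eq e[symmetric] X_def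
      by (rule exI[of _ "star_edges q A fa"], rule exI[of _ "vs q A"]) (use el v in \<open>auto simp: inp_def\<close>)
    fix D
    have "insert 0 {1 + q..<1 + q + A} \<union> {1 + c | c. c < q \<and> D c} \<noteq> {}" by simp
    then show "can_ask (ConnSub (N q A) (M q A fa)) (X q A fa, S0 q A \<union> {1 + c | c. c < q \<and> D c}) [] \<and>
       (ans (ConnSub (N q A) (M q A fa)) (X q A fa, S0 q A \<union> {1 + c | c. c < q \<and> D c}) [] \<noteq> 1 \<longleftrightarrow> (\<exists>a<A. \<forall>c<q. \<not> (fa a c \<and> D c)))"
      using connected_star[of q A fa D] unfolding ConnSub_def dyn_problem.select_convs N_def X_def S0_def by auto
    assume A: "1 \<le> A"
    have lv: "length (vs q A) \<le> 1 + A + q" by (simp add: vs_def)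
    have M1: "M q A fa = 1 + 2 * q + q * q + A * q + A" by (simp add: M_def algebra_simps)
    have li: "length (inp q A fa) \<le> 4 + 2 * M q A fa + (1 + A + q)"
      using length_star_edges[of q A fa] lv by (simp add: inp_def enc_pairs_flat enc_list_def M_def)
    show "A \<le> N q A \<and> A \<le> M q A fa \<and> N q A \<le> A * (q + 2) ^ 6 \<and> M q A fa \<le> A * (q + 2) ^ 6 \<and> length (inp q A fa) \<le> A * (q + 2) ^ 6"
    proof (intro conjI)
      have g: "1 + 2 * q + z + x + A \<le> 8 * (A + q + x + z + 1)"
        "4 + 2 * (1 + 2 * q + z + x + A) + (1 + A + q) \<le> 8 * (A + q + x + z + 1)" for x z :: nat by simp_all
      show "A \<le> N q A" "A \<le> M q A fa" unfolding M1 N_def by simp_all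
      show "N q A \<le> A * (q + 2) ^ 6" by (rule poly_bound[OF A]) (simp add: N_def)
      show "M q A fa \<le> A * (q + 2) ^ 6" by (rule poly_bound[OF A]) (use g(1)[of "q * q" "A * q"] M1 in \<open>simp only:\<close>)
      show "length (inp q A fa) \<le> A * (q + 2) ^ 6" by (rule poly_bound[OF A]) (use le_trans[OF li[unfolded M1] g(2)] in blast)
    qed
  qed
qed

text \<open>The first \<open>q\<close> sets contain the assignments that falsify a clause. The
  universe gets \<open>q + 2\<close> further elements, so that there are no more sets than elements;
  the set of these, at position \<open>q\<close>, is always selected. The last set is never
  selected: it makes the total size \<open>m\<close> at least \<open>A\<close>.\<close>

definition subsets :: "nat \<Rightarrow> nat \<Rightarrow> (nat \<Rightarrow> nat \<Rightarrow> bool) \<Rightarrow> nat list list" where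
  "subsets q A fa = map (\<lambda>c. filter (\<lambda>a. fa a c) [0..<A]) [0..<q] @ [[A..<A + q + 2], [0..<A]]"

definition subset_gen :: gen where
  "subset_gen = For 13 3 (Iff (fals_ex (Cn 0) (Vr 2) (Vr 13) 12) (Emit (Vr 13)) Nop)"

lemma reduces_SubUnion:
  assumes "\<epsilon> \<le> 1" "wc \<longleftrightarrow> Mo \<noteq> Fully_Dynamic"
  shows "reduces wc Mo SubUnion 1 (m_pow (1 - \<epsilon>)) \<epsilon>"
proof -
  let ?q2 = "Bin BAdd (Vr 1) (Cn 2)"
  let ?eN = "Bin BAdd (Vr 3) ?q2" and ?eM = "Bin BAdd (Sum 12 1 (len_ex subset_gen)) (Bin BAdd ?q2 (Vr 3))"
  let ?gj = "if Mo = Decremental then Sq (Emit (Bin BAdd (Vr 1) (Cn 1))) (Sq (For 12 1 (Emit (Vr 12))) (Emit (Vr 1))) else Sq (Emit (Cn 1)) (Emit (Vr 1))"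
  let ?gi = "Sq (Emit (Vr 7)) (Sq (Emit (Vr 8)) (Sq (Emit ?q2) (Sq (For 12 1 (Sq (Emit (len_ex subset_gen)) subset_gen))
    (Sq (Emit ?q2) (Sq (For 12 1 (Emit (Bin BAdd (Vr 3) (Vr 12)))) (Sq (Emit (Bin BAdd (Vr 3) (Vr 1))) (Sq (Emit (Bin BAdd (Bin BAdd (Vr 3) (Vr 1)) (Cn 1)))
      (Sq (Emit (Vr 3)) (Sq (For 13 3 (Emit (Vr 13))) ?gj)))))))))"
  define js where "js q = (if Mo = Decremental then [0..<q] else []) @ [q]" for q
  define N where "N q A = A + q + 2" for q A :: nat
  define M where "M q A fa = (\<Sum>c<q. length (filter (\<lambda>a. fa a c) [0..<A])) + (q + 2 + A)" for q A :: nat and fa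
  define inp where "inp q A fa = N q A # M q A fa # enc_lists (subsets q A fa) @ enc_list (js q)" for q A fa
  define X where "X q A fa = map set (subsets q A fa)" for q A fa
  define S0 where "S0 q A = {q}" for q A :: nat
  have vg: "vars_below_gen 19 subset_gen" "loop_vars_gen subset_gen \<subseteq> insert 3 small_loops"
    by (auto simp: subset_gen_def small_loops_def)
  have syn: "toggle_syntax ?eN ?eM ?gi (Some [Vr 12]) None [] (Cn 1)"
    using vg vars_below_len_ex[OF vg(1)] loop_vars_len_ex[of subset_gen]
    by (auto simp: toggle_syntax_def small_ex_def small_loops_def)
  have lX: "length (X q A fa) = q + 2" for q A fa by (simp add: X_def subsets_def)
  show ?thesis
  proof (rule set_reduces[OF assms syn, where base = 0 and N = N and M = M and inp = inp and X = X and ?S0.0 = S0])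
    fix k n F L m s
    assume cm: "cnf_memory k n F m" and s: "s (Suc 0) = length F" "s 2 = L" "s 3 = 2 ^ L" "k \<le> s 9"
    interpret cnf_memory k n F m by (rule cm)
    define q where "q = length F"
    define fa where "fa = (\<lambda>a c. pfals 0 L a (F ! c))"
    have sq: "s (Suc 0) = q" using s by (simp add: q_def)
    have filt: "concat (map (\<lambda>a. if P a then [a] else []) xs) = filter P xs" for P and xs :: "nat list" by (induction xs) auto
    have sg: "gl m (s(12 := c)) subset_gen = filter (\<lambda>a. fa a c) [0..<2 ^ L]" if "c < q" for c
    proof -
      have "gl m (s(12 := c)) subset_gen = concat (map (\<lambda>a. if fa a c then [a] else []) [0..<2 ^ L])"
        using that by (simp add: subset_gen_def s, intro concat_upt_cong, simp add: fa_def q_def ev_fals_block(2)[OF s(1,2,4)])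
      then show ?thesis unfolding filt .
    qed
    have eM: "ev m s (Sum 12 1 (len_ex subset_gen)) = (\<Sum>c<q. length (filter (\<lambda>a. fa a c) [0..<2 ^ L]))"
      by (simp add: sq ev_len_ex sg)
    have g1: "gl m s (For 12 1 (Sq (Emit (len_ex subset_gen)) subset_gen)) = concat (map enc_list (map (\<lambda>c. filter (\<lambda>a. fa a c) [0..<2 ^ L]) [0..<q]))"
      unfolding gl.simps(4) One_nat_def sq map_map by (rule concat_upt_cong) (simp add: ev_len_ex sg enc_list_def)
    have u: "map ((+) (2 ^ L)) [0..<q] = [2 ^ L..<2 ^ L + q]"
      by (rule nth_equalityI) auto
    have gj: "gl m s ?gj = enc_list (js q)"
      by (simp add: sq js_def enc_list_def)
    have "gl m s ?gi = s 7 # s 8 # enc_lists (subsets q (2 ^ L) fa) @ enc_list (js q)"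
      unfolding gl.simps(3) g1 gj by (simp add: sq s(3) enc_lists_def subsets_def enc_list_def u)
    then show "let q = length F; fa = (\<lambda>a c. pfals 0 L a (F ! c)) in
      ev m s ?eN = N q (2 ^ L) \<and> (s 7 = N q (2 ^ L) \<longrightarrow> ev m s ?eM = M q (2 ^ L) fa) \<and>
      (s 7 = N q (2 ^ L) \<and> s 8 = M q (2 ^ L) fa \<longrightarrow> gl m s ?gi = inp q (2 ^ L) fa) \<and> (\<forall>c. ev m (s(12 := c)) (Vr 12) = 0 + c)"
      unfolding Let_def q_def[symmetric] fa_def[symmetric] using eM
      by (simp add: s(3) sq N_def M_def inp_def)
  next
    fix q A c :: nat assume "c < q"
    then show "0 + c \<notin> S0 q A" by (simp add: S0_def)
  next
    fix q A c :: nat and fa S assume "c < q" "0 + c \<notin> S"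
    then show "can_ins (SubUnion (N q A) (M q A fa)) (X q A fa, S) [0 + c] \<and>
       ins (SubUnion (N q A) (M q A fa)) (X q A fa, S) [0 + c] = (X q A fa, insert (0 + c) S)"
      by (simp add: SubUnion_def lX)
  next
    fix q A v :: nat and fa S assume "v \<in> S"
    then show "can_del (SubUnion (N q A) (M q A fa)) (X q A fa, S) [v] \<and>
       del (SubUnion (N q A) (M q A fa)) (X q A fa, S) [v] = (X q A fa, S - {v})"
      by (simp add: SubUnion_def)
  next
    fix q A :: nat and fa
    have sl: "set_list (N q A) (subsets q A fa)" "length (subsets q A fa) = q + 2"
      by (auto simp: set_list_def subsets_def N_def)
    have "(\<Sum>xs\<leftarrow>subsets q A fa. card (set xs)) = (\<Sum>c\<leftarrow>[0..<q]. length (filter (\<lambda>a. fa a c) [0..<A])) + (q + 2 + A)"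
    proof -
      have "card (set (filter (\<lambda>a. fa a c) [0..<A])) = length (filter (\<lambda>a. fa a c) [0..<A])" for c
        by (rule distinct_card) simp
      then show ?thesis by (simp add: subsets_def comp_def del: set_filter)
    qed
    then have sm: "(\<Sum>xs\<leftarrow>subsets q A fa. card (set xs)) = M q A fa"
      by (simp add: M_def interv_sum_list_conv_sum_set_nat atLeast0LessThan)
    have j: "distinct (js q)" "set (js q) \<subseteq> {..<q + 2}" "set (js q) = S0 q A \<union> (if Mo = Decremental then {0 + c | c. c < q} else {})"
      by (auto simp: js_def S0_def)
    show "(inp q A fa, (X q A fa, S0 q A \<union> (if Mo = Decremental then {0 + c | c. c < q} else {}))) \<in> start (SubUnion (N q A) (M q A fa))"
      unfolding SubUnion_def dyn_problem.select_convs mem_Collect_eq j(3)[symmetric] X_def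
      by (rule exI[of _ "subsets q A fa"], rule exI[of _ "js q"]) (use sl sm j(1,2) in \<open>auto simp: inp_def N_def\<close>)
    fix D
    have Xc: "X q A fa ! c = {a. a < A \<and> fa a c}" if "c < q" for c using that by (auto simp: X_def subsets_def nth_append)
    have Xq: "X q A fa ! q = {A..<A + q + 2}" by (auto simp: X_def subsets_def nth_append)
    have "(\<Union>i\<in>S0 q A \<union> {0 + c | c. c < q \<and> D c}. X q A fa ! i) = {A..<A + q + 2} \<union> {a. a < A \<and> (\<exists>c<q. fa a c \<and> D c)}"
      unfolding S0_def using Xc Xq by auto
    also have "\<dots> = {..<N q A} \<longleftrightarrow> (\<forall>a<A. \<exists>c<q. fa a c \<and> D c)"
    proof
      assume e: "{A..<A + q + 2} \<union> {a. a < A \<and> (\<exists>c<q. fa a c \<and> D c)} = {..<N q A}"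
      show "\<forall>a<A. \<exists>c<q. fa a c \<and> D c"
      proof (intro allI impI)
        fix a assume "a < A"
        then have "a \<in> {A..<A + q + 2} \<union> {a. a < A \<and> (\<exists>c<q. fa a c \<and> D c)}" unfolding e by (simp add: N_def)
        then show "\<exists>c<q. fa a c \<and> D c" using \<open>a < A\<close> by auto
      qed
    qed (auto simp: N_def)
    finally show "can_ask (SubUnion (N q A) (M q A fa)) (X q A fa, S0 q A \<union> {0 + c | c. c < q \<and> D c}) [] \<and>
       (ans (SubUnion (N q A) (M q A fa)) (X q A fa, S0 q A \<union> {0 + c | c. c < q \<and> D c}) [] \<noteq> 1 \<longleftrightarrow> (\<exists>a<A. \<forall>c<q. \<not> (fa a c \<and> D c)))"
      unfolding SubUnion_def by auto
    assume A: "1 \<le> A"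
    have "(\<Sum>c<q. length (filter (\<lambda>a. fa a c) [0..<A])) \<le> (\<Sum>c<q. A)"
      by (rule sum_mono) (metis diff_zero length_filter_le length_upt)
    then have M1: "M q A fa \<le> A * q + (q + 2 + A)" by (simp add: M_def mult.commute)
    have "length (enc_lists (subsets q A fa)) = 1 + (q + 2) + M q A fa"
      by (simp add: enc_lists_def length_concat comp_def subsets_def enc_list_def M_def interv_sum_list_conv_sum_set_nat atLeast0LessThan sum_Suc)
    then have li: "length (inp q A fa) \<le> 2 + (q + 3 + M q A fa) + (2 + q)" by (simp add: inp_def enc_list_def js_def)
    show "A \<le> N q A \<and> A \<le> M q A fa \<and> N q A \<le> A * (q + 2) ^ 6 \<and> M q A fa \<le> A * (q + 2) ^ 6 \<and> length (inp q A fa) \<le> A * (q + 2) ^ 6"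
    proof (intro conjI)
      have g: "a + (q + 2 + A) \<le> 8 * (A + q + a + d + 1)" for a d :: nat by simp
      have g1: "A * q + (q + 2 + A) \<le> 8 * (A + q + A * q + q * q + 1)" by (rule g)
      have "2 + (q + 3 + x) + (2 + q) \<le> 8 * (A + q + a + d + 1)" if "x \<le> a + (q + 2 + A)" for x a d using that A by simp
      from this[OF M1] have g2: "2 + (q + 3 + M q A fa) + (2 + q) \<le> 8 * (A + q + A * q + q * q + 1)" .
      show "A \<le> N q A" "A \<le> M q A fa" unfolding M_def N_def by simp_all
      show "N q A \<le> A * (q + 2) ^ 6" by (rule poly_bound[OF A]) (simp add: N_def)
      show "M q A fa \<le> A * (q + 2) ^ 6" by (rule poly_bound[OF A]) (rule le_trans[OF M1 g1])
      show "length (inp q A fa) \<le> A * (q + 2) ^ 6" by (rule poly_bound[OF A]) (rule le_trans[OF li g2])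
    qed
  qed
qed


section \<open>Pagh's problem: intersections that accumulate over all phases\<close>

section \<open>Emptiness of intersections\<close>

lemma valid_seq_append:
  "valid_seq Mo Q s (rs @ rs') \<longleftrightarrow> valid_seq Mo Q s rs \<and> valid_seq Mo Q (fold (\<lambda>r s. upd Q s r) rs s) rs'"
  by (induction rs arbitrary: s) auto

text \<open>
  Set 0 is the set of all partial assignments, set \<open>1 + c\<close> the set of those that satisfy clause \<open>c\<close>.
  Sets cannot be removed, so every phase adds exactly \<open>q\<close> sets, which fixes their indices: each
  phase intersects successively the sets of the clauses that are still to be satisfied, padded
  with intersections with set 0.
\<close>

locale pp_gadget =
  fixes q A Nb M :: nat and fa D :: "nat \<Rightarrow> nat \<Rightarrow> bool"
  assumes M: "1 + q + Nb * q \<le> M"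
begin

abbreviation Q :: "nat set list dyn_problem" where "Q \<equiv> EmptyPP (A + q + 1) M"

definition base :: "nat list list" where
  "base = [0..<A] # map (\<lambda>c. filter (\<lambda>a. \<not> fa a c) [0..<A]) [0..<q]"

text \<open>The position of the intersection after \<open>c\<close> steps of phase \<open>b\<close>.
  Behind the \<open>1 + q\<close> initial sets each phase appends \<open>q\<close>, so step
  \<open>c\<close> creates position \<open>1 + q + b * q + c\<close>, which is
  \<open>idx b (Suc c)\<close>. A phase begins with set 0, also if \<open>q = 0\<close>.\<close>

definition idx :: "nat \<Rightarrow> nat \<Rightarrow> nat" where "idx b c = (if c = 0 then 0 else q + b * q + c)"

definition step :: "nat \<Rightarrow> nat \<Rightarrow> request" where
  "step b c = Ins [idx b c, if D b c then 1 + c else 0]"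

definition rs :: "nat \<Rightarrow> (request \<times> nat) list" where
  "rs b = map (\<lambda>c. (step b c, 0)) [0..<q] @ [(Query [idx b q], 1)]"

definition alive :: "nat \<Rightarrow> nat \<Rightarrow> nat set" where
  "alive b c = {a. a < A \<and> (\<forall>d<c. D b d \<longrightarrow> \<not> fa a d)}"

text \<open>The length is part of the invariant because it fixes the positions of future sets; the
  initial sets keep their positions since updates only append.\<close>

definition inv :: "nat \<Rightarrow> nat \<Rightarrow> nat set list \<Rightarrow> bool" where
  "inv b c X \<longleftrightarrow> length X = 1 + q + b * q + c \<and> take (1 + q) X = map set base \<and> X ! idx b c = alive b c"

lemma base_nth: "base ! 0 = [0..<A]" "c < q \<Longrightarrow> base ! (1 + c) = filter (\<lambda>a. \<not> fa a c) [0..<A]" "length base = 1 + q"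
  by (simp_all add: base_def)

lemma inv_nth:
  assumes "inv b c X" "i \<le> q"
  shows "X ! i = set (base ! i)"
proof -
  have "X ! i = take (1 + q) X ! i" using assms(2) by simp
  also have "\<dots> = set (base ! i)" using assms by (simp add: inv_def base_nth(3))
  finally show ?thesis .
qed

lemma inv_step:
  assumes "inv b c X" "c < q" "b < Nb"
  shows "valid Q X (step b c) \<and> inv b (Suc c) (upd Q X (step b c))"
proof -
  let ?j = "if D b c then 1 + c else 0"
  have len: "length X = 1 + q + b * q + c" using assms(1) by (simp add: inv_def)
  have "b * q + q \<le> Nb * q" using assms(3) mult_le_mono1[of "Suc b" Nb q] by simp
  then have lM: "length X < M" using len M assms(2) by linarith
  have i: "idx b c < length X" "?j < length X" using len assms(2) by (simp_all add: idx_def)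
  have j: "X ! ?j = (if D b c then {a. a < A \<and> \<not> fa a c} else {..<A})"
    using inv_nth[OF assms(1), of ?j] base_nth(1) base_nth(2)[OF assms(2)] assms(2) by auto
  have "X ! idx b c \<inter> X ! ?j = alive b (Suc c)"
  proof -
    have "X ! idx b c = alive b c" using assms(1) by (simp add: inv_def)
    then show ?thesis unfolding j by (auto simp: alive_def less_Suc_eq)
  qed
  then have u: "upd Q X (step b c) = X @ [alive b (Suc c)]" by (simp add: step_def EmptyPP_def)
  have "(X @ [alive b (Suc c)]) ! idx b (Suc c) = alive b (Suc c)"
    using len by (simp add: idx_def nth_append)
  then have "inv b (Suc c) (X @ [alive b (Suc c)])" using assms(1) len by (simp add: inv_def)
  moreover have "valid Q X (step b c)" using i lM by (simp add: step_def EmptyPP_def)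
  ultimately show ?thesis unfolding u by blast
qed

lemma inv_steps:
  assumes "inv b 0 X" "b < Nb" "c \<le> q"
  shows "valid_seq Fully_Dynamic Q X (map (step b) [0..<c]) \<and> inv b c (fold (\<lambda>r s. upd Q s r) (map (step b) [0..<c]) X)"
  using assms(3)
proof (induction c)
  case (Suc c)
  let ?X = "fold (\<lambda>r s. upd Q s r) (map (step b) [0..<c]) X"
  have IH: "valid_seq Fully_Dynamic Q X (map (step b) [0..<c])" "inv b c ?X" using Suc by simp_all
  have s: "valid Q ?X (step b c)" "inv b (Suc c) (upd Q ?X (step b c))" using inv_step[OF IH(2) _ assms(2)] Suc.prems by simp_all
  have "permitted Fully_Dynamic (step b c)" by (simp add: step_def)
  then show ?case using IH s by (simp add: valid_seq_append)
qed (use assms(1) in simp)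

lemma phase:
  assumes "inv b 0 X" "b < Nb"
  shows "valid_seq Fully_Dynamic Q X (map fst (rs b))" "inv (Suc b) 0 (fold (\<lambda>r s. upd Q s r) (map fst (rs b)) X)"
    "hits Q X (rs b) \<longleftrightarrow> alive b q \<noteq> {}"
proof -
  let ?X = "fold (\<lambda>r s. upd Q s r) (map (step b) [0..<q]) X"
  have s: "valid_seq Fully_Dynamic Q X (map (step b) [0..<q])" "inv b q ?X" using inv_steps[OF assms order_refl] by simp_all
  have f: "map fst (rs b) = map (step b) [0..<q] @ [Query [idx b q]]" "map fst (map (\<lambda>c. (step b c, 0::nat)) [0..<q]) = map (step b) [0..<q]"
    by (simp_all add: rs_def comp_def)
  have len: "length ?X = 1 + q + b * q + q" using s(2) by (simp add: inv_def)
  have "idx b q < length ?X" unfolding len by (simp add: idx_def)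
  then show "valid_seq Fully_Dynamic Q X (map fst (rs b))" using s(1) unfolding f valid_seq_append by (simp add: EmptyPP_def)
  have "?X ! 0 = set [0..<A]" using inv_nth[OF s(2), of 0] base_nth(1) by simp
  then have "inv (Suc b) 0 ?X" using s(2) by (auto simp: inv_def idx_def alive_def)
  then show "inv (Suc b) 0 (fold (\<lambda>r s. upd Q s r) (map fst (rs b)) X)" unfolding f by simp
  have "\<not> hits Q X (map (\<lambda>c. (step b c, 0)) cs)" for cs X by (induction cs arbitrary: X) (auto simp: step_def)
  moreover have "?X ! idx b q = alive b q" using s(2) by (simp add: inv_def)
  ultimately show "hits Q X (rs b) \<longleftrightarrow> alive b q \<noteq> {}" unfolding rs_def hits_append f by (simp add: EmptyPP_def)
qed

definition state :: "nat \<Rightarrow> nat set list" where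
  "state b = fold (\<lambda>r s. upd Q s r) (concat (map (\<lambda>b. map fst (rs b)) [0..<b])) (map set base)"

lemma phases:
  "b \<le> Nb \<Longrightarrow> valid_seq Fully_Dynamic Q (map set base) (concat (map (\<lambda>b. map fst (rs b)) [0..<b])) \<and> inv b 0 (state b)"
proof (induction b)
  case 0
  have "map set base ! 0 = {..<A}" by (simp add: base_def atLeast0LessThan)
  then show ?case by (auto simp: state_def inv_def base_nth(3) idx_def alive_def)
next
  case (Suc b)
  then have "valid_seq Fully_Dynamic Q (map set base) (concat (map (\<lambda>b. map fst (rs b)) [0..<b]))" "inv b 0 (state b)" "b < Nb" by simp_all
  then show ?case using phase[of b "state b"] by (simp add: valid_seq_append state_def)
qed

lemma valid_phases: "valid_phases False Fully_Dynamic Q (map set base) Nb rs state"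
  using phases[of Nb] by (simp add: valid_phases_def state_def)

end

definition idx_ex :: "nat \<Rightarrow> ex" where
  "idx_ex v = Bin BMul (Bin BLess (Cn 0) (Vr v)) (Bin BAdd (Bin BAdd (Vr 1) (Bin BMul (Vr 5) (Vr 1))) (Vr v))"

definition intersect_gen :: gen where
  "intersect_gen = Sq (For 12 1 (req_gen 0 [idx_ex 12, Bin BMul (beta_fals 1) (Bin BAdd (Cn 1) (Vr 12))] (Cn 0))) (req_gen 2 [idx_ex 1] (Cn 1))"

definition satisfiers_gen :: gen where
  "satisfiers_gen = For 13 3 (Iff (fals_ex (Cn 0) (Vr 2) (Vr 13) 12) Nop (Emit (Vr 13)))"

text \<open>Updates cannot be undone, so phases do not restore the state as in the toggling
  reductions. One long valid sequence is built instead, in which phase \<open>b\<close> knows from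
  \<open>b\<close> where its sets are. Emptiness of the final intersection, answer 1, means that no
  partial assignment completes the current one.\<close>

lemma reduces_EmptyPP:
  assumes \<epsilon>: "\<epsilon> \<le> 1"
  shows "reduces False Fully_Dynamic EmptyPP 1 (n_pow (1 - \<epsilon>)) \<epsilon>"
proof -
  let ?q1 = "Bin BAdd (Vr 1) (Cn 1)"
  let ?eN = "Bin BAdd (Vr 3) ?q1" and ?eM = "Bin BAdd (Vr 7) (Bin BMul (Vr 10) (Vr 1))"
  let ?gi = "Sq (Emit (Vr 7)) (Sq (Emit (Vr 8)) (Sq (Emit ?q1) (Sq (Emit (Vr 3)) (Sq (For 13 3 (Emit (Vr 13)))
     (For 12 1 (Sq (Emit (len_ex satisfiers_gen)) satisfiers_gen))))))"
  have vg: "vars_below_gen 19 satisfiers_gen" "loop_vars_gen satisfiers_gen \<subseteq> {0, 1, 2, 3, 9} \<union> {11..18}"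
    by (auto simp: satisfiers_gen_def)
  have vi: "vars_below_gen 19 intersect_gen" "loop_vars_gen intersect_gen \<subseteq> {0, 1, 2, 9} \<union> {11..18}"
    by (auto simp: intersect_gen_def req_gen_def idx_ex_def beta_fals_def)
  have "reduction_instance False Fully_Dynamic EmptyPP 1 (n_pow (1 - \<epsilon>)) \<epsilon> ?eN ?eM ?gi intersect_gen k 3 n F L"
    if F: "kcnf k n F" and L: "1 * L \<le> n" for k n F L
  proof -
    have Ln: "L \<le> n" using L by simp
    define q where "q = length F"
    define m where "m = input_fun (enc_cnf n F)"
    define Y where "Y = n + q + k + 2"
    define fa where "fa = (\<lambda>a c. pfals 0 L a (F ! c))"
    define D where "D b = (\<lambda>c. pfals (1 * L) n (b * 2 ^ (1 * L)) (F ! c))" for b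
    define Nb :: nat where "Nb = 2 ^ (n - 1 * L)"
    define A :: nat where "A = 2 ^ L"
    \<comment> \<open>All sets ever created, \<open>1 + q + Nb * q\<close>, plus \<open>A\<close>
      for the required bound \<open>2 ^ L \<le> M\<close>. The universe has \<open>q + 1\<close>
      elements besides the assignments, so that the initial sets number at most
      \<open>n\<close>.\<close>
    define M where "M = A + q + 1 + Nb * q"
    have cm: "cnf_memory k n F m" by unfold_locales (use F m_def in auto)
    interpret cnf_memory k n F m by (rule cm)
    interpret S: pp_gadget q A Nb M fa D by unfold_locales (simp add: M_def)
    define inp where "inp = (A + q + 1) # M # enc_lists S.base"
    have st: "(inp, map set S.base) \<in> start (EmptyPP (A + q + 1) M)"
      unfolding EmptyPP_def dyn_problem.select_convs mem_Collect_eq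
      by (rule exI[of _ S.base]) (auto simp: inp_def set_list_def S.base_def M_def)
    have filt: "concat (map (\<lambda>a. if P a then [] else [a]) xs) = filter (\<lambda>a. \<not> P a) xs" for P and xs :: "nat list" by (induction xs) auto
    have E: "ev m s ?eN = A + q + 1 \<and> (s 7 = A + q + 1 \<longrightarrow> ev m s ?eM = M) \<and>
       (s 7 = A + q + 1 \<and> s 8 = M \<longrightarrow> gl m s ?gi = inp \<and> (s 5 < Nb \<longrightarrow> gl m s intersect_gen = concat (map record_words (S.rs (s 5)))))"
      if s: "std_env n q L 1 k s" for s
    proof -
      have sv: "s (Suc 0) = length F" "s 2 = L" "s 3 = 2 ^ L" "k \<le> s 9" "s (Suc 0) = q" "s 3 = A" "s 10 = Nb"
        using s by (simp_all add: std_env_def q_def A_def Nb_def)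
      have sg: "gl m (s(12 := c)) satisfiers_gen = filter (\<lambda>a. \<not> fa a c) [0..<A]" if "c < q" for c
      proof -
        have "gl m (s(12 := c)) satisfiers_gen = concat (map (\<lambda>a. if fa a c then [] else [a]) [0..<A])"
          using that by (simp add: satisfiers_gen_def sv(6), intro concat_upt_cong, simp add: fa_def q_def ev_fals_block(2)[OF sv(1,2,4)])
        then show ?thesis unfolding filt .
      qed
      have g1: "gl m s (For 12 1 (Sq (Emit (len_ex satisfiers_gen)) satisfiers_gen)) =
          concat (map enc_list (map (\<lambda>c. filter (\<lambda>a. \<not> fa a c) [0..<A]) [0..<q]))"
        unfolding gl.simps(4) One_nat_def sv(5) map_map by (rule concat_upt_cong) (simp add: ev_len_ex sg enc_list_def)
      have gi: "gl m s ?gi = s 7 # s 8 # enc_lists S.base"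
        unfolding gl.simps(3) g1 by (simp add: sv(5,6) enc_lists_def S.base_def enc_list_def)
      have bf: "ev m (s(12 := c)) (beta_fals 1) = of_bool (D (s 5) c)" if "c < q" for c
        using ev_beta_fals[OF cm s[unfolded q_def] order_refl] that by (simp add: q_def D_def)
      have ix: "ev m t (idx_ex v) = S.idx (t 5) (t v)" if "t (Suc 0) = q" for t v
        using that by (simp add: idx_ex_def S.idx_def)
      have r1: "gl m (s(12 := c)) (req_gen 0 [idx_ex 12, Bin BMul (beta_fals 1) (Bin BAdd (Cn 1) (Vr 12))] (Cn 0)) = record_words (S.step (s 5) c, 0)"
        if "c < q" for c
      proof -
        have "map (ev m (s(12 := c))) [idx_ex 12, Bin BMul (beta_fals 1) (Bin BAdd (Cn 1) (Vr 12))] = [S.idx (s 5) c, if D (s 5) c then 1 + c else 0]"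
          using bf[OF that] ix[of "s(12 := c)" 12] sv(5) by simp
        then show ?thesis by (subst gl_req_gen) (simp_all add: mk_request_def S.step_def del: record_words.simps)
      qed
      have r2: "gl m s (req_gen 2 [idx_ex 1] (Cn 1)) = record_words (Query [S.idx (s 5) q], 1)"
      proof -
        have "ev m s (idx_ex 1) = S.idx (s 5) q" using ix[of s 1] sv(5) by simp
        then show ?thesis by (subst gl_req_gen) (simp_all add: mk_request_def del: record_words.simps)
      qed
      have "gl m s (For 12 1 (req_gen 0 [idx_ex 12, Bin BMul (beta_fals 1) (Bin BAdd (Cn 1) (Vr 12))] (Cn 0))) =
          concat (map (\<lambda>c. record_words (S.step (s 5) c, 0)) [0..<q])"
        unfolding gl.simps(4) One_nat_def sv(5) by (rule concat_upt_cong) (use r1 in simp)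
      then have "gl m s intersect_gen = concat (map record_words (S.rs (s 5)))"
        unfolding intersect_gen_def gl.simps(3) r2 S.rs_def by (simp add: comp_def del: record_words.simps gl.simps)
      then show ?thesis using gi by (simp add: sv(5-7) M_def inp_def)
    qed
    have sat: "satisfiable F \<longleftrightarrow> (\<exists>b<Nb. hits (EmptyPP (A + q + 1) M) (S.state b) (S.rs b))"
    proof -
      have "hits (EmptyPP (A + q + 1) M) (S.state b) (S.rs b) \<longleftrightarrow> (\<exists>a<A. \<forall>c<q. \<not> (fa a c \<and> D b c))" if "b < Nb" for b
        using S.phase(3)[of b "S.state b"] S.phases[of b] that by (auto simp: S.alive_def)
      then show ?thesis unfolding satisfiable_clauses[OF F Ln] by (auto simp: Nb_def A_def fa_def D_def q_def)
    qed
    define B :: nat where "B = 2 ^ n"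
    have AB: "1 \<le> A" "A \<le> B" "Nb \<le> B" unfolding A_def B_def Nb_def using Ln by (simp_all add: power_increasing)
    have Y3: "4 * Y \<le> Y ^ 3"
    proof -
      have "(2 * 2) * Y \<le> (Y * Y) * Y" by (intro mult_le_mono) (simp_all add: Y_def)
      then show ?thesis by (simp add: power3_eq_cube)
    qed
    have qY: "4 * q + 8 \<le> Y ^ 3" using Y3 by (simp add: Y_def)
    have N1: "A + q + 1 \<le> A * Y ^ 3"
    proof -
      have "A * (4 * q + 8) \<le> A * Y ^ 3" using qY by (rule mult_le_mono2)
      moreover have "1 * q \<le> A * q" using AB(1) by (rule mult_le_mono1)
      moreover have "A * (4 * q + 8) = 4 * (A * q) + 8 * A" by (simp add: algebra_simps)
      moreover have "A + q + 1 \<le> 4 * x + 8 * A" if "q \<le> x" for x using that AB(1) by simp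
      ultimately show ?thesis by (metis le_trans mult_1)
    qed
    have BY: "B * (4 * q + 8) \<le> B * Y ^ 3" using qY by (rule mult_le_mono2)
    have Bq: "B * (4 * q + 8) = 4 * (B * q) + 8 * B" by (simp add: algebra_simps)
    have qB: "q \<le> B * q" "A * q \<le> B * q" "Nb * q \<le> B * q" using AB by (simp_all add: mult_le_mono1)
    have M1: "M \<le> B * Y ^ 3"
    proof -
      have "A + q + 1 + y \<le> 4 * x + 8 * B" if "q \<le> x" "y \<le> x" for x y using that AB by simp
      from this[OF qB(1,3)] show ?thesis using BY unfolding M_def Bq by (rule le_trans)
    qed
    have li: "length inp \<le> B * Y ^ 3"
    proof -
      have "length (concat (map (\<lambda>c. enc_list (filter (\<lambda>a. \<not> fa a c) [0..<A])) [0..<q])) \<le> q * (1 + A)"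
        by (rule length_concat_upt_le) (simp add: enc_list_def, metis diff_zero length_filter_le length_upt)
      then have "length inp \<le> 4 + A + q * (1 + A)" by (simp add: inp_def enc_lists_def S.base_def enc_list_def comp_def)
      also have "\<dots> = 4 + A + q + A * q" by (simp add: algebra_simps)
      also have "\<dots> \<le> 4 * (B * q) + 8 * B"
      proof -
        have "4 + A + q + y \<le> 4 * x + 8 * B" if "q \<le> x" "y \<le> x" for x y using that AB by simp
        from this[OF qB(1,2)] show ?thesis .
      qed
      finally show ?thesis using BY unfolding Bq by (rule le_trans)
    qed
    have NB: "n_pow (1 - \<epsilon>) (A + q + 1) M \<le> (2 ^ L * real Y ^ 3) powr (real 1 - \<epsilon>)"
    proof -
      have "real (A + q + 1) \<le> real (A * Y ^ 3)" using N1 by (rule of_nat_mono)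
      then have "real (A + q + 1) powr (1 - \<epsilon>) \<le> real (A * Y ^ 3) powr (1 - \<epsilon>)" using \<epsilon> by (intro powr_mono2) auto
      then show ?thesis by (simp add: n_pow_def A_def)
    qed
    have sh: "\<forall>(rq, e) \<in> set (S.rs b). short rq" "length (S.rs b) \<le> Y ^ 3" for b
      using qY by (auto simp: S.rs_def S.step_def short_def)
    show ?thesis unfolding reduction_instance_def Let_def m_def[symmetric] q_def[symmetric] Y_def[symmetric] Nb_def[symmetric] A_def[symmetric] B_def[symmetric]
    proof (rule exI[of _ "A + q + 1"], rule exI[of _ M], rule exI[of _ inp], rule exI[of _ "map set S.base"], rule exI[of _ S.rs],
        rule exI[of _ S.state], intro conjI)
      show "A \<le> A + q + 1" "A \<le> M" by (simp_all add: M_def)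
      show "n_pow (1 - \<epsilon>) (A + q + 1) M \<le> (2 ^ L * real Y ^ 3) powr (real 1 - \<epsilon>)" by (rule NB)
      show "valid_phases False Fully_Dynamic (EmptyPP (A + q + 1) M) (map set S.base) Nb S.rs S.state" by (rule S.valid_phases)
      show "\<forall>b<Nb. (\<forall>(rq, e) \<in> set (S.rs b). short rq) \<and> length (S.rs b) \<le> Y ^ 3" using sh by blast
    qed (use E st sat N1 M1 li in blast)+
  qed
  then have I: "\<forall>k. \<exists>\<kappa> a. \<forall>n F L. kcnf k n F \<and> 1 * L \<le> n \<longrightarrow>
      reduction_instance False Fully_Dynamic EmptyPP 1 (n_pow (1 - \<epsilon>)) \<epsilon> ?eN ?eM ?gi intersect_gen \<kappa> a n F L" by blast
  have v: "vars_below 19 ?eN" "vars_below 19 ?eM" "vars_below_gen 19 ?gi"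
    "loop_vars ?eN \<union> loop_vars ?eM \<union> loop_vars_gen ?gi \<subseteq> {0, 1, 2, 3, 9} \<union> {11..18}"
    using vg vars_below_len_ex[OF vg(1)] loop_vars_len_ex[of satisfiers_gen] by auto
  show ?thesis unfolding reduces_def
    by (rule exI[of _ ?eN], rule exI[of _ ?eM], rule exI[of _ ?gi], rule exI[of _ intersect_gen]) (intro conjI v vi I)
qed

section \<open>Reduction to exponents up to 1, and the theorem\<close>

section \<open>The theorem\<close>

lemma scale_bound:
  fixes C x y z :: real
  assumes "z \<le> C * x" "x \<le> y" "0 \<le> x"
  shows "z \<le> max C 0 * y"
proof -
  have "C * x \<le> max C 0 * x" using assms(3) by (intro mult_right_mono) auto
  also have "\<dots> \<le> max C 0 * y" using assms(2) by (intro mult_left_mono) auto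
  finally show ?thesis using assms(1) by simp
qed

text \<open>The bounds are only compared for positive parameters, so the threshold is raised to
  \<open>max N 1\<close>; the constant becomes \<open>max C 0\<close> because a negative one would
  reverse the comparison.\<close>

lemma solvable_amortized_mono:
  assumes "solvable_amortized Mo Q t f" "\<And>n m. 1 \<le> n \<Longrightarrow> 1 \<le> m \<Longrightarrow> f n m \<le> f' n m" "\<And>n m. 0 \<le> f n m"
  shows "solvable_amortized Mo Q t f'"
proof -
  from assms(1) obtain P\<^sub>0 P c and C :: real and N where H: "\<forall>n m xs s rs.
       (xs, s) \<in> start (Q n m) \<and> valid_seq Mo (Q n m) s rs \<longrightarrow>
       (\<exists>t\<^sub>0 \<sigma> ts. exec (word_size c n m) P\<^sub>0 (boot (word_size c n m) xs) t\<^sub>0 \<sigma> \<and>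
          serves (word_size c n m) P (Q n m) \<sigma> s rs ts \<and>
          (n \<ge> N \<and> m \<ge> N \<longrightarrow> real t\<^sub>0 \<le> C * real n ^ t \<and>
             real (t\<^sub>0 + sum_list ts) \<le> C * real n ^ t + real (length rs) * (C * f n m)))"
    unfolding solvable_amortized_def by blast
  have b: "C * real n ^ t + real l * (C * f n m) \<le> max C 0 * real n ^ t + real l * (max C 0 * f' n m)" if "1 \<le> n" "1 \<le> m" for n m l
  proof (intro add_mono mult_left_mono)
    show "C * real n ^ t \<le> max C 0 * real n ^ t" by (rule mult_right_mono) auto
    show "C * f n m \<le> max C 0 * f' n m" by (rule scale_bound[OF order_refl assms(2)[OF that] assms(3)])
  qed simp
  have b1: "C * real n ^ t \<le> max C 0 * real n ^ t" for n by (rule mult_right_mono) auto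
  show ?thesis unfolding solvable_amortized_def
  proof (rule exI[of _ P\<^sub>0], rule exI[of _ P], rule exI[of _ c], rule exI[of _ "max C 0"], rule exI[of _ "max N 1"], intro allI impI)
    fix n m xs s rs assume "(xs, s) \<in> start (Q n m) \<and> valid_seq Mo (Q n m) s rs"
    with H obtain t\<^sub>0 \<sigma> ts where e: "exec (word_size c n m) P\<^sub>0 (boot (word_size c n m) xs) t\<^sub>0 \<sigma>"
      "serves (word_size c n m) P (Q n m) \<sigma> s rs ts"
      and T: "n \<ge> N \<and> m \<ge> N \<longrightarrow> real t\<^sub>0 \<le> C * real n ^ t \<and>
             real (t\<^sub>0 + sum_list ts) \<le> C * real n ^ t + real (length rs) * (C * f n m)" by blast
    have "real t\<^sub>0 \<le> max C 0 * real n ^ t \<and> real (t\<^sub>0 + sum_list ts) \<le> max C 0 * real n ^ t + real (length rs) * (max C 0 * f' n m)"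
      if "n \<ge> max N 1 \<and> m \<ge> max N 1"
    proof -
      have nm: "N \<le> n" "N \<le> m" "1 \<le> n" "1 \<le> m" using that by auto
      then show ?thesis using T order_trans[OF _ b1[of n]] order_trans[OF _ b[OF nm(3,4), of "length rs"]] by blast
    qed
    then show "\<exists>t\<^sub>0 \<sigma> ts. exec (word_size c n m) P\<^sub>0 (boot (word_size c n m) xs) t\<^sub>0 \<sigma> \<and>
          serves (word_size c n m) P (Q n m) \<sigma> s rs ts \<and>
          (n \<ge> max N 1 \<and> m \<ge> max N 1 \<longrightarrow> real t\<^sub>0 \<le> max C 0 * real n ^ t \<and>
             real (t\<^sub>0 + sum_list ts) \<le> max C 0 * real n ^ t + real (length rs) * (max C 0 * f' n m))"
      using e by blast
  qed
qed

lemma solvable_worst_case_mono: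
  assumes "solvable_worst_case Mo Q t f" "\<And>n m. 1 \<le> n \<Longrightarrow> 1 \<le> m \<Longrightarrow> f n m \<le> f' n m" "\<And>n m. 0 \<le> f n m"
  shows "solvable_worst_case Mo Q t f'"
proof -
  from assms(1) obtain P\<^sub>0 P c and C :: real and N where H: "\<forall>n m xs s rs.
       (xs, s) \<in> start (Q n m) \<and> valid_seq Mo (Q n m) s rs \<longrightarrow>
       (\<exists>t\<^sub>0 \<sigma> ts. exec (word_size c n m) P\<^sub>0 (boot (word_size c n m) xs) t\<^sub>0 \<sigma> \<and>
          serves (word_size c n m) P (Q n m) \<sigma> s rs ts \<and>
          (n \<ge> N \<and> m \<ge> N \<longrightarrow> real t\<^sub>0 \<le> C * real n ^ t \<and> (\<forall>\<tau> \<in> set ts. real \<tau> \<le> C * f n m)))"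
    unfolding solvable_worst_case_def by blast
  have b: "C * f n m \<le> max C 0 * f' n m" if "1 \<le> n" "1 \<le> m" for n m
    by (rule scale_bound[OF order_refl assms(2)[OF that] assms(3)])
  have b1: "C * real n ^ t \<le> max C 0 * real n ^ t" for n by (rule mult_right_mono) auto
  show ?thesis unfolding solvable_worst_case_def
  proof (rule exI[of _ P\<^sub>0], rule exI[of _ P], rule exI[of _ c], rule exI[of _ "max C 0"], rule exI[of _ "max N 1"], intro allI impI)
    fix n m xs s rs assume "(xs, s) \<in> start (Q n m) \<and> valid_seq Mo (Q n m) s rs"
    with H obtain t\<^sub>0 \<sigma> ts where e: "exec (word_size c n m) P\<^sub>0 (boot (word_size c n m) xs) t\<^sub>0 \<sigma>"
      "serves (word_size c n m) P (Q n m) \<sigma> s rs ts"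
      and T: "n \<ge> N \<and> m \<ge> N \<longrightarrow> real t\<^sub>0 \<le> C * real n ^ t \<and> (\<forall>\<tau> \<in> set ts. real \<tau> \<le> C * f n m)" by blast
    have "real t\<^sub>0 \<le> max C 0 * real n ^ t \<and> (\<forall>\<tau> \<in> set ts. real \<tau> \<le> max C 0 * f' n m)"
      if "n \<ge> max N 1 \<and> m \<ge> max N 1"
    proof -
      have nm: "N \<le> n" "N \<le> m" "1 \<le> n" "1 \<le> m" using that by auto
      then show ?thesis using T order_trans[OF _ b1[of n]] order_trans[OF _ b[OF nm(3,4)]] by blast
    qed
    then show "\<exists>t\<^sub>0 \<sigma> ts. exec (word_size c n m) P\<^sub>0 (boot (word_size c n m) xs) t\<^sub>0 \<sigma> \<and>
          serves (word_size c n m) P (Q n m) \<sigma> s rs ts \<and>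
          (n \<ge> max N 1 \<and> m \<ge> max N 1 \<longrightarrow> real t\<^sub>0 \<le> max C 0 * real n ^ t \<and> (\<forall>\<tau> \<in> set ts. real \<tau> \<le> max C 0 * f' n m))"
      using e by blast
  qed
qed

definition SETH_hard :: "(nat \<Rightarrow> nat \<Rightarrow> 's dyn_problem) \<Rightarrow> nat \<Rightarrow> real \<Rightarrow> bool" where
  "SETH_hard Q g r \<longleftrightarrow> (\<forall>wc Mo e. e \<le> 1 \<longrightarrow> (wc \<longleftrightarrow> Mo \<noteq> Fully_Dynamic) \<longrightarrow> reduces wc Mo Q g (m_pow (r - e)) e)"

text \<open>The time estimate requires \<open>\<epsilon> \<le> 1\<close>. Replacing
  \<open>\<epsilon>\<close> by \<open>min \<epsilon> 1\<close> only enlarges the assumed bound, as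
  \<open>m \<ge> 1\<close> beyond the threshold.\<close>

lemma refute_m_pow:
  assumes "0 < \<epsilon>" "1 \<le> g" and red: "SETH_hard Q g r"
  shows "solvable_amortized Fully_Dynamic Q t (m_pow (r - \<epsilon>)) \<Longrightarrow> \<not> SETH"
    and "solvable_worst_case Mo Q t (m_pow (r - \<epsilon>)) \<Longrightarrow> Mo \<noteq> Fully_Dynamic \<Longrightarrow> \<not> SETH"
proof -
  define e where "e = min \<epsilon> 1"
  have e: "0 < e" "e \<le> 1" using assms(1) by (simp_all add: e_def)
  have mono: "m_pow (r - \<epsilon>) n m \<le> m_pow (r - e) n m" if "1 \<le> m" for n m
    unfolding m_pow_def using that by (intro powr_mono) (auto simp: e_def)
  have nn: "0 \<le> m_pow a n m" for a n m by (simp add: m_pow_def)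
  show "solvable_amortized Fully_Dynamic Q t (m_pow (r - \<epsilon>)) \<Longrightarrow> \<not> SETH"
  proof -
    assume "solvable_amortized Fully_Dynamic Q t (m_pow (r - \<epsilon>))"
    from solvable_amortized_mono[OF this mono nn] have s: "solvable_amortized Fully_Dynamic Q t (m_pow (r - e))" by simp
    have "reduces False Fully_Dynamic Q g (m_pow (r - e)) e"
      using red[unfolded SETH_hard_def, rule_format, OF e(2), of False Fully_Dynamic] by simp
    from reduces_refutes_SETH[OF this e assms(2) nn] show "\<not> SETH" using s by simp
  qed
  show "solvable_worst_case Mo Q t (m_pow (r - \<epsilon>)) \<Longrightarrow> Mo \<noteq> Fully_Dynamic \<Longrightarrow> \<not> SETH"
  proof -
    assume "solvable_worst_case Mo Q t (m_pow (r - \<epsilon>))" and Mo: "Mo \<noteq> Fully_Dynamic"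
    from solvable_worst_case_mono[OF this(1) mono nn] have s: "solvable_worst_case Mo Q t (m_pow (r - e))" by simp
    have "reduces True Mo Q g (m_pow (r - e)) e"
      using red[unfolded SETH_hard_def, rule_format, OF e(2), of True Mo] Mo by simp
    from reduces_refutes_SETH[OF this e assms(2) nn] show "\<not> SETH" using s by simp
  qed
qed

lemma refute_EmptyPP:
  assumes "0 < \<epsilon>" "solvable_amortized Fully_Dynamic EmptyPP t (n_pow (1 - \<epsilon>))"
  shows "\<not> SETH"
proof -
  define e where "e = min \<epsilon> 1"
  have e: "0 < e" "e \<le> 1" using assms(1) by (simp_all add: e_def)
  have mono: "n_pow (1 - \<epsilon>) n m \<le> n_pow (1 - e) n m" if "1 \<le> n" for n m
    unfolding n_pow_def using that by (intro powr_mono) (auto simp: e_def)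
  have nn: "0 \<le> n_pow a n m" for a n m by (simp add: n_pow_def)
  have s: "solvable_amortized Fully_Dynamic EmptyPP t (n_pow (1 - e))" by (rule solvable_amortized_mono[OF assms(2) mono nn])
  from reduces_refutes_SETH[OF reduces_EmptyPP[OF e(2)] e order_refl nn] show ?thesis using s by simp
qed

theorem theorem5p1:
  fixes \<epsilon> :: real and t k :: nat
  assumes "\<epsilon> > 0"
    and "k \<ge> 2"
    and "(solvable_amortized Fully_Dynamic CountSSR t (m_pow (1 - \<epsilon>)) \<or>
          solvable_amortized Fully_Dynamic SC2 t (m_pow (1 - \<epsilon>)) \<or>
          solvable_amortized Fully_Dynamic (AppxSCC k) t (m_pow (1 - \<epsilon>)) \<or>
          solvable_amortized Fully_Dynamic MaxSCC t (m_pow (1 - \<epsilon>)) \<or>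
          solvable_amortized Fully_Dynamic SubUnion t (m_pow (1 - \<epsilon>)) \<or>
          solvable_amortized Fully_Dynamic ConnSub t (m_pow (1 - \<epsilon>)) \<or>
          solvable_amortized Fully_Dynamic EmptyPP t (n_pow (1 - \<epsilon>))) \<or>
         (\<exists>M \<in> {Incremental, Decremental}.
          solvable_worst_case M CountSSR t (m_pow (1 - \<epsilon>)) \<or>
          solvable_worst_case M SC2 t (m_pow (1 - \<epsilon>)) \<or>
          solvable_worst_case M (AppxSCC k) t (m_pow (1 - \<epsilon>)) \<or>
          solvable_worst_case M MaxSCC t (m_pow (1 - \<epsilon>)) \<or>
          solvable_worst_case M SubUnion t (m_pow (1 - \<epsilon>)) \<or>
          solvable_worst_case M ConnSub t (m_pow (1 - \<epsilon>))) \<or>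
         (solvable_amortized Fully_Dynamic STReach t (m_pow (2 - \<epsilon>)) \<or>
          solvable_amortized Fully_Dynamic Diam43 t (m_pow (2 - \<epsilon>))) \<or>
         (\<exists>M \<in> {Incremental, Decremental}.
          solvable_worst_case M STReach t (m_pow (2 - \<epsilon>)) \<or>
          solvable_worst_case M Diam43 t (m_pow (2 - \<epsilon>)))"
  shows "\<not> SETH"
proof -
  have h1: "SETH_hard CountSSR 1 1" "SETH_hard SC2 1 1" "SETH_hard (AppxSCC k) 1 1" "SETH_hard MaxSCC 1 1"
      "SETH_hard SubUnion 1 1" "SETH_hard ConnSub 1 1"
    unfolding SETH_hard_def
    by (intro allI impI, rule reduces_CountSSR reduces_SC2 reduces_AppxSCC[OF assms(2)] reduces_MaxSCC reduces_SubUnion reduces_ConnSub,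
        assumption, assumption)+
  have h2: "SETH_hard STReach 2 2" "SETH_hard Diam43 2 2"
    unfolding SETH_hard_def by (intro allI impI, rule reduces_STReach reduces_Diam43, simp, assumption)+
  note r = h1[THEN refute_m_pow(1)[OF assms(1) order_refl]] h1[THEN refute_m_pow(2)[OF assms(1) order_refl]]
    h2[THEN refute_m_pow(1)[OF assms(1) one_le_numeral]] h2[THEN refute_m_pow(2)[OF assms(1) one_le_numeral]]
    refute_EmptyPP[OF assms(1)]
  show ?thesis by (insert assms(3), elim disjE bexE) (erule r | fastforce)+
qed

end
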